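(* Assume $\mathsf{ZFC}$ is consistent. Then $\mathsf{ZFC}$ does not prove that $\mathsf{BA}(2^\omega)$ implies $\overline{\mathsf{BA}}_{\rm Lip}(2^\omega)$, and $\mathsf{ZFC}$ does not prove that $\mathsf{BA}(\omega^\omega)$ implies $\overline{\mathsf{BA}}_{\rm Lip}(\omega^\omega)$.
   Context: On $\omega^\omega$ use the metric $d(x,y)=2^{-k}$ where $k$ is least with $x(k)\neq y(k)$ (and $d(x,x)=0$); $2^\omega$ carries the restricted metric. Lipschitz always means with constant $1$: $f$ is Lipschitz if for all $x,y$ in its domain and all $k<\omega$, $x\upharpoonright k=y\upharpoonright k$ implies $f(x)\upharpoonright k=f(y)\upharpoonright k$. A subset of a topological space is $\aleph_1$-dense if its intersection with every non-empty open set has size exactly $\aleph_1$. For a topological space $X$, $\mathsf{BA}(X)$ is the statement: for all $\aleph_1$-dense $A,B\subseteq X$ there is an autohomeomorphism $h:X\to X$ with $h``A=B$. $\overline{\mathsf{BA}}_{\rm Lip}(\omega^\omega)$: for all $\aleph_1$-dense $A,B\subseteq\omega^\omega$ there is a Lipschitz $f:\omega^\omega\to\omega^\omega$ such that $f\upharpoonright A$ is a bijection from $A$ onto $B$. $\overline{\mathsf{BA}}_{\rm Lip}(2^\omega)$: for all $\aleph_1$-dense $A,B\subseteq 2^\omega$ there are countably many Lipschitz functions $f_n:2^\omega\to2^\omega$, $n<\omega$, such that $B=\bigcup_{n<\omega}f_n``A$. *)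

theory Defs
  imports Main
begin

section \<open>First-order logic in the language of set theory\<close>

text \<open>Formulas over one binary predicate symbol and equality, with named variables.\<close>

datatype fm =
    Mem nat nat
  | Equ nat nat
  | Bot
  | Imp fm fm
  | Forall nat fm

definition Neg :: "fm \<Rightarrow> fm" where "Neg p = Imp p Bot"
definition And :: "fm \<Rightarrow> fm \<Rightarrow> fm" where "And p q = Neg (Imp p (Neg q))"
definition Or :: "fm \<Rightarrow> fm \<Rightarrow> fm" where "Or p q = Imp (Neg p) q"
definition Iff :: "fm \<Rightarrow> fm \<Rightarrow> fm" where "Iff p q = And (Imp p q) (Imp q p)"
definition Exists :: "nat \<Rightarrow> fm \<Rightarrow> fm" where "Exists x p = Neg (Forall x (Neg p))"

fun fv :: "fm \<Rightarrow> nat set" where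
  "fv (Mem x y) = {x, y}"
| "fv (Equ x y) = {x, y}"
| "fv Bot = {}"
| "fv (Imp p q) = fv p \<union> fv q"
| "fv (Forall x p) = fv p - {x}"

lemma finite_fv: "finite (fv p)"
  by (induction p) auto

text \<open>\<open>subst x y p\<close> replaces the free occurrences of \<open>x\<close> in \<open>p\<close> by \<open>y\<close>, without renaming bound
  variables; \<open>free_for x y p\<close> says that no capture happens when doing so.\<close>

fun subst :: "nat \<Rightarrow> nat \<Rightarrow> fm \<Rightarrow> fm" where
  "subst x y (Mem u v) = Mem (if u = x then y else u) (if v = x then y else v)"
| "subst x y (Equ u v) = Equ (if u = x then y else u) (if v = x then y else v)"
| "subst x y Bot = Bot"
| "subst x y (Imp p q) = Imp (subst x y p) (subst x y q)"
| "subst x y (Forall z p) = (if z = x then Forall z p else Forall z (subst x y p))"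

fun free_for :: "nat \<Rightarrow> nat \<Rightarrow> fm \<Rightarrow> bool" where
  "free_for x y (Mem u v) = True"
| "free_for x y (Equ u v) = True"
| "free_for x y Bot = True"
| "free_for x y (Imp p q) = (free_for x y p \<and> free_for x y q)"
| "free_for x y (Forall z p) = (x \<notin> fv (Forall z p) \<or> (z \<noteq> y \<and> free_for x y p))"

text \<open>The classical Hilbert calculus with equality, in Mendelson's formulation.  Generalization is
  unrestricted, which is harmless because \<open>proves\<close> is only used for theories consisting of
  sentences.\<close>

inductive proves :: "fm set \<Rightarrow> fm \<Rightarrow> bool" (infix "\<turnstile>" 55) for T :: "fm set" where
  Axiom: "p \<in> T \<Longrightarrow> T \<turnstile> p"
| Imp_K: "T \<turnstile> Imp p (Imp q p)"
| Imp_S: "T \<turnstile> Imp (Imp p (Imp q r)) (Imp (Imp p q) (Imp p r))"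
| Double_neg: "T \<turnstile> Imp (Neg (Neg p)) p"
| Forall_inst: "free_for x y p \<Longrightarrow> T \<turnstile> Imp (Forall x p) (subst x y p)"
| Forall_dist: "x \<notin> fv p \<Longrightarrow> T \<turnstile> Imp (Forall x (Imp p q)) (Imp p (Forall x q))"
| Equ_refl: "T \<turnstile> Equ x x"
| Equ_subst: "free_for z x p \<Longrightarrow> free_for z y p
    \<Longrightarrow> T \<turnstile> Imp (Equ x y) (Imp (subst z x p) (subst z y p))"
| MP: "T \<turnstile> Imp p q \<Longrightarrow> T \<turnstile> p \<Longrightarrow> T \<turnstile> q"
| Gen: "T \<turnstile> p \<Longrightarrow> T \<turnstile> Forall x p"

definition consistent :: "fm set \<Rightarrow> bool" where
  "consistent T \<longleftrightarrow> \<not> T \<turnstile> Bot"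

definition universal_closure :: "fm \<Rightarrow> fm" where
  "universal_closure p = foldr Forall (sorted_list_of_set (fv p)) p"


section \<open>Notation for writing concrete formulas\<close>

text \<open>To write concrete formulas without choosing variable names by hand, we use functions from
  \<open>nat\<close> to formulas, the argument \<open>d\<close> being the number of variables in scope: these are the
  variables \<open>0, \<dots>, d - 1\<close>.  A quantifier binds the variable \<open>d\<close> and passes it to its body, so
  variables bound at nested places are automatically distinct.  A closed expression is turned
  into a formula by applying it to \<open>0\<close>.\<close>

type_synonym sfm = "nat \<Rightarrow> fm"

definition mem_s :: "nat \<Rightarrow> nat \<Rightarrow> sfm" (infix "\<^bold>\<in>" 50) where
  "x \<^bold>\<in> y = (\<lambda>d. Mem x y)"
definition equ_s :: "nat \<Rightarrow> nat \<Rightarrow> sfm" (infix "\<^bold>=" 50) where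
  "x \<^bold>= y = (\<lambda>d. Equ x y)"
definition neg_s :: "sfm \<Rightarrow> sfm" ("\<^bold>\<not> _" [40] 40) where
  "(\<^bold>\<not> P) = (\<lambda>d. Neg (P d))"
definition and_s :: "sfm \<Rightarrow> sfm \<Rightarrow> sfm" (infixr "\<^bold>\<and>" 35) where
  "(P \<^bold>\<and> Q) = (\<lambda>d. And (P d) (Q d))"
definition or_s :: "sfm \<Rightarrow> sfm \<Rightarrow> sfm" (infixr "\<^bold>\<or>" 30) where
  "(P \<^bold>\<or> Q) = (\<lambda>d. Or (P d) (Q d))"
definition imp_s :: "sfm \<Rightarrow> sfm \<Rightarrow> sfm" (infixr "\<^bold>\<longrightarrow>" 25) where
  "(P \<^bold>\<longrightarrow> Q) = (\<lambda>d. Imp (P d) (Q d))"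
definition iff_s :: "sfm \<Rightarrow> sfm \<Rightarrow> sfm" (infixr "\<^bold>\<longleftrightarrow>" 25) where
  "(P \<^bold>\<longleftrightarrow> Q) = (\<lambda>d. Iff (P d) (Q d))"
definition all_s :: "(nat \<Rightarrow> sfm) \<Rightarrow> sfm" (binder "\<^bold>\<forall>" 10) where
  "all_s F = (\<lambda>d. Forall d (F d (Suc d)))"
definition ex_s :: "(nat \<Rightarrow> sfm) \<Rightarrow> sfm" (binder "\<^bold>\<exists>" 10) where
  "ex_s F = (\<lambda>d. Exists d (F d (Suc d)))"

lemmas sfm_defs = mem_s_def equ_s_def neg_s_def and_s_def or_s_def imp_s_def iff_s_def
  all_s_def ex_s_def


section \<open>Basic set-theoretic notions\<close>

definition empty_s :: "nat \<Rightarrow> sfm" where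
  "empty_s x = (\<^bold>\<forall>z. \<^bold>\<not> z \<^bold>\<in> x)"

definition subset_s :: "nat \<Rightarrow> nat \<Rightarrow> sfm" (infix "\<^bold>\<subseteq>" 50) where
  "x \<^bold>\<subseteq> y = (\<^bold>\<forall>z. z \<^bold>\<in> x \<^bold>\<longrightarrow> z \<^bold>\<in> y)"

text \<open>\<open>z = x \<union> {x}\<close>\<close>
definition succ_s :: "nat \<Rightarrow> nat \<Rightarrow> sfm" where
  "succ_s x z = (\<^bold>\<forall>u. u \<^bold>\<in> z \<^bold>\<longleftrightarrow> u \<^bold>\<in> x \<^bold>\<or> u \<^bold>= x)"

text \<open>\<open>z = {x, y}\<close>\<close>
definition upair_s :: "nat \<Rightarrow> nat \<Rightarrow> nat \<Rightarrow> sfm" where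
  "upair_s x y z = (\<^bold>\<forall>u. u \<^bold>\<in> z \<^bold>\<longleftrightarrow> u \<^bold>= x \<^bold>\<or> u \<^bold>= y)"

text \<open>\<open>p = {{x}, {x, y}}\<close>\<close>
definition pair_s :: "nat \<Rightarrow> nat \<Rightarrow> nat \<Rightarrow> sfm" where
  "pair_s x y p = (\<^bold>\<forall>z. z \<^bold>\<in> p \<^bold>\<longleftrightarrow> upair_s x x z \<^bold>\<or> upair_s x y z)"

text \<open>\<open>\<langle>x, y\<rangle> \<in> f\<close>, that is, \<open>f(x) = y\<close> when \<open>f\<close> is a function\<close>
definition app_s :: "nat \<Rightarrow> nat \<Rightarrow> nat \<Rightarrow> sfm" where
  "app_s f x y = (\<^bold>\<exists>p. pair_s x y p \<^bold>\<and> p \<^bold>\<in> f)"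

text \<open>\<open>f : X \<rightarrow> Y\<close>\<close>
definition function_s :: "nat \<Rightarrow> nat \<Rightarrow> nat \<Rightarrow> sfm" where
  "function_s f X Y =
     ((\<^bold>\<forall>p. p \<^bold>\<in> f \<^bold>\<longrightarrow> (\<^bold>\<exists>x y. x \<^bold>\<in> X \<^bold>\<and> y \<^bold>\<in> Y \<^bold>\<and> pair_s x y p)) \<^bold>\<and>
      (\<^bold>\<forall>x. x \<^bold>\<in> X \<^bold>\<longrightarrow> (\<^bold>\<exists>y. \<^bold>\<forall>v. app_s f x v \<^bold>\<longleftrightarrow> v \<^bold>= y)))"

definition injective_on_s :: "nat \<Rightarrow> nat \<Rightarrow> sfm" where
  "injective_on_s f A =
     (\<^bold>\<forall>x x' y. x \<^bold>\<in> A \<^bold>\<and> x' \<^bold>\<in> A \<^bold>\<and> app_s f x y \<^bold>\<and> app_s f x' y \<^bold>\<longrightarrow> x \<^bold>= x')"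

text \<open>\<open>f``A = B\<close>\<close>
definition image_s :: "nat \<Rightarrow> nat \<Rightarrow> nat \<Rightarrow> sfm" where
  "image_s f A B = (\<^bold>\<forall>y. y \<^bold>\<in> B \<^bold>\<longleftrightarrow> (\<^bold>\<exists>x. x \<^bold>\<in> A \<^bold>\<and> app_s f x y))"

text \<open>\<open>V\<close> is the preimage of \<open>U\<close> under \<open>f : X \<rightarrow> Y\<close>\<close>
definition preimage_s :: "nat \<Rightarrow> nat \<Rightarrow> nat \<Rightarrow> nat \<Rightarrow> sfm" where
  "preimage_s f X U V = (\<^bold>\<forall>x. x \<^bold>\<in> V \<^bold>\<longleftrightarrow> x \<^bold>\<in> X \<^bold>\<and> (\<^bold>\<exists>y. y \<^bold>\<in> U \<^bold>\<and> app_s f x y))"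

definition bijection_s :: "nat \<Rightarrow> nat \<Rightarrow> nat \<Rightarrow> sfm" where
  "bijection_s f X Y = (function_s f X Y \<^bold>\<and> injective_on_s f X \<^bold>\<and> image_s f X Y)"

definition inductive_s :: "nat \<Rightarrow> sfm" where
  "inductive_s I =
     ((\<^bold>\<exists>z. empty_s z \<^bold>\<and> z \<^bold>\<in> I) \<^bold>\<and> (\<^bold>\<forall>x. x \<^bold>\<in> I \<^bold>\<longrightarrow> (\<^bold>\<exists>s. succ_s x s \<^bold>\<and> s \<^bold>\<in> I)))"

text \<open>\<open>w = \<omega>\<close>\<close>
definition omega_s :: "nat \<Rightarrow> sfm" where
  "omega_s w = (inductive_s w \<^bold>\<and> (\<^bold>\<forall>I. inductive_s I \<^bold>\<longrightarrow> w \<^bold>\<subseteq> I))"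

text \<open>\<open>t = 2 = {0, 1}\<close>\<close>
definition two_s :: "nat \<Rightarrow> sfm" where
  "two_s t = (\<^bold>\<exists>z e. empty_s z \<^bold>\<and> succ_s z e \<^bold>\<and> succ_s e t)"

definition transitive_s :: "nat \<Rightarrow> sfm" where
  "transitive_s x = (\<^bold>\<forall>y. y \<^bold>\<in> x \<^bold>\<longrightarrow> y \<^bold>\<subseteq> x)"

text \<open>In the presence of Foundation, the ordinals are the transitive sets of transitive sets.\<close>
definition ordinal_s :: "nat \<Rightarrow> sfm" where
  "ordinal_s x = (transitive_s x \<^bold>\<and> (\<^bold>\<forall>y. y \<^bold>\<in> x \<^bold>\<longrightarrow> transitive_s y))"

definition countable_s :: "nat \<Rightarrow> sfm" where
  "countable_s x = (\<^bold>\<exists>w f. omega_s w \<^bold>\<and> function_s f x w \<^bold>\<and> injective_on_s f x)"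

text \<open>\<open>\<aleph>\<^sub>1\<close> is the least uncountable ordinal.\<close>
definition aleph1_s :: "nat \<Rightarrow> sfm" where
  "aleph1_s k = (ordinal_s k \<^bold>\<and> \<^bold>\<not> countable_s k \<^bold>\<and> (\<^bold>\<forall>a. a \<^bold>\<in> k \<^bold>\<longrightarrow> countable_s a))"

definition size_aleph1_s :: "nat \<Rightarrow> sfm" where
  "size_aleph1_s x = (\<^bold>\<exists>k f. aleph1_s k \<^bold>\<and> bijection_s f x k)"


section \<open>The theory ZFC\<close>

definition extensionality :: fm where
  "extensionality = (\<^bold>\<forall>x y. (\<^bold>\<forall>z. z \<^bold>\<in> x \<^bold>\<longleftrightarrow> z \<^bold>\<in> y) \<^bold>\<longrightarrow> x \<^bold>= y) 0"

definition foundation :: fm where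
  "foundation =
     (\<^bold>\<forall>x. \<^bold>\<not> empty_s x \<^bold>\<longrightarrow> (\<^bold>\<exists>y. y \<^bold>\<in> x \<^bold>\<and> \<^bold>\<not> (\<^bold>\<exists>z. z \<^bold>\<in> x \<^bold>\<and> z \<^bold>\<in> y))) 0"

definition pairing :: fm where
  "pairing = (\<^bold>\<forall>x y. \<^bold>\<exists>z. upair_s x y z) 0"

definition union :: fm where
  "union = (\<^bold>\<forall>F. \<^bold>\<exists>U. \<^bold>\<forall>x. x \<^bold>\<in> U \<^bold>\<longleftrightarrow> (\<^bold>\<exists>y. y \<^bold>\<in> F \<^bold>\<and> x \<^bold>\<in> y)) 0"

definition power_set :: fm where
  "power_set = (\<^bold>\<forall>x. \<^bold>\<exists>P. \<^bold>\<forall>y. y \<^bold>\<in> P \<^bold>\<longleftrightarrow> y \<^bold>\<subseteq> x) 0"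

definition infinity :: fm where
  "infinity = (\<^bold>\<exists>I. inductive_s I) 0"

text \<open>Every family of nonempty, pairwise disjoint sets has a transversal.\<close>
definition choice :: fm where
  "choice =
     (\<^bold>\<forall>F. (\<^bold>\<forall>x. x \<^bold>\<in> F \<^bold>\<longrightarrow> \<^bold>\<not> empty_s x) \<^bold>\<and>
          (\<^bold>\<forall>x y. x \<^bold>\<in> F \<^bold>\<and> y \<^bold>\<in> F \<^bold>\<and> \<^bold>\<not> x \<^bold>= y \<^bold>\<longrightarrow> \<^bold>\<not> (\<^bold>\<exists>z. z \<^bold>\<in> x \<^bold>\<and> z \<^bold>\<in> y)) \<^bold>\<longrightarrow>
          (\<^bold>\<exists>C. \<^bold>\<forall>x. x \<^bold>\<in> F \<^bold>\<longrightarrow> (\<^bold>\<exists>c. \<^bold>\<forall>z. z \<^bold>\<in> C \<^bold>\<and> z \<^bold>\<in> x \<^bold>\<longleftrightarrow> z \<^bold>= c))) 0"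

text \<open>The two schemes, for an arbitrary formula \<open>p\<close>, possibly with parameters.  In replacement,
  \<open>\<exists>z. \<forall>y. p \<longleftrightarrow> y = z\<close> says that there is exactly one \<open>y\<close> with \<open>p\<close>.\<close>

definition separation_scheme :: "fm set" where
  "separation_scheme =
     {universal_closure (Forall a (Exists b (Forall x (Iff (Mem x b) (And (Mem x a) p)))))
      | a b x p. distinct [a, b, x] \<and> b \<notin> fv p}"

definition replacement_scheme :: "fm set" where
  "replacement_scheme =
     {universal_closure (Forall a (Imp
         (Forall x (Imp (Mem x a) (Exists z (Forall y (Iff p (Equ y z))))))
         (Exists b (Forall x (Imp (Mem x a) (Exists y (And (Mem y b) p)))))))
      | a b x y z p. distinct [a, b, x, y, z] \<and> b \<notin> fv p \<and> z \<notin> fv p}"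

definition ZFC :: "fm set" where
  "ZFC = {extensionality, foundation, pairing, union, power_set, infinity, choice}
         \<union> separation_scheme \<union> replacement_scheme"


section \<open>Baire space and Cantor space\<close>

text \<open>Throughout, the variable \<open>w\<close> stands for \<open>\<omega>\<close> and \<open>X\<close> for \<open>\<omega>\<^sup>\<omega>\<close> or \<open>2\<^sup>\<omega>\<close>.\<close>

definition baire_space_s :: "nat \<Rightarrow> nat \<Rightarrow> sfm" where
  "baire_space_s w X = (\<^bold>\<forall>x. x \<^bold>\<in> X \<^bold>\<longleftrightarrow> function_s x w w)"

definition cantor_space_s :: "nat \<Rightarrow> nat \<Rightarrow> sfm" where
  "cantor_space_s w X = (\<^bold>\<exists>t. two_s t \<^bold>\<and> (\<^bold>\<forall>x. x \<^bold>\<in> X \<^bold>\<longleftrightarrow> function_s x w t))"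

text \<open>\<open>x(i) = y(i)\<close>\<close>
definition same_value_s :: "nat \<Rightarrow> nat \<Rightarrow> nat \<Rightarrow> sfm" where
  "same_value_s x y i = (\<^bold>\<exists>v. app_s x i v \<^bold>\<and> app_s y i v)"

text \<open>\<open>x \<restriction> k = y \<restriction> k\<close>\<close>
definition agree_s :: "nat \<Rightarrow> nat \<Rightarrow> nat \<Rightarrow> sfm" where
  "agree_s x y k = (\<^bold>\<forall>i. i \<^bold>\<in> k \<^bold>\<longrightarrow> same_value_s x y i)"

text \<open>\<open>d(x, y) < 2\<^bsup>-n\<^esup>\<close>: either \<open>x = y\<close>, and the distance is \<open>0\<close>, or the distance is \<open>2\<^bsup>-k\<^esup>\<close> with
  \<open>n < k\<close>, where \<open>k\<close> is least with \<open>x(k) \<noteq> y(k)\<close>.\<close>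
definition dist_less_s :: "nat \<Rightarrow> nat \<Rightarrow> nat \<Rightarrow> nat \<Rightarrow> sfm" where
  "dist_less_s w x y n =
     (x \<^bold>= y \<^bold>\<or>
      (\<^bold>\<exists>k. k \<^bold>\<in> w \<^bold>\<and> \<^bold>\<not> same_value_s x y k \<^bold>\<and> agree_s x y k \<^bold>\<and> n \<^bold>\<in> k))"

text \<open>\<open>U\<close> is open in the metric topology of \<open>X\<close>; radii \<open>2\<^bsup>-n\<^esup>\<close> suffice as these tend to \<open>0\<close>.\<close>
definition open_s :: "nat \<Rightarrow> nat \<Rightarrow> nat \<Rightarrow> sfm" where
  "open_s w X U =
     (U \<^bold>\<subseteq> X \<^bold>\<and>
      (\<^bold>\<forall>x. x \<^bold>\<in> U \<^bold>\<longrightarrow>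
         (\<^bold>\<exists>n. n \<^bold>\<in> w \<^bold>\<and> (\<^bold>\<forall>y. y \<^bold>\<in> X \<^bold>\<and> dist_less_s w x y n \<^bold>\<longrightarrow> y \<^bold>\<in> U))))"

definition aleph1_dense_s :: "nat \<Rightarrow> nat \<Rightarrow> nat \<Rightarrow> sfm" where
  "aleph1_dense_s w X A =
     (A \<^bold>\<subseteq> X \<^bold>\<and>
      (\<^bold>\<forall>U. open_s w X U \<^bold>\<and> \<^bold>\<not> empty_s U \<^bold>\<longrightarrow>
         (\<^bold>\<exists>C. (\<^bold>\<forall>x. x \<^bold>\<in> C \<^bold>\<longleftrightarrow> x \<^bold>\<in> A \<^bold>\<and> x \<^bold>\<in> U) \<^bold>\<and> size_aleph1_s C)))"

text \<open>\<open>h\<close> is a bijection \<open>X \<rightarrow> X\<close> such that \<open>h\<close> and its inverse are continuous.\<close>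
definition autohomeomorphism_s :: "nat \<Rightarrow> nat \<Rightarrow> nat \<Rightarrow> sfm" where
  "autohomeomorphism_s w X h =
     (bijection_s h X X \<^bold>\<and>
      (\<^bold>\<forall>U V. open_s w X U \<^bold>\<and> preimage_s h X U V \<^bold>\<longrightarrow> open_s w X V) \<^bold>\<and>
      (\<^bold>\<forall>U V. open_s w X U \<^bold>\<and> image_s h U V \<^bold>\<longrightarrow> open_s w X V))"

text \<open>\<open>f : X \<rightarrow> X\<close> is Lipschitz with constant \<open>1\<close>.\<close>
definition lipschitz_s :: "nat \<Rightarrow> nat \<Rightarrow> nat \<Rightarrow> sfm" where
  "lipschitz_s w X f =
     (function_s f X X \<^bold>\<and>
      (\<^bold>\<forall>x y x' y' k. x \<^bold>\<in> X \<^bold>\<and> y \<^bold>\<in> X \<^bold>\<and> app_s f x x' \<^bold>\<and> app_s f y y' \<^bold>\<and> k \<^bold>\<in> w \<^bold>\<longrightarrow>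
         agree_s x y k \<^bold>\<longrightarrow> agree_s x' y' k))"


section \<open>The Baumgartner-type axioms\<close>

definition BA_s :: "nat \<Rightarrow> nat \<Rightarrow> sfm" where
  "BA_s w X =
     (\<^bold>\<forall>A B. aleph1_dense_s w X A \<^bold>\<and> aleph1_dense_s w X B \<^bold>\<longrightarrow>
        (\<^bold>\<exists>h. autohomeomorphism_s w X h \<^bold>\<and> image_s h A B))"

definition BA_Baire :: fm where
  "BA_Baire = (\<^bold>\<forall>w X. omega_s w \<^bold>\<and> baire_space_s w X \<^bold>\<longrightarrow> BA_s w X) 0"

definition BA_Cantor :: fm where
  "BA_Cantor = (\<^bold>\<forall>w X. omega_s w \<^bold>\<and> cantor_space_s w X \<^bold>\<longrightarrow> BA_s w X) 0"

definition BA_Lip_Baire :: fm where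
  "BA_Lip_Baire =
     (\<^bold>\<forall>w X. omega_s w \<^bold>\<and> baire_space_s w X \<^bold>\<longrightarrow>
        (\<^bold>\<forall>A B. aleph1_dense_s w X A \<^bold>\<and> aleph1_dense_s w X B \<^bold>\<longrightarrow>
           (\<^bold>\<exists>f. lipschitz_s w X f \<^bold>\<and> injective_on_s f A \<^bold>\<and> image_s f A B))) 0"

text \<open>For Cantor space the axiom asks for a sequence \<open>F = \<langle>f\<^sub>n : n < \<omega>\<rangle>\<close>, i.e. a function with domain
  \<open>\<omega>\<close>, together with a set \<open>L\<close> in which it takes its values.\<close>
definition BA_Lip_Cantor :: fm where
  "BA_Lip_Cantor =
     (\<^bold>\<forall>w X. omega_s w \<^bold>\<and> cantor_space_s w X \<^bold>\<longrightarrow>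
        (\<^bold>\<forall>A B. aleph1_dense_s w X A \<^bold>\<and> aleph1_dense_s w X B \<^bold>\<longrightarrow>
           (\<^bold>\<exists>F L. function_s F w L \<^bold>\<and>
              (\<^bold>\<forall>n f. n \<^bold>\<in> w \<^bold>\<and> app_s F n f \<^bold>\<longrightarrow> lipschitz_s w X f) \<^bold>\<and>
              (\<^bold>\<forall>y. y \<^bold>\<in> B \<^bold>\<longleftrightarrow>
                 (\<^bold>\<exists>n f x. n \<^bold>\<in> w \<^bold>\<and> app_s F n f \<^bold>\<and> x \<^bold>\<in> A \<^bold>\<and> app_s f x y))))) 0"

end

(* A consistent ZFC has a countable model E, possibly ill-founded, and both non-implications are
   witnessed by one forcing extension of E for each of the two spaces. A condition of the forcing is a
   finite set of pairs (coordinate, value) of three kinds: approximations to aleph_1 many new points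
   of two sets A and B, and, for every pair of nice names of aleph_1-dense sets, coherent permutations
   of levels of the tree of finite sequences and a matching of the points named. Splitting a dense
   set into aleph_1 many countable dense blocks and matching only points of blocks with the same index
   gives countably many possible values at each coordinate, so a Delta-system argument yields the
   countable chain condition; hence aleph_1 is preserved. The names occurring in coordinates range
   over a set II which is closed under names of size aleph_1, so a single step, without iteration,
   treats all pairs of dense sets of the extension. The generic permutations induce the
   homeomorphism which gives BA.
   Against the Lipschitz axioms, suppose that countably many Lipschitz functions f_n map A onto a
   superset of B. Uncountably many conditions decide which f_n maps which point of A to the i-th
   point of B, and two of them are compatible, agree on n, and decide the same initial segment of
   length m + 1 of the point of A while leaving the m-th value of the point of B open. Giving
   different m-th values to the two points of B contradicts f_n being Lipschitz. *)

theory Submission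
  imports Defs "HOL-Library.Infinite_Set" "HOL-Library.Countable"
begin

section \<open>Semantics and definable predicates\<close>

text \<open>Since membership in \<open>E\<close> may be ill-founded, every induction and recursion
  takes place inside the model and is available only for predicates definable in it with parameters.
  This is why definability is tracked throughout. What a condition forces is mostly read off from a
  generic filter through it. Only infinitely many levels are matched for a pair of dense sets. If it
  were always all of them, the homeomorphisms would be isometries, against the failure of the
  Lipschitz axioms. In Baire space a level is infinite and has uncountably many permutations, too
  many for countably many values at a coordinate. So conditions take permutations from one countable
  set \<open>ZZ\<close>, closed under extending a permutation to a higher level and correcting one
  value. What is promised at a coordinate refers to names, hence to conditions on further
  coordinates. These have smaller rank, so a stronger condition can be cut down to the part that
  decides the names and be added without touching the coordinate itself. This replaces the stages of
  an iteration.\<close>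

fun sat :: "('a => 'a => bool) => (nat => 'a) => fm => bool" where
  "sat E e (Mem x y) = E (e x) (e y)"
| "sat E e (Equ x y) = (e x = e y)"
| "sat E e Bot = False"
| "sat E e (Imp p q) = (sat E e p --> sat E e q)"
| "sat E e (Forall x p) = (ALL a. sat E (e(x := a)) p)"

lemma sat_Neg [simp]: "sat E e (Neg p) = (~ sat E e p)"
  and sat_And [simp]: "sat E e (And p q) = (sat E e p & sat E e q)"
  and sat_Or [simp]: "sat E e (Or p q) = (sat E e p | sat E e q)"
  and sat_Iff [simp]: "sat E e (Iff p q) = (sat E e p = sat E e q)"
  and sat_Exists [simp]: "sat E e (Exists x p) = (EX a. sat E (e(x := a)) p)"
  by (auto simp: Neg_def And_def Or_def Iff_def Exists_def)

lemma sat_cong: "(!!x. x \<in> fv p ==> e x = e' x) ==> sat E e p = sat E e' p"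
proof (induction p arbitrary: e e')
  case (Forall x p)
  have "sat E (e(x := a)) p = sat E (e'(x := a)) p" for a
    using Forall.prems by (intro Forall.IH) auto
  then show ?case by simp
next
  case (Imp p q)
  have "sat E e p = sat E e' p" "sat E e q = sat E e' q"
    using Imp.prems by (auto intro!: Imp.IH)
  then show ?case by simp
qed simp_all

lemma free_for_notin: "x \<notin> fv p ==> free_for x y p"
  by (induction p) auto

lemma sat_subst: "free_for x y p ==> sat E e (subst x y p) = sat E (e(x := e y)) p"
proof (induction p arbitrary: e)
  case (Forall z p)
  show ?case
  proof (cases "z = x")
    case True
    have "(e(x := e y))(x := a) = e(x := a)" for a by (rule fun_upd_upd)
    then show ?thesis using True by (simp only: subst.simps sat.simps simp_thms if_True)
  next
    case False
    have ff: "free_for x y p" using Forall.prems False free_for_notin[of x p y] by auto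
    have *: "sat E ((e(z := a))(x := (e(z := a)) y)) p = sat E ((e(x := e y))(z := a)) p" for a
      using Forall.prems False by (intro sat_cong) auto
    show ?thesis using False by (simp only: subst.simps sat.simps if_False Forall.IH[OF ff] *)
  qed
qed auto

text \<open>Unrestricted generalization is sound only because the members of \<open>T\<close> hold
  under every assignment, so the induction must carry all \<open>e\<close>.\<close>

lemma soundness:
  assumes "T \<turnstile> p" "!!q e. q \<in> T ==> sat E e q"
  shows "sat E e p"
  using assms(1)
proof (induction arbitrary: e)
  case (Forall_dist x p q)
  have "sat E (e(x := a)) p = sat E e p" for a
    using Forall_dist by (intro sat_cong) auto
  then show ?case by auto
next
  case (Double_neg p) show ?case by (simp add: Neg_def)
next
  case (Gen p x) then show ?case by simp
next
  case (MP p q) from MP.IH[of e] show ?case by simp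
qed (auto simp: assms sat_subst)

lemma sat_universal_closure:
  "(ALL e. sat E e (universal_closure p)) \<longleftrightarrow> (ALL e. sat E e p)"
proof -
  have "(ALL e. sat E e (foldr Forall xs p)) \<longleftrightarrow> (ALL e. sat E e p)" for xs
  proof (induction xs)
    case (Cons x xs)
    have "(ALL e a. sat E (e(x := a)) q) \<longleftrightarrow> (ALL e. sat E e q)" for q
      by (metis fun_upd_triv)
    with Cons show ?case by simp
  qed simp
  then show ?thesis by (simp add: universal_closure_def)
qed

fun ren :: "(nat => nat) => fm => fm" where
  "ren f (Mem x y) = Mem (f x) (f y)"
| "ren f (Equ x y) = Equ (f x) (f y)"
| "ren f Bot = Bot"
| "ren f (Imp p q) = Imp (ren f p) (ren f q)"
| "ren f (Forall x p) = Forall (f x) (ren f p)"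

text \<open>Bound variables are renamed together with the free ones; injectivity of \<open>f\<close>
  then excludes capture.\<close>

lemma sat_ren: "inj f ==> sat E e (ren f p) = sat E (%i. e (f i)) p"
proof (induction p arbitrary: e)
  case (Forall x p)
  have "(%i. (e(f x := a)) (f i)) = (%i. e (f i))(x := a)" for a
    using \<open>inj f\<close> by (auto simp: fun_eq_iff dest: injD)
  then show ?case using Forall by simp
qed auto

definition mix :: "nat => (nat => 'a) => (nat => 'a) => nat => 'a" where
  "mix k c e = (%i. if i < k then c i else e (i - k))"

text \<open>Definability with parameters: the first \<open>k\<close> variables hold the parameters \<open>c\<close>.\<close>

definition dfn :: "('a => 'a => bool) => ((nat => 'a) => bool) => bool" where
  "dfn E Q \<longleftrightarrow> (EX p k c. ALL e. Q e = sat E (mix k c e) p)"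

text \<open>The language has no function symbols, so definability of a term can only mean that of
  its graph. In de Bruijn style the value stands in front of the shifted assignment.\<close>

definition dft :: "('a => 'a => bool) => ((nat => 'a) => 'a) => bool" where
  "dft E t \<longleftrightarrow> dfn E (%e. e 0 = t (%i. e (Suc i)))"

text \<open>Closure rules that follow the syntax of a predicate or a term. With them
  \<open>intro dfi\<close> settles the definability conditions of later inductions and
  comprehensions.\<close>

named_theorems dfi

lemma dfn_ren: assumes "inj f" "dfn E Q" shows "dfn E (%e. Q (%i. e (f i)))"
proof -
  from assms(2) obtain p k c where p: "!!e. Q e = sat E (mix k c e) p" by (auto simp: dfn_def)
  \<comment> \<open>Parameters keep their places; only the variables behind them are
    renamed.\<close>
  define g where "g i = (if i < k then i else k + f (i - k))" for i
  have "inj g"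
  proof (rule injI)
    fix x y assume "g x = g y"
    then show "x = y"
      using injD[OF \<open>inj f\<close>, of "x - k" "y - k"] by (auto simp: g_def split: if_splits)
  qed
  have "Q (%i. e (f i)) = sat E (mix k c e) (ren g p)" for e
  proof -
    have "(%i. mix k c e (g i)) = mix k c (%i. e (f i))" by (auto simp: mix_def g_def)
    then show ?thesis by (simp add: sat_ren[OF \<open>inj g\<close>] p)
  qed
  then show ?thesis unfolding dfn_def by blast
qed

lemma dfn_const [dfi]: "dfn E (%e. b)"
proof (cases b)
  case True
  then have "ALL e. b = sat E (mix 0 undefined e) (Imp Bot Bot)" by simp
  then show ?thesis unfolding dfn_def by blast
next
  case False
  then have "ALL e. b = sat E (mix 0 undefined e) Bot" by simp
  then show ?thesis unfolding dfn_def by blast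
qed

lemma dfn_imp [dfi]: assumes "dfn E Q" "dfn E R" shows "dfn E (%e. Q e --> R e)"
proof -
  from assms obtain p k c q l d where p: "!!e. Q e = sat E (mix k c e) p"
    and q: "!!e. R e = sat E (mix l d e) q" unfolding dfn_def by metis
  define g where "g i = (if i < k then i else i + l)" for i
  define h where "h i = k + i" for i
  define b where "b i = (if i < k then c i else d (i - k))" for i
  have inj: "inj g" "inj h" by (auto simp: inj_def g_def h_def)
  have "(%i. mix (k + l) b e (g i)) = mix k c e" "(%i. mix (k + l) b e (h i)) = mix l d e" for e
    by (auto simp: mix_def g_def h_def b_def)
  then have "ALL e. (Q e --> R e) = sat E (mix (k + l) b e) (Imp (ren g p) (ren h q))"
    by (simp add: sat_ren inj p q)
  then show ?thesis unfolding dfn_def by blast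
qed

lemma dfn_all [dfi]:
  assumes "dfn E (%e. Q (e 0) (%i. e (Suc i)))" shows "dfn E (%e. ALL x. Q x e)"
proof -
  from assms obtain p k c where p: "!!e. Q (e 0) (%i. e (Suc i)) = sat E (mix k c e) p"
    by (auto simp: dfn_def)
  have "Q x e = sat E ((mix (Suc k) c e)(k := x)) p" for x e
  proof -
    have "mix k c (case_nat x e) = (mix (Suc k) c e)(k := x)"
      by (auto simp: mix_def fun_eq_iff split: nat.split)
         (metis Suc_diff_Suc linorder_neqE_nat nat.inject not_less_eq)
    then show ?thesis using p[of "case_nat x e"] by simp
  qed
  then have "ALL e. (ALL x. Q x e) = sat E (mix (Suc k) c e) (Forall k p)" by simp
  then show ?thesis unfolding dfn_def by blast
qed

text \<open>The value \<open>x\<close> becomes parameter number \<open>k\<close>, exactly where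
  \<open>e 0\<close> was read before.\<close>

lemma dfn_par:
  assumes "dfn E (%e. Q (e 0) (%i. e (Suc i)))" shows "dfn E (%e. Q x e)"
proof -
  from assms obtain p k c where p: "!!e. Q (e 0) (%i. e (Suc i)) = sat E (mix k c e) p"
    by (auto simp: dfn_def)
  have "Q x e = sat E (mix (Suc k) (c(k := x)) e) p" for e
  proof -
    have "mix k c (case_nat x e) = mix (Suc k) (c(k := x)) e"
      by (auto simp: mix_def fun_eq_iff split: nat.split)
         (metis Suc_diff_Suc linorder_neqE_nat nat.inject not_less_eq)
    then show ?thesis using p[of "case_nat x e"] by simp
  qed
  then show ?thesis unfolding dfn_def by blast
qed

lemma dfn_neg [dfi]: "dfn E Q ==> dfn E (%e. ~ Q e)"
  using dfn_imp[OF _ dfn_const[of E False], of Q] by simp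

lemma dfn_disj [dfi]: "dfn E Q ==> dfn E R ==> dfn E (%e. Q e | R e)"
  unfolding disj_imp by (rule dfn_imp[OF dfn_neg])

lemma dfn_conj [dfi]: "dfn E Q ==> dfn E R ==> dfn E (%e. Q e & R e)"
  using dfn_neg[OF dfn_disj[OF dfn_neg dfn_neg], of E Q R] by simp

lemma dfn_iff [dfi]: "dfn E Q ==> dfn E R ==> dfn E (%e. Q e = R e)"
proof -
  assume "dfn E Q" "dfn E R"
  then have "dfn E (%e. (Q e --> R e) & (R e --> Q e))" by (intro dfi)
  moreover have "(%e. (Q e --> R e) & (R e --> Q e)) = (%e. Q e = R e)" by auto
  ultimately show ?thesis by (simp only:)
qed

lemma dfn_ex [dfi]: "dfn E (%e. Q (e 0) (%i. e (Suc i))) ==> dfn E (%e. EX x. Q x e)"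
  using dfn_neg[OF dfn_all[OF dfn_neg], of E Q] by simp

lemma dfn_memv: fixes E :: "'a => 'a => bool" shows "dfn E (%e. E (e i) (e j))"
proof -
  have "ALL e. E (e i) (e j) = sat E (mix 0 undefined e) (Mem i j)" by (simp add: mix_def)
  then show ?thesis unfolding dfn_def by blast
qed

lemma dfn_eqv: fixes E :: "'a => 'a => bool" shows "dfn E (%e. e i = e j)"
proof -
  have "ALL e. (e i = e j) = sat E (mix 0 undefined e) (Equ i j)" by (simp add: mix_def)
  then show ?thesis unfolding dfn_def by blast
qed

lemma dft_var [dfi]: "dft E (%e. e i)"
  unfolding dft_def by (rule dfn_eqv)

lemma dft_const [dfi]: "dft E (%e. x)"
  unfolding dft_def by (rule dfn_par[where Q = "%x e. e 0 = x"]) (rule dfn_eqv)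

lemma dft_shift: "dft E t ==> dft E (%e. t (%i. e (Suc i)))"
  unfolding dft_def
  by (drule dfn_ren[rotated, where f = "case_nat 0 (%i. Suc (Suc i))"])
     (auto simp: inj_def split: nat.splits)

text \<open>Substituting a term amounts to quantifying over its value:
  \<open>EX x. x = t e & Q x e\<close>.\<close>

lemma dfc: assumes "dfn E (%e. Q (e 0) (%i. e (Suc i)))" "dft E t" shows "dfn E (%e. Q (t e) e)"
proof -
  have "dfn E (%e. EX x. x = t e & Q x e)"
    by (rule dfn_ex) (rule dfn_conj[OF assms(2)[unfolded dft_def] assms(1)])
  then show ?thesis by simp
qed

lemma dfc1: "dfn E (%e. Q (e 0)) ==> dft E t ==> dfn E (%e. Q (t e))"
  by (rule dfc)

definition swp :: "nat => nat => nat => nat" where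
  "swp i j = (%k. if k = i then j else if k = j then i else k)"

lemma inj_swp: "inj (swp i j)" by (auto simp: inj_def swp_def split: if_splits)

lemma dfc2: assumes "dfn E (%e. Q (e 0) (e (Suc 0)))" "dft E s" "dft E t"
  shows "dfn E (%e. Q (s e) (t e))"
proof (rule dfc[where t = s and Q = "%x e. Q x (t e)", OF _ assms(2)],
       rule dfc[where t = "%e. t (%i. e (Suc i))" and Q = "%y e. Q (e 0) y", OF _ dft_shift[OF assms(3)]])
  show "dfn E (%e. Q (e (Suc 0)) (e 0))"
    using dfn_ren[OF inj_swp assms(1), of 0 1] by (simp add: swp_def)
qed

lemma dfc3: assumes "dfn E (%e. Q (e 0) (e (Suc 0)) (e (Suc (Suc 0))))" "dft E s" "dft E t" "dft E u"
  shows "dfn E (%e. Q (s e) (t e) (u e))"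
proof (rule dfc[where t = s and Q = "%x e. Q x (t e) (u e)", OF _ assms(2)],
       rule dfc[where t = "%e. t (%i. e (Suc i))" and Q = "%y e. Q (e 0) y (u (%i. e (Suc i)))", OF _ dft_shift[OF assms(3)]],
       rule dfc[where t = "%e. u (%i. e (Suc (Suc i)))" and Q = "%y e. Q (e (Suc 0)) (e 0) y", OF _ dft_shift[OF dft_shift[OF assms(4)]]])
  show "dfn E (%e. Q (e (Suc (Suc 0))) (e (Suc 0)) (e 0))"
    using dfn_ren[OF inj_swp assms(1), of 0 2] by (simp add: swp_def numeral_2_eq_2)
qed

lemma dfc4: assumes "dfn E (%e. Q (e 0) (e (Suc 0)) (e (Suc (Suc 0))) (e (Suc (Suc (Suc 0)))))"
    "dft E s" "dft E t" "dft E u" "dft E v"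
  shows "dfn E (%e. Q (s e) (t e) (u e) (v e))"
proof (rule dfc[where t = s and Q = "%x e. Q x (t e) (u e) (v e)", OF _ assms(2)],
       rule dfc[where t = "%e. t (%i. e (Suc i))" and Q = "%y e. Q (e 0) y (u (%i. e (Suc i))) (v (%i. e (Suc i)))", OF _ dft_shift[OF assms(3)]],
       rule dfc[where t = "%e. u (%i. e (Suc (Suc i)))" and Q = "%y e. Q (e (Suc 0)) (e 0) y (v (%i. e (Suc (Suc i))))", OF _ dft_shift[OF dft_shift[OF assms(4)]]],
       rule dfc[where t = "%e. v (%i. e (Suc (Suc (Suc i))))" and Q = "%y e. Q (e (Suc (Suc 0))) (e (Suc 0)) (e 0) y", OF _ dft_shift[OF dft_shift[OF dft_shift[OF assms(5)]]]])
  let ?f = "%i. swp 0 3 (swp 1 2 i)"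
  have "inj ?f" using inj_compose[OF inj_swp inj_swp] by (simp add: o_def)
  then show "dfn E (%e. Q (e (Suc (Suc (Suc 0)))) (e (Suc (Suc 0))) (e (Suc 0)) (e 0))"
    using dfn_ren[OF _ assms(1), of ?f] by (simp add: swp_def numeral_2_eq_2 numeral_3_eq_3)
qed

lemma dfn_mem [dfi]: "dft E s ==> dft E t ==> dfn E (%e. E (s e) (t e))"
  by (rule dfc2[where Q = E]) (rule dfn_memv)

lemma dfn_eq [dfi]: "dft E s ==> dft E t ==> dfn E (%e. s e = t e)"
  by (rule dfc2[where Q = "(=)"]) (rule dfn_eqv)

lemma dftc1: assumes "dfn E (%e. e 0 = F (e (Suc 0)))" "dft E s"
  shows "dft E (%e. F (s e))"
  unfolding dft_def by (rule dfc2[where Q = "%v x. v = F x", OF assms(1) dft_var dft_shift[OF assms(2)]])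

lemma dftc2: assumes "dfn E (%e. e 0 = F (e (Suc 0)) (e (Suc (Suc 0))))" "dft E s" "dft E t"
  shows "dft E (%e. F (s e) (t e))"
  unfolding dft_def
  by (rule dfc3[where Q = "%v x y. v = F x y", OF assms(1) dft_var dft_shift[OF assms(2)] dft_shift[OF assms(3)]])

lemma dftc3: assumes "dfn E (%e. e 0 = F (e (Suc 0)) (e (Suc (Suc 0))) (e (Suc (Suc (Suc 0)))))"
    "dft E s" "dft E t" "dft E u"
  shows "dft E (%e. F (s e) (t e) (u e))"
  unfolding dft_def
  by (rule dfc4[where Q = "%v x y z. v = F x y z",
        OF assms(1) dft_var dft_shift[OF assms(2)] dft_shift[OF assms(3)] dft_shift[OF assms(4)]])

lemma dft_if [dfi]: "dfn E Q ==> dft E s ==> dft E t ==> dft E (%e. if Q e then s e else t e)"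
proof -
  assume a: "dfn E Q" "dft E s" "dft E t"
  have "dfn E (%e. Q (%i. e (Suc i)))" using dfn_ren[OF _ a(1), of Suc] by simp
  then have "dfn E (%e. (Q (%i. e (Suc i)) --> e 0 = s (%i. e (Suc i))) &
     (~ Q (%i. e (Suc i)) --> e 0 = t (%i. e (Suc i))))"
    by (intro dfn_conj dfn_imp dfn_neg dfn_eq dft_var dft_shift a)
  moreover have "((b --> v = x) & (~ b --> v = y)) = (v = (if b then x else y))" for b and v x y :: 'a by simp
  ultimately show ?thesis unfolding dft_def by (simp only:)
qed

text \<open>The formula \<open>p\<close> is fixed in the metatheory, so recursion on it involves no
  definition of truth inside the model. This turns instances of the axiom schemes into statements
  about definable predicates.\<close>

lemma dfn_sat: assumes "!!i. dft E (t i)" shows "dfn E (%e. sat E (%i. t i e) p)"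
  using assms
proof (induction p arbitrary: t)
  case (Forall x p)
  have "dfn E (%e. sat E (%i. (if i = x then %e. e 0 else (%e. t i (%i. e (Suc i)))) e) p)"
    by (rule Forall.IH) (auto intro: dfi dft_shift Forall.prems)
  then have "dfn E (%e. sat E ((%i. t i (%i. e (Suc i)))(x := e 0)) p)"
    by (simp add: fun_upd_def if_distrib[where f = "%f. f _"])
  then show ?case using dfn_all[where Q = "%a e. sat E ((%i. t i e)(x := a)) p" and E = E] by simp
qed (auto intro: dfi)

text \<open>An assignment \<open>e0\<close> has infinitely many values, but a formula has finitely
  many free variables, so finitely many of these values have to become parameters.\<close>

lemma dfn_fix: assumes "dfn E Q" shows "dfn E (%e. Q (%i. if i < m then e i else e0 (i - m)))"
proof -
  from assms obtain p k c where p: "!!e. Q e = sat E (mix k c e) p" by (auto simp: dfn_def)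
  obtain n where n: "!!i. i \<in> fv p ==> i < n" "k + m < n"
    using finite_fv[of p] by (metis finite_insert finite_nat_set_iff_bounded insertI1 insertI2)
  \<comment> \<open>The \<open>m\<close> live variables move behind the new parameters, which occupy
    the places below \<open>n\<close>.\<close>
  define g where "g i = (if i < k then i else if i < k + m then n + (i - k) else if i < n then i else i + m)" for i
  have inj: "inj g" using n(2) by (auto simp: inj_def g_def split: if_splits)
  have "Q (%i. if i < m then e i else e0 (i - m)) = sat E (mix n (mix k c (%i. e0 (i - m))) e) (ren g p)" for e
    unfolding p sat_ren[OF inj]
    using n by (intro sat_cong) (auto simp: mix_def g_def dest: n(1))
  then show ?thesis unfolding dfn_def by blast
qed

section \<open>Models of ZFC\<close>

text \<open>The schemes are stated for definable predicates of the metalogic instead of formulas,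
  which lets the set theory below be written without syntax.\<close>

locale zfc =
  fixes E :: "'a => 'a => bool" (infix "\<e>" 50)
  assumes extens: "!!x y. (!!z. z \<e> x \<longleftrightarrow> z \<e> y) ==> x = y"
    and found: "!!x z. z \<e> x ==> EX y. y \<e> x & ~ (EX z. z \<e> x & z \<e> y)"
    and pairing: "!!x y. EX z. ALL u. u \<e> z \<longleftrightarrow> u = x | u = y"
    and union: "!!F. EX U. ALL x. x \<e> U \<longleftrightarrow> (EX y. y \<e> F & x \<e> y)"
    and power: "!!x. EX P. ALL y. y \<e> P \<longleftrightarrow> (ALL z. z \<e> y --> z \<e> x)"
    and infinity: "EX I. (EX z. (ALL u. ~ u \<e> z) & z \<e> I) &
        (ALL x. x \<e> I --> (EX s. (ALL u. u \<e> s \<longleftrightarrow> u \<e> x | u = x) & s \<e> I))"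
    and choice: "!!F. (ALL x. x \<e> F --> (EX z. z \<e> x)) ==>
        (ALL x y. x \<e> F & y \<e> F & x ~= y --> ~ (EX z. z \<e> x & z \<e> y)) ==>
        EX C. ALL x. x \<e> F --> (EX c. ALL z. z \<e> C & z \<e> x \<longleftrightarrow> z = c)"
    and sep: "!!Q a. dfn E (%e. Q (e 0)) ==> EX b. ALL x. x \<e> b \<longleftrightarrow> x \<e> a & Q x"
    and repl: "!!Q a. dfn E (%e. Q (e 0) (e (Suc 0))) ==> (!!x. x \<e> a ==> EX z. ALL y. Q x y \<longleftrightarrow> y = z) ==>
        EX b. ALL x. x \<e> a --> (EX y. y \<e> b & Q x y)"

lemmas zfc_ax_defs = extensionality_def foundation_def pairing_def union_def power_set_def
  infinity_def choice_def inductive_s_def empty_s_def subset_s_def succ_s_def upair_s_def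

lemma sat_choice: "sat E e choice \<longleftrightarrow>
   (ALL F. (ALL x. E x F --> (EX z. E z x)) &
        (ALL x y. E x F & E y F & x ~= y --> ~ (EX z. E z x & E z y)) -->
        (EX C. ALL x. E x F --> (EX c. ALL z. E z C & E z x \<longleftrightarrow> z = c)))"
  by (simp add: zfc_ax_defs sfm_defs cong del: imp_cong)

lemma zfc_imp_sat:
  assumes "zfc E" "p \<in> ZFC" shows "sat E e p"
proof -
  interpret zfc E by fact
  consider "p \<in> {extensionality, foundation, pairing, Defs.union, power_set, infinity, choice}"
    | "p \<in> separation_scheme" | "p \<in> replacement_scheme"
    using assms(2) unfolding ZFC_def by auto
  then show ?thesis
  proof cases
    case 1
    have "sat E e extensionality" by (simp add: zfc_ax_defs sfm_defs) (blast intro: extens)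
    moreover have "sat E e foundation" using found by (auto simp: zfc_ax_defs sfm_defs)
    moreover have "sat E e pairing" using pairing by (auto simp: zfc_ax_defs sfm_defs)
    moreover have "sat E e Defs.union" using union by (auto simp: zfc_ax_defs sfm_defs)
    moreover have "sat E e power_set" using power by (auto simp: zfc_ax_defs sfm_defs)
    moreover have "sat E e infinity" using infinity by (auto simp: zfc_ax_defs sfm_defs)
    moreover have "sat E e choice" unfolding sat_choice
      by (intro allI impI, elim conjE) (rule choice)
    ultimately show ?thesis using 1 by auto
  next
    case 2
    then obtain a b x q where p: "p = universal_closure (Forall a (Exists b (Forall x (Iff (Mem x b) (And (Mem x a) q)))))"
      and d: "distinct [a, b, x]" "b \<notin> fv q" unfolding separation_scheme_def by blast
    have "sat E e (Forall a (Exists b (Forall x (Iff (Mem x b) (And (Mem x a) q)))))" for e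
    proof -
      { fix A
        have "dfn E (%f. sat E (%i. (if i = x then %f. f 0 else (%f. (e(a := A)) i)) f) q)"
          by (rule dfn_sat) (auto intro: dfi)
        moreover have "(%i. (if i = x then %f. f 0 else (%f. (e(a := A)) i)) f) = e(a := A, x := f 0)"
          for f :: "nat => 'a" by (auto simp: fun_eq_iff)
        ultimately have "dfn E (%f. sat E (e(a := A, x := f 0)) q)" by (simp only:)
        from sep[OF this, of A] obtain B where B: "!!z. E z B \<longleftrightarrow> E z A & sat E (e(a := A, x := z)) q" by blast
        have "sat E (e(a := A, b := B, x := z)) q = sat E (e(a := A, x := z)) q" for z
          using d by (intro sat_cong) auto
        with B have "EX B. ALL z. E z B \<longleftrightarrow> E z A & sat E (e(a := A, b := B, x := z)) q" by auto }
      then show ?thesis using d by (simp add: eq_commute)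
    qed
    then show ?thesis using p sat_universal_closure by metis
  next
    case 3
    then obtain a b x y z q where p: "p = universal_closure (Forall a (Imp
         (Forall x (Imp (Mem x a) (Exists z (Forall y (Iff q (Equ y z))))))
         (Exists b (Forall x (Imp (Mem x a) (Exists y (And (Mem y b) q)))))))"
      and d: "distinct [a, b, x, y, z]" "b \<notin> fv q" "z \<notin> fv q" unfolding replacement_scheme_def by blast
    have "sat E e (Forall a (Imp
         (Forall x (Imp (Mem x a) (Exists z (Forall y (Iff q (Equ y z))))))
         (Exists b (Forall x (Imp (Mem x a) (Exists y (And (Mem y b) q)))))))" for e
    proof -
      { fix A
        let ?Q = "%u v. sat E (e(a := A, x := u, y := v)) q"
        have "dfn E (%f. sat E (%i. (if i = y then %f. f (Suc 0) else if i = x then %f. f 0 else (%f. (e(a := A)) i)) f) q)"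
          by (rule dfn_sat) (auto intro: dfi)
        moreover have "(%i. (if i = y then %f. f (Suc 0) else if i = x then %f. f 0 else (%f. (e(a := A)) i)) f) =
            e(a := A, x := f 0, y := f (Suc 0))" for f :: "nat => 'a" by (auto simp: fun_eq_iff)
        ultimately have df: "dfn E (%f. ?Q (f 0) (f (Suc 0)))" by (simp only:)
        have z: "sat E (e(a := A, x := u, z := w, y := v)) q = ?Q u v" for u v w
          using d by (intro sat_cong) auto
        have b: "sat E (e(a := A, b := B, x := u, y := v)) q = ?Q u v" for u v B
          using d by (intro sat_cong) auto
        have "(ALL u. E u A --> (EX w. ALL v. ?Q u v \<longleftrightarrow> v = w)) --> (EX B. ALL u. E u A --> (EX v. E v B & ?Q u v))"
          using repl[OF df, of A] by blast
        then have "(ALL u. E u A --> (EX w. ALL v. sat E (e(a := A, x := u, z := w, y := v)) q \<longleftrightarrow> v = w)) -->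
          (EX B. ALL u. E u A --> (EX v. E v B & sat E (e(a := A, b := B, x := u, y := v)) q))"
          unfolding z b . }
      then show ?thesis using d by (simp add: eq_commute)
    qed
    then show ?thesis using p sat_universal_closure by metis
  qed
qed

lemma sat_imp_zfc:
  assumes s: "!!p e. p \<in> ZFC ==> sat E e p" shows "zfc E"
proof
  have ax: "sat E e extensionality" "sat E e foundation" "sat E e pairing" "sat E e Defs.union"
    "sat E e power_set" "sat E e infinity" "sat E e choice" for e
    using s unfolding ZFC_def by auto
  show "x = y" if "!!z. E z x \<longleftrightarrow> E z y" for x y
  proof -
    have "ALL x y. (ALL z. E z x = E z y) --> x = y"
      using ax(1) by (simp add: zfc_ax_defs sfm_defs)
    with that show ?thesis by blast
  qed
  show "EX y. E y x & ~ (EX z. E z x & E z y)" if "E z x" for x z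
    using ax(2) that by (auto simp: zfc_ax_defs sfm_defs)
  show "EX z. ALL u. E u z \<longleftrightarrow> u = x | u = y" for x y
    using ax(3) by (auto simp: zfc_ax_defs sfm_defs)
  show "EX U. ALL x. E x U \<longleftrightarrow> (EX y. E y F & E x y)" for F
    using ax(4) by (auto simp: zfc_ax_defs sfm_defs)
  show "EX P. ALL y. E y P \<longleftrightarrow> (ALL z. E z y --> E z x)" for x
    using ax(5) by (auto simp: zfc_ax_defs sfm_defs)
  show "EX I. (EX z. (ALL u. ~ E u z) & E z I) & (ALL x. E x I --> (EX s. (ALL u. E u s \<longleftrightarrow> E u x | u = x) & E s I))"
    using ax(6) by (auto simp: zfc_ax_defs sfm_defs)
  show "EX C. ALL x. E x F --> (EX c. ALL z. E z C & E z x \<longleftrightarrow> z = c)"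
    if "ALL x. E x F --> (EX z. E z x)" "ALL x y. E x F & E y F & x ~= y --> ~ (EX z. E z x & E z y)" for F
    using ax(7)[unfolded sat_choice] that by blast
  show "EX b. ALL x. E x b \<longleftrightarrow> E x a & Q x" if df: "dfn E (%e. Q (e 0))" for Q a
  proof -
    from df obtain p k c where p: "!!e. Q (e 0) = sat E (mix k c e) p" by (auto simp: dfn_def)
    \<comment> \<open>\<open>mix\<close> reads \<open>e 0\<close> at place \<open>k\<close>, so the
      variable \<open>k\<close> stands for \<open>x\<close>; \<open>n\<close> and
      \<open>Suc n\<close> lie beyond the free variables of \<open>p\<close> and stand for
      \<open>a\<close> and \<open>b\<close>.\<close>
    obtain n where n: "!!i. i \<in> fv p ==> i < n" "k < n"
      using finite_fv[of p] by (metis finite_insert finite_nat_set_iff_bounded insertI1 insertI2)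
    have "sat E e (universal_closure (Forall n (Exists (Suc n) (Forall k (Iff (Mem k (Suc n)) (And (Mem k n) p))))))" for e
    proof (rule s)
      have "distinct [n, Suc n, k]" "Suc n \<notin> fv p" using n by fastforce+
      then show "universal_closure (Forall n (Exists (Suc n) (Forall k (Iff (Mem k (Suc n)) (And (Mem k n) p))))) \<in> ZFC"
        unfolding ZFC_def separation_scheme_def by blast
    qed
    then have "sat E (mix k c undefined) (Forall n (Exists (Suc n) (Forall k (Iff (Mem k (Suc n)) (And (Mem k n) p)))))"
      using sat_universal_closure by blast
    then have "EX b. ALL x. E x b = (E x a & sat E ((mix k c undefined)(n := a, Suc n := b, k := x)) p)"
      using n by (simp add: eq_commute[of k])
    moreover have "sat E ((mix k c undefined)(n := a, Suc n := b, k := x)) p = sat E (mix k c (%i. if i = 0 then x else undefined (i))) p" for b x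
      using n(1) by (intro sat_cong) (fastforce simp: mix_def)
    ultimately show ?thesis using p[of "%i. if i = 0 then _ else undefined i"] by simp
  qed
  show "EX b. ALL x. E x a --> (EX y. E y b & Q x y)" if df: "dfn E (%e. Q (e 0) (e (Suc 0)))"
    and uq: "!!x. E x a ==> EX z. ALL y. Q x y \<longleftrightarrow> y = z" for Q a
  proof -
    from df obtain p k c where p: "!!e. Q (e 0) (e (Suc 0)) = sat E (mix k c e) p" by (auto simp: dfn_def)
    obtain n where n: "!!i. i \<in> fv p ==> i < n" "Suc k < n"
      using finite_fv[of p] by (metis finite_insert finite_nat_set_iff_bounded insertI1 insertI2)
    let ?f = "Forall n (Imp
         (Forall k (Imp (Mem k n) (Exists (Suc (Suc n)) (Forall (Suc k) (Iff p (Equ (Suc k) (Suc (Suc n))))))))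
         (Exists (Suc n) (Forall k (Imp (Mem k n) (Exists (Suc k) (And (Mem (Suc k) (Suc n)) p))))))"
    have "sat E e (universal_closure ?f)" for e
    proof (rule s)
      have "distinct [n, Suc n, k, Suc k, Suc (Suc n)]" "Suc n \<notin> fv p" "Suc (Suc n) \<notin> fv p" using n by fastforce+
      then show "universal_closure ?f \<in> ZFC"
        unfolding ZFC_def replacement_scheme_def by blast
    qed
    then have "sat E (mix k c undefined) ?f"
      using sat_universal_closure by blast
    then have "(ALL x. E x a --> (EX w. ALL y. sat E ((mix k c undefined)(n := a, k := x, Suc (Suc n) := w, Suc k := y)) p = (y = w))) -->
       (EX b. ALL x. E x a --> (EX y. E y b & sat E ((mix k c undefined)(n := a, Suc n := b, k := x, Suc k := y)) p))"
      using n(2) by (simp add: eq_commute[of k] eq_commute[of "Suc k"] cong del: imp_cong)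
        (erule allE[where x = a], assumption)
    moreover have "sat E ((mix k c undefined)(n := a, Suc n := b, k := x, Suc k := y)) p = Q x y"
      "sat E ((mix k c undefined)(n := a, k := x, Suc (Suc n) := b, Suc k := y)) p = Q x y" for b x y
    proof -
      let ?e = "%i. if i = 0 then x else if i = Suc 0 then y else undefined i"
      have "sat E ((mix k c undefined)(n := a, Suc n := b, k := x, Suc k := y)) p = sat E (mix k c ?e) p"
        "sat E ((mix k c undefined)(n := a, k := x, Suc (Suc n) := b, Suc k := y)) p = sat E (mix k c ?e) p"
        using n by (intro sat_cong; fastforce simp: mix_def)+
      then show "sat E ((mix k c undefined)(n := a, Suc n := b, k := x, Suc k := y)) p = Q x y"
      "sat E ((mix k c undefined)(n := a, k := x, Suc (Suc n) := b, Suc k := y)) p = Q x y"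
        using p[of ?e] by simp_all
    qed
    ultimately have "(ALL x. E x a --> (EX w. ALL y. Q x y = (y = w))) --> (EX b. ALL x. E x a --> (EX y. E y b & Q x y))"
      by (simp only:)
    with uq show ?thesis by blast
  qed
qed

section \<open>Set theory inside a model\<close>

context zfc
begin

abbreviation "D \<equiv> dfn E"
abbreviation "T \<equiv> dft E"

definition coll :: "('a => bool) => 'a" where "coll Q = (THE x. ALL z. z \<e> x \<longleftrightarrow> Q z)"

lemma coll: assumes "EX x. ALL z. z \<e> x \<longleftrightarrow> Q z" shows "z \<e> coll Q \<longleftrightarrow> Q z"
proof -
  have "EX! x. ALL z. z \<e> x \<longleftrightarrow> Q z" using assms extens by metis
  from theI'[OF this] show ?thesis unfolding coll_def by blast
qed

lemma dft_coll:
  assumes "!!e z. z \<e> t e \<longleftrightarrow> Q z e" "D (%e. Q (e 0) (%i. e (Suc i)))" shows "T t"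
proof -
  have "D (%e. ALL z. z \<e> e 0 \<longleftrightarrow> Q z (%i. e (Suc i)))"
  proof (intro dfi)
    show "D (%e. Q (e 0) (%i. e (Suc (Suc i))))"
      using dfn_ren[OF _ assms(2), of "case_nat 0 (%i. Suc (Suc i))"] by (auto simp: inj_def split: nat.splits)
  qed
  moreover have "(ALL z. z \<e> v \<longleftrightarrow> Q z e) \<longleftrightarrow> v = t e" for v e using assms(1) extens by metis
  ultimately show ?thesis unfolding dft_def by (simp only:)
qed

text \<open>Comprehension applies to predicates of one variable; freezing the rest of the assignment
  makes it usable under binders.\<close>

lemma D_fix: assumes "D (%e. Q (e 0) (%i. e (Suc i)))" shows "D (%e. Q (e 0) e0)"
  using dfn_fix[OF assms, of 1 e0] by simp

lemma T_fix: assumes "T (%e. F (e 0) (%i. e (Suc i)))" shows "T (%e. F (e 0) e0)"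
proof -
  have "D (%e. e 0 = F (e (Suc 0)) (%i. e (Suc (Suc i))))" using assms unfolding dft_def .
  from dfn_fix[OF this, of 2 e0] have "D (%e. e 0 = F (e (Suc 0)) e0)" by (simp add: numeral_2_eq_2)
  then show ?thesis by (rule dftc1[OF _ dft_var, where F = "%x. F x e0"])
qed

definition emp where "emp = coll (%_. False)"
definition upair where "upair x y = coll (%z. z = x | z = y)"
definition un where "un F = coll (%z. EX y. y \<e> F & z \<e> y)"
definition pw where "pw x = coll (%y. ALL z. z \<e> y --> z \<e> x)"
definition sepS where "sepS a Q = coll (%z. z \<e> a & Q z)"
definition img where "img F a = coll (%z. EX x. x \<e> a & z = F x)"
definition pair where "pair x y = upair (upair x x) (upair x y)"
definition cup where "cup x y = un (upair x y)"
definition adj where "adj x y = cup x (upair y y)"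
definition succ where "succ x = adj x x"

lemma sepS: "D (%e. Q (e 0)) ==> z \<e> sepS a Q \<longleftrightarrow> z \<e> a & Q z"
  unfolding sepS_def by (rule coll) (rule sep)

lemma emp [simp]: "~ z \<e> emp"
  unfolding emp_def using sep[of "%_. False"] dfn_const by (subst coll) auto

lemma emp_iff: "x = emp \<longleftrightarrow> (ALL z. ~ z \<e> x)" using extens emp by metis
lemma ne_emp: "x ~= emp \<longleftrightarrow> (EX z. z \<e> x)" using emp_iff by blast

lemma upair [simp]: "z \<e> upair x y \<longleftrightarrow> z = x | z = y"
  unfolding upair_def by (rule coll) (rule pairing)

lemma un [simp]: "z \<e> un F \<longleftrightarrow> (EX y. y \<e> F & z \<e> y)"
  unfolding un_def by (rule coll) (rule union)

lemma pw [simp]: "z \<e> pw x \<longleftrightarrow> (ALL y. y \<e> z --> y \<e> x)"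
  unfolding pw_def by (rule coll) (rule power)

lemma cup [simp]: "z \<e> cup x y \<longleftrightarrow> z \<e> x | z \<e> y" unfolding cup_def by auto
lemma adj [simp]: "z \<e> adj x y \<longleftrightarrow> z \<e> x | z = y" unfolding adj_def by auto
lemma succ [simp]: "z \<e> succ x \<longleftrightarrow> z \<e> x | z = x" unfolding succ_def by auto

lemma pair_inj [simp]: "pair x y = pair u v \<longleftrightarrow> x = u & y = v"
proof
  assume a: "pair x y = pair u v"
  then have "upair x x \<e> pair u v" "upair x y \<e> pair u v" "upair u u \<e> pair x y" "upair u v \<e> pair x y"
    unfolding pair_def using upair by metis+
  then have b: "upair x x = upair u u | upair x x = upair u v" "upair x y = upair u u | upair x y = upair u v"
    "upair u v = upair x x | upair u v = upair x y"
    unfolding pair_def by auto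
  then have "x = u" using upair by metis
  with b show "x = u & y = v" using upair by metis
qed simp

lemma img [simp]: assumes "T (%e. F (e 0))" shows "z \<e> img F a \<longleftrightarrow> (EX x. x \<e> a & z = F x)"
proof -
  have d: "D (%e. e (Suc 0) = F (e 0))" using assms by (intro dfi)
  obtain b where b: "!!x. x \<e> a ==> F x \<e> b" using repl[of "%x y. y = F x" a] d by auto
  have "D (%e. EX x. x \<e> a & e 0 = F x)"
    by (intro dfi dftc1[of E F, OF assms[unfolded dft_def]])
  from sep[OF this, of b] obtain c where "!!z. z \<e> c \<longleftrightarrow> z \<e> b & (EX x. x \<e> a & z = F x)" by blast
  then show ?thesis unfolding img_def using b by (intro coll) blast
qed

lemma upair_T [dfi]: "T s ==> T t ==> T (%e. upair (s e) (t e))"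
  by (rule dftc2, fold dft_def[of E "%e. upair (e 0) (e (Suc 0))"], rule dft_coll, rule upair) (intro dfi | assumption)+

lemma un_T [dfi]: "T s ==> T (%e. un (s e))"
  by (rule dftc1, fold dft_def[of E "%e. un (e 0)"], rule dft_coll, rule un) (intro dfi | assumption)+

lemma pw_T [dfi]: "T s ==> T (%e. pw (s e))"
  by (rule dftc1, fold dft_def[of E "%e. pw (e 0)"], rule dft_coll, rule pw) (intro dfi | assumption)+

lemma pair_T [dfi]: "T s ==> T t ==> T (%e. pair (s e) (t e))"
  unfolding pair_def by (intro dfi)
lemma cup_T [dfi]: "T s ==> T t ==> T (%e. cup (s e) (t e))"
  unfolding cup_def by (intro dfi)
lemma adj_T [dfi]: "T s ==> T t ==> T (%e. adj (s e) (t e))"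
  unfolding adj_def by (intro dfi)
lemma succ_T [dfi]: "T s ==> T (%e. succ (s e))"
  unfolding succ_def by (intro dfi)

lemma sepS_T [dfi]: assumes "T s" "D (%e. P (e 0) (%i. e (Suc i)))" shows "T (%e. sepS (s e) (%x. P x e))"
proof (rule dft_coll)
  show "z \<e> sepS (s e) (%x. P x e) \<longleftrightarrow> z \<e> s e & P z e" for e z
    by (rule sepS) (rule D_fix[OF assms(2)])
  show "D (%e. e 0 \<e> s (%i. e (Suc i)) & P (e 0) (%i. e (Suc i)))"
    by (intro dfi dft_shift assms)
qed

lemma T_ren: assumes "inj f" "T t" shows "T (%e. t (%i. e (f i)))"
proof -
  have "inj (case_nat 0 (%i. Suc (f i)))"
    by (rule injI) (auto split: nat.splits dest: injD[OF assms(1)])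
  from dfn_ren[OF this assms(2)[unfolded dft_def]] show ?thesis unfolding dft_def by simp
qed

lemma img_T [dfi]: assumes "T s" "T (%e. F (e 0) (%i. e (Suc i)))" shows "T (%e. img (%x. F x e) (s e))"
proof (rule dft_coll)
  show "z \<e> img (%x. F x e) (s e) \<longleftrightarrow> (EX x. x \<e> s e & z = F x e)" for e z
    by (rule img) (rule T_fix[OF assms(2)])
  show "D (%e. EX x. x \<e> s (%i. e (Suc i)) & e 0 = F x (%i. e (Suc i)))"
    using T_ren[OF _ assms(2), of "case_nat 0 (%i. Suc (Suc i))"]
    by (intro dfi dft_shift assms) (auto simp: inj_def split: nat.splits)
qed

definition sub where "sub x y \<longleftrightarrow> (ALL z. z \<e> x --> z \<e> y)"
lemma sub_D [dfi]: "T s ==> T t ==> D (%e. sub (s e) (t e))"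
  unfolding sub_def by (intro dfi dft_shift)
lemma subI: "(!!z. z \<e> x ==> z \<e> y) ==> sub x y" by (simp add: sub_def)
lemma subD: "sub x y ==> z \<e> x ==> z \<e> y" by (simp add: sub_def)
lemma sub_refl [simp]: "sub x x" by (simp add: sub_def)
lemma sub_trans: "sub x y ==> sub y z ==> sub x z" by (simp add: sub_def)
lemma sub_antisym: "sub x y ==> sub y x ==> x = y" unfolding sub_def using extens by blast

subsection \<open>Functions\<close>

text \<open>The union of all \<open>y\<close> paired with \<open>x\<close> in \<open>f\<close>,
  which is the value if there is exactly one such \<open>y\<close>. Given by comprehension, the term
  is always defined and its definability needs no side condition.\<close>

definition app where "app f x = sepS (un (un (un f))) (%z. EX y. pair x y \<e> f & z \<e> y)"
definition fn where "fn f a \<longleftrightarrow> (ALL p. p \<e> f --> (EX x y. x \<e> a & p = pair x y)) &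
   (ALL x. x \<e> a --> (EX y. ALL v. pair x v \<e> f \<longleftrightarrow> v = y))"
definition lam where "lam a F = img (%x. pair x (F x)) a"
definition isfun where "isfun f a b \<longleftrightarrow> fn f a & (ALL x. x \<e> a --> app f x \<e> b)"
definition inje where "inje f a \<longleftrightarrow> (ALL x y. x \<e> a & y \<e> a & app f x = app f y --> x = y)"

lemma pair_un: "pair x y \<e> f ==> x \<e> un (un f) & y \<e> un (un f)"
  unfolding pair_def by (simp, meson upair)

lemma app: "z \<e> app f x \<longleftrightarrow> (EX y. pair x y \<e> f & z \<e> y)"
proof -
  have "D (%e. EX y. pair x y \<e> f & e 0 \<e> y)" by (intro dfi)
  then show ?thesis unfolding app_def using pair_un[of x _ f] by (subst sepS) (auto, blast)
qed

lemma app_T [dfi]: "T s ==> T t ==> T (%e. app (s e) (t e))"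
  unfolding app_def by (intro dfi dft_shift)
lemma fn_D [dfi]: "T s ==> T t ==> D (%e. fn (s e) (t e))"
  unfolding fn_def by (intro dfi dft_shift)
lemma isfun_D [dfi]: "T s ==> T t ==> T u ==> D (%e. isfun (s e) (t e) (u e))"
  unfolding isfun_def by (intro dfi dft_shift)
lemma inje_D [dfi]: "T s ==> T t ==> D (%e. inje (s e) (t e))"
  unfolding inje_def by (intro dfi dft_shift)
lemma lam_T [dfi]: "T s ==> T (%e. F (e 0) (%i. e (Suc i))) ==> T (%e. lam (s e) (%x. F x e))"
  unfolding lam_def by (intro dfi)

lemma fn_app: assumes "fn f a" "x \<e> a" shows "pair x v \<e> f \<longleftrightarrow> v = app f x"
proof -
  obtain y where y: "!!v. pair x v \<e> f \<longleftrightarrow> v = y" using assms unfolding fn_def by blast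
  then have "app f x = y" by (intro extens) (simp add: app)
  with y show ?thesis by simp
qed

lemma fn_mem: assumes "fn f a" shows "p \<e> f \<longleftrightarrow> (EX x. x \<e> a & p = pair x (app f x))"
proof
  assume p: "p \<e> f"
  then obtain x y where "x \<e> a" "p = pair x y" using assms unfolding fn_def by blast
  moreover from this have "y = app f x" using p fn_app[OF assms, of x y] by simp
  ultimately show "EX x. x \<e> a & p = pair x (app f x)" by blast
next
  assume "EX x. x \<e> a & p = pair x (app f x)"
  then show "p \<e> f" using fn_app[OF assms] by blast
qed

lemma fn_dom: "fn f a ==> pair x y \<e> f ==> x \<e> a"
  unfolding fn_def by fastforce

lemma fn_ext: "fn f a ==> fn g a ==> (!!x. x \<e> a ==> app f x = app g x) ==> f = g"
  by (rule extens) (simp only: fn_mem cong: conj_cong)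

lemma fn_cong_dom: "fn f a ==> fn f b ==> a = b"
  by (rule extens) (metis fn_app fn_dom)

lemma lam_mem: "T (%e. F (e 0)) ==> p \<e> lam a F \<longleftrightarrow> (EX x. x \<e> a & p = pair x (F x))"
  unfolding lam_def by (rule img) (intro dfi)

lemma lam: assumes "T (%e. F (e 0))" shows "fn (lam a F) a" "x \<e> a ==> app (lam a F) x = F x"
proof -
  show f: "fn (lam a F) a" unfolding fn_def by (auto simp: lam_mem[OF assms])
  assume "x \<e> a"
  with fn_app[OF f this, of "F x"] show "app (lam a F) x = F x" by (auto simp: lam_mem[OF assms])
qed

lemma lam_cong: "T (%e. F (e 0)) ==> T (%e. G (e 0)) ==> (!!x. x \<e> a ==> F x = G x) ==> lam a F = lam a G"
  by (rule extens) (auto simp: lam_mem)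

lemma app_D0: "T (%e. app f (e 0))" by (intro dfi)

lemma fn_adj: assumes "fn f a" "~ b \<e> a"
  shows "fn (adj f (pair b y)) (adj a b)" "x \<e> a ==> app (adj f (pair b y)) x = app f x"
    "app (adj f (pair b y)) b = y"
proof -
  have n: "~ pair b v \<e> f" for v using assms fn_dom by blast
  show f: "fn (adj f (pair b y)) (adj a b)" unfolding fn_def
  proof (intro conjI allI impI)
    show "EX x z. x \<e> adj a b & p = pair x z" if "p \<e> adj f (pair b y)" for p
      using that assms(1) unfolding fn_def by auto
    show "EX w. ALL v. pair x v \<e> adj f (pair b y) \<longleftrightarrow> v = w" if "x \<e> adj a b" for x
      using that assms fn_app[OF assms(1)] n by auto
  qed
  show "app (adj f (pair b y)) b = y" using fn_app[OF f, of b y] by auto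
  show "x \<e> a ==> app (adj f (pair b y)) x = app f x"
    using fn_app[OF f, of x "app f x"] fn_app[OF assms(1), of x "app f x"] by auto
qed

subsection \<open>Natural numbers and induction on membership\<close>

definition ind where "ind I \<longleftrightarrow> emp \<e> I & (ALL x. x \<e> I --> succ x \<e> I)"
definition omega where "omega = coll (%x. ALL I. ind I --> x \<e> I)"
definition trs where "trs x \<longleftrightarrow> (ALL y. y \<e> x --> sub y x)"

lemma ind_D [dfi]: "T s ==> D (%e. ind (s e))" unfolding ind_def by (intro dfi dft_shift)
lemma trs_D [dfi]: "T s ==> D (%e. trs (s e))" unfolding trs_def by (intro dfi dft_shift)

lemma omega: "x \<e> omega \<longleftrightarrow> (ALL I. ind I --> x \<e> I)"
proof -
  obtain I where "(EX z. (ALL u. ~ u \<e> z) & z \<e> I) & (ALL x. x \<e> I --> (EX s. (ALL u. u \<e> s \<longleftrightarrow> u \<e> x | u = x) & s \<e> I))"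
    using infinity by blast
  then have I: "ind I" unfolding ind_def using emp_iff extens succ by metis
  have "D (%e. ALL I. ind I --> e 0 \<e> I)" by (intro dfi)
  from sep[OF this, of I] I show ?thesis unfolding omega_def by (intro coll) blast
qed

lemma omega_0 [simp]: "emp \<e> omega" and omega_succ: "n \<e> omega ==> succ n \<e> omega"
  by (auto simp: omega ind_def)

lemma omega_induct [consumes 1, case_names D emp succ]:
  assumes "n \<e> omega" "D (%e. P (e 0))" "P emp" "!!n. n \<e> omega ==> P n ==> P (succ n)"
  shows "P n"
proof -
  have "ind (sepS omega P)" unfolding ind_def using assms by (auto simp: sepS omega_succ)
  with assms(1) have "n \<e> sepS omega P" unfolding omega by blast
  then show ?thesis using assms(2) by (simp add: sepS)
qed

lemma nat_trs: "n \<e> omega ==> trs n"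
proof (induct rule: omega_induct)
  case D show ?case by (intro dfi)
qed (auto simp: trs_def sub_def)

lemma nat_cases: assumes "n \<e> omega" obtains "n = emp" | m where "m \<e> omega" "n = succ m"
proof -
  have "n = emp | (EX m. m \<e> omega & n = succ m)" using assms
    by (induct rule: omega_induct) (auto intro!: dfi)
  then show thesis using that by blast
qed

lemma omega_trs: "trs omega"
proof -
  have "sub n omega" if "n \<e> omega" for n using that
    by (induct rule: omega_induct) (auto intro!: dfi simp: sub_def)
  then show ?thesis by (simp add: trs_def)
qed

lemma nat_mem: "n \<e> omega ==> m \<e> n ==> m \<e> omega" using omega_trs unfolding trs_def sub_def by blast

lemma mem_irrefl [simp]: "~ x \<e> x"
  using found[of x "upair x x"] by auto

lemma mem_asym: "x \<e> y ==> ~ y \<e> x"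
  using found[of x "upair x y"] by auto

text \<open>No recursion theorem is available yet: it rests on induction on membership, which in
  turn needs this lemma. So the sequence \<open>x\<close>, \<open>un x\<close>,
  \<open>un (un x)\<close>, ... is built by hand from finite approximations \<open>A n f\<close>,
  and replacement collects its terms.\<close>

lemma transitive_superset: "EX t. trs t & sub x t"
proof -
  define A where "A n f \<longleftrightarrow> fn f (succ n) & app f emp = x & (ALL m. m \<e> n --> app f (succ m) = un (app f m))" for n f
  have A_D: "T s ==> T t ==> D (%e. A (s e) (t e))" for s t unfolding A_def by (intro dfi dft_shift)
  have agree: "m \<e> succ n --> m \<e> succ k --> app f m = app g m" if "m \<e> omega" "A n f" "A k g" "n \<e> omega" "k \<e> omega" for m n k f g
    using that(1)
  proof (induct rule: omega_induct)
    case D show ?case by (intro dfi)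
  next
    case emp show ?case using that unfolding A_def by simp
  next
    case (succ m)
    have "m \<e> n" if "succ m \<e> succ n" "n \<e> omega" for n
      using that nat_trs[of n] unfolding trs_def sub_def by auto
    then show ?case using succ that unfolding A_def by auto
  qed
  have ex: "EX f. A n f" if "n \<e> omega" for n using that
  proof (induct rule: omega_induct)
    case D show ?case by (intro dfi A_D)
  next
    case emp
    have "A emp (adj emp (pair emp x))" unfolding A_def
      using fn_adj[of emp emp emp x] by (auto simp: fn_def succ_def)
    then show ?case by blast
  next
    case (succ n)
    then obtain f where f: "A n f" by blast
    let ?g = "adj f (pair (succ n) (un (app f n)))"
    have nin: "~ succ n \<e> succ n" by (rule mem_irrefl)
    have fs: "fn f (succ n)" using f unfolding A_def by blast
    have e0: "emp \<e> succ n" using succ(1)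
      by (induct rule: omega_induct) (auto intro!: dfi)
    have "A (succ n) ?g" unfolding A_def
    proof (intro conjI allI impI)
      show "fn ?g (succ (succ n))" using fn_adj(1)[OF fs nin] by (simp add: succ_def[of "succ n"])
      show "app ?g emp = x" using fn_adj(2)[OF fs nin e0] f unfolding A_def by simp
      show "app ?g (succ m) = un (app ?g m)" if m: "m \<e> succ n" for m
      proof (cases "m = n")
        case True then show ?thesis using fn_adj(2)[OF fs nin m] fn_adj(3)[OF fs nin] by simp
      next
        case False
        with m have mn: "m \<e> n" by simp
        then have "succ m \<e> succ n --> app ?g (succ m) = un (app ?g m)"
          using fn_adj(2)[OF fs nin] m f unfolding A_def by simp
        moreover have "succ m \<e> succ n"
        proof -
          have "ALL m. m \<e> n --> succ m \<e> succ n" using succ(1)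
            by (induct rule: omega_induct) (auto intro!: dfi)
          then show ?thesis using mn by blast
        qed
        ultimately show ?thesis by blast
      qed
    qed
    then show ?case by blast
  qed
  define R where "R n y \<longleftrightarrow> (EX f. A n f & y = app f n)" for n y
  have R_D: "D (%e. R (e 0) (e (Suc 0)))" unfolding R_def by (intro dfi A_D)
  have "EX z. ALL y. R n y \<longleftrightarrow> y = z" if "n \<e> omega" for n
    unfolding R_def using ex[OF that] agree[OF that _ _ that that] by (metis succ)
  from repl[OF R_D this] obtain b where b: "!!n. n \<e> omega ==> EX y. y \<e> b & R n y" by blast
  define W where "W = sepS b (%y. EX n. n \<e> omega & R n y)"
  have W: "y \<e> W \<longleftrightarrow> y \<e> b & (EX n. n \<e> omega & R n y)" for y
    unfolding W_def by (rule sepS) (intro dfi dfc2[OF R_D])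
  have uniq: "R n y ==> R n z ==> n \<e> omega ==> y = z" for n y z
    unfolding R_def using agree by (metis succ)
  have Wn: "y \<e> W \<longleftrightarrow> (EX n. n \<e> omega & R n y)" for y
    using W b uniq by metis
  have R0: "R emp x" unfolding R_def using ex[OF omega_0] unfolding A_def by auto
  have RS: "R (succ n) (un y)" if Rn: "R n y" "n \<e> omega" for n y
  proof -
    obtain f where f: "A n f" "y = app f n" using Rn unfolding R_def by blast
    obtain g where g: "A (succ n) g" using ex[OF omega_succ[OF Rn(2)]] by blast
    have "app g (succ n) = un (app g n)" using g unfolding A_def by simp
    also have "app g n = y" using agree[OF Rn(2) g f(1)] Rn(2) omega_succ f(2) by simp
    finally show ?thesis unfolding R_def using g by metis
  qed
  have "sub x (un W)" unfolding sub_def using R0 Wn omega_0 by (metis un)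
  moreover have "trs (un W)" unfolding trs_def sub_def
  proof (intro allI impI)
    fix y z assume "y \<e> un W" and z: "z \<e> y"
    then obtain n w where w: "n \<e> omega" "R n w" "y \<e> w" unfolding un Wn by blast
    then have "un w \<e> W" using RS Wn omega_succ by blast
    moreover have "z \<e> un w" using w z by auto
    ultimately show "z \<e> un W" unfolding un[of z W] by blast
  qed
  ultimately show ?thesis by blast
qed

text \<open>Foundation speaks about sets, and by separation the counterexamples inside a transitive
  set containing \<open>x\<close> form one. For a \<open>P\<close> that is not definable this could
  fail, as the model may be ill-founded from outside.\<close>

lemma eps_induct [case_names D step]:
  assumes "D (%e. P (e 0))" "!!x. (!!y. y \<e> x ==> P y) ==> P x"
  shows "P x"
proof (rule ccontr)
  assume n: "~ P x"
  obtain t where t: "trs t" "sub (upair x x) t" using transitive_superset by blast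
  have mem: "z \<e> sepS t (%z. ~ P z) \<longleftrightarrow> z \<e> t & ~ P z" for z
    by (rule sepS) (intro dfi assms)
  have "x \<e> sepS t (%z. ~ P z)" using n t by (simp add: mem sub_def)
  from found[OF this] obtain y where y: "y \<e> t" "~ P y" "!!z. z \<e> y ==> z \<e> t ==> P z" unfolding mem by blast
  have "z \<e> t" if "z \<e> y" for z using that y(1) t(1) unfolding trs_def sub_def by blast
  then have "P y" using y(3) assms(2)[of y] by blast
  with y show False by blast
qed

subsection \<open>Recursion on membership\<close>

text \<open>Partial solutions of the recursion on transitive domains. \<open>G\<close> receives the
  set \<open>y\<close> and the restriction of the solution to \<open>y\<close>.\<close>

definition att where "att G f d \<longleftrightarrow> fn f d & trs d & (ALL y. y \<e> d --> app f y = G y (lam y (app f)))"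
definition recR where "recR G x v \<longleftrightarrow> (EX f d. att G f d & x \<e> d & v = app f x)"
definition rec where "rec G x = (THE v. recR G x v)"

context
  fixes G
  assumes G: "T (%e. G (e 0) (e (Suc 0)))"
begin

lemma G_T: "T s ==> T t ==> T (%e. G (s e) (t e))"
  by (rule dftc2[OF G[unfolded dft_def]])

lemma att_D: "T s ==> T t ==> D (%e. att G (s e) (t e))"
  unfolding att_def by (intro dfi G_T dft_shift)
lemma recR_D: "T s ==> T t ==> D (%e. recR G (s e) (t e))"
  unfolding recR_def by (intro dfi att_D dft_shift)

lemma att_agree: assumes "att G f d" "att G g d'" shows "y \<e> d --> y \<e> d' --> app f y = app g y"
proof (induct y rule: eps_induct)
  case D show ?case by (intro dfi recR_D)
next
  case (step y)
  show ?case
  proof (intro impI)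
    assume y: "y \<e> d" "y \<e> d'"
    then have "lam y (app f) = lam y (app g)"
      using step assms by (intro lam_cong app_D0) (auto simp: att_def trs_def sub_def)
    then show "app f y = app g y" using y assms unfolding att_def by metis
  qed
qed

lemma recR_unique: "recR G x v ==> recR G x w ==> v = w"
  unfolding recR_def using att_agree by blast

lemma recR_ex: "EX v. recR G x v"
proof (induct x rule: eps_induct)
  case D show ?case by (intro dfi recR_D)
next
  case (step x)
  obtain t where t: "trs t" "sub x t" using transitive_superset by blast
  \<comment> \<open>The elements of the transitive set at which the recursion already has a value;
    replacement gathers their values into one solution with domain \<open>d\<close>, to which
    \<open>x\<close> is then adjoined if necessary.\<close>
  define d where "d = sepS t (%z. EX v. recR G z v)"
  have d: "z \<e> d \<longleftrightarrow> z \<e> t & (EX v. recR G z v)" for z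
    unfolding d_def by (rule sepS) (intro dfi recR_D)
  have rd: "EX v. recR G w v" if "recR G z v" "w \<e> z" for w z v
    using that unfolding recR_def att_def trs_def sub_def by blast
  have trd: "trs d" using t(1) rd unfolding trs_def sub_def d by blast
  have xd: "sub x d" using step t(2) unfolding sub_def d by blast
  have "EX z. ALL y. recR G w y \<longleftrightarrow> y = z" if "w \<e> d" for w using that recR_unique unfolding d by blast
  with repl[of "recR G" d] obtain b where b: "!!w. w \<e> d ==> EX y. y \<e> b & recR G w y"
    using recR_D[OF dft_var dft_var] by blast
  define f where "f = sepS (pw (pw (cup d b))) (%p. EX w v. w \<e> d & recR G w v & p = pair w v)"
  have pb: "pair w v \<e> pw (pw (cup d b))" if "w \<e> d" "v \<e> b" for w v
    using that by (auto simp: pair_def)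
  have "p \<e> f \<longleftrightarrow> p \<e> pw (pw (cup d b)) & (EX w v. w \<e> d & recR G w v & p = pair w v)" for p
    unfolding f_def by (rule sepS) (intro dfi recR_D)
  then have f: "p \<e> f \<longleftrightarrow> (EX w v. w \<e> d & recR G w v & p = pair w v)" for p
    using b pb recR_unique by metis
  have fnf: "fn f d" unfolding fn_def f using b recR_unique by (auto, blast)
  have fr: "recR G w (app f w)" if "w \<e> d" for w
    using fn_app[OF fnf that, of "app f w"] f by auto
  have af: "att G f d" unfolding att_def
  proof (intro conjI allI impI fnf trd)
    fix y assume y: "y \<e> d"
    obtain g c where g: "att G g c" "y \<e> c" "app f y = app g y" using fr[OF y] unfolding recR_def by blast
    have "lam y (app f) = lam y (app g)"
    proof (intro lam_cong app_D0)
      fix z assume z: "z \<e> y"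
      then have "z \<e> d" "z \<e> c" using y trd g unfolding att_def trs_def sub_def by blast+
      then have "recR G z (app g z)" "recR G z (app f z)" using g fr unfolding recR_def by blast+
      then show "app f z = app g z" using recR_unique by blast
    qed
    then show "app f y = G y (lam y (app f))" using g unfolding att_def by simp
  qed
  show ?case
  proof (cases "x \<e> d")
    case True then show ?thesis using af unfolding recR_def by blast
  next
    case False
    let ?g = "adj f (pair x (G x (lam x (app f))))"
    note fa = fn_adj[OF fnf False]
    have "lam y (app ?g) = lam y (app f)" if "sub y d" for y
      using that fa(2) by (intro lam_cong app_D0) (auto simp: sub_def)
    then have "att G ?g (adj d x)"
      using fa xd trd af unfolding att_def by (auto simp: trs_def sub_def)
    then show ?thesis unfolding recR_def by fastforce
  qed
qed

lemma recR_rec: "recR G x v \<longleftrightarrow> v = rec G x"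
proof -
  have "EX! v. recR G x v" using recR_ex recR_unique by blast
  from theI'[OF this] recR_unique show ?thesis unfolding rec_def by blast
qed

lemma rec_T: "T s ==> T (%e. rec G (s e))"
  by (rule dftc1) (auto simp: recR_rec[symmetric] intro: dfi recR_D)

lemma rec_eq: "rec G x = G x (lam x (rec G))"
proof -
  obtain f d where f: "att G f d" "x \<e> d" "rec G x = app f x" using recR_rec[of x "rec G x"] unfolding recR_def by blast
  have "lam x (app f) = lam x (rec G)"
  proof (intro lam_cong app_D0)
    show "T (%e. rec G (e 0))" by (rule rec_T[OF dft_var])
    fix z assume "z \<e> x"
    then have "z \<e> d" using f unfolding att_def trs_def sub_def by blast
    then show "app f z = rec G z" using f recR_rec[of z "app f z"] unfolding recR_def by blast
  qed
  then show ?thesis using f unfolding att_def by simp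
qed

end

end

context zfc
begin

subsection \<open>Ordinals, the cumulative hierarchy and collection\<close>

definition VG where "VG x f = un (img (%y. pw (app f y)) x)"
definition V where "V = rec VG"

lemma VG_T: "T (%e. VG (e 0) (e (Suc 0)))" unfolding VG_def by (intro dfi)
lemma V_T [dfi]: "T s ==> T (%e. V (s e))" unfolding V_def by (rule rec_T[OF VG_T])

lemma V: "z \<e> V x \<longleftrightarrow> (EX y. y \<e> x & sub z (V y))"
proof -
  have t: "T (%e. V (e 0))" by (intro dfi)
  have e: "V x = VG x (lam x V)" unfolding V_def by (rule rec_eq[OF VG_T])
  have i: "w \<e> img (%y. pw (app (lam x V) y)) x \<longleftrightarrow> (EX y. y \<e> x & w = pw (app (lam x V) y))" for w
    by (rule img) (intro dfi)
  have "z \<e> V x \<longleftrightarrow> (EX y. y \<e> x & sub z (app (lam x V) y))"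
  proof -
    have "z \<e> V x \<longleftrightarrow> (EX w. w \<e> img (%y. pw (app (lam x V) y)) x & z \<e> w)"
      by (subst e) (simp only: VG_def un)
    also have "\<dots> \<longleftrightarrow> (EX y. y \<e> x & z \<e> pw (app (lam x V) y))" unfolding i by metis
    finally show ?thesis by (simp only: pw sub_def)
  qed
  also have "\<dots> \<longleftrightarrow> (EX y. y \<e> x & sub z (V y))" using lam(2)[OF t, of _ x] by (simp cong: conj_cong)
  finally show ?thesis .
qed

definition Ord where "Ord x \<longleftrightarrow> trs x & (ALL y. y \<e> x --> trs y)"
lemma Ord_D [dfi]: "T s ==> D (%e. Ord (s e))" unfolding Ord_def by (intro dfi dft_shift)

lemma trsD: "trs x ==> y \<e> x ==> z \<e> y ==> z \<e> x" unfolding trs_def sub_def by blast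
lemma Ord_trsD: "Ord x ==> y \<e> x ==> z \<e> y ==> z \<e> x" unfolding Ord_def using trsD[of x y z] by blast
lemma Ord_mem: "Ord x ==> y \<e> x ==> Ord y" unfolding Ord_def trs_def sub_def by blast
lemma Ord_subD: "Ord x ==> y \<e> x ==> sub y x" using Ord_trsD by (blast intro: subI)

lemma Ord_linear: "Ord x --> (ALL y. Ord y --> x \<e> y | x = y | y \<e> x)"
proof (induct x rule: eps_induct)
  case D show ?case by (intro dfi)
next
  case (step x)
  note IHx = step
  show ?case
  proof (intro impI allI)
    fix y assume x: "Ord x"
    show "Ord y ==> x \<e> y | x = y | y \<e> x"
    proof -
      have "Ord y --> x \<e> y | x = y | y \<e> x"
      proof (induct y rule: eps_induct)
        case D show ?case by (intro dfi)
      next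
        case (step y)
        show ?case
        proof (intro impI, rule ccontr)
          assume y: "Ord y" and n: "~ (x \<e> y | x = y | y \<e> x)"
          have "z \<e> x \<longleftrightarrow> z \<e> y" for z
          proof
            assume z: "z \<e> x"
            with IHx x y have "z \<e> y | z = y | y \<e> z" using Ord_mem by blast
            with n z Ord_trsD[OF x z] show "z \<e> y" by blast
          next
            assume z: "z \<e> y"
            with step y have "x \<e> z | x = z | z \<e> x" using Ord_mem by blast
            with n z Ord_trsD[OF y z] show "z \<e> x" by blast
          qed
          then have "x = y" by (rule extens)
          with n show False by blast
        qed
      qed
      then show "Ord y ==> x \<e> y | x = y | y \<e> x" by blast
    qed
  qed
qed

lemma Ord_lin: "Ord x ==> Ord y ==> x \<e> y | x = y | y \<e> x" using Ord_linear by blast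

lemma Ord_least: assumes "D (%e. P (e 0))" "Ord a" "P a"
  shows "EX b. Ord b & P b & (ALL c. c \<e> b --> ~ P c)"
proof -
  note dfc1[OF assms(1), dfi]
  have "Ord a --> P a --> (EX b. Ord b & P b & (ALL c. c \<e> b --> ~ P c))"
  proof (induct a rule: eps_induct)
    case D show ?case by (intro dfi)
  next
    case (step a) then show ?case using Ord_mem by blast
  qed
  with assms show ?thesis by blast
qed

lemma Ord_un: assumes "!!x. x \<e> A ==> Ord x" shows "Ord (un A)"
  unfolding Ord_def
proof (intro conjI allI impI)
  show "trs (un A)" unfolding trs_def sub_def
  proof (intro allI impI)
    fix y z assume "y \<e> un A" and z: "z \<e> y"
    then obtain w where "w \<e> A" "y \<e> w" by auto
    then have "w \<e> A" "z \<e> w" using Ord_trsD[OF assms] z by blast+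
    then show "z \<e> un A" by auto
  qed
  fix y assume "y \<e> un A"
  then obtain w where "w \<e> A" "y \<e> w" by auto
  then show "trs y" using assms[of w] unfolding Ord_def by blast
qed

lemma Ord_succ: "Ord x ==> Ord (succ x)"
  unfolding Ord_def trs_def sub_def succ by blast

lemma Ord_succ_mem: "Ord a ==> b \<e> a ==> succ b \<e> a | succ b = a"
  using Ord_lin[of "succ b" a] Ord_succ Ord_mem mem_asym mem_irrefl succ by metis

lemma Ord_omega: "Ord omega" unfolding Ord_def using omega_trs nat_trs by blast
lemma Ord_nat: "n \<e> omega ==> Ord n" using Ord_omega Ord_mem by blast

lemma V_mono: "sub x y ==> sub (V x) (V y)" unfolding sub_def using V by (metis sub_def)
lemma V_trs: "trs (V x)"
proof (induct x rule: eps_induct)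
  case D show ?case by (intro dfi)
next
  case (step x)
  show ?case unfolding trs_def
  proof (intro allI impI subI)
    fix y z assume "y \<e> V x" "z \<e> y"
    then obtain w where w: "w \<e> x" "z \<e> V w" unfolding V[of y x] sub_def by blast
    with step have "sub z (V w)" unfolding trs_def by blast
    with w show "z \<e> V x" unfolding V[of z x] by blast
  qed
qed

lemma V_mem_sub: "y \<e> x ==> sub (V y) (V x)"
proof (rule subI)
  fix z assume "y \<e> x" "z \<e> V y"
  then show "z \<e> V x" using V_trs[of y] unfolding V[of z x] trs_def by blast
qed
lemma V_succ: "z \<e> V (succ x) \<longleftrightarrow> sub z (V x)"
proof
  assume "z \<e> V (succ x)"
  then obtain y where y: "y \<e> x | y = x" "sub z (V y)" unfolding V[of z] by auto
  then show "sub z (V x)" using sub_trans V_mem_sub by blast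
qed (use V[of z "succ x"] in auto)

lemma ex_V: "EX a. Ord a & x \<e> V a"
proof (induct x rule: eps_induct)
  case D show ?case by (intro dfi)
next
  case (step x)
  define R where "R y a \<longleftrightarrow> Ord a & y \<e> V a & (ALL b. b \<e> a --> ~ y \<e> V b)" for y a
  have R_D: "D (%e. R (e 0) (e (Suc 0)))" unfolding R_def by (intro dfi)
  have Rex: "EX a. R y a" if yx: "y \<e> x" for y
  proof -
    obtain a where "Ord a" "y \<e> V a" using step[OF yx] by blast
    moreover have "D (%e. y \<e> V (e 0))" by (intro dfi)
    ultimately show ?thesis using Ord_least[of "%a. y \<e> V a" a] unfolding R_def by blast
  qed
  have Run: "R y a ==> R y b ==> a = b" for y a b unfolding R_def using Ord_lin by blast
  have "EX z. ALL w. R y w \<longleftrightarrow> w = z" if "y \<e> x" for y using Rex[OF that] Run by blast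
  from repl[OF R_D this] obtain b where b: "!!y. y \<e> x ==> EX a. a \<e> b & R y a" by blast
  define A where "A = sepS b Ord"
  have A: "a \<e> A \<longleftrightarrow> a \<e> b & Ord a" for a unfolding A_def by (rule sepS) (intro dfi)
  have "sub x (V (un A))"
  proof (rule subI)
    fix y assume "y \<e> x"
    then obtain a where a: "a \<e> A" "y \<e> V a" using b unfolding A R_def by blast
    then have "sub a (un A)" by (auto simp: sub_def)
    with a V_mono show "y \<e> V (un A)" unfolding sub_def by blast
  qed
  then have "x \<e> V (succ (un A))" by (simp add: V_succ)
  moreover have "Ord (succ (un A))" by (intro Ord_succ Ord_un) (simp add: A)
  ultimately show ?case by blast
qed

text \<open>Scott's trick: the least level of the hierarchy that contains a witness is unique, so
  replacement applies to the levels.\<close>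

lemma collection: assumes Q: "D (%e. Q (e 0) (e (Suc 0)))" and ex: "!!x. x \<e> a ==> EX y. Q x y"
  shows "EX b. ALL x. x \<e> a --> (EX y. y \<e> b & Q x y)"
proof -
  note dfc2[OF Q, dfi]
  define R where "R x a \<longleftrightarrow> Ord a & (EX y. y \<e> V a & Q x y) & (ALL b. b \<e> a --> ~ (EX y. y \<e> V b & Q x y))" for x a
  have R_D: "D (%e. R (e 0) (e (Suc 0)))" unfolding R_def by (intro dfi)
  have Rex: "EX c. R x c" if xa: "x \<e> a" for x
  proof -
    obtain y where "Q x y" using ex[OF xa] by blast
    moreover obtain c where "Ord c" "y \<e> V c" using ex_V[of y] by blast
    moreover have "D (%e. EX y. y \<e> V (e 0) & Q x y)" by (intro dfi)
    ultimately show ?thesis using Ord_least[of "%a. EX y. y \<e> V a & Q x y" c] unfolding R_def by blast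
  qed
  have Run: "R y a ==> R y b ==> a = b" for y a b unfolding R_def using Ord_lin by blast
  have "EX z. ALL w. R y w \<longleftrightarrow> w = z" if "y \<e> a" for y using Rex[OF that] Run by blast
  from repl[OF R_D this] obtain b where b: "!!y. y \<e> a ==> EX c. c \<e> b & R y c" by blast
  have "T (%e. V (e 0))" by (intro dfi)
  then have "EX y. y \<e> un (img V b) & Q x y" if "x \<e> a" for x
    using b[OF that] unfolding R_def by (simp, blast)
  then show ?thesis by blast
qed

subsection \<open>Choice\<close>

definition prod where "prod x y = sepS (pw (pw (cup x y))) (%p. EX u v. u \<e> x & v \<e> y & p = pair u v)"

lemma prod: "p \<e> prod x y \<longleftrightarrow> (EX u v. u \<e> x & v \<e> y & p = pair u v)"
proof -
  have "D (%e. EX u v. u \<e> x & v \<e> y & e 0 = pair u v)" by (intro dfi)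
  then show ?thesis unfolding prod_def by (subst sepS) (auto simp: pair_def)
qed
lemma prod_pair [simp]: "pair u v \<e> prod x y \<longleftrightarrow> u \<e> x & v \<e> y" by (auto simp: prod)
lemma prod_T [dfi]: "T s ==> T t ==> T (%e. prod (s e) (t e))"
  unfolding prod_def by (intro dfi dft_shift)

lemma choice_function: assumes "!!x. x \<e> F ==> EX z. z \<e> x"
  shows "EX c. fn c F & (ALL x. x \<e> F --> app c x \<e> x)"
proof -
  \<comment> \<open>Tagging each \<open>x\<close> with itself makes the family disjoint, as the
    axiom of choice requires.\<close>
  let ?f = "%x. prod (upair x x) x"
  have t: "T (%e. ?f (e 0))" by (intro dfi)
  let ?F = "img ?f F"
  have F: "z \<e> ?F \<longleftrightarrow> (EX x. x \<e> F & z = ?f x)" for z using t by simp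
  have "ALL x. x \<e> ?F --> (EX z. z \<e> x)" unfolding F using assms by (auto simp: prod)
  moreover have "ALL x y. x \<e> ?F & y \<e> ?F & x ~= y --> ~ (EX z. z \<e> x & z \<e> y)" unfolding F by (auto simp: prod)
  ultimately obtain C where C: "!!x. x \<e> ?F ==> EX c. ALL z. z \<e> C & z \<e> x \<longleftrightarrow> z = c" using choice by blast
  have C': "EX y. y \<e> x & (ALL v. pair x v \<e> C & v \<e> x \<longleftrightarrow> v = y)" if xF: "x \<e> F" for x
  proof -
    obtain c where c: "!!z. z \<e> C & z \<e> ?f x \<longleftrightarrow> z = c" using C[of "?f x"] xF unfolding F by blast
    then obtain y where "c = pair x y" "y \<e> x" by (metis prod upair)
    with c[of "pair x _"] show ?thesis by (intro exI[of _ y]) auto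
  qed
  define c where "c = sepS C (%p. EX x y. x \<e> F & y \<e> x & p = pair x y)"
  have c: "p \<e> c \<longleftrightarrow> p \<e> C & (EX x y. x \<e> F & y \<e> x & p = pair x y)" for p
    unfolding c_def by (rule sepS) (intro dfi)
  have f: "fn c F" unfolding fn_def
  proof (intro conjI allI impI)
    show "p \<e> c ==> EX x y. x \<e> F & p = pair x y" for p by (auto simp: c)
    show "x \<e> F ==> EX y. ALL v. pair x v \<e> c \<longleftrightarrow> v = y" for x using C'[of x] by (auto simp: c)
  qed
  moreover have "app c x \<e> x" if "x \<e> F" for x
    using fn_app[OF f that, of "app c x"] by (auto simp: c)
  ultimately show ?thesis by blast
qed

text \<open>The internal form of choosing witnesses. Choices made in the metatheory would give
  functions that need not be elements of the model.\<close>

lemma skolem: assumes Q: "D (%e. Q (e 0) (e (Suc 0)))" and ex: "!!x. x \<e> a ==> EX y. Q x y"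
  shows "EX f. fn f a & (ALL x. x \<e> a --> Q x (app f x))"
proof -
  note dfc2[OF Q, dfi]
  obtain b where b: "!!x. x \<e> a ==> EX y. y \<e> b & Q x y" using collection[OF Q ex] by blast
  let ?h = "%x. sepS b (%y. Q x y)"
  have h: "y \<e> ?h x \<longleftrightarrow> y \<e> b & Q x y" for x y by (rule sepS) (intro dfi)
  have t: "T (%e. ?h (e 0))" by (intro dfi)
  have "!!x. x \<e> img ?h a ==> EX z. z \<e> x" using b t by (auto simp: h)
  from choice_function[OF this] obtain c where c: "!!x. x \<e> img ?h a ==> app c x \<e> x" by blast
  have t2: "T (%e. app c (?h (e 0)))" by (intro dfi)
  have "Q x (app c (?h x))" if "x \<e> a" for x
    using c[of "?h x"] t that by (auto simp: h)
  then show ?thesis by (intro exI[of _ "lam a (%x. app c (?h x))"]) (simp add: lam[OF t2])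
qed

lemma well_order: "EX a f. Ord a & fn f a & (ALL y. y \<e> x \<longleftrightarrow> (EX b. b \<e> a & app f b = y))"
proof -
  have dd: "D (%e. EX z. z \<e> e 0)" by (intro dfi)
  have "!!y. y \<e> sepS (pw x) (%y. EX z. z \<e> y) ==> EX z. z \<e> y"
    by (simp add: sepS[OF dd])
  from choice_function[OF this] obtain c
    where "!!y. y \<e> sepS (pw x) (%y. EX z. z \<e> y) ==> app c y \<e> y" by blast
  moreover have "D (%e. EX z. z \<e> e 0)" by (intro dfi)
  ultimately have c: "sub y x ==> EX z. z \<e> y ==> app c y \<e> y" for y by (simp add: sepS sub_def)
  define R where "R b f = sepS x (%z. ~ (EX d. d \<e> b & app f d = z))" for b f
  \<comment> \<open>When nothing is left, the value is \<open>x\<close> itself, which is not an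
    element of \<open>x\<close> and so marks the end.\<close>
  define G where "G b f = (if EX z. z \<e> R b f then app c (R b f) else x)" for b f
  have R: "z \<e> R b f \<longleftrightarrow> z \<e> x & ~ (EX d. d \<e> b & app f d = z)" for z b f
    unfolding R_def by (rule sepS) (intro dfi)
  have G_T: "T (%e. G (e 0) (e (Suc 0)))" unfolding G_def R_def by (intro dfi)
  define H where "H = rec G"
  have H_T [dfi]: "T s ==> T (%e. H (s e))" for s unfolding H_def by (rule rec_T[OF G_T])
  have H0: "T (%e. H (e 0))" by (intro dfi)
  have HG: "H b = G b (lam b H)" for b unfolding H_def by (rule rec_eq[OF G_T])
  have HR: "z \<e> R b (lam b H) \<longleftrightarrow> z \<e> x & ~ (EX d. d \<e> b & H d = z)" for z b
    unfolding R using lam(2)[OF H0, of _ b] by metis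
  have Hc: "H b = x & (ALL z. z \<e> x --> (EX d. d \<e> b & H d = z)) | H b \<e> x & ~ (EX d. d \<e> b & H d = H b)" for b
  proof (cases "EX z. z \<e> R b (lam b H)")
    case True
    have "sub (R b (lam b H)) x" by (simp add: sub_def HR)
    with c True have "app c (R b (lam b H)) \<e> R b (lam b H)" by blast
    then show ?thesis using HG[of b] True unfolding G_def HR by simp
  next
    case False then show ?thesis using HG[of b] unfolding G_def HR by auto
  qed
  have "EX a. Ord a & H a = x"
  proof (rule ccontr)
    assume n: "~ (EX a. Ord a & H a = x)"
    \<comment> \<open>If the end never came, \<open>H\<close> would map the ordinals one-to-one into
      \<open>x\<close>, and replacement along its inverse would produce a set of all ordinals. The
      default \<open>emp\<close> keeps \<open>K\<close> functional.\<close>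
    define K where "K z b \<longleftrightarrow> (if EX d. Ord d & H d = z then Ord b & H b = z else b = emp)" for z b
    have K_D: "D (%e. K (e 0) (e (Suc 0)))" unfolding K_def if_bool_eq_conj by (intro dfi)
    have uniq: "b = d" if "Ord b" "Ord d" "H b = H d" for b d
      using Ord_lin[OF that(1,2)] Hc[of b] Hc[of d] n that by metis
    have "EX w. ALL y. K z y \<longleftrightarrow> y = w" for z unfolding K_def using uniq by auto
    from repl[OF K_D this] obtain B where B: "!!z. z \<e> x ==> EX b. b \<e> B & K z b" by blast
    have OB: "b \<e> B" if "Ord b" for b
    proof -
      have "H b \<e> x" using Hc[of b] n that by blast
      from B[OF this] obtain b' where "b' \<e> B" "K (H b) b'" by blast
      then show ?thesis using that uniq[of b' b] unfolding K_def by metis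
    qed
    have "z \<e> sepS B Ord \<longleftrightarrow> z \<e> B & Ord z" for z by (rule sepS) (intro dfi)
    then have S: "z \<e> sepS B Ord \<longleftrightarrow> Ord z" for z using OB by blast
    then have "Ord (succ (un (sepS B Ord)))" by (intro Ord_succ Ord_un) blast
    then have "succ (un (sepS B Ord)) \<e> sepS B Ord" using S by blast
    then have "un (sepS B Ord) \<e> un (sepS B Ord)" by (metis succ un)
    then show False by simp
  qed
  moreover have "D (%e. H (e 0) = x)" by (intro dfi)
  ultimately obtain a where a: "Ord a" "H a = x" "!!c. c \<e> a ==> H c ~= x"
    using Ord_least[of "%a. H a = x"] by blast
  have "y \<e> x \<longleftrightarrow> (EX b. b \<e> a & app (lam a H) b = y)" for y
    using Hc a lam(2)[OF H0, of _ a] by (metis mem_irrefl)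
  then show ?thesis using a lam(1)[OF H0] by blast
qed

end

context zfc
begin

subsection \<open>Coverings, countable and finite sets\<close>

text \<open>Size at most that of \<open>a\<close>. Values outside \<open>x\<close> are allowed, so
  an empty \<open>x\<close> is no exception.\<close>

definition cov where "cov a x \<longleftrightarrow> (EX f. fn f a & (ALL y. y \<e> x --> (EX n. n \<e> a & app f n = y)))"
abbreviation "ctbl x \<equiv> cov omega x"

lemma cov_D [dfi]: "T s ==> T t ==> D (%e. cov (s e) (t e))" unfolding cov_def by (intro dfi dft_shift)

lemma covI: assumes "T (%e. F (e 0))" "!!y. y \<e> x ==> EX n. n \<e> a & F n = y" shows "cov a x"
  unfolding cov_def
proof (rule exI[of _ "lam a F"], intro conjI allI impI)
  show "fn (lam a F) a" by (rule lam[OF assms(1)])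
  fix y assume "y \<e> x"
  then obtain n where "n \<e> a" "F n = y" using assms(2) by blast
  then show "EX n. n \<e> a & app (lam a F) n = y" using lam(2)[OF assms(1)] by blast
qed

lemma covE: assumes "cov a x" obtains f where "fn f a" "!!y. y \<e> x ==> EX n. n \<e> a & app f n = y"
  using assms unfolding cov_def by blast

lemma cov_trans: assumes "cov a x" "cov x y" shows "cov a y"
proof -
  obtain f where f: "!!y. y \<e> x ==> EX n. n \<e> a & app f n = y" using covE[OF assms(1)] by blast
  obtain g where g: "!!z. z \<e> y ==> EX n. n \<e> x & app g n = z" using covE[OF assms(2)] by blast
  show ?thesis by (rule covI[where F = "%n. app g (app f n)"]) (intro dfi, use f g in blast)
qed

lemma cov_sub: "cov a x ==> sub y x ==> cov a y" unfolding cov_def sub_def by blast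

lemma cov_dom: assumes "cov a x" "sub a b" shows "cov b x"
proof -
  obtain f where f: "!!y. y \<e> x ==> EX n. n \<e> a & app f n = y" using covE[OF assms(1)] by blast
  show ?thesis by (rule covI[where F = "app f"]) (intro dfi, use f assms(2) in \<open>auto simp: sub_def\<close>)
qed

lemma cov_refl [simp]: "cov a a" by (rule covI[where F = "%x. x"]) (intro dfi, simp)
lemma cov_of_sub: "sub x a ==> cov a x" using cov_sub cov_refl by blast
lemma cov_img: "T (%e. F (e 0)) ==> cov x (img F x)"
  by (rule covI[where F = F]) auto
lemma cov_emp [simp]: "cov a emp" using cov_of_sub[of emp] by (simp add: sub_def)
lemma cov_of_emp: "cov emp x ==> x = emp" unfolding cov_def emp_iff by auto

definition fst where "fst p = sepS (un (un p)) (%z. EX u v. p = pair u v & z \<e> u)"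
definition snd where "snd p = sepS (un (un p)) (%z. EX u v. p = pair u v & z \<e> v)"
lemma fst_T [dfi]: "T s ==> T (%e. fst (s e))" unfolding fst_def by (intro dfi dft_shift)
lemma snd_T [dfi]: "T s ==> T (%e. snd (s e))" unfolding snd_def by (intro dfi dft_shift)

lemma un_pair: "z \<e> un (pair u v) \<longleftrightarrow> z = u | z = v"
  unfolding un pair_def by auto

lemma fst [simp]: "fst (pair u v) = u"
proof (rule extens)
  fix z
  have "z \<e> fst (pair u v) \<longleftrightarrow> z \<e> un (un (pair u v)) & (EX u' v'. pair u v = pair u' v' & z \<e> u')"
    unfolding fst_def by (rule sepS) (intro dfi)
  then show "z \<e> fst (pair u v) \<longleftrightarrow> z \<e> u" unfolding un[of z] un_pair by auto
qed

lemma snd [simp]: "snd (pair u v) = v"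
proof (rule extens)
  fix z
  have "z \<e> snd (pair u v) \<longleftrightarrow> z \<e> un (un (pair u v)) & (EX u' v'. pair u v = pair u' v' & z \<e> v')"
    unfolding snd_def by (rule sepS) (intro dfi)
  then show "z \<e> snd (pair u v) \<longleftrightarrow> z \<e> v" unfolding un[of z] un_pair by auto
qed

lemma cov_union: assumes "cov c a" "!!y. y \<e> a ==> cov b y" shows "cov (prod c b) (un a)"
proof -
  obtain h where h: "!!y. y \<e> a ==> EX n. n \<e> c & app h n = y" using covE[OF assms(1)] by blast
  have "D (%e. fn (e (Suc 0)) b & (ALL z. z \<e> e 0 --> (EX n. n \<e> b & app (e (Suc 0)) n = z)))" by (intro dfi)
  from skolem[OF this, of a] assms(2)
  obtain g where g: "!!y z. y \<e> a ==> z \<e> y ==> EX n. n \<e> b & app (app g y) n = z" unfolding cov_def by blast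
  show ?thesis
  proof (rule covI[where F = "%p. app (app g (app h (fst p))) (snd p)"])
    show "T (%e. app (app g (app h (fst (e 0)))) (snd (e 0)))" by (intro dfi)
    fix z assume "z \<e> un a"
    then obtain y where y: "y \<e> a" "z \<e> y" by auto
    then obtain n where n: "n \<e> b" "app (app g y) n = z" using g by blast
    obtain m where m: "m \<e> c" "app h m = y" using h y by blast
    show "EX p. p \<e> prod c b & app (app g (app h (fst p))) (snd p) = z"
      by (rule exI[of _ "pair m n"]) (simp add: m n)
  qed
qed

lemma cov_prod: assumes "cov a x" "cov b y" shows "cov (prod a b) (prod x y)"
proof -
  obtain f where f: "!!y. y \<e> x ==> EX n. n \<e> a & app f n = y" using covE[OF assms(1)] by blast
  obtain g where g: "!!z. z \<e> y ==> EX n. n \<e> b & app g n = z" using covE[OF assms(2)] by blast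
  show ?thesis
  proof (rule covI[where F = "%p. pair (app f (fst p)) (app g (snd p))"])
    show "T (%e. pair (app f (fst (e 0))) (app g (snd (e 0))))" by (intro dfi)
    fix z assume "z \<e> prod x y"
    then obtain u v where "z = pair u v" "u \<e> x" "v \<e> y" by (auto simp: prod)
    moreover from this obtain m n where "m \<e> a" "n \<e> b" "app f m = u" "app g n = v" using f g by blast
    ultimately show "EX p. p \<e> prod a b & pair (app f (fst p)) (app g (snd p)) = z"
      by (intro exI[of _ "pair m n"]) simp
  qed
qed

lemma inj_cov: assumes "isfun f x b" "inje f x" shows "cov b x"
\<comment> \<open>A fibre has at most one element, so taking its union inverts
  \<open>f\<close>.\<close>
proof (rule covI[where F = "%n. un (sepS x (%y. app f y = n))"])
  show "T (%e. un (sepS x (%y. app f y = e 0)))" by (intro dfi)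
  fix y assume y: "y \<e> x"
  have "z \<e> sepS x (%z. app f z = app f y) \<longleftrightarrow> z \<e> x & app f z = app f y" for z
    by (rule sepS) (intro dfi)
  then have "z \<e> sepS x (%z. app f z = app f y) \<longleftrightarrow> z = y" for z using y assms(2) unfolding inje_def by metis
  then have "un (sepS x (%z. app f z = app f y)) = y" by (intro extens) simp
  then show "EX n. n \<e> b & un (sepS x (%z. app f z = n)) = y" using y assms(1) unfolding isfun_def by blast
qed

lemma cov_inj: assumes "cov a x" shows "EX f. isfun f x a & inje f x"
proof -
  obtain g where g: "!!y. y \<e> x ==> EX n. n \<e> a & app g n = y" using covE[OF assms(1)] by blast
  have "D (%e. e (Suc 0) \<e> a & app g (e (Suc 0)) = e 0)" by (intro dfi)
  from skolem[OF this, of x] g obtain f where "fn f x" "!!y. y \<e> x ==> app f y \<e> a & app g (app f y) = y" by blast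
  then show ?thesis unfolding isfun_def inje_def by metis
qed

subsection \<open>Recursion on the natural numbers and pairing\<close>

lemma un_succ: "trs n ==> un (succ n) = n"
  by (rule extens) (auto dest: trsD)
lemma succ_ne [simp]: "succ n ~= emp" using ne_emp succ by metis
lemma succ_inj: "n \<e> omega ==> m \<e> omega ==> succ n = succ m \<longleftrightarrow> n = m" using un_succ nat_trs by metis

definition nrec where "nrec z S = rec (%n f. if n = emp then z else S (un n) (app f (un n)))"

lemma assumes S: "T (%e. S (e 0) (e (Suc 0)))"
  shows nrec_0: "nrec z S emp = z" and nrec_succ: "n \<e> omega ==> nrec z S (succ n) = S n (nrec z S n)"
    and nrec_T: "T t ==> T (%e. nrec z S (t e))"
proof -
  have S': "T s ==> T t ==> T (%e. S (s e) (t e))" for s t by (rule dftc2[OF S[unfolded dft_def]])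
  let ?G = "%n f. if n = emp then z else S (un n) (app f (un n))"
  have G: "T (%e. ?G (e 0) (e (Suc 0)))" by (intro dfi S')
  show "nrec z S emp = z" unfolding nrec_def by (subst rec_eq[OF G]) simp
  show TT: "T t ==> T (%e. nrec z S (t e))" for t unfolding nrec_def by (rule rec_T[OF G])
  assume n: "n \<e> omega"
  have "nrec z S (succ n) = ?G (succ n) (lam (succ n) (nrec z S))" unfolding nrec_def by (rule rec_eq[OF G])
  then show "nrec z S (succ n) = S n (nrec z S n)" using nat_trs[OF n] lam(2)[OF TT[OF dft_var], of n "succ n"]
    by (simp add: un_succ)
qed

text \<open>Only one-place recursion is at hand, so the recursion on \<open>n\<close> builds the
  whole function sending \<open>m\<close> to \<open>m + n\<close> as a set.\<close>

definition plus where "plus m n = app (nrec (lam omega (%m. m)) (%n g. lam omega (%m. succ (app g m))) n) m"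

lemma plus_T [dfi]: "T s ==> T t ==> T (%e. plus (s e) (t e))"
  unfolding plus_def by (intro dfi nrec_T)

lemma plus_0: "m \<e> omega ==> plus m emp = m"
  unfolding plus_def by (subst nrec_0) (intro dfi, simp add: lam[OF dft_var])

lemma plus_succ: assumes "m \<e> omega" "n \<e> omega" shows "plus m (succ n) = succ (plus m n)"
proof -
  have "T (%e. succ (app (nrec (lam omega (%m. m)) (%n g. lam omega (%m. succ (app g m))) n) (e 0)))" by (intro dfi)
  then show ?thesis unfolding plus_def using assms by (subst nrec_succ) (auto intro!: dfi simp: lam)
qed

lemma plus_omega: "n \<e> omega ==> m \<e> omega ==> plus m n \<e> omega"
  by (induct rule: omega_induct) (auto intro!: dfi simp: plus_0 plus_succ omega_succ)

lemma plus_succ1: "n \<e> omega ==> m \<e> omega ==> plus (succ m) n = succ (plus m n)"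
  by (induct rule: omega_induct) (auto intro!: dfi simp: plus_0 plus_succ omega_succ)

lemma plus_01: "n \<e> omega ==> plus emp n = n"
  by (induct rule: omega_induct) (auto intro!: dfi simp: plus_0 plus_succ omega_succ)

text \<open>The next point along Cantor's antidiagonals: \<open>(0, b)\<close> is followed by
  \<open>(b + 1, 0)\<close>, and \<open>(a + 1, b)\<close> by \<open>(a, b + 1)\<close>.\<close>

definition nx where "nx p = (if fst p = emp then pair (succ (snd p)) emp else pair (un (fst p)) (succ (snd p)))"
definition en where "en = nrec (pair emp emp) (%n p. nx p)"

lemma nx_T [dfi]: "T s ==> T (%e. nx (s e))" unfolding nx_def by (intro dfi)
lemma en_T [dfi]: "T s ==> T (%e. en (s e))" unfolding en_def by (intro dfi nrec_T)
lemma en_0: "en emp = pair emp emp" unfolding en_def by (rule nrec_0) (intro dfi)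
lemma en_succ: "n \<e> omega ==> en (succ n) = nx (en n)" unfolding en_def by (rule nrec_succ) (intro dfi)

lemma nat_succ_mem: "n \<e> omega ==> m \<e> n ==> succ m \<e> succ n"
  using Ord_succ_mem[of n m] Ord_nat by auto

text \<open>The components of a code do not exceed the code, so a recursion may look up earlier
  values at decoded places.\<close>

lemma en_bound: "n \<e> omega ==> EX a b. en n = pair a b & a \<e> omega & b \<e> omega & a \<e> succ n & b \<e> succ n"
proof (induct rule: omega_induct)
  case D show ?case by (intro dfi)
next
  case emp show ?case by (simp add: en_0)
next
  case (succ n)
  then obtain a b where ab: "en n = pair a b" "a \<e> omega" "b \<e> omega" "a \<e> succ n" "b \<e> succ n" by blast
  have b: "succ b \<e> succ (succ n)" using ab succ nat_succ_mem omega_succ by blast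
  show ?case
  proof (cases rule: nat_cases[OF ab(2)])
    case 1
    then show ?thesis using ab succ b by (auto simp: en_succ nx_def omega_succ)
  next
    case (2 m)
    then have "m \<e> succ n" using ab(4) nat_trs[OF omega_succ[OF succ(1)]] trsD[of "succ n" a m] by simp
    then have "m \<e> succ (succ n)" by simp
    then show ?thesis using ab succ b 2 nat_trs by (simp add: en_succ nx_def omega_succ un_succ del: succ)
  qed
qed

text \<open>Walking along an antidiagonal leads from \<open>(m + j, k)\<close> to
  \<open>(m, k + j)\<close>, so it suffices to reach the points \<open>(n, 0)\<close>. For
  \<open>n > 0\<close> such a point follows the end \<open>(0, n - 1)\<close> of the previous
  antidiagonal.\<close>

lemma en_onto: assumes "m \<e> omega" "n \<e> omega" shows "EX k. k \<e> omega & en k = pair m n"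
proof -
  define R where "R p \<longleftrightarrow> (EX k. k \<e> omega & en k = p)" for p
  have R_D [dfi]: "T s ==> D (%e. R (s e))" for s unfolding R_def by (intro dfi dft_shift)
  have nx: "R p ==> R (nx p)" for p unfolding R_def using en_succ omega_succ by metis
  have R0: "R (pair emp emp)" unfolding R_def using en_0 omega_0 by blast
  have 1: "ALL m k. m \<e> omega --> k \<e> omega --> R (pair (plus m j) k) --> R (pair m (plus k j))" if "j \<e> omega" for j
    using that
  proof (induct rule: omega_induct)
    case D show ?case by (intro dfi)
  next
    case emp then show ?case by (simp add: plus_0)
  next
    case (succ j)
    show ?case
    proof (intro allI impI)
      fix m k assume mk: "m \<e> omega" "k \<e> omega" "R (pair (plus m (succ j)) k)"
      then have "R (pair (plus m j) (succ k))"
        using nx[OF mk(3)] succ nat_trs[OF plus_omega[OF succ(1) mk(1)]] by (simp add: nx_def plus_succ un_succ)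
      then have "R (pair m (plus (succ k) j))" using succ(2) mk omega_succ by blast
      then show "R (pair m (plus k (succ j)))" using mk succ by (simp add: plus_succ plus_succ1)
    qed
  qed
  have 2: "R (pair n emp)" if "n \<e> omega" for n using that
  proof (induct rule: omega_induct)
    case D show ?case by (intro dfi)
  next
    case emp show ?case by (rule R0)
  next
    case (succ n)
    then have "R (pair emp n)" using 1[OF succ(1), rule_format, of emp emp] by (simp add: plus_01)
    from nx[OF this] show ?case by (simp add: nx_def)
  qed
  have "R (pair m n)" using 1[OF assms(2), rule_format, of m emp] 2[OF plus_omega[OF assms(2,1)]] assms by (simp add: plus_01)
  then show ?thesis unfolding R_def .
qed

lemma ctbl_prod_omega: "ctbl (prod omega omega)"
  by (rule covI[where F = en]) (intro dfi, auto simp: prod dest: en_onto)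

lemma ctbl_prod: "ctbl x ==> ctbl y ==> ctbl (prod x y)"
  using cov_trans[OF ctbl_prod_omega cov_prod] by blast

lemma ctbl_un: "ctbl a ==> (!!y. y \<e> a ==> ctbl y) ==> ctbl (un a)"
  using cov_trans[OF ctbl_prod_omega cov_union] by blast

text \<open>Term \<open>k + 1\<close> of a sequence applies the operation coded by \<open>k\<close>
  to two earlier terms. Every operation with two places of arguments has a code, hence the range of
  the sequence is closed.\<close>

lemma countable_closure:
  assumes Op: "T (%e. Op (e 0) (e (Suc 0)) (e (Suc (Suc 0))))"
  shows "EX Z. ctbl Z & z0 \<e> Z & (ALL t x y. t \<e> omega --> x \<e> Z --> y \<e> Z --> Op t x y \<e> Z)"
proof -
  have Op_T: "T s ==> T t ==> T u ==> T (%e. Op (s e) (t e) (u e))" for s t u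
    by (rule dftc3[OF Op[unfolded dft_def]])
  define G where "G n f = (if n = emp then z0 else Op (fst (en (un n)))
     (app f (fst (en (snd (en (un n)))))) (app f (snd (en (snd (en (un n)))))))" for n f
  have G_T: "T (%e. G (e 0) (e (Suc 0)))" unfolding G_def by (intro dfi Op_T)
  define z where "z = rec G"
  have z_T: "T s ==> T (%e. z (s e))" for s unfolding z_def by (rule rec_T[OF G_T])
  have zG: "z n = G n (lam n z)" for n unfolding z_def by (rule rec_eq[OF G_T])
  have z0: "z emp = z0" by (simp add: zG[of emp] G_def)
  have zS: "z (succ k) = Op t (z i) (z j)" if k: "k \<e> omega" "en k = pair t k'" "en k' = pair i j" for k t k' i j
  proof -
    obtain "k' \<e> omega" "k' \<e> succ k" using en_bound[OF k(1)] k(2) by auto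
    moreover from this have "i \<e> succ k'" "j \<e> succ k'" using en_bound[of k'] k(3) by auto
    ultimately have "i \<e> succ k" "j \<e> succ k" using nat_trs[OF omega_succ[OF k(1)]] by (metis succ trsD)+
    then show ?thesis using k nat_trs[OF k(1)] lam(2)[OF z_T[OF dft_var], of _ "succ k"]
      by (simp add: zG[of "succ k"] G_def un_succ del: succ)
  qed
  have mem: "x \<e> img z omega \<longleftrightarrow> (EX n. n \<e> omega & x = z n)" for x by (rule img) (intro z_T dfi)
  show ?thesis
  proof (intro exI[of _ "img z omega"] conjI allI impI)
    show "ctbl (img z omega)" by (rule cov_img) (intro z_T dfi)
    show "z0 \<e> img z omega" unfolding mem using z0 omega_0 by metis
    fix t x y assume t: "t \<e> omega" and "x \<e> img z omega" "y \<e> img z omega"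
    then obtain i j where ij: "i \<e> omega" "x = z i" "j \<e> omega" "y = z j" unfolding mem by blast
    obtain k' where k': "k' \<e> omega" "en k' = pair i j" using en_onto[OF ij(1,3)] by blast
    obtain k where k: "k \<e> omega" "en k = pair t k'" using en_onto[OF t k'(1)] by blast
    show "Op t x y \<e> img z omega" unfolding mem using zS[OF k k'(2)] ij omega_succ[OF k(1)] by metis
  qed
qed

subsection \<open>Finite sets\<close>

definition fin where "fin x \<longleftrightarrow> (EX n. n \<e> omega & cov n x)"
lemma fin_D [dfi]: "T s ==> D (%e. fin (s e))" unfolding fin_def by (intro dfi dft_shift)

lemma mem_sepS_ne [simp]: "z \<e> sepS x (%z. z ~= y) \<longleftrightarrow> z \<e> x & z ~= y" by (rule sepS) (intro dfi)

lemma cov_remove: assumes "n \<e> omega" "cov (succ n) x" "y \<e> x" shows "cov n (sepS x (%z. z ~= y))"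
proof -
  obtain f where f: "!!y. y \<e> x ==> EX i. i \<e> succ n & app f i = y" using covE[OF assms(2)] by blast
  obtain k where k: "k \<e> succ n" "app f k = y" using f assms(3) by blast
  show ?thesis
  \<comment> \<open>The index \<open>k\<close> of the removed element takes over the value at the
    dropped index \<open>n\<close>.\<close>
  proof (rule covI[where F = "%i. if i = k then app f n else app f i"])
    show "T (%e. if e 0 = k then app f n else app f (e 0))" by (intro dfi)
    fix z assume "z \<e> sepS x (%z. z ~= y)"
    then obtain i where i: "i \<e> succ n" "app f i = z" "z ~= y" using f by auto
    then show "EX i. i \<e> n & (if i = k then app f n else app f i) = z" using k by (metis succ)
  qed
qed

lemma fin_induct [consumes 1, case_names D emp adj]:
  assumes "fin x" "D (%e. P (e 0))" "P emp" "!!x y. fin x ==> P x ==> P (adj x y)" shows "P x"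
proof -
  note dfc1[OF assms(2), dfi]
  have "ALL x. cov n x --> P x" if "n \<e> omega" for n using that
  proof (induct rule: omega_induct)
    case D show ?case by (intro dfi)
  next
    case emp then show ?case using cov_of_emp assms(3) by blast
  next
    case (succ n)
    show ?case
    proof (intro allI impI)
      fix x assume x: "cov (succ n) x"
      show "P x"
      proof (cases "x = emp")
        case False
        then obtain y where y: "y \<e> x" using ne_emp by blast
        let ?x = "sepS x (%z. z ~= y)"
        have "cov n ?x" by (rule cov_remove[OF succ(1) x y])
        then have "P (adj ?x y)" using succ assms(4) unfolding fin_def by blast
        moreover have "adj ?x y = x" by (rule extens) (use y in auto)
        ultimately show ?thesis by simp
      qed (use assms(3) in simp)
    qed
  qed
  with assms(1) show ?thesis unfolding fin_def by blast
qed

lemma fin_emp [simp]: "fin emp" unfolding fin_def using omega_0 by (meson cov_emp)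

lemma fin_adj [simp]: assumes "fin x" shows "fin (adj x y)"
proof -
  obtain n f where n: "n \<e> omega" "fn f n" "!!y. y \<e> x ==> EX i. i \<e> n & app f i = y"
    using assms unfolding fin_def cov_def by blast
  have "cov (succ n) (adj x y)"
  proof (rule covI[where F = "%i. if i = n then y else app f i"])
    show "T (%e. if e 0 = n then y else app f (e 0))" by (intro dfi)
    fix z assume "z \<e> adj x y"
    then consider "z = y" | i where "i \<e> n" "app f i = z" using n(3) by auto
    then show "EX i. i \<e> succ n & (if i = n then y else app f i) = z" by (metis succ mem_irrefl)
  qed
  then show ?thesis using n(1) omega_succ unfolding fin_def by blast
qed

lemma fin_sub: "fin x ==> sub y x ==> fin y" unfolding fin_def using cov_sub by blast
lemma fin_ctbl: "fin x ==> ctbl x"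
  unfolding fin_def using cov_dom omega_trs unfolding trs_def by blast
lemma fin_img: "T (%e. F (e 0)) ==> fin x ==> fin (img F x)"
  unfolding fin_def using cov_trans cov_img by blast
lemma fin_upair [simp]: "fin (upair x y)"
proof -
  have "upair x y = adj (adj emp x) y" by (rule extens) auto
  then show ?thesis by simp
qed
lemma fin_cup: assumes "fin x" "fin y" shows "fin (cup x y)"
  using assms(1)
proof (induct rule: fin_induct)
  case D show ?case by (intro dfi)
next
  case emp
  have "cup emp y = y" by (rule extens) auto
  then show ?case using assms by simp
next
  case (adj x z)
  have "cup (adj x z) y = adj (cup x y) z" by (rule extens) auto
  then show ?case using adj by simp
qed
lemma fin_nat: "n \<e> omega ==> fin n" unfolding fin_def using cov_refl by blast

lemma nat_max: "m \<e> omega ==> n \<e> omega ==> sub m n | sub n m"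
  using Ord_lin[of m n] Ord_nat Ord_subD sub_refl by metis

lemma not_fin_omega: "~ fin omega"
proof -
  have "EX m. m \<e> omega & (ALL n. n \<e> x --> n \<e> omega --> n \<e> m)" if "fin x" for x using that
  proof (induct rule: fin_induct)
    case D show ?case by (intro dfi)
  next
    case emp show ?case by (rule exI[of _ emp]) simp
  next
    case (adj x y)
    then obtain m where m: "m \<e> omega" "!!n. n \<e> x ==> n \<e> omega ==> n \<e> m" by blast
    show ?case
    proof (cases "y \<e> omega")
      case True
      then have "EX k. k \<e> omega & sub m k & y \<e> k"
        using nat_max[OF m(1) omega_succ[OF True]] m(1) omega_succ[OF True] sub_refl unfolding sub_def by (metis succ)
      then show ?thesis using m unfolding sub_def by auto
    qed (use m in auto)
  qed
  then show ?thesis using mem_irrefl by blast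
qed

end

context zfc
begin

subsection \<open>Uncountable ordinals\<close>

lemma cantor: "~ cov x (pw x)"
proof
  assume "cov x (pw x)"
  then obtain f where f: "!!y. y \<e> pw x ==> EX n. n \<e> x & app f n = y" using covE by blast
  have d: "z \<e> sepS x (%z. ~ z \<e> app f z) \<longleftrightarrow> z \<e> x & ~ z \<e> app f z" for z by (rule sepS) (intro dfi)
  have "sepS x (%z. ~ z \<e> app f z) \<e> pw x" by (simp add: d)
  from f[OF this] obtain n where "n \<e> x" "app f n = sepS x (%z. ~ z \<e> app f z)" by blast
  with d[of n] show False by simp
qed

text \<open>The successor cardinal of the size of \<open>X\<close>. By Cantor's theorem, a
  well-ordering of \<open>pw X\<close> yields an ordinal that \<open>X\<close> does not
  cover.\<close>

definition lub where "lub X = (SOME k. Ord k & ~ cov X k & (ALL a. a \<e> k --> cov X a))"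

lemma lub: "Ord (lub X)" "~ cov X (lub X)" "a \<e> lub X ==> cov X a"
proof -
  obtain c f where a: "Ord c" "fn f c" "!!y. y \<e> pw X \<longleftrightarrow> (EX b. b \<e> c & app f b = y)" using well_order[of "pw X"] by blast
  then have "cov c (pw X)" unfolding cov_def by blast
  then have "~ cov X c" using cov_trans cantor by blast
  moreover have "D (%e. ~ cov X (e 0))" by (intro dfi)
  ultimately have "EX k. Ord k & ~ cov X k & (ALL a. a \<e> k --> cov X a)"
    using Ord_least[of "%k. ~ cov X k" c] a(1) by blast
  from someI_ex[OF this] show "Ord (lub X)" "~ cov X (lub X)" "a \<e> lub X ==> cov X a"
    unfolding lub_def by blast+
qed

lemma lub_mem: "Ord a ==> cov X a ==> a \<e> lub X"
  using Ord_lin[of a "lub X"] lub Ord_subD cov_sub by metis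

lemma lub_succ: assumes h: "cov X (prod X X)" "a \<e> X" "b \<e> X" "a ~= b" and x: "x \<e> lub X" shows "succ x \<e> lub X"
proof -
  have "cov X (upair x (upair x x))"
    by (rule covI[where F = "%i. if i = a then x else upair x x"]) (intro dfi, use h in auto)
  moreover have "cov X (upair x x)"
    by (rule covI[where F = "%i. x"]) (intro dfi, use h in auto)
  ultimately have "cov (prod X X) (un (upair x (upair x x)))" using lub(3)[OF x] by (intro cov_union) auto
  moreover have "un (upair x (upair x x)) = succ x" by (rule extens) (auto simp: un)
  ultimately have "cov X (succ x)" using cov_trans[OF h(1)] by metis
  then show ?thesis using lub_mem Ord_succ Ord_mem[OF lub(1) x] by blast
qed

text \<open>Regularity of the successor cardinal: a union of \<open>X\<close> many sets of the size
  of \<open>X\<close> is covered by the square of \<open>X\<close>.\<close>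

lemma lub_un: assumes h: "cov X (prod X X)" "sub A (lub X)" "cov X A" shows "un A \<e> lub X"
proof (rule lub_mem)
  show "Ord (un A)" using Ord_un Ord_mem[OF lub(1)] h(2) unfolding sub_def by blast
  have "cov (prod X X) (un A)" using h lub(3) unfolding sub_def by (intro cov_union) auto
  then show "cov X (un A)" using cov_trans[OF h(1)] by blast
qed

definition "w1 = lub omega"

lemma w1: "Ord w1" "~ ctbl w1" "a \<e> w1 ==> ctbl a" unfolding w1_def by (rule lub)+ assumption
lemma w1_succ: "x \<e> w1 ==> succ x \<e> w1"
  unfolding w1_def by (rule lub_succ[OF ctbl_prod_omega omega_0 omega_succ[OF omega_0]]) (use succ_ne[of emp, symmetric] in auto)
lemma w1_un: "sub A w1 ==> ctbl A ==> un A \<e> w1"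
  unfolding w1_def by (rule lub_un[OF ctbl_prod_omega])
lemma omega_w1: "omega \<e> w1" unfolding w1_def by (rule lub_mem) (simp_all add: Ord_omega)

lemma V_two: assumes "Ord d" "!!b. b \<e> d ==> succ b \<e> d" "u \<e> V d" "v \<e> V d"
  shows "EX b. b \<e> d & u \<e> V b & v \<e> V b"
proof -
  have "EX b. b \<e> d & u \<e> V b" if "u \<e> V d" for u using that assms(2) V_succ unfolding V[of u d] by blast
  then obtain a b where ab: "a \<e> d" "u \<e> V a" "b \<e> d" "v \<e> V b" using assms by blast
  have "a \<e> b | a = b | b \<e> a" using Ord_lin Ord_mem[OF assms(1)] ab by blast
  then show ?thesis using ab V_mem_sub unfolding sub_def by blast
qed

context
  fixes d assumes d: "Ord d" "!!b. b \<e> d ==> succ b \<e> d"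
begin
lemma V_upair: "u \<e> V d ==> v \<e> V d ==> upair u v \<e> V d"
  using V_two[OF d, of u v] unfolding V[of "upair u v" d] sub_def by auto
lemma V_pair: "u \<e> V d ==> v \<e> V d ==> pair u v \<e> V d"
  unfolding pair_def by (intro V_upair)
lemma V_adj: assumes "u \<e> V d" "v \<e> V d" shows "adj u v \<e> V d"
proof -
  obtain b where b: "b \<e> d" "u \<e> V b" "v \<e> V b" using V_two[OF d assms] by blast
  then have "sub (adj u v) (V b)" using V_trs[of b] unfolding sub_def trs_def by (metis adj sub_def)
  then show ?thesis using b unfolding V[of "adj u v" d] by blast
qed
end

lemma Ord_sub_V: "Ord a --> sub a (V a)"
proof (induct a rule: eps_induct)
  case D show ?case by (intro dfi)
next
  case (step a)
  show ?case
  proof (intro impI subI)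
    fix b assume "Ord a" "b \<e> a"
    then show "b \<e> V a" using step Ord_mem unfolding V[of b a] by blast
  qed
qed

text \<open>\<open>II\<close> is closed under subsets of size at most that of \<open>X1\<close>, and in this way it will contain all
  the nice names for sets of \<open>\<aleph>\<^sub>1\<close> many points.\<close>

definition "X1 = V w1"
definition "kap = lub X1"
definition "II = V kap"

lemma X1_pair: "u \<e> X1 ==> v \<e> X1 ==> pair u v \<e> X1"
  and X1_adj: "u \<e> X1 ==> v \<e> X1 ==> adj u v \<e> X1"
  unfolding X1_def by (rule V_pair V_adj, rule w1, erule w1_succ, assumption, assumption)+
lemma w1_X1: "sub w1 X1" unfolding X1_def using Ord_sub_V w1(1) by blast
lemma X1_prod: "sub (prod X1 X1) X1" unfolding sub_def prod using X1_pair by blast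
lemma X1_cov_prod: "cov X1 (prod X1 X1)" by (rule cov_of_sub[OF X1_prod])
lemma omega_sub_X1: "sub omega X1" using w1_X1 Ord_trsD[OF w1(1) omega_w1] unfolding sub_def by blast
lemma kap: "Ord kap" unfolding kap_def by (rule lub)
lemma kap_succ: "x \<e> kap ==> succ x \<e> kap"
  unfolding kap_def
  by (rule lub_succ[OF X1_cov_prod, of emp "succ emp"]) (use omega_sub_X1 succ_ne[of emp, symmetric] omega_succ in \<open>auto simp: sub_def\<close>)
lemma w1_kap: "w1 \<e> kap" unfolding kap_def by (rule lub_mem[OF w1(1) cov_of_sub[OF w1_X1]])

lemma II_pair: "u \<e> II ==> v \<e> II ==> pair u v \<e> II"
  and II_adj: "u \<e> II ==> v \<e> II ==> adj u v \<e> II"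
  unfolding II_def by (rule V_pair V_adj, rule kap, erule kap_succ, assumption, assumption)+
lemma X1_II: "sub X1 II" unfolding X1_def II_def by (rule V_mem_sub[OF w1_kap])
lemma emp_II [simp]: "emp \<e> II" using X1_II omega_sub_X1 omega_0 unfolding sub_def by blast
text \<open>The ranks of the elements are ordinals below \<open>kap\<close>, no more of them than
  elements of \<open>X1\<close>. As \<open>kap\<close> is regular, they are bounded below
  it.\<close>

lemma II_closed: assumes b: "sub b II" "cov X1 b" shows "b \<e> II"
proof -
  have "D (%e. e (Suc 0) \<e> kap & sub (e 0) (V (e (Suc 0))))" by (intro dfi)
  moreover have "EX c. c \<e> kap & sub y (V c)" if "y \<e> b" for y using b(1) that V[of y kap] unfolding sub_def II_def by blast
  ultimately obtain h where h: "!!y. y \<e> b ==> app h y \<e> kap & sub y (V (app h y))"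
    using skolem[of "%y c. c \<e> kap & sub y (V c)" b] by blast
  let ?F = "%y. succ (app h y)"
  have F: "T (%e. ?F (e 0))" by (intro dfi)
  have "sub (img ?F b) kap" using h kap_succ F by (auto simp: sub_def simp del: succ)
  moreover have "cov X1 (img ?F b)" using cov_trans[OF b(2) cov_img[OF F]] .
  ultimately have u: "un (img ?F b) \<e> kap" unfolding kap_def by (intro lub_un X1_cov_prod)
  have "sub b (V (un (img ?F b)))"
  proof (rule subI)
    fix y assume y: "y \<e> b"
    then have "y \<e> V (?F y)" using h V_succ by blast
    moreover have "sub (?F y) (un (img ?F b))" using y F unfolding sub_def un by auto
    ultimately show "y \<e> V (un (img ?F b))" using V_mono unfolding sub_def by blast
  qed
  then show ?thesis using u unfolding II_def V[of b kap] by blast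
qed

lemma II_fin: assumes "fin x" "sub x II" shows "x \<e> II"
proof -
  have "sub x II --> x \<e> II" using assms(1)
  proof (induct rule: fin_induct)
    case D show ?case by (intro dfi)
  qed (auto simp: sub_def intro: II_adj)
  with assms show ?thesis by blast
qed

subsection \<open>Uncountable families of finite functions\<close>

text \<open>The pigeonhole principle for uncountable sets: otherwise \<open>J\<close> would be a
  countable union of countable sets.\<close>

lemma thin: assumes "ctbl Z" "D (%e. Q (e 0) (e (Suc 0)))" "~ ctbl J" "!!i. i \<e> J ==> EX z. z \<e> Z & Q i z"
  shows "EX z. z \<e> Z & ~ ctbl (sepS J (%i. Q i z))"
proof (rule ccontr)
  note dfc2[OF assms(2), dfi]
  assume n: "~ ?thesis"
  let ?F = "%z. sepS J (%i. Q i z)"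
  have F: "T (%e. ?F (e 0))" by (intro dfi)
  have m: "i \<e> ?F z \<longleftrightarrow> i \<e> J & Q i z" for i z by (rule sepS) (intro dfi)
  have "ctbl (un (img ?F Z))" using n F cov_trans[OF assms(1) cov_img[OF F]] by (intro ctbl_un) auto
  moreover have "sub J (un (img ?F Z))"
  proof (rule subI)
    fix i assume i: "i \<e> J"
    then obtain z where "z \<e> Z" "Q i z" using assms(4) by blast
    then have "?F z \<e> img ?F Z" "i \<e> ?F z" using F i by (auto simp: m)
    then show "i \<e> un (img ?F Z)" unfolding un[of i] by blast
  qed
  ultimately show False using cov_sub assms(3) by blast
qed

definition agree where "agree p q \<longleftrightarrow> (ALL c u v. pair c u \<e> p & pair c v \<e> q --> u = v)"
definition pf where "pf p Z \<longleftrightarrow> fin p & agree p p & (ALL w. w \<e> p --> (EX c u. u \<e> Z & w = pair c u))"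
definition dif where "dif p s = sepS p (%w. ~ w \<e> s)"
lemma agree_D [dfi]: "T s ==> T t ==> D (%e. agree (s e) (t e))" unfolding agree_def by (intro dfi dft_shift)
lemma pf_D [dfi]: "T s ==> T t ==> D (%e. pf (s e) (t e))" unfolding pf_def by (intro dfi dft_shift)
lemma dif_T [dfi]: "T s ==> T t ==> T (%e. dif (s e) (t e))" unfolding dif_def by (intro dfi dft_shift)
lemma dif [simp]: "w \<e> dif p s \<longleftrightarrow> w \<e> p & ~ w \<e> s" unfolding dif_def by (rule sepS) (intro dfi)

lemma ctbl_adj: "ctbl x ==> ctbl (adj x y)"
  unfolding adj_def cup_def by (rule ctbl_un[OF fin_ctbl[OF fin_upair]]) (auto simp: fin_ctbl[OF fin_upair])

text \<open>An induction in place of the Delta-system lemma: \<open>s\<close> is the common part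
  found so far and \<open>n\<close> bounds what is left. If no two members of \<open>J\<close>
  agree, each differs from a fixed \<open>p0\<close> in a pair \<open>w\<close> with coordinate from
  \<open>p0\<close> and value in \<open>Z\<close>. There are countably many such \<open>w\<close>,
  so uncountably many members share one, which joins \<open>s\<close>.\<close>

lemma ccc_aux: assumes Z: "ctbl Z" and n: "n \<e> omega"
  shows "ALL J s. ~ ctbl J & (ALL p. p \<e> J --> pf p Z & sub s p & cov n (dif p s)) -->
    (EX p q. p \<e> J & q \<e> J & p ~= q & agree p q)"
  using n
proof (induct rule: omega_induct)
  case D show ?case by (intro dfi)
next
  case emp
  show ?case
  proof (intro allI impI, elim conjE)
    fix J s assume J: "~ ctbl J" "ALL p. p \<e> J --> pf p Z & sub s p & cov emp (dif p s)"
    have "p = s" if "p \<e> J" for p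
    proof -
      have d: "dif p s = zfc.emp E" and s: "sub s p" using J(2) that cov_of_emp by blast+
      have "~ w \<e> dif p s" for w unfolding d by simp
      then have "sub p s" unfolding sub_def dif by blast
      with s show ?thesis by (rule sub_antisym[rotated])
    qed
    then have "sub J (upair s s)" by (auto simp: sub_def)
    then have "ctbl J" using fin_ctbl[OF fin_upair] cov_sub by blast
    with J show "EX p q. p \<e> J & q \<e> J & p ~= q & agree p q" by blast
  qed
next
  case (succ n)
  show ?case
  proof (intro allI impI, elim conjE, rule ccontr)
    fix J s assume J: "~ ctbl J" "ALL p. p \<e> J --> pf p Z & sub s p & cov (zfc.succ E n) (dif p s)"
      and neg: "~ (EX p q. p \<e> J & q \<e> J & p ~= q & agree p q)"
    have "J ~= emp" using J(1) by auto
    then obtain p0 where p0: "p0 \<e> J" using ne_emp by blast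
    let ?K = "sepS J (%p. p ~= p0)"
    have K: "~ ctbl ?K"
    proof
      assume "ctbl ?K"
      moreover have "sub J (adj ?K p0)" by (auto simp: sub_def)
      ultimately show False using ctbl_adj cov_sub J(1) by blast
    qed
    let ?W = "prod (img fst p0) Z"
    have fT: "T (%e. fst (e 0))" by (intro dfi)
    have W: "ctbl ?W" using J(2) p0 Z fin_ctbl cov_trans[OF _ cov_img[OF fT]] unfolding pf_def by (intro ctbl_prod) auto
    have ex: "EX w. w \<e> ?W & w \<e> p & ~ w \<e> p0" if p: "p \<e> ?K" for p
    proof -
      have "p \<e> J" "p ~= p0" using p by auto
      then have "~ agree p0 p" using neg p0 by blast
      then obtain c u v where c: "pair c u \<e> p0" "pair c v \<e> p" "u ~= v" unfolding agree_def by blast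
      have "v \<e> Z" using J(2) \<open>p \<e> J\<close> c(2) unfolding pf_def by (metis pair_inj)
      moreover have "~ pair c v \<e> p0" using J(2) p0 c unfolding pf_def agree_def by blast
      moreover have "c \<e> img fst p0" using c(1) fst[of c u] unfolding img[OF fT] by metis
      ultimately show ?thesis using c by (intro exI[of _ "pair c v"]) simp
    qed
    have dQ: "D (%e. e (Suc 0) \<e> e 0 & ~ e (Suc 0) \<e> p0)" by (intro dfi)
    from thin[OF W dQ K ex] obtain w where w: "~ ctbl (sepS ?K (%p. w \<e> p & ~ w \<e> p0))" by blast
    let ?L = "sepS ?K (%p. w \<e> p & ~ w \<e> p0)"
    have "p \<e> ?L \<longleftrightarrow> p \<e> ?K & (w \<e> p & ~ w \<e> p0)" for p by (rule sepS) (intro dfi)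
    then have L: "p \<e> ?L \<longleftrightarrow> p \<e> J & p ~= p0 & w \<e> p & ~ w \<e> p0" for p by auto
    have "pf p Z & sub (adj s w) p & cov n (dif p (adj s w))" if p: "p \<e> ?L" for p
    proof -
      have ws: "~ w \<e> s" using J(2) p0 p L subD by blast
      have "cov n (sepS (dif p s) (%z. z ~= w))"
        using J(2) p L ws by (intro cov_remove succ(1)) auto
      moreover have "sepS (dif p s) (%z. z ~= w) = dif p (adj s w)" by (rule extens) auto
      ultimately show ?thesis using J(2) p unfolding L sub_def by auto
    qed
    then obtain p q where "p \<e> ?L" "q \<e> ?L" "p ~= q" "agree p q" using succ(2) w by blast
    with neg L show False by blast
  qed
qed

lemma ccc: assumes Z: "ctbl Z" and J: "~ ctbl J" and F: "T (%e. F (e 0))" and pf: "!!i. i \<e> J ==> pf (F i) Z"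
  shows "EX i j. i \<e> J & j \<e> J & i ~= j & agree (F i) (F j)"
proof (rule ccontr)
  note FT = dftc1[OF F[unfolded dft_def]]
  assume neg: "~ ?thesis"
  \<comment> \<open>A finite function agrees with itself, so a repeated value of \<open>F\<close>
    would already give the two indices.\<close>
  have inj: "i = j" if "i \<e> J" "j \<e> J" "F i = F j" for i j
    using neg pf[OF that(1)] that unfolding pf_def by metis
  have cK: "~ ctbl (img F J)"
  proof
    assume "ctbl (img F J)"
    moreover have "cov (img F J) J"
    proof (rule covI[where F = "%p. un (sepS J (%i. F i = p))"])
      show "T (%e. un (sepS J (%i. F i = e 0)))" by (intro dfi FT)
      fix i assume i: "i \<e> J"
      have "z \<e> sepS J (%k. F k = F i) \<longleftrightarrow> z \<e> J & F z = F i" for z by (rule sepS) (intro dfi FT)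
      then have "z \<e> sepS J (%k. F k = F i) \<longleftrightarrow> z = i" for z using inj i by blast
      then have "un (sepS J (%k. F k = F i)) = i" by (intro extens) simp
      then show "EX n. n \<e> img F J & un (sepS J (%i. F i = n)) = i" using i F by auto
    qed
    ultimately show False using cov_trans J by blast
  qed
  have "EX n. n \<e> omega & cov n p" if "p \<e> img F J" for p
    using that pf F unfolding pf_def fin_def by auto
  from thin[where Q = "%p n. cov n p", OF cov_refl _ cK this] obtain n where n: "n \<e> omega" "~ ctbl (sepS (img F J) (%p. cov n p))"
    using cov_D[OF dft_var dft_var] by blast
  have "p \<e> sepS (img F J) (%p. cov n p) \<longleftrightarrow> p \<e> img F J & cov n p" for p by (rule sepS) (intro dfi)
  then have m: "p \<e> sepS (img F J) (%p. cov n p) \<longleftrightarrow> (EX i. i \<e> J & p = F i) & cov n p" for p by (simp add: F)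
  have "dif p emp = p" for p by (rule extens) simp
  then have "ALL p. p \<e> sepS (img F J) (%p. cov n p) --> pf p Z & sub emp p & cov n (dif p emp)"
    using pf unfolding m by (auto simp: sub_def)
  then obtain p q where "p \<e> sepS (img F J) (%p. cov n p)" "q \<e> sepS (img F J) (%p. cov n p)" "p ~= q" "agree p q"
    using ccc_aux[OF Z n(1)] n(2) by blast
  with neg m show False by metis
qed

end

section \<open>Forcing\<close>

text \<open>Conditions are ordered by reverse inclusion. Every set is a name; the pairs
  \<open>(z, q)\<close> in it with \<open>q\<close> a condition determine its value. Forced equality is the largest forcing
  bisimulation, so no recursion on names is needed.\<close>

locale forcing = zfc E for E :: "nat => nat => bool" (infix "\<e>" 50) +
  fixes P :: nat
  assumes one: "emp \<e> P"
begin

definition nm where "nm x z q \<longleftrightarrow> pair z q \<e> x & q \<e> P"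
lemma nm_D [dfi]: "T s ==> T t ==> T u ==> D (%e. nm (s e) (t e) (u e))" unfolding nm_def by (intro dfi)

definition forth where "forth A p x y \<longleftrightarrow> (ALL z q r. nm x z q & r \<e> P & sub p r & sub q r -->
   (EX r' w q'. r' \<e> P & sub r r' & nm y w q' & sub q' r' & A r' z w))"
definition bf where "bf A p x y \<longleftrightarrow> p \<e> P & forth A p x y & forth (%r z w. A r w z) p y x"
definition tr where "tr p x y = pair p (pair x y)"
definition bis where "bis R \<longleftrightarrow> (ALL p x y. tr p x y \<e> R --> bf (%p x y. tr p x y \<e> R) p x y)"
definition feq where "feq p x y \<longleftrightarrow> (EX R. bis R & tr p x y \<e> R)"

lemma tr_T [dfi]: "T s ==> T t ==> T u ==> T (%e. tr (s e) (t e) (u e))" unfolding tr_def by (intro dfi)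
lemma bis_D [dfi]: "T s ==> D (%e. bis (s e))" unfolding bis_def bf_def forth_def by (intro dfi dft_shift)
lemma feq_D [dfi]: "T s ==> T t ==> T u ==> D (%e. feq (s e) (t e) (u e))" unfolding feq_def by (intro dfi dft_shift)

lemma bf_mono: "bf A p x y ==> (!!p x y. A p x y ==> B p x y) ==> bf B p x y"
  unfolding bf_def forth_def by meson

lemma feq_bf1: "feq p x y ==> bf feq p x y"
  unfolding feq_def bis_def by (elim exE conjE) (rule bf_mono, blast, auto)

lemma trs_pairD: "trs t ==> pair z q \<e> t ==> z \<e> t & q \<e> t"
  unfolding pair_def trs_def sub_def by (metis upair)

text \<open>Coinduction up to \<open>feq\<close>. A bisimulation has to be a set, so the definable
  relation is cut down to conditions and to names in a transitive set around \<open>x\<close> and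
  \<open>y\<close>.\<close>

lemma coind:
  assumes D0: "D (%e. A (e 0) (e (Suc 0)) (e (Suc (Suc 0))))"
    and st: "!!p x y. A p x y ==> bf (%p x y. A p x y | feq p x y) p x y"
    and a: "A p x y"
  shows "feq p x y"
proof -
  note dfc3[OF D0, dfi]
  obtain t where t: "trs t" "sub (upair x y) t" using transitive_superset by blast
  define S where "S = sepS (prod P (prod t t)) (%w. EX p x y. w = tr p x y & (A p x y | feq p x y))"
  have "w \<e> S \<longleftrightarrow> w \<e> prod P (prod t t) & (EX p x y. w = tr p x y & (A p x y | feq p x y))" for w
    unfolding S_def by (rule sepS) (intro dfi)
  then have S: "tr p x y \<e> S \<longleftrightarrow> p \<e> P & x \<e> t & y \<e> t & (A p x y | feq p x y)" for p x y
    by (auto simp: tr_def)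
  have nt: "nm x z q ==> x \<e> t ==> z \<e> t" for x z q
    using trs_pairD[OF t(1)] trsD[OF t(1)] unfolding nm_def by blast
  have "bf (%p x y. tr p x y \<e> S) p x y" if "tr p x y \<e> S" for p x y
  proof -
    have b: "bf (%p x y. A p x y | feq p x y) p x y"
      using that st feq_bf1 bf_mono[of feq p x y "%p x y. A p x y | feq p x y"] unfolding S by blast
    have xy: "x \<e> t" "y \<e> t" using that unfolding S by auto
    show ?thesis using b unfolding bf_def forth_def S by (meson nt xy)
  qed
  then have "bis S" unfolding bis_def by blast
  moreover have "tr p x y \<e> S" using a t(2) st[OF a] unfolding S bf_def sub_def by auto
  ultimately show ?thesis unfolding feq_def by blast
qed

lemma feq_bf: "feq p x y \<longleftrightarrow> bf feq p x y"
proof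
  assume b: "bf feq p x y"
  show "feq p x y"
  proof (rule coind[of "%p x y. bf feq p x y"])
    show "D (%e. bf feq (e 0) (e (Suc 0)) (e (Suc (Suc 0))))" unfolding bf_def forth_def by (intro dfi)
    show "bf (%p x y. bf feq p x y | feq p x y) p x y" if "bf feq p x y" for p x y
      using that by (rule bf_mono) blast
  qed (rule b)
qed (rule feq_bf1)

lemma feq_P: "feq p x y ==> p \<e> P" using feq_bf1 unfolding bf_def by blast

lemma feq_refl: "p \<e> P ==> feq p x x"
proof (rule coind[of "%p x y. p \<e> P & x = y"])
  show "D (%e. e 0 \<e> P & e (Suc 0) = e (Suc (Suc 0)))" by (intro dfi)
  have *: "forth B p x x" if "!!r z. r \<e> P ==> B r z z" for B p x
    unfolding forth_def using that sub_refl by blast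
  show "p \<e> P & x = y ==> bf (%p x y. p \<e> P & x = y | feq p x y) p x y" for p x y
    unfolding bf_def by (auto intro!: *)
qed simp

lemma feq_sym: "feq p x y ==> feq p y x"
proof (rule coind[of "%p x y. feq p y x"])
  show "D (%e. feq (e 0) (e (Suc (Suc 0))) (e (Suc 0)))" by (intro dfi)
  show "feq p y x ==> bf (%p x y. feq p y x | feq p x y) p x y" for p x y
    using feq_bf1[of p y x] unfolding bf_def forth_def by meson
qed simp

lemma feq_mono: "feq p x y ==> q \<e> P ==> sub p q ==> feq q x y"
proof (rule coind[of "%q x y. EX p. feq p x y & q \<e> P & sub p q"])
  show "D (%e. EX p. feq p (e (Suc 0)) (e (Suc (Suc 0))) & e 0 \<e> P & sub p (e 0))" by (intro dfi)
  show "EX p. feq p x y & q \<e> P & sub p q ==> bf (%q x y. (EX p. feq p x y & q \<e> P & sub p q) | feq q x y) q x y" for q x y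
    using feq_bf1[of _ x y] unfolding bf_def forth_def by (meson sub_trans)
qed blast

lemma feq_forth: assumes "feq p x y" "nm x z q" "r \<e> P" "sub p r" "sub q r"
  obtains r' w q' where "r' \<e> P" "sub r r'" "nm y w q'" "sub q' r'" "feq r' z w"
  using feq_bf1[OF assms(1)] assms(2-) unfolding bf_def forth_def by meson

lemma feq_trans: "feq p x y ==> feq p y z ==> feq p x z"
proof (rule coind[of "%p x z. EX y. feq p x y & feq p y z"])
  show "D (%e. EX y. feq (e 0) (e (Suc 0)) y & feq (e 0) y (e (Suc (Suc 0))))" by (intro dfi)
  have *: "forth (%p x z. EX y. feq p x y & feq p y z) p x z" if xy: "feq p x y" "feq p y z" for p x y z
    unfolding forth_def
  proof (intro allI impI, elim conjE)
    fix u q r assume a: "nm x u q" "r \<e> P" "sub p r" "sub q r"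
    obtain r1 v q1 where r1: "r1 \<e> P" "sub r r1" "nm y v q1" "sub q1 r1" "feq r1 u v"
      using feq_forth[OF xy(1) a] by blast
    obtain r2 w q2 where r2: "r2 \<e> P" "sub r1 r2" "nm z w q2" "sub q2 r2" "feq r2 v w"
      using feq_forth[OF xy(2) r1(3,1) sub_trans[OF a(3) r1(2)] r1(4)] by blast
    show "EX r' w q'. r' \<e> P & sub r r' & nm z w q' & sub q' r' & (EX y. feq r' u y & feq r' y w)"
      using r1 r2 feq_mono[OF r1(5) r2(1,2)] sub_trans by blast
  qed
  fix p x z assume "EX y. feq p x y & feq p y z"
  then obtain y where y: "feq p x y" "feq p y z" by blast
  have f1: "forth (%p x z. EX y. feq p x y & feq p y z) p x z" using * y by blast
  have "forth (%p x z. EX y. feq p x y & feq p y z) p z x" using *[OF feq_sym[OF y(2)] feq_sym[OF y(1)]] .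
  then have f2: "forth (%p x z. EX y. feq p z y & feq p y x) p z x" unfolding forth_def using feq_sym by meson
  show "bf (%p x z. (EX y. feq p x y & feq p y z) | feq p x z) p x z"
    using f1 f2 feq_P[OF y(1)] unfolding bf_def forth_def by meson
qed blast

lemma feq_dense: "p \<e> P ==> (!!q. q \<e> P ==> sub p q ==> EX r. r \<e> P & sub q r & feq r x y) ==> feq p x y"
proof (rule coind[of "%p x y. p \<e> P & (ALL q. q \<e> P & sub p q --> (EX r. r \<e> P & sub q r & feq r x y))"])
  show "D (%e. e 0 \<e> P & (ALL q. q \<e> P & sub (e 0) q --> (EX r. r \<e> P & sub q r & feq r (e (Suc 0)) (e (Suc (Suc 0))))))" by (intro dfi)
  fix p x y assume a: "p \<e> P & (ALL q. q \<e> P & sub p q --> (EX r. r \<e> P & sub q r & feq r x y))"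
  have *: "forth feq p x y" if a: "!!q. q \<e> P ==> sub p q ==> EX r. r \<e> P & sub q r & feq r x y" for x y
    unfolding forth_def
  proof (intro allI impI, elim conjE)
    fix z q r assume z: "nm x z q" "r \<e> P" "sub p r" "sub q r"
    then obtain r1 where r1: "r1 \<e> P" "sub r r1" "feq r1 x y" using a by blast
    show "EX r' w q'. r' \<e> P & sub r r' & nm y w q' & sub q' r' & feq r' z w"
      using feq_forth[OF r1(3) z(1) r1(1) sub_refl sub_trans[OF z(4) r1(2)]] sub_trans[OF r1(2)] by metis
  qed
  have f1: "forth feq p x y" using * a by blast
  have "forth feq p y x" using * a feq_sym by blast
  then have f2: "forth (%r z w. feq r w z) p y x" unfolding forth_def using feq_sym by meson
  show "bf (%p x y. p \<e> P & (ALL q. q \<e> P & sub p q --> (EX r. r \<e> P & sub q r & feq r x y)) | feq p x y) p x y"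
    by (rule bf_mono[of feq]) (use f1 f2 a in \<open>auto simp: bf_def\<close>)
qed blast

definition fmem where "fmem p x y \<longleftrightarrow> (ALL r. r \<e> P & sub p r -->
   (EX r' z q. r' \<e> P & sub r r' & nm y z q & sub q r' & feq r' x z))"
lemma fmem_D [dfi]: "T s ==> T t ==> T u ==> D (%e. fmem (s e) (t e) (u e))" unfolding fmem_def by (intro dfi dft_shift)

fun frc :: "nat => (nat => nat) => fm => bool" where
  "frc p e (Mem x y) = fmem p (e x) (e y)"
| "frc p e (Equ x y) = feq p (e x) (e y)"
| "frc p e Bot = False"
| "frc p e (Imp a b) = (ALL q. q \<e> P --> sub p q --> frc q e a --> frc q e b)"
| "frc p e (Forall x a) = (ALL v. frc p (e(x := v)) a)"

lemma frc_mono: "frc p e a ==> q \<e> P ==> sub p q ==> frc q e a"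
proof (induction a arbitrary: e)
  case (Mem x y) then show ?case unfolding frc.simps fmem_def using sub_trans by blast
next
  case (Equ x y) then show ?case using feq_mono by simp
next
  case (Imp a b) then show ?case using sub_trans by simp
qed auto

text \<open>Atomic forcing is closed under density, and implication and the universal quantifier
  inherit this. It makes the intuitionistic looking clauses classical.\<close>

lemma frc_dense: "p \<e> P ==> (!!q. q \<e> P ==> sub p q ==> EX r. r \<e> P & sub q r & frc r e a) ==> frc p e a"
proof (induction a arbitrary: p e)
  case (Mem x y) then show ?case unfolding frc.simps fmem_def using sub_trans sub_refl by metis
next
  case (Equ x y) then show ?case using feq_dense by simp
next
  case Bot then show ?case using sub_refl by fastforce
next
  case (Imp a b)
  show ?case unfolding frc.simps
  proof (intro allI impI)
    fix q assume q: "q \<e> P" "sub p q" "frc q e a"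
    show "frc q e b"
    proof (rule Imp.IH(2)[OF q(1)])
      fix r assume r: "r \<e> P" "sub q r"
      then obtain s where "s \<e> P" "sub r s" "frc s e (Imp a b)" using Imp.prems(2)[of r] q sub_trans by blast
      then show "EX s. s \<e> P & sub r s & frc s e b" using frc_mono[OF q(3), of s] sub_trans[OF r(2), of s] by auto
    qed
  qed
next
  case (Forall x a)
  show ?case unfolding frc.simps
    by (intro allI Forall.IH[OF Forall.prems(1)]) (use Forall.prems(2)[unfolded frc.simps] in blast)
qed

lemma frc_D: assumes "T s" "!!i. T (t i)" shows "D (%e. frc (s e) (%i. t i e) p)"
  using assms
proof (induction p arbitrary: s t)
  case (Imp a b)
  show ?case unfolding frc.simps
    by (intro dfi Imp.IH dft_shift Imp.prems)
next
  case (Forall x p)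
  have "D (%e. frc (s (%i. e (Suc i))) (%i. (if i = x then %e. e 0 else (%e. t i (%i. e (Suc i)))) e) p)"
    by (rule Forall.IH) (auto intro: dfi dft_shift Forall.prems)
  moreover have "(%i. (if i = x then %e. e 0 else (%e. t i (%i. e (Suc i)))) e) = (%i. t i (%i. e (Suc i)))(x := e 0)"
    for e :: "nat => nat" by (auto simp: fun_eq_iff)
  ultimately have "D (%e. frc (s (%i. e (Suc i))) ((%i. t i (%i. e (Suc i)))(x := e 0)) p)" by (simp only:)
  then show ?case unfolding frc.simps by (rule dfn_all)
qed (auto intro: dfi)

definition CG where "CG x f = img (%y. pair (app f y) emp) x"
definition chk where "chk = rec CG"
lemma CG_T: "T (%e. CG (e 0) (e (Suc 0)))" unfolding CG_def by (intro dfi)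
lemma chk_T [dfi]: "T s ==> T (%e. chk (s e))" unfolding chk_def by (rule rec_T[OF CG_T])

lemma nm_chk: "nm (chk x) z q \<longleftrightarrow> (EX y. y \<e> x & z = chk y) & q = emp"
proof -
  have t: "T (%e. chk (e 0))" by (intro dfi)
  have e: "chk x = CG x (lam x chk)" unfolding chk_def by (rule rec_eq[OF CG_T])
  have i: "w \<e> img (%y. pair (app (lam x chk) y) emp) x \<longleftrightarrow> (EX y. y \<e> x & w = pair (app (lam x chk) y) emp)" for w
    by (rule img) (intro dfi)
  have "pair z q \<e> chk x \<longleftrightarrow> (EX y. y \<e> x & z = app (lam x chk) y & q = emp)"
    by (subst e) (simp only: CG_def i pair_inj)
  then show ?thesis unfolding nm_def using one lam(2)[OF t, of _ x] by metis
qed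

lemma emp_sub [simp]: "sub emp p" by (simp add: sub_def)

lemma feq_chk: "ALL y p. feq p (chk x) (chk y) --> x = y"
proof (induct x rule: eps_induct)
  case D show ?case by (intro dfi)
next
  case (step x)
  show ?case
  proof (intro allI impI extens)
    fix y p z assume f: "feq p (chk x) (chk y)"
    show "z \<e> x \<longleftrightarrow> z \<e> y"
    proof
      assume z: "z \<e> x"
      then have nn: "nm (chk x) (chk z) emp" unfolding nm_chk by blast
      obtain r w q where "r \<e> P" "sub p r" "nm (chk y) w q" "sub q r" "feq r (chk z) w"
        by (rule feq_forth[OF f nn feq_P[OF f] sub_refl emp_sub])
      then show "z \<e> y" using step[OF z] unfolding nm_chk by blast
    next
      assume z: "z \<e> y"
      then have nn: "nm (chk y) (chk z) emp" unfolding nm_chk by blast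
      obtain r w q where "r \<e> P" "sub p r" "nm (chk x) w q" "sub q r" "feq r (chk z) w"
        by (rule feq_forth[OF feq_sym[OF f] nn feq_P[OF f] sub_refl emp_sub])
      then show "z \<e> x" using step feq_sym unfolding nm_chk by blast
    qed
  qed
qed

end

subsection \<open>Generic filters\<close>

text \<open>\<open>G\<close> is a set of the metatheory, whereas the dense sets \<open>d\<close>
  that it has to meet are elements of the model.\<close>

locale generic = forcing E P for E :: "nat => nat => bool" (infix "\<e>" 50) and P +
  fixes G :: "nat set"
  assumes G_P: "p \<in> G ==> p \<e> P"
    and G_one: "emp \<in> G"
    and G_up: "p \<in> G ==> q \<e> P ==> sub q p ==> q \<in> G"
    and G_dir: "p \<in> G ==> q \<in> G ==> EX r. r \<in> G & sub p r & sub q r"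
    and G_gen: "(!!p. p \<e> P ==> EX q. q \<e> P & sub p q & q \<e> d) ==> EX p. p \<in> G & p \<e> d"

text \<open>The elements of the model are natural numbers, so step \<open>n\<close> can take care of
  the dense set \<open>n\<close>.\<close>

lemma (in forcing) generic_exists: assumes "p \<e> P" shows "EX G. p \<in> G & generic E P G"
proof -
  define step where "step n q = (if EX r. r \<e> P & sub q r & r \<e> n then SOME r. r \<e> P & sub q r & r \<e> n else q)" for n q
  define s where "s = rec_nat p step"
  have s0: "s 0 = p" and sS: "s (Suc n) = step n (s n)" for n by (simp_all add: s_def)
  have stepP: "q \<e> P ==> step n q \<e> P & sub q (step n q)" for n q
    using someI_ex[of "%r. r \<e> P & sub q r & r \<e> n"] unfolding step_def by auto
  have sP: "s n \<e> P" for n by (induction n) (auto simp: s0 sS assms stepP)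
  have smono: "m \<le> n ==> sub (s m) (s n)" for m n
    by (induction n rule: dec_induct) (auto simp: sS intro: sub_trans stepP[THEN conjunct2] sP)
  let ?G = "{q. q \<e> P & (EX n. sub q (s n))}"
  have g: "generic E P ?G"
  proof unfold_locales
    show "emp \<in> ?G" using one by (auto simp: sub_def)
    show "EX r. r \<in> ?G & sub q r & sub q' r" if "q \<in> ?G" "q' \<in> ?G" for q q'
    proof -
      obtain m n where "sub q (s m)" "sub q' (s n)" using \<open>q \<in> ?G\<close> \<open>q' \<in> ?G\<close> by blast
      then have "sub q (s (max m n))" "sub q' (s (max m n))" using smono sub_trans by (meson max.cobounded1 max.cobounded2)+
      then show ?thesis using sP sub_refl by blast
    qed
    show "EX p. p \<in> ?G & p \<e> d" if "!!p. p \<e> P ==> EX q. q \<e> P & sub p q & q \<e> d" for d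
    proof -
      have "EX r. r \<e> P & sub (s d) r & r \<e> d" using that sP by blast
      then have "s (Suc d) \<e> d" using someI_ex[of "%r. r \<e> P & sub (s d) r & r \<e> d"] unfolding sS step_def by auto
      then show ?thesis using sP sub_refl by blast
    qed
  qed (auto intro: sub_trans)
  have "sub p (s 0)" by (simp add: s0)
  then have "p \<in> ?G" using assms by blast
  then show ?thesis by (intro exI[of _ ?G] conjI g)
qed

context generic
begin

lemma gen_below:
  assumes Q: "D (%e. Q (e 0))" and p: "p \<in> G" and d: "!!q. q \<e> P ==> sub p q ==> EX r. r \<e> P & sub q r & Q r"
  shows "EX q. q \<in> G & sub p q & Q q"
proof -
  note dfc1[OF Q, dfi]
  \<comment> \<open>Adding the conditions incompatible with \<open>p\<close> turns density below
    \<open>p\<close> into density.\<close>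
  define d where "d = sepS P (%q. (Q q & sub p q) | ~ (EX r. r \<e> P & sub p r & sub q r))"
  have m: "q \<e> d \<longleftrightarrow> q \<e> P & ((Q q & sub p q) | ~ (EX r. r \<e> P & sub p r & sub q r))" for q
    unfolding d_def by (rule sepS) (intro dfi)
  have "EX r. r \<e> P & sub q r & r \<e> d" if q: "q \<e> P" for q
  proof (cases "EX r. r \<e> P & sub p r & sub q r")
    case True
    then obtain r where r: "r \<e> P" "sub p r" "sub q r" by blast
    then show ?thesis using d[OF r(1,2)] unfolding m using sub_trans by blast
  qed (use q m sub_refl in blast)
  from G_gen[OF this] obtain q where q: "q \<in> G" "q \<e> d" by blast
  moreover obtain r where "r \<in> G" "sub p r" "sub q r" using G_dir[OF p q(1)] by blast
  ultimately show ?thesis using G_P unfolding m by blast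
qed

definition eqG where "eqG x y \<longleftrightarrow> (EX p. p \<in> G & feq p x y)"
definition memG where "memG x y \<longleftrightarrow> (EX z q. nm y z q & q \<in> G & eqG x z)"

lemma eqG_refl [simp]: "eqG x x" unfolding eqG_def using G_one feq_refl one by blast
lemma eqG_sym: "eqG x y ==> eqG y x" unfolding eqG_def using feq_sym by blast
lemma eqG_trans: "eqG x y ==> eqG y z ==> eqG x z"
  unfolding eqG_def using G_dir feq_mono feq_trans G_P by meson

lemma eqG_forth: assumes "eqG x y" "nm x z q" "q \<in> G" shows "memG z y"
proof -
  obtain p where p: "p \<in> G" "feq p x y" using assms(1) unfolding eqG_def by blast
  obtain r where r: "r \<in> G" "sub p r" "sub q r" using G_dir[OF p(1) assms(3)] by blast
  have "EX t. t \<in> G & sub r t & (EX w q'. nm y w q' & sub q' t & feq t z w)"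
  proof (rule gen_below[OF _ r(1)])
    show "D (%e. EX w q'. nm y w q' & sub q' (e 0) & feq (e 0) z w)" by (intro dfi)
    fix s assume s: "s \<e> P" "sub r s"
    obtain t w q' where "t \<e> P" "sub s t" "nm y w q'" "sub q' t" "feq t z w"
      by (rule feq_forth[OF p(2) assms(2) s(1) sub_trans[OF r(2) s(2)] sub_trans[OF r(3) s(2)]])
    then show "EX t. t \<e> P & sub s t & (EX w q'. nm y w q' & sub q' t & feq t z w)" by blast
  qed
  then show ?thesis unfolding memG_def eqG_def using G_up nm_def by blast
qed

lemma memG_eq1: "memG x y ==> eqG x x' ==> memG x' y"
  unfolding memG_def using eqG_sym eqG_trans by blast
lemma memG_eq2: "memG x y ==> eqG y y' ==> memG x y'"
  unfolding memG_def[of x y] using eqG_forth memG_eq1 eqG_sym by blast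

lemma memG_truth: "memG x y \<longleftrightarrow> (EX p. p \<in> G & fmem p x y)"
proof
  assume "memG x y"
  then obtain z q p where z: "nm y z q" "q \<in> G" "p \<in> G" "feq p x z" unfolding memG_def eqG_def by blast
  then obtain r where r: "r \<in> G" "sub p r" "sub q r" using G_dir by blast
  have "fmem r x y" unfolding fmem_def using z r feq_mono sub_trans sub_refl by meson
  with r show "EX p. p \<in> G & fmem p x y" by blast
next
  assume "EX p. p \<in> G & fmem p x y"
  then obtain p where p: "p \<in> G" "fmem p x y" by blast
  have "EX t. t \<in> G & sub p t & (EX z q. nm y z q & sub q t & feq t x z)"
    by (rule gen_below[OF _ p(1)]) (intro dfi, use p(2) in \<open>auto simp: fmem_def\<close>)
  then show "memG x y" unfolding memG_def eqG_def using G_up nm_def by blast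
qed

lemma memG_ext: assumes a: "!!z. memG z x \<longleftrightarrow> memG z y" shows "eqG x y"
proof -
  \<comment> \<open>\<open>q\<close> puts some \<open>z\<close> into \<open>x\<close> that no
    extension of \<open>q\<close> forces into \<open>y\<close>. A condition without an extension of
    this kind, for either order of \<open>x\<close> and \<open>y\<close>, forces them equal.\<close>
  define N where "N x y q \<longleftrightarrow> (EX z r. nm x z r & sub r q & (ALL s. s \<e> P & sub q s --> ~ fmem s z y))" for x y q
  have N_D: "T t ==> D (%e. N x y (t e))" for x y t unfolding N_def by (intro dfi dft_shift)
  have nN: "~ N x y q" if q: "q \<in> G" and xy: "!!z. memG z x ==> memG z y" for x y q
  proof
    assume "N x y q"
    then obtain z r where z: "nm x z r" "sub r q" "!!s. s \<e> P ==> sub q s ==> ~ fmem s z y" unfolding N_def by blast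
    then have "r \<in> G" using G_up[OF q] unfolding nm_def by blast
    then have "memG z y" using xy z(1) unfolding memG_def using eqG_refl by blast
    then obtain p where p: "p \<in> G" "fmem p z y" unfolding memG_truth by blast
    obtain s where s: "s \<in> G" "sub p s" "sub q s" using G_dir[OF p(1) q] by blast
    have "fmem s z y" using p(2) s(2) unfolding fmem_def using sub_trans by blast
    with z(3) s G_P show False by blast
  qed
  have fo: "forth feq q x y" if q: "!!s. s \<e> P ==> sub q s ==> ~ N x y s" for x y q
    unfolding forth_def
  proof (intro allI impI, elim conjE)
    fix z q1 r assume z: "nm x z q1" "r \<e> P" "sub q r" "sub q1 r"
    then have "~ N x y r" using q by blast
    then obtain s where s: "s \<e> P" "sub r s" "fmem s z y" using z unfolding N_def by blast
    then obtain s' w q' where "s' \<e> P" "sub s s'" "nm y w q'" "sub q' s'" "feq s' z w" unfolding fmem_def using sub_refl by blast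
    then show "EX r' w q'. r' \<e> P & sub r r' & nm y w q' & sub q' r' & feq r' z w" using sub_trans[OF s(2)] by blast
  qed
  have "EX q. q \<in> G & sub emp q & (feq q x y | N x y q | N y x q)"
  proof (rule gen_below[OF _ G_one])
    show "D (%e. feq (e 0) x y | N x y (e 0) | N y x (e 0))" by (intro dfi N_D)
    fix q assume q: "q \<e> P"
    show "EX r. r \<e> P & sub q r & (feq r x y | N x y r | N y x r)"
    proof (cases "EX r. r \<e> P & sub q r & (N x y r | N y x r)")
      case False
      then have "forth feq q x y" "forth feq q y x" using fo by blast+
      then have "bf feq q x y" using q feq_sym unfolding bf_def forth_def by meson
      then show ?thesis using feq_bf q sub_refl by blast
    qed blast
  qed
  then show ?thesis using nN a unfolding eqG_def by blast
qed

end

section \<open>Foundation in the extension, and the extension as a model on the natural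
  numbers\<close>

context forcing
begin

text \<open>An element of a name lies three membership steps below it, through a pair and a
  singleton, so the induction carries elements and elements of elements along.\<close>

lemma nm_induct:
  assumes P: "D (%e. Q (e 0))" and st: "!!y. (!!z s. nm y z s ==> Q z) ==> Q y" shows "Q x"
proof -
  note dfc1[OF P, dfi]
  have "Q x & (ALL u. u \<e> x --> Q u) & (ALL u v. u \<e> x --> v \<e> u --> Q v)"
  proof (induct x rule: eps_induct)
    case D show ?case by (intro dfi)
  next
    case (step t)
    have "Q t"
    proof (rule st)
      fix z s assume "nm t z s"
      then have "pair z s \<e> t" unfolding nm_def by blast
      then have "ALL u v. u \<e> pair z s --> v \<e> u --> Q v" using step by blast
      moreover have "upair z z \<e> pair z s" "z \<e> upair z z" by (auto simp: pair_def)
      ultimately show "Q z" by blast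
    qed
    then show ?case using step by blast
  qed
  then show ?thesis by blast
qed

definition dm where "dm x = sepS (un (un x)) (%z. EX q. nm x z q)"
lemma dm: "z \<e> dm x \<longleftrightarrow> (EX q. nm x z q)"
proof -
  have "z \<e> dm x \<longleftrightarrow> z \<e> un (un x) & (EX q. nm x z q)" unfolding dm_def by (rule sepS) (intro dfi)
  then show ?thesis using pair_un unfolding nm_def by blast
qed
lemma dm_T [dfi]: "T s ==> T (%e. dm (s e))" unfolding dm_def by (intro dfi dft_shift)

end

context generic
begin

text \<open>Either a condition of the filter makes some element of \<open>x\<close> minimal, or
  below such a condition every name forced into \<open>x\<close> has a member that can be forced
  into \<open>x\<close>. In the second case \<open>nm_induct\<close>, carried out in the ground
  model, shows that no name is forced into \<open>x\<close> there.\<close>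

lemma memG_found: assumes "memG z x" shows "EX y. memG y x & ~ (EX z. memG z x & memG z y)"
proof (rule ccontr)
  assume neg: "~ ?thesis"
  define A where "A y r \<longleftrightarrow> (EX z s. nm y z s & sub s r & fmem r z x)" for y r
  have A_D [dfi]: "T s ==> T t ==> D (%e. A (s e) (t e))" for s t unfolding A_def by (intro dfi dft_shift)
  define B where "B p \<longleftrightarrow> (ALL y q. q \<e> P & sub p q & fmem q y x --> (EX r. r \<e> P & sub q r & A y r))" for p
  define C where "C p \<longleftrightarrow> (EX y. fmem p y x & ~ (EX r. r \<e> P & sub p r & A y r))" for p
  have "EX p. p \<in> G & sub emp p & (B p | C p)"
  proof (rule gen_below[OF _ G_one])
    show "D (%e. B (e 0) | C (e 0))" unfolding B_def C_def by (intro dfi)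
    fix p assume p: "p \<e> P"
    show "EX r. r \<e> P & sub p r & (B r | C r)"
    proof (cases "B p")
      case False
      then show ?thesis unfolding B_def C_def by blast
    qed (use p sub_refl in blast)
  qed
  then obtain p where p: "p \<in> G" "B p | C p" by blast
  have nC: "~ C p"
  proof
    assume "C p"
    then obtain y where y: "fmem p y x" "!!r. r \<e> P ==> sub p r ==> ~ A y r" unfolding C_def by blast
    then have "memG y x" using p memG_truth by blast
    then obtain z where z: "memG z x" "memG z y" using neg by blast
    then obtain w s where w: "nm y w s" "s \<in> G" "eqG z w" unfolding memG_def by blast
    then obtain t where t: "t \<in> G" "fmem t w x" using memG_eq1[OF z(1)] memG_truth by blast
    obtain r1 where r1: "r1 \<in> G" "sub p r1" "sub t r1" using G_dir p(1) t(1) by blast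
    obtain r where r: "r \<in> G" "sub r1 r" "sub s r" using G_dir r1(1) w(2) by blast
    have "fmem r w x" using t(2) r r1 sub_trans unfolding fmem_def by blast
    then have "A y r" unfolding A_def using w r by blast
    then show False using y(2) r r1 G_P sub_trans by blast
  qed
  with p have Bp: "B p" by blast
  have "ALL q. q \<e> P & sub p q --> ~ fmem q y x" for y
  proof (rule nm_induct[of "%y. ALL q. q \<e> P & sub p q --> ~ fmem q y x"])
    show "D (%e. ALL q. q \<e> P & sub p q --> ~ fmem q (e 0) x)" by (intro dfi)
    fix y assume IH: "!!z s. nm y z s ==> ALL q. q \<e> P & sub p q --> ~ fmem q z x"
    show "ALL q. q \<e> P & sub p q --> ~ fmem q y x"
      using Bp IH sub_trans unfolding B_def A_def by blast
  qed
  moreover obtain q where "q \<in> G" "fmem q z x" using assms memG_truth by blast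
  moreover from this obtain r where "r \<in> G" "sub p r" "sub q r" using G_dir p(1) by blast
  ultimately show False using G_P sub_trans unfolding fmem_def by blast
qed

lemma memG_upn: "memG v (upair (pair x emp) (pair y emp)) \<longleftrightarrow> eqG v x | eqG v y"
  unfolding memG_def nm_def using G_one one by auto

lemma memG_irrefl: "~ memG x x"
proof
  assume x: "memG x x"
  let ?s = "upair (pair x emp) (pair x emp)"
  have s: "memG v ?s \<longleftrightarrow> eqG v x" for v by (simp add: memG_upn)
  from memG_found[of x ?s] s obtain y where "eqG y x" "~ (EX z. eqG z x & memG z y)" by auto
  then show False using x memG_eq2 eqG_sym eqG_refl by blast
qed

definition rep where "rep x = (LEAST y. eqG x y)"
lemma rep_eq: "eqG x (rep x)" unfolding rep_def by (rule LeastI[of "eqG x" x]) simp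
lemma rep_iff: "rep x = rep y \<longleftrightarrow> eqG x y"
proof
  assume "eqG x y"
  then have "eqG x = eqG y" using eqG_sym eqG_trans by blast
  then show "rep x = rep y" unfolding rep_def by simp
qed (metis rep_eq eqG_sym eqG_trans)

text \<open>With finitely many classes there would be a name for a set containing everything, itself
  included.\<close>

lemma infinite_rep: "infinite (range rep)"
proof
  assume f: "finite (range rep)"
  have *: "EX s. \<forall>r \<in> F. pair r emp \<e> s" if "finite F" for F
    using that
  proof (induction F)
    case (insert x F)
    then obtain s where "\<forall>r \<in> F. pair r emp \<e> s" by blast
    then show ?case by (intro exI[of _ "adj s (pair x emp)"]) auto
  qed simp
  obtain s where "!!x. pair (rep x) emp \<e> s" using *[OF f] by auto
  then have "memG s s" unfolding memG_def nm_def using rep_eq G_one one by blast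
  then show False using memG_irrefl by blast
qed

text \<open>Satisfaction interprets \<open>Equ\<close> by true equality, so names with equal values
  are identified. Numbering the classes keeps the extension on the type of the ground model.\<close>

definition nam where "nam n = enumerate (range rep) n"
definition val where "val x = inv nam (rep x)"
definition EG where "EG m n \<longleftrightarrow> memG (nam m) (nam n)"

lemma nam_inj: "inj nam" and nam_range: "range nam = range rep"
  using bij_enumerate[OF infinite_rep] unfolding nam_def bij_betw_def by auto

lemma nam_val: "nam (val x) = rep x"
proof -
  have "rep x \<in> range nam" unfolding nam_range by (rule rangeI)
  then show ?thesis unfolding val_def by (rule f_inv_into_f)
qed
lemma val_eq: "val x = val y \<longleftrightarrow> eqG x y"
proof
  assume "val x = val y"
  then have "nam (val x) = nam (val y)" by (rule arg_cong)
  then show "eqG x y" unfolding nam_val rep_iff .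
next
  assume "eqG x y"
  then have "rep x = rep y" unfolding rep_iff .
  then show "val x = val y" unfolding val_def by (rule arg_cong)
qed
lemma eqG_nam: "eqG (nam (val x)) x" unfolding nam_val by (rule eqG_sym[OF rep_eq])
lemma val_nam [simp]: "val (nam n) = n"
proof -
  obtain x where "nam n = rep x" using nam_range by (metis rangeE rangeI)
  then have "rep (nam n) = nam n" using rep_iff rep_eq eqG_sym by metis
  then show ?thesis unfolding val_def using inv_f_f[OF nam_inj] by simp
qed
lemma EG: "EG (val x) (val y) \<longleftrightarrow> memG x y"
  unfolding EG_def using eqG_nam eqG_sym memG_eq1 memG_eq2 by blast
lemma EG_val: "EG m (val y) \<longleftrightarrow> memG (nam m) y" using EG[of "nam m" y] by simp

lemma val_surj: "EX x. m = val x" using val_nam by metis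

lemma frc_D0: "D (%q. frc (q 0) e a)"
  using frc_D[of "%e. e 0" "%i _. e i"] by (simp add: dft_var dft_const)

text \<open>For implication and the universal quantifier the filter contains a condition that forces
  the formula, or one below which a counterexample persists; \<open>frc_dense\<close> supplies the
  second kind where the first fails.\<close>

lemma truth: "sat EG (%i. val (e i)) a \<longleftrightarrow> (EX p. p \<in> G & frc p e a)"
proof (induction a arbitrary: e)
  case (Mem x y) show ?case by (simp add: EG memG_truth)
next
  case (Equ x y) show ?case by (simp add: val_eq eqG_def)
next
  case (Imp a b)
  show ?case
  proof
    assume s: "sat EG (%i. val (e i)) (Imp a b)"
    have "EX p. p \<in> G & sub emp p & (frc p e (Imp a b) | (frc p e a & ~ (EX q. q \<e> P & sub p q & frc q e b)))"
    proof (rule gen_below[OF _ G_one])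
      show "D (%q. frc (q 0) e (Imp a b) | (frc (q 0) e a & ~ (EX r. r \<e> P & sub (q 0) r & frc r e b)))"
        by (intro dfi frc_D0 dfc1[OF frc_D0])
      fix q assume q: "q \<e> P"
      show "EX p. p \<e> P & sub q p & (frc p e (Imp a b) | (frc p e a & ~ (EX q. q \<e> P & sub p q & frc q e b)))"
      proof (cases "frc q e (Imp a b)")
        case False
        then obtain r where r: "r \<e> P" "sub q r" "frc r e a" "~ frc r e b" by auto
        then obtain t where t: "t \<e> P" "sub r t" "~ (EX u. u \<e> P & sub t u & frc u e b)"
          using frc_dense[OF r(1), of e b] by blast
        then show ?thesis using frc_mono[OF r(3)] r sub_trans by blast
      qed (use q sub_refl in blast)
    qed
    then obtain p where p: "p \<in> G" "frc p e (Imp a b) | (frc p e a & ~ (EX q. q \<e> P & sub p q & frc q e b))" by blast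
    have "~ (frc p e a & ~ (EX q. q \<e> P & sub p q & frc q e b))"
    proof
      assume n: "frc p e a & ~ (EX q. q \<e> P & sub p q & frc q e b)"
      then have "sat EG (%i. val (e i)) b" using s p(1) Imp.IH(1) by auto
      then obtain q where q: "q \<in> G" "frc q e b" using Imp.IH(2) by blast
      obtain r where "r \<in> G" "sub p r" "sub q r" using G_dir[OF p(1) q(1)] by blast
      then show False using n frc_mono[OF q(2)] G_P by blast
    qed
    then show "EX p. p \<in> G & frc p e (Imp a b)" using p by blast
  next
    assume "EX p. p \<in> G & frc p e (Imp a b)"
    then obtain p where p: "p \<in> G" "frc p e (Imp a b)" by blast
    show "sat EG (%i. val (e i)) (Imp a b)" unfolding sat.simps
    proof
      assume "sat EG (%i. val (e i)) a"
      then obtain q where q: "q \<in> G" "frc q e a" using Imp.IH(1) by blast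
      obtain r where r: "r \<in> G" "sub p r" "sub q r" using G_dir[OF p(1) q(1)] by blast
      then have "frc r e b" using p(2) frc_mono[OF q(2)] G_P by auto
      then show "sat EG (%i. val (e i)) b" using r Imp.IH(2) by blast
    qed
  qed
next
  case (Forall x a)
  have upd: "(%i. val (e i))(x := val v) = (%i. val ((e(x := v)) i))" for v by auto
  have F: "sat EG (%i. val (e i)) (Forall x a) \<longleftrightarrow> (ALL v. EX p. p \<in> G & frc p (e(x := v)) a)"
    unfolding sat.simps Forall.IH[symmetric] upd[symmetric] using val_surj by metis
  show ?case unfolding F
  proof
    assume s: "ALL v. EX p. p \<in> G & frc p (e(x := v)) a"
    have "EX p. p \<in> G & sub emp p & (frc p e (Forall x a) | (EX v. ALL q. q \<e> P & sub p q --> ~ frc q (e(x := v)) a))"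
    proof (rule gen_below[OF _ G_one])
      have "D (%f. frc (f 0) (%i. (if i = x then %f. f (Suc 0) else (%f. e i)) f) a)"
        by (rule frc_D) (auto intro: dfi)
      moreover have "(%i. (if i = x then %f. f (Suc 0) else (%f. e i)) f) = e(x := f (Suc 0))"
        for f :: "nat => nat" by (auto simp: fun_eq_iff)
      ultimately have "D (%f. frc (f 0) (e(x := f (Suc 0))) a)" by (simp only:)
      note dfc2[OF this, dfi]
      show "D (%f. frc (f 0) e (Forall x a) | (EX v. ALL q. q \<e> P & sub (f 0) q --> ~ frc q (e(x := v)) a))"
        by (intro dfi frc_D0)
      fix q assume q: "q \<e> P"
      show "EX p. p \<e> P & sub q p & (frc p e (Forall x a) | (EX v. ALL q. q \<e> P & sub p q --> ~ frc q (e(x := v)) a))"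
      proof (cases "frc q e (Forall x a)")
        case False
        then obtain v where "~ frc q (e(x := v)) a" by auto
        then obtain t where "t \<e> P" "sub q t" "~ (EX u. u \<e> P & sub t u & frc u (e(x := v)) a)"
          using frc_dense[OF q, of "e(x := v)" a] by blast
        then show ?thesis by blast
      qed (use q sub_refl in blast)
    qed
    then obtain p where p: "p \<in> G" "frc p e (Forall x a) | (EX v. ALL q. q \<e> P & sub p q --> ~ frc q (e(x := v)) a)" by blast
    have "~ (EX v. ALL q. q \<e> P & sub p q --> ~ frc q (e(x := v)) a)"
    proof
      assume "EX v. ALL q. q \<e> P & sub p q --> ~ frc q (e(x := v)) a"
      then obtain v where v: "!!q. q \<e> P ==> sub p q ==> ~ frc q (e(x := v)) a" by blast
      obtain q where q: "q \<in> G" "frc q (e(x := v)) a" using s by blast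
      obtain r where "r \<in> G" "sub p r" "sub q r" using G_dir[OF p(1) q(1)] by blast
      then show False using v frc_mono[OF q(2)] G_P by blast
    qed
    with p show "EX p. p \<in> G & frc p e (Forall x a)" by blast
  qed auto
qed simp

text \<open>A definable relation of the extension becomes definable in the ground model once forcing
  is mentioned. In this way separation and replacement in the extension are reduced to those in
  \<open>E\<close>.\<close>

lemma dfn_EG_names: assumes "dfn EG (%e. Q (e 0) (e (Suc 0)))"
  shows "EX F. (ALL u v. Q (val u) (val v) \<longleftrightarrow> (EX p. p \<in> G & F p u v)) &
    D (%e. F (e 0) (e (Suc 0)) (e (Suc (Suc 0))))"
proof -
  from assms obtain a k c where a: "!!e. Q (e 0) (e (Suc 0)) = sat EG (mix k c e) a" unfolding dfn_def by blast
  define en where "en u v = mix k (%i. nam (c i)) (%i. if i = 0 then u else v)" for u v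
  have "(%i. val (en u v i)) = mix k c (%i. if i = 0 then val u else val v)" for u v
    unfolding en_def mix_def by (auto simp: fun_eq_iff)
  then have 1: "Q (val u) (val v) \<longleftrightarrow> (EX p. p \<in> G & frc p (en u v) a)" for u v
    using a[of "%i. if i = 0 then val u else val v"] truth[of "en u v" a] by simp
  have "D (%e. frc (e 0) (%i. (if i < k then %e. nam (c i) else if i = k then %e. e (Suc 0) else (%e. e (Suc (Suc 0)))) e) a)"
    by (rule frc_D) (auto intro: dfi)
  moreover have "(%i. (if i < k then %e. nam (c i) else if i = k then %e. e (Suc 0) else (%e. e (Suc (Suc 0)))) e) = en (e (Suc 0)) (e (Suc (Suc 0)))" for e
    unfolding en_def mix_def by (auto simp: fun_eq_iff)
  ultimately have "D (%e. frc (e 0) (en (e (Suc 0)) (e (Suc (Suc 0)))) a)" by (simp only:)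
  with 1 show ?thesis by (intro exI[of _ "%p u v. frc p (en u v) a"]) blast
qed

lemma nameset: assumes "dfn EG (%e. Q (e 0))"
  shows "EX y. ALL z. EG z y \<longleftrightarrow> (EX u. u \<e> d & z = val u) & Q z"
proof -
  obtain F where F: "!!u v. Q (val u) \<longleftrightarrow> (EX p. p \<in> G & F p u v)" "D (%e. F (e 0) (e (Suc 0)) (e (Suc (Suc 0))))"
    using dfn_EG_names[of "%u v. Q u", OF assms] by blast
  note dfc3[OF F(2), dfi]
  \<comment> \<open>A name in \<open>d\<close> enters the new name with all conditions that force
    the property of it.\<close>
  define y where "y = sepS (prod d P) (%w. EX u q. w = pair u q & F q u emp)"
  have "w \<e> y \<longleftrightarrow> w \<e> prod d P & (EX u q. w = pair u q & F q u emp)" for w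
    unfolding y_def by (rule sepS) (intro dfi)
  then have y: "nm y u q \<longleftrightarrow> u \<e> d & q \<e> P & F q u emp" for u q unfolding nm_def by auto
  have "EG z (val y) \<longleftrightarrow> (EX u. u \<e> d & z = val u) & Q z" for z
  proof -
    have "EG z (val y) \<longleftrightarrow> (EX u q. u \<e> d & q \<in> G & F q u emp & z = val u)"
      unfolding EG_val memG_def y val_eq[symmetric] val_nam using G_P by blast
    then show ?thesis using F(1)[of _ emp] by blast
  qed
  then show ?thesis by blast
qed

lemma EG_dm: "EG z (val x) ==> EX u. u \<e> dm x & z = val u"
  unfolding EG_val memG_def dm val_eq[symmetric] val_nam by blast

lemma memG_chk: "memG v (chk x) \<longleftrightarrow> (EX y. y \<e> x & eqG v (chk y))"
  unfolding memG_def nm_chk using G_one by blast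

definition j where "j x = val (chk x)"
lemma EG_j: "EG v (j x) \<longleftrightarrow> (EX y. y \<e> x & v = j y)"
  unfolding j_def EG_val memG_chk val_eq[symmetric] val_nam ..
lemma j_inj [simp]: "j x = j y \<longleftrightarrow> x = y"
  unfolding j_def val_eq eqG_def using feq_chk feq_refl one G_one by blast
lemma EG_jj [simp]: "EG (j y) (j x) \<longleftrightarrow> y \<e> x" unfolding EG_j by auto

lemma EG_ext: "(!!z. EG z x \<longleftrightarrow> EG z y) ==> x = y"
proof -
  assume a: "!!z. EG z x \<longleftrightarrow> EG z y"
  have "eqG (nam x) (nam y)" by (rule memG_ext) (metis EG a val_nam)
  then show ?thesis by (metis val_eq val_nam)
qed

lemma EG_found: assumes "EG z x" shows "EX y. EG y x & ~ (EX z. EG z x & EG z y)"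
proof -
  obtain y where "memG y (nam x)" "~ (EX z. memG z (nam x) & memG z y)"
    using memG_found assms unfolding EG_def by blast
  then have "EG (val y) x" "~ (EX z. EG z x & EG z (val y))" using EG val_nam by metis+
  then show ?thesis by blast
qed

lemma EG_sep: assumes "dfn EG (%e. Q (e 0))" shows "EX b. ALL x. EG x b \<longleftrightarrow> EG x a & Q x"
proof -
  have "dfn EG (%e. EG (e 0) a & Q (e 0))" by (intro dfn_conj dfn_mem dft_var dft_const assms)
  from nameset[OF this, of "dm (nam a)"] obtain y
    where "!!z. EG z y \<longleftrightarrow> (EX u. u \<e> dm (nam a) & z = val u) & EG z a & Q z" by blast
  then show ?thesis using EG_dm[of _ "nam a"] by (intro exI[of _ y]) auto
qed

lemma EG_bound: "EX d. ALL z y. EG y F --> EG z y --> (EX u. u \<e> d & z = val u)"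
proof (rule exI[of _ "un (img dm (dm (nam F)))"], intro allI impI)
  fix z y assume yz: "EG y F" "EG z y"
  then obtain u where u: "u \<e> dm (nam F)" "y = val u" using EG_dm[of y "nam F"] by auto
  then obtain v where "v \<e> dm u" "z = val v" using yz EG_dm by blast
  moreover have "T (%e. dm (e 0))" by (intro dfi)
  ultimately show "EX u. u \<e> un (img dm (dm (nam F))) & z = val u" using u by auto
qed

text \<open>Kuratowski pairs spelled out in the extension, where the set theory of
  \<open>zfc\<close> cannot be used before the extension is known to be a model.\<close>

definition isU where "isU t a c \<longleftrightarrow> (ALL s. EG s t \<longleftrightarrow> s = a | s = c)"
definition isP where "isP w b z \<longleftrightarrow> (ALL t. EG t w \<longleftrightarrow> isU t b b | isU t b z)"

lemma isP_inj: assumes "isP w b z" "isP w b' z'" "!!x y. EX t. isU t x y" shows "b = b' & z = z'"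
proof -
  obtain t1 t2 t3 t4 where t: "isU t1 b b" "isU t2 b z" "isU t3 b' b'" "isU t4 b' z'" using assms(3) by metis
  then have m: "EG t1 w" "EG t2 w" "EG t3 w" "EG t4 w" using assms(1,2) unfolding isP_def by blast+
  then have "isU t1 b' b' | isU t1 b' z'" "isU t2 b' b' | isU t2 b' z'" "isU t4 b b | isU t4 b z" using assms(1,2) unfolding isP_def by blast+
  then show ?thesis using t unfolding isU_def by metis
qed

lemma zfc_EG: "zfc EG"
proof (rule zfc.intro)
  show ext: "x = y" if "!!z. EG z x = EG z y" for x y using that by (rule EG_ext)
  show fnd: "EX y. EG y x & ~ (EX z. EG z x & EG z y)" if "EG z x" for x z using that by (rule EG_found)
  show pr: "EX z. ALL u. EG u z = (u = x | u = y)" for x y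
  proof -
    have "dfn EG (%e. True)" by (rule dfn_const)
    from nameset[OF this, of "upair (nam x) (nam y)"] show ?thesis by (auto, metis val_nam)
  qed
  show "EX U. ALL x. EG x U = (EX y. EG y F & EG x y)" for F
  proof -
    obtain d where d: "!!z y. EG y F ==> EG z y ==> EX u. u \<e> d & z = val u" using EG_bound by metis
    have "dfn EG (%e. EX y. EG y F & EG (e 0) y)" by (intro dfi)
    from nameset[OF this, of d] d show ?thesis by metis
  qed
  show "EX Q. ALL y. EG y Q = (ALL z. EG z y --> EG z x)" for x
  proof -
    \<comment> \<open>Every subset has a name among the subsets of this product: pair each name in
      \<open>dm (nam x)\<close> with the conditions that force it into the subset.\<close>
    let ?d = "pw (prod (dm (nam x)) P)"
    have ex: "EX u. u \<e> ?d & y = val u" if y: "!!z. EG z y ==> EG z x" for y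
    proof -
      define u where "u = sepS (prod (dm (nam x)) P) (%w. EX z q. w = pair z q & fmem q z (nam y))"
      have uw: "w \<e> u \<longleftrightarrow> w \<e> prod (dm (nam x)) P & (EX z q. w = pair z q & fmem q z (nam y))" for w
        unfolding u_def by (rule sepS) (intro dfi)
      then have un: "nm u z q \<longleftrightarrow> z \<e> dm (nam x) & q \<e> P & fmem q z (nam y)" for z q unfolding nm_def by auto
      have "y = val u"
      proof (rule EG_ext)
        fix v
        have "EG v (val u) \<longleftrightarrow> (EX z q. z \<e> dm (nam x) & q \<in> G & fmem q z (nam y) & v = val z)"
          unfolding EG_val memG_def un val_eq[symmetric] val_nam using G_P by blast
        also have "\<dots> \<longleftrightarrow> (EX z. z \<e> dm (nam x) & EG v y & v = val z)" using memG_truth EG val_nam by metis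
        also have "\<dots> \<longleftrightarrow> EG v y" using y EG_dm[of v "nam x"] by auto
        finally show "EG v y \<longleftrightarrow> EG v (val u)" ..
      qed
      moreover have "u \<e> ?d" using uw by simp
      ultimately show ?thesis by blast
    qed
    have "dfn EG (%e. ALL z. EG z (e 0) --> EG z x)" by (intro dfi)
    from nameset[OF this, of ?d] ex show ?thesis by metis
  qed
  show "EX I. (EX z. (ALL u. ~ EG u z) & EG z I) & (ALL x. EG x I --> (EX s. (ALL u. EG u s = (EG u x | u = x)) & EG s I))"
  proof (rule exI[of _ "j omega"], intro conjI allI impI)
    show "EX z. (ALL u. ~ EG u z) & EG z (j omega)" by (intro exI[of _ "j emp"] conjI allI) (auto simp: EG_j[of _ emp])
    fix x assume "EG x (j omega)"
    then obtain n where "n \<e> omega" "x = j n" unfolding EG_j by blast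
    then show "EX s. (ALL u. EG u s = (EG u x | u = x)) & EG s (j omega)"
      by (intro exI[of _ "j (succ n)"]) (auto simp: EG_j omega_succ)
  qed
  show sp: "EX b. ALL x. EG x b = (EG x a & Q x)" if "dfn EG (%e. Q (e 0))" for Q a using that by (rule EG_sep)
  show "EX b. ALL x. EG x a --> (EX y. EG y b & Q x y)" if Q: "dfn EG (%e. Q (e 0) (e (Suc 0)))"
    and ex: "!!x. EG x a ==> EX z. ALL y. Q x y = (y = z)" for Q a
  proof -
    obtain F where F: "!!u v. Q (val u) (val v) \<longleftrightarrow> (EX p. p \<in> G & F p u v)" "D (%e. F (e 0) (e (Suc 0)) (e (Suc (Suc 0))))"
      using dfn_EG_names[OF Q] by blast
    note dfc3[OF F(2), dfi]
    \<comment> \<open>Collection runs over names together with conditions, as different conditions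
      may force different witnesses; the implication makes the relation total.\<close>
    have "D (%e. (EX y. F (snd (e 0)) (fst (e 0)) y) --> F (snd (e 0)) (fst (e 0)) (e (Suc 0)))" by (intro dfi)
    from collection[OF this, of "prod (dm (nam a)) P"] obtain b where
      b: "!!w. w \<e> prod (dm (nam a)) P ==> EX y. y \<e> b & ((EX y. F (snd w) (fst w) y) --> F (snd w) (fst w) y)" by metis
    have "dfn EG (%e. True)" by (rule dfn_const)
    from nameset[OF this, of b] obtain B where B: "!!z. EG z B \<longleftrightarrow> (EX u. u \<e> b & z = val u)" by auto
    have "EX y. EG y B & Q x y" if xa: "EG x a" for x
    proof -
      obtain u where u: "u \<e> dm (nam a)" "x = val u" using EG_dm[of x "nam a"] xa by auto
      obtain v where "Q x (val v)" using ex[OF xa] val_surj by metis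
      then obtain q where q: "q \<in> G" "F q u v" using F(1) u by blast
      then have "pair u q \<e> prod (dm (nam a)) P" using u G_P by simp
      from b[OF this] q(2) obtain y where "y \<e> b" "F q u y" by auto
      then show ?thesis using B q u F(1) by blast
    qed
    then show ?thesis by blast
  qed
  show "EX C. ALL x. EG x F --> (EX c. ALL z. (EG z C & EG z x) = (z = c))"
    if ne: "ALL x. EG x F --> (EX z. EG z x)"
      and dj: "ALL x y. EG x F & EG y F & x ~= y --> ~ (EX z. EG z x & EG z y)" for F
  proof -
    obtain d where d: "!!z y. EG y F ==> EG z y ==> EX u. u \<e> d & z = val u" using EG_bound by metis
    \<comment> \<open>The names of possible elements are well-ordered in the ground model, and each
      set of the family gives up the element whose name comes first.\<close>
    obtain a g where a: "Ord a" "!!y. y \<e> d \<longleftrightarrow> (EX b. b \<e> a & app g b = y)" using well_order[of d] by metis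
    define upn where "upn x y = upair (pair x emp) (pair y emp)" for x y
    define prn where "prn x y = upn (upn x x) (upn x y)" for x y
    have upn_T [dfi]: "T s ==> T t ==> T (%e. upn (s e) (t e))" for s t unfolding upn_def by (intro dfi)
    have prn_T [dfi]: "T s ==> T t ==> T (%e. prn (s e) (t e))" for s t unfolding prn_def by (intro dfi)
    have U: "isU (val (upn x y)) (val x) (val y)" for x y
      unfolding isU_def EG_val upn_def memG_upn val_eq[symmetric] val_nam by blast
    have isU_un: "isU t x y ==> isU t' x y ==> t = t'" for t t' x y unfolding isU_def by (intro EG_ext) simp
    have exU: "EX t. isU t x y" for x y using U val_nam by metis
    have Pn: "isP (val (prn x y)) (val x) (val y)" for x y
    proof -
      have i: "isU t (val a) (val b) \<longleftrightarrow> t = val (upn a b)" for t a b using U isU_un by blast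
      show ?thesis unfolding isP_def i prn_def using U[of "upn x x" "upn x y"] unfolding isU_def by blast
    qed
    define W where "W = img (%b. pair (prn (chk b) (app g b)) emp) a"
    have Wm: "w \<e> W \<longleftrightarrow> (EX b. b \<e> a & w = pair (prn (chk b) (app g b)) emp)" for w
      unfolding W_def by (rule img) (intro dfi)
    have Wn: "nm W w q \<longleftrightarrow> (EX b. b \<e> a & w = prn (chk b) (app g b)) & q = emp" for w q unfolding nm_def Wm using one by auto
    have W: "EG w (val W) \<longleftrightarrow> (EX b. b \<e> a & w = val (prn (chk b) (app g b)))" for w
      unfolding EG_val memG_def Wn val_eq[symmetric] val_nam using G_one by blast
    define Rel where "Rel b z \<longleftrightarrow> (EX w. EG w (val W) & isP w b z)" for b z
    have Rel: "Rel b z \<longleftrightarrow> (EX c. c \<e> a & b = j c & z = val (app g c))" for b z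
      unfolding Rel_def W j_def using Pn isP_inj[OF _ _ exU] by metis
    have isU_D [dfi]: "dft EG s ==> dft EG t ==> dft EG u ==> dfn EG (%e. isU (s e) (t e) (u e))" for s t u
      unfolding isU_def by (intro dfi dft_shift)
    have Rel_D [dfi]: "dft EG s ==> dft EG t ==> dfn EG (%e. Rel (s e) (t e))" for s t
      unfolding Rel_def isP_def by (intro dfi dft_shift)
    define L where "L b z x \<longleftrightarrow> Rel b z & EG z x & ~ (EX c y. EG c b & Rel c y & EG y x)" for b z x
    have "dfn EG (%e. EX x b. EG x F & L b (e 0) x)" unfolding L_def by (intro dfi)
    from nameset[OF this, of d] obtain C where
      C: "!!z. EG z C \<longleftrightarrow> (EX u. u \<e> d & z = val u) & (EX x b. EG x F & L b z x)" by blast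
    have "EX c. ALL z. (EG z C & EG z x) = (z = c)" if xF: "EG x F" for x
    proof -
      have "dfn EG (%e. EX z. Rel (e 0) z & EG z x)" by (intro dfi)
      from sp[OF this, of "j a"] obtain B where B: "!!b. EG b B \<longleftrightarrow> EG b (j a) & (EX z. Rel b z & EG z x)" by blast
      obtain z0 where z0: "EG z0 x" using ne xF by blast
      obtain u where u: "u \<e> d" "z0 = val u" using d[OF xF z0] by blast
      obtain c where c: "c \<e> a" "app g c = u" using u(1) unfolding a(2) by blast
      then have c: "c \<e> a" "z0 = val (app g c)" using u(2) by auto
      then have "EG (j c) B" unfolding B Rel using z0 by auto
      from fnd[OF this] obtain b where b: "EG b B" "~ (EX z. EG z B & EG z b)" by blast
      then obtain z where z: "Rel b z" "EG z x" unfolding B by blast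
      then obtain c where c: "c \<e> a" "b = j c" "z = val (app g c)" unfolding Rel by blast
      have L: "L b z x" unfolding L_def
      proof (intro conjI z notI)
        assume "EX c y. EG c b & Rel c y & EG y x"
        then obtain c' y where "EG c' b" "Rel c' y" "EG y x" by blast
        then have "EG c' B" unfolding B using Rel by auto
        then show False using b \<open>EG c' b\<close> by blast
      qed
      have un: "z' = z" if L': "L b' z' x" for b' z'
      proof -
        obtain c' where c': "c' \<e> a" "b' = j c'" "z' = val (app g c')" using L' unfolding L_def Rel by blast
        have "c' \<e> c | c' = c | c \<e> c'" using Ord_lin Ord_mem[OF a(1)] c c' by blast
        moreover have "~ EG b' b" "~ EG b b'" using L L' unfolding L_def by blast+
        then have "~ c' \<e> c" "~ c \<e> c'" using c c' by auto
        ultimately show ?thesis using c c' by blast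
      qed
      have "(EG z' C & EG z' x) = (z' = z)" for z'
      proof
        assume a: "EG z' C & EG z' x"
        then obtain x' b' where x': "EG x' F" "L b' z' x'" unfolding C by blast
        then have "x' = x" using dj xF a unfolding L_def by blast
        with x' un show "z' = z" by blast
      next
        assume "z' = z"
        then show "EG z' C & EG z' x" unfolding C using L xF z d[OF xF z(2)] by blast
      qed
      then show ?thesis by blast
    qed
    then show ?thesis by blast
  qed
qed

sublocale N: zfc EG by (rule zfc_EG)

end

section \<open>Evaluation of the formulas\<close>

text \<open>A quantifier binds the first variable out of scope, so two rules for updates suffice:
  the new variable is hit and the smaller ones are passed by.\<close>

lemma upd_same: "(e(d := a)) d = a" by simp
lemma upd_less: "x < (d::nat) ==> (e(d := a)) x = e x" by simp

lemmas sfm_sat = sfm_defs upd_same upd_less less_Suc_eq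

context zfc
begin

lemma ext_iff: "x = y \<longleftrightarrow> (ALL z. z \<e> x \<longleftrightarrow> z \<e> y)" using extens by blast

lemma sat_empty: "x < d ==> sat E e (empty_s x d) \<longleftrightarrow> e x = emp"
  by (simp add: empty_s_def sfm_sat emp_iff del: fun_upd_apply)

lemma sat_subset: "x < d ==> y < d ==> sat E e (subset_s x y d) \<longleftrightarrow> sub (e x) (e y)"
  by (simp add: subset_s_def sfm_sat sub_def del: fun_upd_apply)

lemma sat_succ: "x < d ==> z < d ==> sat E e (succ_s x z d) \<longleftrightarrow> e z = succ (e x)"
  by (simp add: succ_s_def sfm_sat ext_iff[of "e z"] del: fun_upd_apply)

lemma sat_upair: "x < d ==> y < d ==> z < d ==> sat E e (upair_s x y z d) \<longleftrightarrow> e z = upair (e x) (e y)"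
  by (simp add: upair_s_def sfm_sat ext_iff[of "e z"] del: fun_upd_apply)

lemma sat_pair: "x < d ==> y < d ==> p < d ==> sat E e (pair_s x y p d) \<longleftrightarrow> e p = pair (e x) (e y)"
  by (simp add: pair_s_def sfm_sat sat_upair ext_iff[of "e p"] pair_def del: fun_upd_apply)

lemma sat_app: "f < d ==> x < d ==> y < d ==> sat E e (app_s f x y d) \<longleftrightarrow> pair (e x) (e y) \<e> e f"
  by (simp add: app_s_def sfm_sat sat_pair del: fun_upd_apply)

lemma isfun_iff: "isfun f X Y \<longleftrightarrow> (ALL p. p \<e> f --> (EX x y. x \<e> X & y \<e> Y & p = pair x y)) &
   (ALL x. x \<e> X --> (EX y. ALL v. pair x v \<e> f \<longleftrightarrow> v = y))"
proof
  assume f: "isfun f X Y"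
  then have fn: "fn f X" unfolding isfun_def by blast
  have "EX x y. x \<e> X & y \<e> Y & p = pair x y" if "p \<e> f" for p
    using f that unfolding isfun_def fn_mem[OF fn] by blast
  with fn show "(ALL p. p \<e> f --> (EX x y. x \<e> X & y \<e> Y & p = pair x y)) &
     (ALL x. x \<e> X --> (EX y. ALL v. pair x v \<e> f \<longleftrightarrow> v = y))" unfolding fn_def by blast
next
  assume f: "(ALL p. p \<e> f --> (EX x y. x \<e> X & y \<e> Y & p = pair x y)) &
     (ALL x. x \<e> X --> (EX y. ALL v. pair x v \<e> f \<longleftrightarrow> v = y))"
  then have fn: "fn f X" unfolding fn_def by blast
  have "app f x \<e> Y" if "x \<e> X" for x
    using f fn_app[OF fn that, of "app f x"] pair_inj by metis
  with fn show "isfun f X Y" unfolding isfun_def by blast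
qed

lemma sat_function: "f < d ==> X < d ==> Y < d ==> sat E e (function_s f X Y d) \<longleftrightarrow> isfun (e f) (e X) (e Y)"
  unfolding isfun_iff
  by (simp add: function_s_def sfm_sat sat_pair sat_app del: fun_upd_apply)

definition injR where "injR f A \<longleftrightarrow> (ALL x x' y. x \<e> A & x' \<e> A & pair x y \<e> f & pair x' y \<e> f --> x = x')"
definition imgR where "imgR f A B \<longleftrightarrow> (ALL y. y \<e> B \<longleftrightarrow> (EX x. x \<e> A & pair x y \<e> f))"
definition preR where "preR f X U W \<longleftrightarrow> (ALL x. x \<e> W \<longleftrightarrow> x \<e> X & (EX y. y \<e> U & pair x y \<e> f))"
definition bijR where "bijR f X Y \<longleftrightarrow> isfun f X Y & injR f X & imgR f X Y"

lemma sat_inj: "f < d ==> A < d ==> sat E e (injective_on_s f A d) \<longleftrightarrow> injR (e f) (e A)"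
  by (simp add: injective_on_s_def injR_def sfm_sat sat_app del: fun_upd_apply)
lemma sat_image: "f < d ==> A < d ==> B < d ==> sat E e (image_s f A B d) \<longleftrightarrow> imgR (e f) (e A) (e B)"
  by (simp add: image_s_def imgR_def sfm_sat sat_app del: fun_upd_apply)
lemma sat_preimage: "f < d ==> X < d ==> U < d ==> W < d ==> sat E e (preimage_s f X U W d) \<longleftrightarrow> preR (e f) (e X) (e U) (e W)"
  by (simp add: preimage_s_def preR_def sfm_sat sat_app del: fun_upd_apply)
lemma sat_bij: "f < d ==> X < d ==> Y < d ==> sat E e (bijection_s f X Y d) \<longleftrightarrow> bijR (e f) (e X) (e Y)"
  by (simp add: bijection_s_def bijR_def sfm_sat sat_function sat_inj sat_image del: fun_upd_apply)

lemma injR_inje: "fn f A ==> injR f A \<longleftrightarrow> inje f A"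
  unfolding injR_def inje_def by (metis fn_app)

lemma sat_inductive: "I < d ==> sat E e (inductive_s I d) \<longleftrightarrow> ind (e I)"
  by (simp add: inductive_s_def ind_def sfm_sat sat_empty sat_succ del: fun_upd_apply)

lemma sat_omega: "w < d ==> sat E e (omega_s w d) \<longleftrightarrow> e w = omega"
proof -
  assume "w < d"
  then have "sat E e (omega_s w d) \<longleftrightarrow> ind (e w) & (ALL I. ind I --> sub (e w) I)"
    by (simp add: omega_s_def sfm_sat sat_inductive sat_subset del: fun_upd_apply)
  moreover have "ind omega" unfolding ind_def using omega_succ by simp
  moreover have "ind I ==> sub omega I" for I unfolding sub_def omega by blast
  ultimately show ?thesis using sub_antisym[of "e w" omega] by metis
qed

definition "two = succ (succ emp)"

lemma sat_two: "t < d ==> sat E e (two_s t d) \<longleftrightarrow> e t = two"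
  by (simp add: two_s_def two_def sfm_sat sat_empty sat_succ del: fun_upd_apply)

lemma sat_trans: "x < d ==> sat E e (transitive_s x d) \<longleftrightarrow> trs (e x)"
  by (simp add: transitive_s_def trs_def sfm_sat sat_subset del: fun_upd_apply)

lemma sat_ordinal: "x < d ==> sat E e (ordinal_s x d) \<longleftrightarrow> Ord (e x)"
  by (simp add: ordinal_s_def Ord_def sfm_sat sat_trans del: fun_upd_apply)

lemma ctbl_iff: "ctbl x \<longleftrightarrow> (EX f. isfun f x omega & injR f x)"
  using cov_inj[of omega x] inj_cov[of _ x omega] injR_inje unfolding isfun_def by blast

lemma sat_countable: "x < d ==> sat E e (countable_s x d) \<longleftrightarrow> ctbl (e x)"
  unfolding ctbl_iff
  by (simp add: countable_s_def sfm_sat sat_omega sat_function sat_inj del: fun_upd_apply)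

text \<open>\<open>w1\<close> was picked by \<open>SOME\<close>; being unique, it is the set that
  the formula for aleph_1 describes.\<close>

lemma w1_unique: "Ord k & ~ ctbl k & (ALL a. a \<e> k --> ctbl a) \<longleftrightarrow> k = w1"
  using Ord_lin[of k w1] w1 by blast

lemma sat_aleph1: "k < d ==> sat E e (aleph1_s k d) \<longleftrightarrow> e k = w1"
  unfolding w1_unique[symmetric]
  by (simp add: aleph1_s_def sfm_sat sat_ordinal sat_countable del: fun_upd_apply)

definition size1 where "size1 x \<longleftrightarrow> (EX f. bijR f x w1)"
lemma sat_size1: "x < d ==> sat E e (size_aleph1_s x d) \<longleftrightarrow> size1 (e x)"
  by (simp add: size_aleph1_s_def size1_def sfm_sat sat_aleph1 sat_bij del: fun_upd_apply)

definition sameR where "sameR x y i \<longleftrightarrow> (EX v. pair i v \<e> x & pair i v \<e> y)"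
definition agrR where "agrR x y k \<longleftrightarrow> (ALL i. i \<e> k --> sameR x y i)"
definition distl where "distl x y n \<longleftrightarrow> x = y | (EX k. k \<e> omega & ~ sameR x y k & agrR x y k & n \<e> k)"
definition openR where "openR X U \<longleftrightarrow> sub U X & (ALL x. x \<e> U --> (EX n. n \<e> omega & (ALL y. y \<e> X & distl x y n --> y \<e> U)))"
definition dense1 where "dense1 X A \<longleftrightarrow> sub A X &
  (ALL U. openR X U & U ~= emp --> (EX C. (ALL x. x \<e> C \<longleftrightarrow> x \<e> A & x \<e> U) & size1 C))"
definition autoh where "autoh X h \<longleftrightarrow> bijR h X X &
  (ALL U W. openR X U & preR h X U W --> openR X W) & (ALL U W. openR X U & imgR h U W --> openR X W)"
definition lipR where "lipR X f \<longleftrightarrow> isfun f X X & (ALL x y x' y' k. x \<e> X & y \<e> X & pair x x' \<e> f & pair y y' \<e> f & k \<e> omega -->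
   agrR x y k --> agrR x' y' k)"

lemma sat_same: "x < d ==> y < d ==> i < d ==> sat E e (same_value_s x y i d) \<longleftrightarrow> sameR (e x) (e y) (e i)"
  by (simp add: same_value_s_def sameR_def sfm_sat sat_app del: fun_upd_apply)
lemma sat_agree: "x < d ==> y < d ==> k < d ==> sat E e (agree_s x y k d) \<longleftrightarrow> agrR (e x) (e y) (e k)"
  by (simp add: agree_s_def agrR_def sfm_sat sat_same del: fun_upd_apply)
lemma sat_dist: "w < d ==> x < d ==> y < d ==> n < d ==> e w = omega ==>
   sat E e (dist_less_s w x y n d) \<longleftrightarrow> distl (e x) (e y) (e n)"
  by (simp add: dist_less_s_def distl_def sfm_sat sat_same sat_agree del: fun_upd_apply)
lemma sat_open: "w < d ==> X < d ==> U < d ==> e w = omega ==>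
   sat E e (open_s w X U d) \<longleftrightarrow> openR (e X) (e U)"
  by (simp add: open_s_def openR_def sfm_sat sat_subset sat_dist del: fun_upd_apply)
lemma sat_dense: "w < d ==> X < d ==> A < d ==> e w = omega ==>
   sat E e (aleph1_dense_s w X A d) \<longleftrightarrow> dense1 (e X) (e A)"
  by (simp add: aleph1_dense_s_def dense1_def sfm_sat sat_subset sat_open sat_empty sat_size1 del: fun_upd_apply)
lemma sat_autoh: "w < d ==> X < d ==> h < d ==> e w = omega ==>
   sat E e (autohomeomorphism_s w X h d) \<longleftrightarrow> autoh (e X) (e h)"
  by (simp add: autohomeomorphism_s_def autoh_def sfm_sat sat_open sat_bij sat_preimage sat_image del: fun_upd_apply)
lemma sat_lip: "w < d ==> X < d ==> f < d ==> e w = omega ==>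
   sat E e (lipschitz_s w X f d) \<longleftrightarrow> lipR (e X) (e f)"
  by (simp add: lipschitz_s_def lipR_def sfm_sat sat_function sat_app sat_agree del: fun_upd_apply)

definition fs where "fs S = sepS (pw (prod omega S)) (%x. isfun x omega S)"
lemma fs [simp]: "x \<e> fs S \<longleftrightarrow> isfun x omega S"
proof -
  have "x \<e> fs S \<longleftrightarrow> x \<e> pw (prod omega S) & isfun x omega S" unfolding fs_def by (rule sepS) (intro dfi)
  moreover have "isfun x omega S ==> x \<e> pw (prod omega S)" unfolding isfun_iff pw prod by blast
  ultimately show ?thesis by blast
qed
lemma fs_T [dfi]: "T s ==> T (%e. fs (s e))" unfolding fs_def by (intro dfi dft_shift)

definition BA where "BA X \<longleftrightarrow> (ALL A B. dense1 X A & dense1 X B --> (EX h. autoh X h & imgR h A B))"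

lemma sat_BA: "w < d ==> X < d ==> e w = omega ==> sat E e (BA_s w X d) \<longleftrightarrow> BA (e X)"
  by (simp add: BA_s_def BA_def sfm_sat sat_dense sat_autoh sat_image del: fun_upd_apply)

lemma sat_BA_Baire: "sat E e BA_Baire \<longleftrightarrow> BA (fs omega)"
proof -
  have "sat E e BA_Baire \<longleftrightarrow> (ALL w X. w = omega & (ALL x. x \<e> X \<longleftrightarrow> isfun x w w) --> BA X)"
    by (simp add: BA_Baire_def baire_space_s_def sfm_sat sat_omega sat_function sat_BA del: fun_upd_apply cong: imp_cong)
  also have "\<dots> \<longleftrightarrow> BA (fs omega)" by (simp add: ext_iff[of _ "fs omega", symmetric, simplified])
  finally show ?thesis .
qed

lemma sat_BA_Cantor: "sat E e BA_Cantor \<longleftrightarrow> BA (fs two)"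
proof -
  have "sat E e BA_Cantor \<longleftrightarrow> (ALL w X. w = omega & (ALL x. x \<e> X \<longleftrightarrow> isfun x w two) --> BA X)"
    by (simp add: BA_Cantor_def cantor_space_s_def sfm_sat sat_omega sat_two sat_function sat_BA del: fun_upd_apply cong: imp_cong)
  also have "\<dots> \<longleftrightarrow> BA (fs two)" by (simp add: ext_iff[of _ "fs two", symmetric, simplified])
  finally show ?thesis .
qed

lemma sat_Lip_Baire: "sat E e BA_Lip_Baire \<longleftrightarrow> (ALL A B. dense1 (fs omega) A & dense1 (fs omega) B -->
    (EX f. lipR (fs omega) f & injR f A & imgR f A B))"
proof -
  have "sat E e BA_Lip_Baire \<longleftrightarrow> (ALL w X. w = omega & (ALL x. x \<e> X \<longleftrightarrow> isfun x w w) -->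
     (ALL A B. dense1 X A & dense1 X B --> (EX f. lipR X f & injR f A & imgR f A B)))"
    by (simp add: BA_Lip_Baire_def baire_space_s_def sfm_sat sat_omega sat_function sat_dense sat_lip sat_inj sat_image del: fun_upd_apply cong: imp_cong)
  also have "\<dots> \<longleftrightarrow> (ALL A B. dense1 (fs omega) A & dense1 (fs omega) B -->
    (EX f. lipR (fs omega) f & injR f A & imgR f A B))" by (simp add: ext_iff[of _ "fs omega", symmetric, simplified])
  finally show ?thesis .
qed

lemma sat_Lip_Cantor: "sat E e BA_Lip_Cantor \<longleftrightarrow> (ALL A B. dense1 (fs two) A & dense1 (fs two) B -->
    (EX F L. isfun F omega L & (ALL n f. n \<e> omega & pair n f \<e> F --> lipR (fs two) f) &
      (ALL y. y \<e> B \<longleftrightarrow> (EX n f x. n \<e> omega & pair n f \<e> F & x \<e> A & pair x y \<e> f))))"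
proof -
  have "sat E e BA_Lip_Cantor \<longleftrightarrow> (ALL w X. w = omega & (ALL x. x \<e> X \<longleftrightarrow> isfun x w two) -->
     (ALL A B. dense1 X A & dense1 X B --> (EX F L. isfun F omega L & (ALL n f. n \<e> omega & pair n f \<e> F --> lipR X f) &
      (ALL y. y \<e> B \<longleftrightarrow> (EX n f x. n \<e> omega & pair n f \<e> F & x \<e> A & pair x y \<e> f)))))"
    by (simp add: BA_Lip_Cantor_def cantor_space_s_def sfm_sat sat_omega sat_two sat_function sat_dense sat_lip sat_app del: fun_upd_apply cong: imp_cong)
  also have "\<dots> \<longleftrightarrow> (ALL A B. dense1 (fs two) A & dense1 (fs two) B -->
    (EX F L. isfun F omega L & (ALL n f. n \<e> omega & pair n f \<e> F --> lipR (fs two) f) &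
      (ALL y. y \<e> B \<longleftrightarrow> (EX n f x. n \<e> omega & pair n f \<e> F & x \<e> A & pair x y \<e> f))))"
     by (simp add: ext_iff[of _ "fs two", symmetric, simplified])
  finally show ?thesis .
qed

end

context generic
begin

subsection \<open>Absoluteness\<close>

lemma j_emp: "j emp = N.emp" by (rule N.extens) (simp add: EG_j)
lemma j_upair: "j (upair x y) = N.upair (j x) (j y)" by (rule N.extens) (auto simp: EG_j)
lemma j_pair: "j (pair x y) = N.pair (j x) (j y)" by (simp add: pair_def N.pair_def j_upair)
lemma j_succ: "j (succ x) = N.succ (j x)" by (rule N.extens) (auto simp: EG_j)
lemma j_prod: "j (prod x y) = N.prod (j x) (j y)"
  by (rule N.extens) (auto simp: EG_j N.prod prod j_pair, metis j_pair prod)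
lemma j_two: "j two = N.two" by (simp add: two_def N.two_def j_succ j_emp)

text \<open>Natural numbers of the extension are old by induction there. If an old one were missing,
  foundation in the extension would give a minimal missing one, and its predecessor shows that it is
  not missing.\<close>

lemma j_omega: "j omega = N.omega"
proof (rule N.sub_antisym)
  show "N.sub N.omega (j omega)"
  proof (rule N.subI)
    fix z assume "EG z N.omega"
    then show "EG z (j omega)"
    proof (induct rule: N.omega_induct)
      case D show ?case by (intro dfi)
    next
      case emp show ?case unfolding j_emp[symmetric] by simp
    next
      case (succ n)
      then obtain m where "m \<e> omega" "n = j m" unfolding EG_j by blast
      then show ?case unfolding EG_j using j_succ omega_succ by metis
    qed
  qed
  have "EG (j n) N.omega" if "n \<e> omega" for n
  proof (rule ccontr)
    assume c: "~ EG (j n) N.omega"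
    have "dfn EG (%e. EG (e 0) (j omega) & ~ EG (e 0) N.omega)" by (intro dfi)
    from N.sep[OF this, of "j omega"] obtain B where B: "!!z. EG z B \<longleftrightarrow> EG z (j omega) & ~ EG z N.omega" by blast
    have "EG (j n) B" using c that B by simp
    from N.found[OF this] obtain y where y: "EG y B" "~ (EX z. EG z B & EG z y)" by blast
    then obtain m where m: "m \<e> omega" "y = j m" unfolding B EG_j by blast
    show False
    proof (rule nat_cases[OF m(1)])
      assume "m = emp"
      then show False using y m B j_emp by simp
    next
      fix k assume k: "k \<e> omega" "m = succ k"
      then have "EG (j k) y" using m by simp
      moreover have "EG (j k) (j omega)" using k by simp
      ultimately have "EG (j k) N.omega" using y(2) unfolding B by blast
      then have "EG (j m) N.omega" unfolding k j_succ by (rule N.omega_succ)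
      then show False using y m B by simp
    qed
  qed
  then show "N.sub (j omega) N.omega" unfolding N.sub_def EG_j by blast
qed

lemma j_trs: "trs x ==> N.trs (j x)"
  unfolding N.trs_def N.sub_def
proof (intro allI impI)
  fix y z assume t: "trs x" and "EG y (j x)" and z: "EG z y"
  then obtain u where u: "u \<e> x" "y = j u" unfolding EG_j by blast
  then obtain v where "v \<e> u" "z = j v" using z unfolding u(2) EG_j by blast
  then show "EG z (j x)" using trsD[OF t u(1)] by simp
qed
lemma j_Ord: "Ord x ==> N.Ord (j x)" unfolding N.Ord_def using j_trs unfolding Ord_def EG_j by blast

lemma j_pair_mem: "EG (N.pair a b) (j f) \<longleftrightarrow> (EX x y. a = j x & b = j y & pair x y \<e> f)"
proof
  assume "EG (N.pair a b) (j f)"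
  then obtain p where p: "p \<e> f" "N.pair a b = j p" unfolding EG_j by blast
  have "EG (N.upair a a) (j p)" "EG (N.upair a b) (j p)" using p(2) unfolding N.pair_def by (metis N.upair)+
  then obtain s t where st: "N.upair a a = j s" "N.upair a b = j t" unfolding EG_j by blast
  have "EG a (j s)" "EG b (j t)" using st by (metis N.upair)+
  then obtain x y where "a = j x" "b = j y" unfolding EG_j by blast
  then show "EX x y. a = j x & b = j y & pair x y \<e> f" using p j_pair j_inj by metis
qed (auto simp: j_pair[symmetric])

lemma j_fn: assumes "fn f a" shows "N.fn (j f) (j a)" "x \<e> a ==> N.app (j f) (j x) = j (app f x)"
proof -
  show f: "N.fn (j f) (j a)" unfolding N.fn_def
  proof (intro conjI allI impI)
    fix p assume "EG p (j f)"
    then obtain x y where "p = j (pair x y)" "x \<e> a" using assms unfolding EG_j fn_def by blast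
    then show "EX x y. EG x (j a) & p = N.pair x y" by (metis j_pair EG_jj)
  next
    fix x assume "EG x (j a)"
    then obtain u where u: "u \<e> a" "x = j u" unfolding EG_j by blast
    then show "EX y. ALL v. EG (N.pair x v) (j f) = (v = y)"
      unfolding j_pair_mem using fn_app[OF assms u(1)] by (intro exI[of _ "j (app f u)"]) auto
  qed
  assume x: "x \<e> a"
  then have "EG (N.pair (j x) (j (app f x))) (j f)" unfolding j_pair_mem using fn_app[OF assms x] by auto
  then show "N.app (j f) (j x) = j (app f x)" using N.fn_app[OF f, of "j x"] x by simp
qed

lemma j_cov: assumes "cov a x" shows "N.cov (j a) (j x)"
proof -
  obtain f where f: "fn f a" "!!y. y \<e> x ==> EX n. n \<e> a & app f n = y" using covE[OF assms] by blast
  show ?thesis unfolding N.cov_def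
  proof (rule exI[of _ "j f"], intro conjI allI impI)
    fix y assume "EG y (j x)"
    then obtain u where u: "u \<e> x" "y = j u" unfolding EG_j by blast
    then obtain n where "n \<e> a" "app f n = u" using f(2) by blast
    then show "EX n. EG n (j a) & N.app (j f) n = y" using u j_fn(2)[OF f(1)] by (intro exI[of _ "j n"]) simp
  qed (rule j_fn(1)[OF f(1)])
qed

end

section \<open>Nodes and permutations of levels\<close>

text \<open>\<open>S\<close> is \<open>two\<close> for Cantor space and \<open>omega\<close> for
  Baire space; both are treated at once.\<close>

locale nodes = zfc E for E :: "'a => 'a => bool" (infix "\<e>" 50) +
  fixes S assumes S_omega: "sub S omega" and S_0: "emp \<e> S" and S_1: "succ emp \<e> S"
begin

definition fsp where "fsp a = sepS (pw (prod a S)) (%x. isfun x a S)"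
lemma fsp [simp]: "x \<e> fsp a \<longleftrightarrow> isfun x a S"
proof -
  have "x \<e> fsp a \<longleftrightarrow> x \<e> pw (prod a S) & isfun x a S" unfolding fsp_def by (rule sepS) (intro dfi)
  moreover have "isfun x a S ==> x \<e> pw (prod a S)" unfolding isfun_iff pw prod by blast
  ultimately show ?thesis by blast
qed
lemma fsp_T [dfi]: "T s ==> T (%e. fsp (s e))" unfolding fsp_def by (intro dfi dft_shift)
lemma isfun_lam: "T (%e. F (e 0)) ==> (!!i. i \<e> a ==> F i \<e> b) ==> isfun (lam a F) a b"
  unfolding isfun_def by (simp add: lam)

lemma fun_mem: "isfun s l S ==> w \<e> s \<longleftrightarrow> (EX i. i \<e> l & w = pair i (app s i))"
  unfolding isfun_def using fn_mem by blast
lemma fun_pair: "isfun s l S ==> pair i v \<e> s \<longleftrightarrow> i \<e> l & v = app s i"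
  using fun_mem by auto
lemma fun_ext: "isfun s l S ==> isfun t l S ==> (!!i. i \<e> l ==> app s i = app t i) ==> s = t"
  unfolding isfun_def using fn_ext by blast

lemma sub_fun: assumes "isfun s l S" "isfun x a S" shows "sub s x \<longleftrightarrow> sub l a & (ALL i. i \<e> l --> app s i = app x i)"
  unfolding sub_def fun_mem[OF assms(1)] fun_mem[OF assms(2)] by auto

lemma sub_level: "isfun s l S ==> isfun x a S ==> sub s x ==> sub l a" using sub_fun by blast
lemma sub_same: "isfun s l S ==> isfun t l S ==> sub s t ==> s = t" using sub_fun fun_ext by blast
lemma sub_common: "isfun s l S ==> isfun t m S ==> isfun x a S ==> sub l m ==> sub s x ==> sub t x ==> sub s t"
  by (simp add: sub_fun) (simp add: sub_def)
lemma sub_common_same: "isfun s l S ==> isfun t l S ==> isfun x a S ==> sub s x ==> sub t x ==> s = t"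
  using sub_common sub_same sub_refl by blast

lemma restr_ex: assumes "isfun x a S" "sub l a" shows "EX s. isfun s l S & sub s x"
proof -
  have "T (%e. app x (e 0))" by (intro dfi)
  note l = lam[OF this]
  have "isfun (lam l (app x)) l S" unfolding isfun_def using assms l unfolding isfun_def sub_def by auto
  moreover have "sub (lam l (app x)) x" unfolding sub_fun[OF calculation assms(1)] using assms(2) l by simp
  ultimately show ?thesis by blast
qed

text \<open>The tail of \<open>s'\<close> beyond \<open>s\<close> is the set of pairs
  \<open>dif s' s\<close>, so having the same tail is an equality of sets.\<close>

lemma graft: assumes "isfun s' l' S" "isfun s l S" "sub s s'" "isfun t l S"
  shows "EX t'. isfun t' l' S & sub t t' & dif s' s = dif t' t"
proof -
  have T: "T (%e. if e 0 \<e> l then app t (e 0) else app s' (e 0))" by (intro dfi)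
  note lm = lam[OF T]
  let ?t = "lam l' (%i. if i \<e> l then app t i else app s' i)"
  have t: "isfun ?t l' S" by (rule isfun_lam[OF T]) (use assms in \<open>auto simp: isfun_def\<close>)
  moreover have "sub t ?t" unfolding sub_fun[OF assms(4) t] using sub_level[OF assms(2,1,3)] lm by (simp add: sub_def)
  moreover have "dif s' s = dif ?t t"
  proof (rule extens)
    fix w
    show "w \<e> dif s' s \<longleftrightarrow> w \<e> dif ?t t"
      unfolding dif fun_mem[OF t] fun_mem[OF assms(1)] fun_mem[OF assms(2)] fun_mem[OF assms(4)]
      using assms(3) lm(2)[of _ l'] unfolding sub_fun[OF assms(2,1)] by auto
  qed
  ultimately show ?thesis by blast
qed

lemma ext_node: assumes "isfun s l S" "sub l a" shows "EX x. isfun x a S & sub s x"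
proof -
  have T: "T (%e. if e 0 \<e> l then app s (e 0) else emp)" by (intro dfi)
  note lm = lam[OF T]
  let ?x = "lam a (%i. if i \<e> l then app s i else emp)"
  have t: "isfun ?x a S" by (rule isfun_lam[OF T]) (use assms S_0 in \<open>auto simp: isfun_def\<close>)
  moreover have "sub s ?x" unfolding sub_fun[OF assms(1) t] using assms(2) lm by (simp add: sub_def)
  ultimately show ?thesis by blast
qed

definition ND where "ND = sepS (pw (prod omega S)) (%s. EX l. l \<e> omega & isfun s l S)"
lemma ND: "s \<e> ND \<longleftrightarrow> (EX l. l \<e> omega & isfun s l S)"
proof -
  have "s \<e> ND \<longleftrightarrow> s \<e> pw (prod omega S) & (EX l. l \<e> omega & isfun s l S)" unfolding ND_def by (rule sepS) (intro dfi)
  moreover have "s \<e> pw (prod omega S)" if "l \<e> omega" "isfun s l S" for l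
    using that nat_mem unfolding isfun_iff pw prod by blast
  ultimately show ?thesis by blast
qed

lemma fun_fin: assumes "fin l" "isfun s l S" shows "fin s"
proof -
  have T: "T (%e. pair (e 0) (app s (e 0)))" by (intro dfi)
  have "s = img (%i. pair i (app s i)) l" by (rule extens) (simp add: fun_mem[OF assms(2)] img[OF T])
  then show ?thesis using fin_img[OF T assms(1)] by simp
qed

subsection \<open>Closure properties of hereditarily finite collections\<close>

context
  fixes Z assumes Z0: "emp \<e> Z" and Za: "!!x y. x \<e> Z ==> y \<e> Z ==> adj x y \<e> Z"
begin

lemma cl_fin: assumes "fin x" "sub x Z" shows "x \<e> Z"
proof -
  have "sub x Z --> x \<e> Z" using assms(1)
  proof (induct rule: fin_induct)
    case D show ?case by (intro dfi)
  qed (auto simp: sub_def Z0 intro: Za)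
  with assms show ?thesis by blast
qed
lemma cl_pair: "x \<e> Z ==> y \<e> Z ==> pair x y \<e> Z"
  unfolding pair_def by (intro cl_fin fin_upair) (auto simp: sub_def intro!: cl_fin)
lemma cl_omega: "n \<e> omega ==> n \<e> Z"
proof (induct rule: omega_induct)
  case D show ?case by (intro dfi)
qed (auto simp: Z0 Za succ_def)
lemma cl_node: assumes "s \<e> ND" shows "s \<e> Z"
proof -
  obtain l where l: "l \<e> omega" "isfun s l S" using assms unfolding ND by blast
  show ?thesis
  proof (rule cl_fin[OF fun_fin[OF fin_nat[OF l(1)] l(2)]])
    show "sub s Z" unfolding sub_def fun_mem[OF l(2)]
      using l nat_mem[OF l(1)] S_omega cl_omega cl_pair unfolding isfun_def sub_def by blast
  qed
qed
end

lemma ND_ctbl: "ctbl ND"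
proof -
  have "T (%e. adj (e (Suc 0)) (e (Suc (Suc 0))))" by (intro dfi)
  from countable_closure[where Op = "%t x y. adj x y", OF this] obtain Z where
    "ctbl Z" "emp \<e> Z" "!!x y. x \<e> Z ==> y \<e> Z ==> adj x y \<e> Z" using omega_0 by blast
  then show ?thesis using cl_node cov_sub unfolding sub_def by blast
qed

lemma ND_V: "s \<e> ND ==> s \<e> V omega"
  by (rule cl_node[rotated 2]) (auto simp: V[of emp] sub_def intro!: omega_0 V_adj Ord_omega omega_succ exI[of _ emp])

subsection \<open>Permutations of levels\<close>

text \<open>A permutation of level \<open>l\<close> as a set of pairs of nodes. In Baire space this
  set is infinite for \<open>l > 0\<close>, although conditions are finite.\<close>

definition Perm where "Perm p l \<longleftrightarrow> l \<e> omega & (ALL w. w \<e> p --> (EX s t. isfun s l S & isfun t l S & w = pair s t)) &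
  (ALL s. isfun s l S --> (EX t. pair s t \<e> p)) & (ALL t. isfun t l S --> (EX s. pair s t \<e> p)) &
  (ALL s t s' t'. pair s t \<e> p & pair s' t' \<e> p --> (s = s' \<longleftrightarrow> t = t'))"
definition coh where "coh p p' \<longleftrightarrow> (ALL s t s' t'. pair s t \<e> p & pair s' t' \<e> p' --> (sub s s' \<longleftrightarrow> sub t t'))"
lemma Perm_D [dfi]: "T s ==> T t ==> D (%e. Perm (s e) (t e))" unfolding Perm_def by (intro dfi dft_shift)
lemma coh_D [dfi]: "T s ==> T t ==> D (%e. coh (s e) (t e))" unfolding coh_def by (intro dfi dft_shift)

lemma PermD: assumes "Perm p l" shows "l \<e> omega" "pair s t \<e> p ==> isfun s l S" "pair s t \<e> p ==> isfun t l S"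
  "isfun s l S ==> EX t. pair s t \<e> p" "isfun t l S ==> EX s. pair s t \<e> p"
  "pair s t \<e> p ==> pair s' t' \<e> p ==> s = s' \<longleftrightarrow> t = t'"
proof -
  show "l \<e> omega" using assms unfolding Perm_def by blast
  show "pair s t \<e> p ==> isfun s l S" "pair s t \<e> p ==> isfun t l S"
    using assms unfolding Perm_def by (metis pair_inj)+
  show "isfun s l S ==> EX t. pair s t \<e> p" "isfun t l S ==> EX s. pair s t \<e> p"
    "pair s t \<e> p ==> pair s' t' \<e> p ==> s = s' \<longleftrightarrow> t = t'"
    using assms unfolding Perm_def by blast+
qed

lemma coh_refl: assumes "Perm p l" shows "coh p p"
  unfolding coh_def using PermD[OF assms] sub_same sub_refl by metis

lemma coh_sym: assumes "Perm p l" "Perm p' l'" "sub l l'" "coh p p'" shows "coh p' p"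
  unfolding coh_def
proof (intro allI impI, elim conjE)
  fix s' t' s t assume m: "pair s' t' \<e> p'" "pair s t \<e> p"
  note P = PermD[OF assms(1)] and P' = PermD[OF assms(2)]
  have c: "sub s s' \<longleftrightarrow> sub t t'" using assms(4) m unfolding coh_def by blast
  have "l = l'" if "sub s' s | sub t' t"
    using that sub_level P(2,3)[OF m(2)] P'(2,3)[OF m(1)] assms(3) sub_antisym by blast
  then show "sub s' s \<longleftrightarrow> sub t' t" using c sub_same P(2,3)[OF m(2)] P'(2,3)[OF m(1)] sub_refl by metis
qed

lemma coh_trans: assumes "Perm r k" "Perm p l" "Perm p' l'" "sub k l" "coh r p" "coh p p'" "sub l l'" shows "coh r p'"
  unfolding coh_def
proof (intro allI impI, elim conjE)
  fix a b s' t' assume m: "pair a b \<e> r" "pair s' t' \<e> p'"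
  note R = PermD(2,3)[OF assms(1) m(1)] and P' = PermD(2,3)[OF assms(3) m(2)] and P = PermD[OF assms(2)]
  obtain s where s: "isfun s l S" "sub s s'" using restr_ex[OF P'(1) assms(7)] by blast
  obtain t where t: "pair s t \<e> p" using P(4)[OF s(1)] by blast
  have tt: "sub t t'" using assms(6) t m(2) s(2) unfolding coh_def by blast
  have tf: "isfun t l S" using P(3)[OF t] .
  have "sub a s' \<longleftrightarrow> sub a s" using sub_common[OF R(1) s(1) P'(1) assms(4) _ s(2)] s(2) sub_trans by blast
  also have "\<dots> \<longleftrightarrow> sub b t" using assms(5) m(1) t unfolding coh_def by blast
  also have "\<dots> \<longleftrightarrow> sub b t'" using sub_common[OF R(2) tf P'(2) assms(4) _ tt] tt sub_trans by blast
  finally show "sub a s' \<longleftrightarrow> sub b t'" .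
qed

text \<open>\<open>exP\<close> moves initial segments by \<open>p\<close> and keeps the tails;
  \<open>swP\<close> follows \<open>p\<close> by the exchange of \<open>u\<close> and
  \<open>v\<close>. Pairs of nodes lie in \<open>V omega\<close>, so the bound cuts nothing
  off.\<close>

definition exP where "exP p l' = sepS (V omega) (%w. EX s' t' s t. w = pair s' t' & isfun s' l' S & isfun t' l' S &
   pair s t \<e> p & sub s s' & sub t t' & dif s' s = dif t' t)"
definition swP where "swP p u v = sepS (V omega) (%w. EX s t. pair s t \<e> p & w = pair s (if t = u then v else if t = v then u else t))"
lemma exP_T [dfi]: "T s ==> T t ==> T (%e. exP (s e) (t e))" unfolding exP_def by (intro dfi dft_shift)
lemma swP_T [dfi]: "T s ==> T t ==> T u ==> T (%e. swP (s e) (t e) (u e))" unfolding swP_def by (intro dfi dft_shift)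

lemma node_pair_V: "l \<e> omega ==> isfun s l S ==> isfun t l S ==> pair s t \<e> V omega"
  using ND_V ND by (intro V_pair Ord_omega omega_succ) blast+

lemma exP: assumes l': "l' \<e> omega"
  shows "w \<e> exP p l' \<longleftrightarrow> (EX s' t' s t. w = pair s' t' & isfun s' l' S & isfun t' l' S &
   pair s t \<e> p & sub s s' & sub t t' & dif s' s = dif t' t)"
proof -
  have "w \<e> exP p l' \<longleftrightarrow> w \<e> V omega & (EX s' t' s t. w = pair s' t' & isfun s' l' S & isfun t' l' S &
   pair s t \<e> p & sub s s' & sub t t' & dif s' s = dif t' t)" unfolding exP_def by (rule sepS) (intro dfi)
  then show ?thesis using node_pair_V[OF l'] by blast
qed

lemma swP: assumes "Perm p l" "isfun u l S" "isfun v l S"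
  shows "w \<e> swP p u v \<longleftrightarrow> (EX s t. pair s t \<e> p & w = pair s (if t = u then v else if t = v then u else t))"
proof -
  have "w \<e> swP p u v \<longleftrightarrow> w \<e> V omega & (EX s t. pair s t \<e> p & w = pair s (if t = u then v else if t = v then u else t))"
    unfolding swP_def by (rule sepS) (intro dfi)
  moreover have "pair s (if t = u then v else if t = v then u else t) \<e> V omega" if "pair s t \<e> p" for s t
    using PermD(1-3)[OF assms(1)] that assms(2,3) by (intro node_pair_V[of l]) auto
  ultimately show ?thesis by blast
qed

lemma dif_det: "sub s s' ==> sub s t' ==> dif s' s = dif t' s ==> s' = t'"
  by (rule extens) (metis dif sub_def)

lemma exP_perm: assumes p: "Perm p l" and l': "l' \<e> omega" "sub l l'"
  shows "Perm (exP p l') l'" "coh p (exP p l')"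
proof -
  note P = PermD[OF p] and ex = exP[OF l'(1)]
  have inj: "s1 = s2 \<longleftrightarrow> t1 = t2" if q: "pair s1 t1 \<e> exP p l'" "pair s2 t2 \<e> exP p l'" for s1 t1 s2 t2
  proof -
    obtain a1 b1 where 1: "isfun s1 l' S" "isfun t1 l' S" "pair a1 b1 \<e> p" "sub a1 s1" "sub b1 t1" "dif s1 a1 = dif t1 b1"
      using q(1) unfolding ex pair_inj by blast
    obtain a2 b2 where 2: "isfun s2 l' S" "isfun t2 l' S" "pair a2 b2 \<e> p" "sub a2 s2" "sub b2 t2" "dif s2 a2 = dif t2 b2"
      using q(2) unfolding ex pair_inj by blast
    note f = P(2,3)[OF 1(3)] P(2,3)[OF 2(3)]
    have ab: "a1 = a2 \<longleftrightarrow> b1 = b2" using P(6)[OF 1(3) 2(3)] .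
    show ?thesis
    proof
      assume "s1 = s2"
      then have "a1 = a2" using sub_common_same[OF f(1,3) 1(1,4)] 2(4) by blast
      then show "t1 = t2" using ab 1 2 \<open>s1 = s2\<close> dif_det[of b1 t1 t2] by simp
    next
      assume "t1 = t2"
      then have "b1 = b2" using sub_common_same[OF f(2,4) 1(2,5)] 2(5) by blast
      then show "s1 = s2" using ab 1 2 \<open>t1 = t2\<close> dif_det[of a1 s1 s2] by simp
    qed
  qed
  have tot: "EX t'. pair s' t' \<e> exP p l'" if s': "isfun s' l' S" for s'
  proof -
    obtain s where s: "isfun s l S" "sub s s'" using restr_ex[OF s' l'(2)] by blast
    obtain t where t: "pair s t \<e> p" using P(4)[OF s(1)] by blast
    show ?thesis using graft[OF s' s P(3)[OF t]] s s' t unfolding ex pair_inj by blast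
  qed
  have onto: "EX s'. pair s' t' \<e> exP p l'" if t': "isfun t' l' S" for t'
  proof -
    obtain t where t: "isfun t l S" "sub t t'" using restr_ex[OF t' l'(2)] by blast
    obtain s where s: "pair s t \<e> p" using P(5)[OF t(1)] by blast
    obtain s' where "isfun s' l' S" "sub s s'" "dif t' t = dif s' s" using graft[OF t' t P(2)[OF s]] by blast
    then show ?thesis using t t' s unfolding ex pair_inj by metis
  qed
  have mem: "!!w. w \<e> exP p l' ==> EX s t. isfun s l' S & isfun t l' S & w = pair s t" unfolding ex by blast
  show "Perm (exP p l') l'" unfolding Perm_def using l'(1) mem tot onto inj by blast
  show "coh p (exP p l')" unfolding coh_def
  proof (intro allI impI, elim conjE)
    fix a b s' t' assume m: "pair a b \<e> p" "pair s' t' \<e> exP p l'"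
    obtain s t where st: "isfun s' l' S" "isfun t' l' S" "pair s t \<e> p" "sub s s'" "sub t t'"
      using m(2) unfolding ex pair_inj by blast
    note f = P(2,3)[OF m(1)] P(2,3)[OF st(3)]
    have "sub a s' \<longleftrightarrow> a = s" using sub_common_same[OF f(1,3) st(1)] st(4) by blast
    moreover have "sub b t' \<longleftrightarrow> b = t" using sub_common_same[OF f(2,4) st(2)] st(5) by blast
    ultimately show "sub a s' \<longleftrightarrow> sub b t'" using P(6)[OF m(1) st(3)] by blast
  qed
qed

lemma swP_perm: assumes p: "Perm p l" and uv: "isfun u l S" "isfun v l S" shows "Perm (swP p u v) l"
proof -
  note P = PermD[OF p] and sw = swP[OF p uv]
  have 1: "EX s t. isfun s l S & isfun t l S & w = pair s t" if "w \<e> swP p u v" for w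
    using that P(2,3) uv unfolding sw by (metis (full_types))
  have 2: "EX t. pair s t \<e> swP p u v" if "isfun s l S" for s
    using P(4)[OF that] unfolding sw by blast
  have 3: "EX s. pair s t \<e> swP p u v" if "isfun t l S" for t
  proof -
    obtain s where "pair s (if t = u then v else if t = v then u else t) \<e> p" using P(5) uv \<open>isfun t l S\<close> by (metis (full_types))
    then show ?thesis unfolding sw pair_inj by (intro exI[of _ s] exI[of _ "if t = u then v else if t = v then u else t"]) auto
  qed
  have 4: "s = s' \<longleftrightarrow> t = t'" if a: "pair s t \<e> swP p u v" "pair s' t' \<e> swP p u v" for s t s' t'
  proof -
    obtain x where x: "pair s x \<e> p" "t = (if x = u then v else if x = v then u else x)" using a(1) unfolding sw pair_inj by blast
    obtain x' where x': "pair s' x' \<e> p" "t' = (if x' = u then v else if x' = v then u else x')" using a(2) unfolding sw pair_inj by blast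
    show ?thesis using P(6)[OF x(1) x'(1)] x(2) x'(2) by (auto split: if_splits)
  qed
  show ?thesis unfolding Perm_def using P(1) 1 2 3 4 by blast
qed

text \<open>Starting from \<open>exP\<close>, the pairs of \<open>u\<close> are put in one after
  another, each by one exchange. The old and the new image of \<open>s\<close> restrict to the same
  node of level \<open>l\<close>, so coherence with \<open>p\<close> is kept.\<close>

lemma refine:
  assumes Z: "!!p l. p \<e> Z ==> l \<e> omega ==> exP p l \<e> Z" "!!p u v. p \<e> Z ==> u \<e> ND ==> v \<e> ND ==> swP p u v \<e> Z"
    and p: "Perm p l" "p \<e> Z" and l': "l' \<e> omega" "sub l l'" and u: "fin u"
    and uf: "!!w. w \<e> u ==> EX s t. isfun s l' S & isfun t l' S & w = pair s t"
    and ui: "!!s t s' t'. pair s t \<e> u ==> pair s' t' \<e> u ==> s = s' \<longleftrightarrow> t = t'"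
    and uc: "!!a b s t. pair a b \<e> p ==> pair s t \<e> u ==> sub a s \<longleftrightarrow> sub b t"
  shows "EX q. q \<e> Z & Perm q l' & coh p q & sub u q"
proof -
  have "sub v u --> (EX q. q \<e> Z & Perm q l' & coh p q & sub v q)" if "fin v" for v
    using that
  proof (induct rule: fin_induct)
    case D show ?case by (intro dfi)
  next
    case emp
    show ?case using exP_perm[OF p(1) l'] Z(1)[OF p(2) l'(1)] by (auto simp: sub_def)
  next
    case (adj v w)
    show ?case
    proof
      assume s: "sub (zfc.adj E v w) u"
      then have wu: "w \<e> u" and vu: "sub v u" by (auto simp: sub_def)
      obtain q where q: "q \<e> Z" "Perm q l'" "coh p q" "sub v q" using adj(2) vu by blast
      obtain s t where st: "isfun s l' S" "isfun t l' S" "w = pair s t" using uf[OF wu] by blast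
      note Q = PermD[OF q(2)]
      obtain x where x: "pair s x \<e> q" using Q(4)[OF st(1)] by blast
      have xf: "isfun x l' S" using Q(3)[OF x] .
      show "EX q. q \<e> Z & Perm q l' & coh p q & sub (zfc.adj E v w) q"
      proof (cases "x = t")
        case True
        then show ?thesis using q x st by (intro exI[of _ q]) (auto simp: sub_def)
      next
        case False
        let ?q = "swP q x t"
        note sw = swP[OF q(2) xf st(2)]
        have "?q \<e> Z" using Z(2)[OF q(1)] xf st(2) l'(1) ND by blast
        moreover have "Perm ?q l'" by (rule swP_perm[OF q(2) xf st(2)])
        moreover have "coh p ?q" unfolding coh_def
        proof (intro allI impI, elim conjE)
          fix a b s' t' assume m: "pair a b \<e> p" "pair s' t' \<e> ?q"
          then obtain y where y: "pair s' y \<e> q" "t' = (if y = x then t else if y = t then x else y)" unfolding sw pair_inj by blast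
          have "sub b x \<longleftrightarrow> sub b t" using uc[OF m(1), of s t] wu st(3) q(3) m(1) x unfolding coh_def by blast
          then have "sub b t' \<longleftrightarrow> sub b y" using y(2) by auto
          then show "sub a s' \<longleftrightarrow> sub b t'" using q(3) m(1) y(1) unfolding coh_def by blast
        qed
        moreover have "pair s t \<e> ?q" unfolding sw pair_inj using x by (intro exI[of _ s] exI[of _ x]) simp
        moreover have "c \<e> ?q" if c: "c \<e> v" for c
        proof -
          obtain s1 t1 where c1: "c = pair s1 t1" using uf vu c unfolding sub_def by blast
          have cq: "pair s1 t1 \<e> q" using q(4) c c1 unfolding sub_def by blast
          have i: "s1 = s \<longleftrightarrow> t1 = t" using ui[of s1 t1 s t] c c1 vu wu st(3) unfolding sub_def by blast
          have i2: "s1 = s \<longleftrightarrow> t1 = x" using Q(6)[OF cq x] .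
          \<comment> \<open>No pair inserted earlier has image \<open>x\<close> or \<open>t\<close>,
            so the exchange leaves it alone.\<close>
          then have "t1 ~= x" "t1 ~= t" using i False by auto
          then show ?thesis unfolding sw c1 pair_inj using cq by (intro exI[of _ s1] exI[of _ t1]) simp
        qed
        ultimately show ?thesis using st(3) by (intro exI[of _ ?q]) (auto simp: sub_def)
      qed
    qed
  qed
  then show ?thesis using u sub_refl by blast
qed

lemma max_perm:
  assumes "fin v" "!!p. p \<e> v ==> EX l. Perm p l" "p0 \<e> v"
  shows "EX p l. p \<e> v & Perm p l & (ALL p' l'. p' \<e> v --> Perm p' l' --> sub l' l)"
proof -
  have "sub u v --> u = zfc.emp E | (EX p l. p \<e> u & Perm p l & (ALL p' l'. p' \<e> u --> Perm p' l' --> sub l' l))" if "fin u" for u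
    using that
  proof (induct rule: fin_induct)
    case D show ?case by (intro dfi)
  next
    case emp show ?case by simp
  next
    case (adj u q)
    show ?case
    proof (intro impI disjI2)
      assume s: "sub (zfc.adj E u q) v"
      then have uv: "sub u v" "q \<e> v" by (auto simp: sub_def)
      obtain k where k: "Perm q k" using assms(2) uv(2) by blast
      \<comment> \<open>A level is never empty, so a permutation determines its level.\<close>
      have un: "k' = k" if "Perm q k'" for k'
      proof -
        obtain x where x: "isfun x k S"
          using isfun_lam[of "%_. zfc.emp E" k S, OF dft_const] S_0 by blast
        obtain y where "pair x y \<e> q" using PermD(4)[OF k x] by blast
        then have "isfun x k' S" using PermD(2)[OF that] by blast
        then show ?thesis using x fn_cong_dom unfolding isfun_def by blast
      qed
      have kw: "k \<e> omega" using PermD(1)[OF k] .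
      have am: "z \<e> zfc.adj E u q \<longleftrightarrow> z \<e> u | z = q" and en: "~ z \<e> zfc.emp E" for z by simp_all
      consider "u = zfc.emp E" | p l where "p \<e> u" "Perm p l" "!!p' l'. p' \<e> u ==> Perm p' l' ==> sub l' l"
        using adj(2) uv by blast
      then show "EX p l. p \<e> zfc.adj E u q & Perm p l & (ALL p' l'. p' \<e> zfc.adj E u q --> Perm p' l' --> sub l' l)"
      proof cases
        case 1
        show ?thesis unfolding am
          by (rule exI[of _ q], rule exI[of _ k]) (use k un en sub_refl 1 in blast)
      next
        case (2 p l)
        have "sub k l | sub l k" using nat_max kw PermD(1)[OF 2(2)] by blast
        then show ?thesis
        proof
          assume "sub k l"
          then show ?thesis unfolding am
            by (intro exI[of _ p] exI[of _ l]) (use 2 un in blast)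
        next
          assume lk: "sub l k"
          have le: "sub l' k" if "p' \<e> u" "Perm p' l'" for p' l' using sub_trans[OF 2(3)[OF that] lk] .
          have kk: "sub k' k" if "Perm q k'" for k' using un[OF that] by simp
          show ?thesis unfolding am
            by (rule exI[of _ q], rule exI[of _ k]) (use k le kk in blast)
        qed
      qed
    qed
  qed
  then show ?thesis using assms(1,3) sub_refl emp by metis
qed

end

section \<open>The partial order\<close>

locale baum = nodes E S for E :: "nat => nat => bool" (infix "\<e>" 50) and S
begin

text \<open>An infinite level has uncountably many permutations, so conditions draw theirs from one
  countable set that \<open>refine\<close> does not leave. Lying below \<open>X1\<close> keeps the
  conditions inside \<open>II\<close>.\<close>

definition "ZZ = (SOME Z. ctbl Z & sub Z X1 & emp \<e> Z & (ALL x y. x \<e> Z --> y \<e> Z --> adj x y \<e> Z) &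
   (ALL p l. p \<e> Z --> l \<e> omega --> exP p l \<e> Z) & (ALL p u v. p \<e> Z --> u \<e> ND --> v \<e> ND --> swP p u v \<e> Z))"

lemma sub_Vomega_X1: "sub x (V omega) ==> x \<e> X1"
  unfolding X1_def V[of x] using omega_w1 by blast

lemma ZZ: "ctbl ZZ" "sub ZZ X1" "emp \<e> ZZ" "x \<e> ZZ ==> y \<e> ZZ ==> adj x y \<e> ZZ"
   "p \<e> ZZ ==> l \<e> omega ==> exP p l \<e> ZZ" "p \<e> ZZ ==> u \<e> ND ==> v \<e> ND ==> swP p u v \<e> ZZ"
proof -
  \<comment> \<open>\<open>t\<close> selects among adjoining, extending and exchanging; the two
    nodes of an exchange travel as one pair.\<close>
  define Op where "Op t x y = (if t = emp then adj x y else if t = succ emp then exP x y else swP x (fst y) (snd y))" for t x y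
  have "T (%e. Op (e 0) (e (Suc 0)) (e (Suc (Suc 0))))" unfolding Op_def by (intro dfi)
  from countable_closure[OF this, of emp] obtain Z where Z: "ctbl Z" "emp \<e> Z"
    and op: "!!t x y. t \<e> omega ==> x \<e> Z ==> y \<e> Z ==> Op t x y \<e> Z" by blast
  have n: "succ emp \<e> omega" "succ (succ emp) \<e> omega" "succ (succ emp) ~= succ emp"
    using omega_succ succ_inj[of "succ emp" emp] by auto
  have Za: "adj x y \<e> Z" if "x \<e> Z" "y \<e> Z" for x y using op[OF omega_0 that] unfolding Op_def by simp
  have Ze: "exP x y \<e> Z" if "x \<e> Z" "y \<e> omega" for x y
    using op[OF n(1) that(1) cl_omega[OF Z(2) Za that(2)]] unfolding Op_def by simp
  have Zs: "swP x u v \<e> Z" if "x \<e> Z" "u \<e> ND" "v \<e> ND" for x u v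
    using op[OF n(2) that(1) cl_pair[OF Z(2) Za cl_node[OF Z(2) Za that(2)] cl_node[OF Z(2) Za that(3)]]] n(3)
    unfolding Op_def by simp
  let ?Z = "sepS Z (%z. z \<e> X1)"
  have m: "z \<e> ?Z \<longleftrightarrow> z \<e> Z & z \<e> X1" for z by (rule sepS) (intro dfi)
  have s: "sub (exP p l) (V omega)" for p l unfolding sub_def exP_def
    by (subst sepS) (intro dfi, blast)
  have s': "sub (swP p u v) (V omega)" for p u v unfolding sub_def swP_def
    by (subst sepS) (intro dfi, blast)
  have "ctbl ?Z & sub ?Z X1 & emp \<e> ?Z & (ALL x y. x \<e> ?Z --> y \<e> ?Z --> adj x y \<e> ?Z) &
   (ALL p l. p \<e> ?Z --> l \<e> omega --> exP p l \<e> ?Z) & (ALL p u v. p \<e> ?Z --> u \<e> ND --> v \<e> ND --> swP p u v \<e> ?Z)"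
    unfolding m using Z Za Ze Zs X1_adj sub_Vomega_X1[OF s] sub_Vomega_X1[OF s'] sub_Vomega_X1[of emp]
      cov_sub[OF Z(1)] by (auto simp: sub_def m)
  from someI[of "%Z. ctbl Z & sub Z X1 & emp \<e> Z & (ALL x y. x \<e> Z --> y \<e> Z --> adj x y \<e> Z) &
   (ALL p l. p \<e> Z --> l \<e> omega --> exP p l \<e> Z) & (ALL p u v. p \<e> Z --> u \<e> ND --> v \<e> ND --> swP p u v \<e> Z)", OF this]
  show "ctbl ZZ" "sub ZZ X1" "emp \<e> ZZ" "x \<e> ZZ ==> y \<e> ZZ ==> adj x y \<e> ZZ"
   "p \<e> ZZ ==> l \<e> omega ==> exP p l \<e> ZZ" "p \<e> ZZ ==> u \<e> ND ==> v \<e> ND ==> swP p u v \<e> ZZ"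
    unfolding ZZ_def by blast+
qed

lemma ZZ_pair: "x \<e> ZZ ==> y \<e> ZZ ==> pair x y \<e> ZZ" using cl_pair ZZ(3,4) by blast
lemma ZZ_omega: "n \<e> omega ==> n \<e> ZZ" using cl_omega ZZ(3,4) by blast
lemma ZZ_fin: "fin x ==> sub x ZZ ==> x \<e> ZZ" using cl_fin ZZ(3,4) by blast
lemma ZZ_ND: "s \<e> ND ==> s \<e> ZZ" using cl_node ZZ(3,4) by blast

text \<open>At \<open>c0 a\<close> a condition has permutations of levels which approximate the homeomorphism belonging to
  the pair \<open>a\<close> of names, at \<open>c1 a h\<close> a matching of the points in the \<open>h\<close>-th blocks of the two dense sets
  named, and at \<open>c2 t i\<close> values of the \<open>i\<close>-th point of the dense set number \<open>t\<close> for which the Lipschitz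
  axiom fails.\<close>

definition "c0 a = pair emp a"
definition "c1 a h = pair (succ emp) (pair a h)"
definition "c2 t i = pair two (pair t i)"
lemma c_T [dfi]: "T s ==> T (%e. c0 (s e))" "T s ==> T t ==> T (%e. c1 (s e) (t e))" "T s ==> T t ==> T (%e. c2 (s e) (t e))"
  unfolding c0_def c1_def c2_def by (intro dfi; assumption)+

lemma c_simps [simp]: "c0 a = c0 b \<longleftrightarrow> a = b" "c1 a h = c1 b k \<longleftrightarrow> a = b & h = k" "c2 t i = c2 u k \<longleftrightarrow> t = u & i = k"
  "c0 a ~= c1 b h" "c0 a ~= c2 t i" "c1 b h ~= c0 a" "c2 t i ~= c0 a" "c1 a h ~= c2 t i" "c2 t i ~= c1 a h"
  using succ_inj[of "succ emp" emp] omega_succ[of emp] succ_ne[of emp] succ_ne[of "succ emp"]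
  unfolding c0_def c1_def c2_def two_def by (auto dest: sym)

text \<open>\<open>dec r N x s\<close>: by the nice name \<open>N\<close>, the condition \<open>r\<close> forces that the point with index \<open>x\<close> extends \<open>s\<close>.\<close>

definition dec where "dec r N x s \<longleftrightarrow> (EX q s'. pair q (pair x s') \<e> N & sub q r & sub s s')"
lemma dec_D [dfi]: "T s ==> T t ==> T u ==> T v ==> D (%e. dec (s e) (t e) (u e) (v e))"
  unfolding dec_def by (intro dfi dft_shift)
lemma dec_mono: "dec r N x s ==> sub r r' ==> dec r' N x s" unfolding dec_def using sub_trans by blast
lemma dec_sub: "dec r N x s ==> sub s' s ==> dec r N x s'" unfolding dec_def using sub_trans by blast

definition k0 where "k0 w \<longleftrightarrow> (EX a p l. a \<e> II & p \<e> ZZ & Perm p l & w = pair (c0 a) p)"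
definition k1 where "k1 w \<longleftrightarrow> (EX a h n m. a \<e> II & h \<e> w1 & n \<e> omega & m \<e> omega & w = pair (c1 a h) (pair n m))"
definition k2 where "k2 w \<longleftrightarrow> (EX t i k d. t \<e> two & i \<e> w1 & k \<e> omega & d \<e> S & w = pair (c2 t i) (pair k d))"
text \<open>The coordinate \<open>a\<close> is a pair of nice names. What \<open>r\<close> decides
  of point \<open>n\<close> in block \<open>h\<close> of the first set is sent by \<open>p\<close>
  to what it decides of point \<open>m\<close> in block \<open>h\<close> of the second.\<close>

definition match where "match r a h n m p \<longleftrightarrow> (EX s t. pair s t \<e> p & dec r (fst a) (pair h n) s & dec r (snd a) (pair h m) t)"
text \<open>A matching at \<open>c1 a h\<close> requires a permutation at \<open>c0 a\<close>.
  Otherwise the union of two conditions with equal fibres at common coordinates could combine a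
  matching of one with a permutation of the other, and \<open>match\<close> might fail.\<close>

definition cond where "cond r \<longleftrightarrow> fin r & (ALL w. w \<e> r --> k0 w | k1 w | k2 w) &
  (ALL a p p'. pair (c0 a) p \<e> r & pair (c0 a) p' \<e> r --> coh p p') &
  (ALL a h n m n' m'. pair (c1 a h) (pair n m) \<e> r & pair (c1 a h) (pair n' m') \<e> r --> (n = n' \<longleftrightarrow> m = m')) &
  (ALL a h x. pair (c1 a h) x \<e> r --> (EX p. pair (c0 a) p \<e> r)) &
  (ALL a h n m p. pair (c1 a h) (pair n m) \<e> r & pair (c0 a) p \<e> r --> match r a h n m p) &
  (ALL t i k d d'. pair (c2 t i) (pair k d) \<e> r & pair (c2 t i) (pair k d') \<e> r --> d = d')"

lemma match_D [dfi]: "T s ==> T t ==> T u ==> T v ==> T w ==> T x ==> D (%e. match (s e) (t e) (u e) (v e) (w e) (x e))"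
  unfolding match_def by (intro dfi dft_shift)
lemma k_D [dfi]: "T s ==> D (%e. k0 (s e))" "T s ==> D (%e. k1 (s e))" "T s ==> D (%e. k2 (s e))"
  unfolding k0_def k1_def k2_def by (intro dfi dft_shift; assumption)+
lemma cond_D [dfi]: "T s ==> D (%e. cond (s e))" unfolding cond_def by (intro dfi dft_shift)
lemma match_mono: "match r a h n m p ==> sub r r' ==> match r' a h n m p" unfolding match_def using dec_mono by blast

lemma condD: assumes "cond r" shows "fin r" "w \<e> r ==> k0 w | k1 w | k2 w"
  "pair (c0 a) p \<e> r ==> pair (c0 a) p' \<e> r ==> coh p p'"
  "pair (c1 a h) (pair n m) \<e> r ==> pair (c1 a h) (pair n' m') \<e> r ==> n = n' \<longleftrightarrow> m = m'"
  "pair (c1 a h) x \<e> r ==> EX p. pair (c0 a) p \<e> r"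
  "pair (c1 a h) (pair n m) \<e> r ==> pair (c0 a) p \<e> r ==> match r a h n m p"
  "pair (c2 t i) (pair k d) \<e> r ==> pair (c2 t i) (pair k d') \<e> r ==> d = d'"
proof -
  note c = assms[unfolded cond_def]
  show "fin r" using c[THEN conjunct1] .
  show "w \<e> r ==> k0 w | k1 w | k2 w" using c[THEN conjunct2, THEN conjunct1] by blast
  show "pair (c0 a) p \<e> r ==> pair (c0 a) p' \<e> r ==> coh p p'" using c[THEN conjunct2, THEN conjunct2, THEN conjunct1] by blast
  show "pair (c1 a h) (pair n m) \<e> r ==> pair (c1 a h) (pair n' m') \<e> r ==> n = n' \<longleftrightarrow> m = m'" using c[THEN conjunct2, THEN conjunct2, THEN conjunct2, THEN conjunct1] by blast
  show "pair (c1 a h) x \<e> r ==> EX p. pair (c0 a) p \<e> r" using c[THEN conjunct2, THEN conjunct2, THEN conjunct2, THEN conjunct2, THEN conjunct1] by blast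
  show "pair (c1 a h) (pair n m) \<e> r ==> pair (c0 a) p \<e> r ==> match r a h n m p" using c[THEN conjunct2, THEN conjunct2, THEN conjunct2, THEN conjunct2, THEN conjunct2, THEN conjunct1] by blast
  show "pair (c2 t i) (pair k d) \<e> r ==> pair (c2 t i) (pair k d') \<e> r ==> d = d'" using c[THEN conjunct2, THEN conjunct2, THEN conjunct2, THEN conjunct2, THEN conjunct2, THEN conjunct2] by blast
qed

lemma cond0: "cond r ==> pair (c0 a) p \<e> r ==> a \<e> II & p \<e> ZZ & (EX l. Perm p l)"
  using condD(2)[of r "pair (c0 a) p"] unfolding k0_def k1_def k2_def by auto
lemma cond2: "cond r ==> pair (c2 t i) x \<e> r ==> t \<e> two & i \<e> w1 & (EX k d. k \<e> omega & d \<e> S & x = pair k d)"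
  using condD(2)[of r "pair (c2 t i) x"] unfolding k0_def k1_def k2_def by auto

lemma two_omega: "two \<e> omega" unfolding two_def by (intro omega_succ omega_0)
lemma X1_in_II: "x \<e> X1 ==> x \<e> II" using X1_II unfolding sub_def by blast
lemma omega_X1: "n \<e> omega ==> n \<e> X1" using omega_sub_X1 unfolding sub_def by blast
lemma w1_in_X1: "n \<e> w1 ==> n \<e> X1" using w1_X1 unfolding sub_def by blast
lemma S_in_omega: "n \<e> S ==> n \<e> omega" using S_omega unfolding sub_def by blast
lemma two_in_omega: "t \<e> two ==> t \<e> omega" using nat_mem two_omega by blast

lemma fact_prod: assumes "k0 w | k1 w | k2 w"
  shows "EX c v. w = pair c v & c \<e> II & v \<e> ZZ & v \<e> II"
proof -
  have om: "n \<e> omega ==> n \<e> II" for n using omega_X1 X1_in_II by blast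
  have z: "n \<e> ZZ ==> n \<e> II" for n using ZZ(2) X1_in_II unfolding sub_def by blast
  note i = om z II_pair omega_0 omega_succ two_omega w1_in_X1 X1_in_II ZZ_pair ZZ_omega S_in_omega two_in_omega
  from assms show ?thesis
  proof (elim disjE)
    assume "k0 w" then show ?thesis unfolding k0_def c0_def using i by blast
  next
    assume "k1 w"
    then obtain a h n m where w: "a \<e> II" "h \<e> w1" "n \<e> omega" "m \<e> omega" "w = pair (c1 a h) (pair n m)" unfolding k1_def by blast
    have "c1 a h \<e> II" unfolding c1_def using w i by simp
    moreover have "pair n m \<e> ZZ" using w i by simp
    ultimately show ?thesis using w z by blast
  next
    assume "k2 w"
    then obtain t h n m where w: "t \<e> two" "h \<e> w1" "n \<e> omega" "m \<e> S" "w = pair (c2 t h) (pair n m)" unfolding k2_def by blast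
    have "c2 t h \<e> II" unfolding c2_def using w i by simp
    moreover have "pair n m \<e> ZZ" using w i by simp
    ultimately show ?thesis using w z by blast
  qed
qed

definition "PP = sepS (pw (prod II II)) cond"
lemma PP: "r \<e> PP \<longleftrightarrow> cond r"
proof -
  have "r \<e> PP \<longleftrightarrow> r \<e> pw (prod II II) & cond r" unfolding PP_def by (rule sepS) (intro dfi)
  moreover have "r \<e> pw (prod II II)" if "cond r"
    unfolding pw prod using condD(2)[OF that] fact_prod by blast
  ultimately show ?thesis by blast
qed

lemma cond_emp: "cond emp" unfolding cond_def by simp

sublocale forcing E PP by unfold_locales (simp add: PP cond_emp)

lemma PP_II: assumes "r \<e> PP" shows "r \<e> II"
proof (rule II_fin)
  show "fin r" using assms condD(1) unfolding PP by blast
  show "sub r II" unfolding sub_def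
  proof (intro allI impI)
    fix w assume "w \<e> r"
    then obtain c v where "w = pair c v" "c \<e> II" "v \<e> II" using assms condD(2) fact_prod unfolding PP by meson
    then show "w \<e> II" using II_pair by blast
  qed
qed

subsection \<open>The countable chain condition\<close>

text \<open>A condition may have several values at a coordinate, and whole fibres must coincide.
  \<open>hat\<close> turns a condition into a finite function from coordinates to fibres; these are
  elements of the countable set \<open>ZZ\<close>, so \<open>ccc\<close> applies.\<close>

definition fagree where "fagree r r' \<longleftrightarrow> (ALL c x y. pair c x \<e> r & pair c y \<e> r' --> (ALL z. pair c z \<e> r \<longleftrightarrow> pair c z \<e> r'))"
definition fib where "fib r c = sepS (un (un r)) (%z. pair c z \<e> r)"
definition hat where "hat r = img (%w. pair (fst w) (fib r (fst w))) r"
lemma fib_T [dfi]: "T s ==> T t ==> T (%e. fib (s e) (t e))" unfolding fib_def by (intro dfi dft_shift)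
lemma hat_T [dfi]: "T s ==> T (%e. hat (s e))" unfolding hat_def by (intro dfi dft_shift)
lemma fib: "z \<e> fib r c \<longleftrightarrow> pair c z \<e> r"
proof -
  have "z \<e> fib r c \<longleftrightarrow> z \<e> un (un r) & pair c z \<e> r" unfolding fib_def by (rule sepS) (intro dfi)
  then show ?thesis using pair_un by blast
qed
lemma hat: "z \<e> hat r \<longleftrightarrow> (EX w. w \<e> r & z = pair (fst w) (fib r (fst w)))"
  unfolding hat_def by (rule img) (intro dfi)

lemma cond_cup: assumes r: "cond r" and r': "cond r'" and ag: "fagree r r'" shows "cond (cup r r')"
proof -
  note R = condD[OF r] and R' = condD[OF r']
  have s: "sub r (cup r r')" "sub r' (cup r r')" by (auto simp: sub_def)
  have A: "pair c z \<e> r \<longleftrightarrow> pair c z \<e> r'" if "pair c x \<e> r" "pair c y \<e> r'" for c x y z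
    using ag that unfolding fagree_def by blast
  show ?thesis unfolding cond_def cup
  proof (intro conjI allI impI)
    show "fin (cup r r')" by (rule fin_cup[OF R(1) R'(1)])
    show "w \<e> r | w \<e> r' ==> k0 w | k1 w | k2 w" for w using R(2) R'(2) by blast
    show "(pair (c0 a) p \<e> r | pair (c0 a) p \<e> r') & (pair (c0 a) p' \<e> r | pair (c0 a) p' \<e> r') ==> coh p p'" for a p p'
      using R(3) R'(3) A by blast
    show "(pair (c1 a h) (pair n m) \<e> r | pair (c1 a h) (pair n m) \<e> r') &
       (pair (c1 a h) (pair n' m') \<e> r | pair (c1 a h) (pair n' m') \<e> r') ==> (n = n') = (m = m')" for a h n m n' m'
      using R(4) R'(4) A by blast
    show "pair (c1 a h) x \<e> r | pair (c1 a h) x \<e> r' ==> EX p. pair (c0 a) p \<e> r | pair (c0 a) p \<e> r'" for a h x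
      using R(5) R'(5) by blast
    show "match (cup r r') a h n m p" if "(pair (c1 a h) (pair n m) \<e> r | pair (c1 a h) (pair n m) \<e> r') &
       (pair (c0 a) p \<e> r | pair (c0 a) p \<e> r')" for a h n m p
    proof -
      have "pair (c1 a h) (pair n m) \<e> r & pair (c0 a) p \<e> r | pair (c1 a h) (pair n m) \<e> r' & pair (c0 a) p \<e> r'"
        using that R(5) R'(5) A by meson
      then show ?thesis using R(6) R'(6) match_mono s by blast
    qed
    show "(pair (c2 t i) (pair k d) \<e> r | pair (c2 t i) (pair k d) \<e> r') &
       (pair (c2 t i) (pair k d') \<e> r | pair (c2 t i) (pair k d') \<e> r') ==> d = d'" for t i k d d'
      using R(7) R'(7) A by blast
  qed
qed

lemma hat_pf: assumes "cond r" shows "pf (hat r) ZZ"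
  unfolding pf_def
proof (intro conjI allI impI)
  have t: "T (%e. pair (fst (e 0)) (fib r (fst (e 0))))" by (intro dfi)
  have t2: "T (%e. snd (e 0))" by (intro dfi)
  show "fin (hat r)" unfolding hat_def by (rule fin_img[OF t condD(1)[OF assms]])
  show "agree (hat r) (hat r)" unfolding agree_def hat by auto
  fix w assume "w \<e> hat r"
  then obtain v where v: "v \<e> r" "w = pair (fst v) (fib r (fst v))" unfolding hat by blast
  have "fib r (fst v) \<e> ZZ"
  proof (rule ZZ_fin)
    have "sub (fib r (fst v)) (img snd r)" unfolding sub_def fib img[OF t2] using snd by metis
    then show "fin (fib r (fst v))" using fin_sub fin_img[OF t2 condD(1)[OF assms]] by blast
    show "sub (fib r (fst v)) ZZ" unfolding sub_def fib
      using condD(2)[OF assms] fact_prod by (metis pair_inj)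
  qed
  then show "EX c u. u \<e> ZZ & w = pair c u" using v by blast
qed

lemma hat_agree: assumes "agree (hat r) (hat r')" shows "fagree r r'"
  unfolding fagree_def
proof (intro allI impI, elim conjE)
  fix c x y z assume "pair c x \<e> r" "pair c y \<e> r'"
  then have "pair c (fib r c) \<e> hat r" "pair c (fib r' c) \<e> hat r'" unfolding hat using fst by metis+
  then have "fib r c = fib r' c" using assms unfolding agree_def by blast
  then show "pair c z \<e> r \<longleftrightarrow> pair c z \<e> r'" using fib by metis
qed

text \<open>The countable chain condition with a colouring \<open>H\<close>, by which
  \<open>J\<close> is thinned out first. Besides compatibility it yields equal fibres, which tell
  what the union does not contain.\<close>

lemma ccc_P:
  assumes J: "~ ctbl J" and F: "T (%e. F (e 0))" and H: "T (%e. H (e 0))" and Y: "ctbl Y"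
    and FP: "!!i. i \<e> J ==> F i \<e> PP & H i \<e> Y"
  shows "EX i k. i \<e> J & k \<e> J & i ~= k & H i = H k & fagree (F i) (F k) & cup (F i) (F k) \<e> PP"
proof -
  note FT = dftc1[OF F[unfolded dft_def]] and HT = dftc1[OF H[unfolded dft_def]]
  have "D (%e. H (e 0) = e (Suc 0))" by (intro dfi HT)
  from thin[OF Y this J] FP obtain y where y: "~ ctbl (sepS J (%i. H i = y))" by blast
  have m: "i \<e> sepS J (%i. H i = y) \<longleftrightarrow> i \<e> J & H i = y" for i by (rule sepS) (intro dfi HT)
  have t: "T (%e. hat (F (e 0)))" by (intro dfi FT)
  have pf: "pf (hat (F i)) ZZ" if "i \<e> sepS J (%i. H i = y)" for i using that FP hat_pf unfolding m PP by blast
  obtain i k where ik: "i \<e> J" "H i = y" "k \<e> J" "H k = y" "i ~= k" "agree (hat (F i)) (hat (F k))"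
    using ccc[OF ZZ(1) y t pf] unfolding m by blast
  have "cond (F i)" "cond (F k)" using FP ik PP by blast+
  then have "cond (cup (F i) (F k))" using cond_cup hat_agree ik by blast
  then show ?thesis using ik hat_agree unfolding PP by metis
qed

subsection \<open>Extending conditions\<close>

text \<open>No clause links the coordinates \<open>c2\<close> with others, so an open value can be
  set at will. This freedom defeats the Lipschitz functions.\<close>

lemma add2: assumes r: "cond r" and x: "t \<e> two" "i \<e> w1" "k \<e> omega" "d \<e> S" "!!d'. ~ pair (c2 t i) (pair k d') \<e> r"
  shows "cond (adj r (pair (c2 t i) (pair k d)))" (is "cond ?r")
proof -
  note R = condD[OF r]
  have s: "sub r ?r" by (auto simp: sub_def)
  have k: "k2 (pair (c2 t i) (pair k d))" unfolding k2_def using x by blast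
  have m0: "pair (c0 b) q \<e> ?r \<longleftrightarrow> pair (c0 b) q \<e> r" for b q by simp
  have m1: "pair (c1 b g) x \<e> ?r \<longleftrightarrow> pair (c1 b g) x \<e> r" for b g x by simp
  have m2: "pair (c2 u e) x \<e> ?r \<longleftrightarrow> pair (c2 u e) x \<e> r | u = t & e = i & x = pair k d" for u e x by simp
  show ?thesis unfolding cond_def
  proof (intro conjI allI impI)
    show "fin ?r" using R(1) by simp
    show "w \<e> ?r ==> k0 w | k1 w | k2 w" for w unfolding adj using R(2) k by blast
    show "pair (c0 b) q \<e> ?r & pair (c0 b) q' \<e> ?r ==> coh q q'" for b q q' unfolding m0 using R(3) by blast
    show "pair (c1 b g) (pair n1 m1) \<e> ?r & pair (c1 b g) (pair n2 m2) \<e> ?r ==> (n1 = n2) = (m1 = m2)" for b g n1 m1 n2 m2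
      unfolding m1 pair_inj using R(4) by blast
    show "pair (c1 b g) x \<e> ?r ==> EX q. pair (c0 b) q \<e> ?r" for b g x unfolding m0 m1 using R(5) by blast
    show "pair (c1 b g) (pair n1 m1) \<e> ?r & pair (c0 b) q \<e> ?r ==> match ?r b g n1 m1 q" for b g n1 m1 q
      unfolding m0 m1 pair_inj using R(6) match_mono[OF _ s] by blast
    show "pair (c2 u e) (pair k1 d1) \<e> ?r & pair (c2 u e) (pair k1 d2) \<e> ?r ==> d1 = d2" for u e k1 d1 d2
      unfolding m2 pair_inj using R(7) x(5) by blast
  qed
qed

lemma add1: assumes r: "cond r" and x: "a \<e> II" "h \<e> w1" "n \<e> omega" "m \<e> omega"
  and p: "pair (c0 a) p \<e> r" and new: "!!n' m'. pair (c1 a h) (pair n' m') \<e> r ==> n' ~= n & m' ~= m"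
  and mt: "!!p. pair (c0 a) p \<e> r ==> match r a h n m p"
  shows "cond (adj r (pair (c1 a h) (pair n m)))" (is "cond ?r")
proof -
  note R = condD[OF r]
  have s: "sub r ?r" by (auto simp: sub_def)
  have k: "k1 (pair (c1 a h) (pair n m))" unfolding k1_def using x by blast
  have m0: "pair (c0 b) q \<e> ?r \<longleftrightarrow> pair (c0 b) q \<e> r" for b q by simp
  have m1: "pair (c1 b g) x \<e> ?r \<longleftrightarrow> pair (c1 b g) x \<e> r | b = a & g = h & x = pair n m" for b g x by simp
  have m2: "pair (c2 u e) x \<e> ?r \<longleftrightarrow> pair (c2 u e) x \<e> r" for u e x by simp
  show ?thesis unfolding cond_def
  proof (intro conjI allI impI)
    show "fin ?r" using R(1) by simp
    show "w \<e> ?r ==> k0 w | k1 w | k2 w" for w unfolding adj using R(2) k by blast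
    show "pair (c0 b) q \<e> ?r & pair (c0 b) q' \<e> ?r ==> coh q q'" for b q q' unfolding m0 using R(3) by blast
    show "pair (c1 b g) (pair n1 m1) \<e> ?r & pair (c1 b g) (pair n2 m2) \<e> ?r ==> (n1 = n2) = (m1 = m2)" for b g n1 m1 n2 m2
      unfolding m1 pair_inj using R(4) new by blast
    show "pair (c1 b g) x \<e> ?r ==> EX q. pair (c0 b) q \<e> ?r" for b g x unfolding m0 m1 using R(5) p by blast
    show "pair (c1 b g) (pair n1 m1) \<e> ?r & pair (c0 b) q \<e> ?r ==> match ?r b g n1 m1 q" for b g n1 m1 q
      unfolding m0 m1 pair_inj using R(6) mt match_mono[OF _ s] by blast
    show "pair (c2 u e) (pair k1 d1) \<e> ?r & pair (c2 u e) (pair k1 d2) \<e> ?r ==> d1 = d2" for u e k1 d1 d2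
      unfolding m2 pair_inj using R(7) by blast
  qed
qed

lemma add0: assumes r: "cond r" and x: "a \<e> II" "p \<e> ZZ" "Perm p l"
  and co: "!!p'. pair (c0 a) p' \<e> r ==> coh p p' & coh p' p"
  and mt: "!!h n m. pair (c1 a h) (pair n m) \<e> r ==> match r a h n m p"
  shows "cond (adj r (pair (c0 a) p))" (is "cond ?r")
proof -
  note R = condD[OF r]
  have s: "sub r ?r" by (auto simp: sub_def)
  have k: "k0 (pair (c0 a) p)" unfolding k0_def using x by blast
  have pp: "coh p p" by (rule coh_refl[OF x(3)])
  have m0: "pair (c0 b) q \<e> ?r \<longleftrightarrow> pair (c0 b) q \<e> r | b = a & q = p" for b q by simp
  have m1: "pair (c1 b g) x \<e> ?r \<longleftrightarrow> pair (c1 b g) x \<e> r" for b g x by simp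
  have m2: "pair (c2 u e) x \<e> ?r \<longleftrightarrow> pair (c2 u e) x \<e> r" for u e x by simp
  show ?thesis unfolding cond_def
  proof (intro conjI allI impI)
    show "fin ?r" using R(1) by simp
    show "w \<e> ?r ==> k0 w | k1 w | k2 w" for w unfolding adj using R(2) k by blast
    show "pair (c0 b) q \<e> ?r & pair (c0 b) q' \<e> ?r ==> coh q q'" for b q q' unfolding m0 using R(3) co pp by blast
    show "pair (c1 b g) (pair n1 m1) \<e> ?r & pair (c1 b g) (pair n2 m2) \<e> ?r ==> (n1 = n2) = (m1 = m2)" for b g n1 m1 n2 m2
      unfolding m1 pair_inj using R(4) by blast
    show "pair (c1 b g) x \<e> ?r ==> EX q. pair (c0 b) q \<e> ?r" for b g x unfolding m0 m1 using R(5) by blast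
    show "pair (c1 b g) (pair n1 m1) \<e> ?r & pair (c0 b) q \<e> ?r ==> match ?r b g n1 m1 q" for b g n1 m1 q
      unfolding m0 m1 pair_inj using R(6) mt match_mono[OF _ s] by blast
    show "pair (c2 u e) (pair k1 d1) \<e> ?r & pair (c2 u e) (pair k1 d2) \<e> ?r ==> d1 = d2" for u e k1 d1 d2
      unfolding m2 pair_inj using R(7) by blast
  qed
qed

text \<open>Conditions can be amalgamated below a rank, since a name only mentions conditions on coordinates
  of smaller rank.\<close>

definition low where "low b w \<longleftrightarrow> (EX a p. w = pair (c0 a) p & a \<e> V b) | (EX a h x. w = pair (c1 a h) x & a \<e> V b) |
   (EX t i x. w = pair (c2 t i) x)"
lemma low_simps [simp]: "low b (pair (c0 a) p) \<longleftrightarrow> a \<e> V b" "low b (pair (c1 a h) x) \<longleftrightarrow> a \<e> V b" "low b (pair (c2 t i) x)"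
  unfolding low_def by auto

lemma V_pairD: "pair x y \<e> V b ==> x \<e> V b & y \<e> V b"
  using trs_pairD[OF V_trs] .

lemma fst_snd_pair: assumes "y \<e> fst a | y \<e> snd a" shows "EX u v. a = pair u v"
proof -
  have "y \<e> fst a \<longleftrightarrow> y \<e> un (un a) & (EX u v. a = pair u v & y \<e> u)" unfolding fst_def by (rule sepS) (intro dfi)
  moreover have "y \<e> snd a \<longleftrightarrow> y \<e> un (un a) & (EX u v. a = pair u v & y \<e> v)" unfolding snd_def by (rule sepS) (intro dfi)
  ultimately show ?thesis using assms by blast
qed

text \<open>A condition mentioned by a name inside \<open>V b\<close> lies in \<open>V b\<close>,
  and by transitivity so do the names in its coordinates.\<close>

lemma name_low: assumes N: "sub N (V b)" and q: "pair q y \<e> N" "sub q r" "cond r" and w: "w \<e> q" shows "low b w"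
proof -
  have "q \<e> V b" using N q(1) V_pairD unfolding sub_def by blast
  then have wV: "w \<e> V b" using V_trs w trsD by blast
  have "w \<e> r" using q(2) w subD by blast
  from condD(2)[OF q(3) this] show ?thesis
  proof (elim disjE)
    assume "k0 w"
    then obtain a p where "w = pair (c0 a) p" unfolding k0_def by blast
    moreover from this have "a \<e> V b" using wV V_pairD unfolding c0_def by blast
    ultimately show ?thesis by simp
  next
    assume "k1 w"
    then obtain a h x where "w = pair (c1 a h) x" unfolding k1_def by blast
    moreover from this have "a \<e> V b" using wV V_pairD unfolding c1_def by blast
    ultimately show ?thesis by simp
  next
    assume "k2 w" then show ?thesis unfolding k2_def by auto
  qed
qed

text \<open>Such a \<open>b\<close> is the rank of \<open>a\<close>. At this threshold everything
  the components of \<open>a\<close> mention is low, while the coordinate \<open>a\<close> is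
  not.\<close>

lemma rank_ex: "EX b. sub a (V b) & ~ a \<e> V b"
proof -
  obtain c where c: "Ord c" "a \<e> V c" using ex_V by blast
  have "D (%e. a \<e> V (e 0))" by (intro dfi)
  from Ord_least[OF this c] obtain d where d: "a \<e> V d" "!!b. b \<e> d ==> ~ a \<e> V b" by blast
  then obtain b where "b \<e> d" "sub a (V b)" unfolding V[of a d] by blast
  then show ?thesis using d by blast
qed

text \<open>At a name in \<open>V b\<close> the union contains all of \<open>r'\<close>, including
  what the names refer to; at any other name it has exactly the permutations and matchings of
  \<open>r\<close>. So \<open>match\<close> is inherited from \<open>r'\<close> or from
  \<open>r\<close>.\<close>

lemma amalgam: assumes r: "cond r" "cond r'" "sub r r'"
  shows "cond (cup r (sepS r' (low b)))"
proof -
  note R = condD[OF r(1)] and R' = condD[OF r(2)]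
  let ?u = "cup r (sepS r' (low b))"
  have "w \<e> sepS r' (low b) \<longleftrightarrow> w \<e> r' & low b w" for w
    by (rule sepS) (unfold low_def, intro dfi)
  then have m: "w \<e> ?u \<longleftrightarrow> w \<e> r | w \<e> r' & low b w" for w by simp
  have ur': "sub ?u r'" and ru: "sub r ?u" using r(3) unfolding sub_def m by blast+
  have d: "dec ?u N x s" if "dec r' N x s" "sub N (V b)" for N x s
    using that name_low[OF that(2) _ _ r(2)] unfolding dec_def sub_def m by meson
  have mt: "match ?u a h n z p" if mr: "match r' a h n z p" "a \<e> V b" for a h n z p
  proof -
    have "sub N (V b)" if "N = fst a | N = snd a" for N
    proof -
      have "sub a (V b)" using mr(2) V_trs unfolding trs_def by blast
      have "y \<e> V b" if y: "y \<e> N" for y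
      proof -
        obtain u v where uv: "a = pair u v" using y \<open>N = fst a | N = snd a\<close> fst_snd_pair by blast
        then have "u \<e> V b" "v \<e> V b" using mr(2) V_pairD by blast+
        then show ?thesis using y \<open>N = fst a | N = snd a\<close> uv V_trs trsD by auto
      qed
      then show ?thesis by (rule subI)
    qed
    then show ?thesis using mr(1) d unfolding match_def by blast
  qed
  show "cond ?u" unfolding cond_def
  proof (intro conjI allI impI)
    show "fin ?u" by (rule fin_sub[OF R'(1) ur'])
    show "w \<e> ?u ==> k0 w | k1 w | k2 w" for w using R'(2) ur' subD by blast
    show "pair (c0 a) p \<e> ?u & pair (c0 a) p' \<e> ?u ==> coh p p'" for a p p' using R'(3) ur' subD by blast
    show "pair (c1 a h) (pair n m) \<e> ?u & pair (c1 a h) (pair n' m') \<e> ?u ==> (n = n') = (m = m')" for a h n m n' m'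
      using R'(4) ur' subD by blast
    show "pair (c1 a h) x \<e> ?u ==> EX p. pair (c0 a) p \<e> ?u" for a h x unfolding m low_simps using R(5) R'(5) by blast
    show "match ?u a h n k p" if "pair (c1 a h) (pair n k) \<e> ?u & pair (c0 a) p \<e> ?u" for a h n k p
    proof (cases "a \<e> V b")
      case True
      then show ?thesis using that R'(6) ur' subD mt by blast
    next
      case False
      then show ?thesis using that R(6) match_mono[OF _ ru] unfolding m low_simps by blast
    qed
    show "pair (c2 t i) (pair k d) \<e> ?u & pair (c2 t i) (pair k d') \<e> ?u ==> d = d'" for t i k d d'
      using R'(7) ur' subD by blast
  qed
qed

end

section \<open>Finite combinations of bounds, and enumerations of length aleph_1\<close>

context zfc
begin

text \<open>Finite means finite in the model, so even combining finitely many bounds takes an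
  internal induction.\<close>

lemma fin_eventually:
  assumes Q: "D (%e. Q (e 0) (e (Suc 0)))" and F: "fin F"
    and ev: "!!x. x \<e> F ==> EX n. n \<e> omega & (ALL m. m \<e> omega --> sub n m --> Q x m)"
  shows "EX n. n \<e> omega & (ALL m. m \<e> omega --> sub n m --> (ALL x. x \<e> F --> Q x m))"
proof -
  note dfc2[OF Q, dfi]
  have "sub u F --> (EX n. n \<e> omega & (ALL m. m \<e> omega --> sub n m --> (ALL x. x \<e> u --> Q x m)))" if "fin u" for u
    using that
  proof (induct rule: fin_induct)
    case D show ?case by (intro dfi)
  next
    case emp show ?case by (intro impI exI[of _ "zfc.emp E"]) simp
  next
    case (adj u x)
    have am: "z \<e> zfc.adj E u x \<longleftrightarrow> z \<e> u | z = x" for z by simp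
    show ?case
    proof
      assume "sub (zfc.adj E u x) F"
      then have "sub u F" "x \<e> F" by (auto simp: sub_def)
      then obtain n k where n: "n \<e> omega" "!!m y. m \<e> omega ==> sub n m ==> y \<e> u ==> Q y m"
        and k: "k \<e> omega" "!!m. m \<e> omega ==> sub k m ==> Q x m" using adj(2) ev by meson
      from nat_max[OF n(1) k(1)] show "EX n. n \<e> omega & (ALL m. m \<e> omega --> sub n m --> (ALL y. y \<e> zfc.adj E u x --> Q y m))"
      proof
        assume nk: "sub n k"
        have "Q y m" if "m \<e> omega" "sub k m" "y \<e> u | y = x" for y m
          using n(2)[OF that(1) sub_trans[OF nk that(2)]] k(2)[OF that(1,2)] that(3) by blast
        then show ?thesis using k(1) unfolding am by blast
      next
        assume kn: "sub k n"
        have "Q y m" if "m \<e> omega" "sub n m" "y \<e> u | y = x" for y m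
          using n(2)[OF that(1,2)] k(2)[OF that(1) sub_trans[OF kn that(2)]] that(3) by blast
        then show ?thesis using n(1) unfolding am by blast
      qed
    qed
  qed
  then show ?thesis using F sub_refl by blast
qed

lemma w1_inj: assumes "Ord a" "a \<e> w1" "T (%e. F (e 0))" "!!h. h \<e> w1 ==> F h \<e> succ a"
  "!!h k. h \<e> w1 ==> k \<e> w1 ==> F h = F k ==> h = k" shows False
proof -
  have "isfun (lam w1 F) w1 (succ a)" "inje (lam w1 F) w1"
    unfolding isfun_def inje_def using assms lam[OF assms(3)] by (auto simp del: succ)
  then have "cov (succ a) w1" by (rule inj_cov)
  moreover have "ctbl (succ a)" using w1(3)[OF w1_succ[OF assms(2)]] .
  ultimately show False using cov_trans w1(2) by blast
qed

lemma least_index: assumes f: "isfun f A w1" and Q: "D (%e. Q (e 0))" and x: "x \<e> A" "Q x"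
  shows "EX y. y \<e> A & Q y & (ALL z. z \<e> A --> Q z --> ~ app f z \<e> app f y)"
proof -
  note dfc1[OF Q, dfi]
  have "D (%e. EX y. y \<e> A & Q y & app f y = e 0)" by (intro dfi)
  moreover have "Ord (app f x)" using f x Ord_mem[OF w1(1)] unfolding isfun_def by blast
  ultimately obtain b where b: "EX y. y \<e> A & Q y & app f y = b" "!!c. c \<e> b ==> ~ (EX y. y \<e> A & Q y & app f y = c)"
    using Ord_least[of "%b. EX y. y \<e> A & Q y & app f y = b" "app f x"] x by blast
  then show ?thesis by blast
qed

lemma index_le: "isfun f A w1 ==> x \<e> A ==> y \<e> A ==> ~ app f x \<e> app f y ==> app f y \<e> succ (app f x)"
  using Ord_lin[of "app f x" "app f y"] Ord_mem[OF w1(1)] unfolding isfun_def by auto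

text \<open>Enumerate \<open>C\<close> by recursion, always taking the remaining element of least
  index under \<open>f\<close>. This goes on for \<open>w1\<close> steps because \<open>C\<close> is
  uncountable. It omits no \<open>x\<close>, since otherwise all values would have at most the index
  of \<open>x\<close>, against \<open>w1_inj\<close>.\<close>

lemma size1I: assumes c: "cov w1 C" and u: "~ ctbl C" shows "size1 C"
proof -
  obtain f where f: "isfun f C w1" "inje f C" using cov_inj[OF c] by blast
  define L where "L U x \<longleftrightarrow> x \<e> C & ~ x \<e> U & (ALL z. z \<e> C --> ~ z \<e> U --> ~ app f z \<e> app f x)" for U x
  have L_D [dfi]: "T s ==> T t ==> D (%e. L (s e) (t e))" for s t unfolding L_def by (intro dfi dft_shift)
  have un1: "x = y" if "L U x" "L U y" for U x y
  proof -
    have xy: "x \<e> C" "y \<e> C" "~ app f x \<e> app f y" "~ app f y \<e> app f x" using that unfolding L_def by blast+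
    then have "app f x = app f y" using Ord_lin Ord_mem[OF w1(1)] f(1) unfolding isfun_def by blast
    then show ?thesis using f(2) xy unfolding inje_def by blast
  qed
  define G where "G h g = un (sepS C (%x. L (img (app g) h) x))" for h g
  have G_T: "T (%e. G (e 0) (e (Suc 0)))" unfolding G_def by (intro dfi)
  define H where "H = rec G"
  have H_T [dfi]: "T s ==> T (%e. H (s e))" for s unfolding H_def by (rule rec_T[OF G_T])
  have H0: "T (%e. H (e 0))" by (intro dfi)
  have im: "img (app (lam h H)) h = img H h" for h
  proof (rule extens)
    fix z
    have "T (%e. app (lam h H) (e 0))" by (intro dfi)
    then show "z \<e> img (app (lam h H)) h \<longleftrightarrow> z \<e> img H h" using H0 lam(2)[OF H0, of _ h] by (simp cong: conj_cong)
  qed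
  have HG: "H h = un (sepS C (%x. L (img H h) x))" for h
    using rec_eq[OF G_T, of h] unfolding H_def[symmetric] by (simp only: G_def im)
  have HL: "L (img H h) (H h)" if h: "h \<e> w1" for h
  proof -
    have "ctbl (img H h)" using cov_trans[OF w1(3)[OF h] cov_img[OF H0]] .
    then have "~ sub C (img H h)" using cov_sub u by blast
    then obtain x where "x \<e> C" "~ x \<e> img H h" unfolding sub_def by blast
    moreover have "D (%e. ~ e 0 \<e> img H h)" by (intro dfi)
    ultimately obtain y where y: "L (img H h) y" using least_index[OF f(1), of "%x. ~ x \<e> img H h"] unfolding L_def by blast
    have "z \<e> sepS C (%x. L (img H h) x) \<longleftrightarrow> z \<e> C & L (img H h) z" for z by (rule sepS) (intro dfi)
    moreover have "L (img H h) z \<longleftrightarrow> z = y" for z using y un1[of "img H h" z y] by blast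
    moreover have "y \<e> C" using y unfolding L_def by blast
    ultimately have "z \<e> sepS C (%x. L (img H h) x) \<longleftrightarrow> z = y" for z by metis
    then have "H h = y" unfolding HG[of h] by (intro extens) simp
    then show ?thesis using y by simp
  qed
  have inj: "h = k" if "h \<e> w1" "k \<e> w1" "H h = H k" for h k
  proof -
    have "~ h \<e> k" if "h \<e> w1" "k \<e> w1" "H h = H k" for h k
      using HL[OF that(2)] that(3) H0 unfolding L_def by auto
    then show ?thesis using that Ord_lin Ord_mem[OF w1(1)] by metis
  qed
  have onto: "EX h. h \<e> w1 & H h = x" if x: "x \<e> C" for x
  proof (rule ccontr)
    assume n: "~ ?thesis"
    have fx: "app f x \<e> w1" using f(1) x unfolding isfun_def by blast
    have t: "T (%e. app f (H (e 0)))" by (intro dfi)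
    show False
    proof (rule w1_inj[OF Ord_mem[OF w1(1) fx] fx t])
      fix h assume h: "h \<e> w1"
      have "~ x \<e> img H h" using n H0 Ord_trsD[OF w1(1) h] by auto
      then show "app f (H h) \<e> succ (app f x)" using HL[OF h] x index_le[OF f(1) x] unfolding L_def by blast
    next
      fix h k assume "h \<e> w1" "k \<e> w1" "app f (H h) = app f (H k)"
      then show "h = k" using inj HL f(2) unfolding L_def inje_def by blast
    qed
  qed
  define g where "g = sepS (prod C w1) (%w. EX h. h \<e> w1 & w = pair (H h) h)"
  have "w \<e> g \<longleftrightarrow> w \<e> prod C w1 & (EX h. h \<e> w1 & w = pair (H h) h)" for w unfolding g_def by (rule sepS) (intro dfi)
  then have g: "w \<e> g \<longleftrightarrow> (EX h. h \<e> w1 & w = pair (H h) h)" for w using HL unfolding L_def prod by blast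
  have "bijR g C w1" unfolding bijR_def isfun_iff injR_def imgR_def g pair_inj
    using HL onto inj unfolding L_def by (intro conjI) (blast, metis, metis, metis)
  then show ?thesis unfolding size1_def by blast
qed

lemma size1D: assumes "size1 C" shows "EX f. isfun f C w1 & inje f C" "~ ctbl C" "cov w1 C"
proof -
  obtain f where f: "isfun f C w1" "injR f C" "imgR f C w1" using assms unfolding size1_def bijR_def by blast
  then have fi: "inje f C" using injR_inje unfolding isfun_def by blast
  with f show "EX f. isfun f C w1 & inje f C" by blast
  show "cov w1 C" by (rule inj_cov[OF f(1) fi])
  have fn: "fn f C" using f(1) unfolding isfun_def by blast
  have "cov C w1" unfolding cov_def using f(3) fn fn_app[OF fn] unfolding imgR_def by metis
  then show "~ ctbl C" using cov_trans w1(2) by blast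
qed

end

section \<open>The topology of the sequence space in terms of nodes\<close>

context nodes
begin

lemma ND_emp: "emp \<e> ND" unfolding ND by (rule exI[of _ emp]) (auto simp: isfun_def fn_def)
lemma ND_fun: "s \<e> ND ==> EX l. l \<e> omega & isfun s l S" using ND by blast
lemma node_at: "x \<e> fs S ==> l \<e> omega ==> EX s. isfun s l S & sub s x & s \<e> ND"
  using restr_ex[of x omega l] omega_trs unfolding trs_def ND by auto
lemma sub_omega: "n \<e> omega ==> sub n omega" using omega_trs unfolding trs_def by blast

lemma same_iff: "x \<e> fs S ==> y \<e> fs S ==> i \<e> omega ==> sameR x y i \<longleftrightarrow> app x i = app y i"
  unfolding sameR_def by (auto simp: fun_pair)
lemma agr_iff: "x \<e> fs S ==> y \<e> fs S ==> k \<e> omega ==> agrR x y k \<longleftrightarrow> (ALL i. i \<e> k --> app x i = app y i)"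
  unfolding agrR_def using same_iff nat_mem by blast

text \<open>Distance less than \<open>2^-n\<close> means agreement up to and including
  \<open>n\<close>, hence the \<open>succ n\<close>.\<close>

lemma dist_iff: assumes x: "x \<e> fs S" "y \<e> fs S" "n \<e> omega"
  shows "distl x y n \<longleftrightarrow> (ALL i. i \<e> succ n --> app x i = app y i)"
proof
  assume "distl x y n"
  then show "ALL i. i \<e> succ n --> app x i = app y i" unfolding distl_def
  proof
    assume "EX k. k \<e> omega & ~ sameR x y k & agrR x y k & n \<e> k"
    then obtain k where k: "k \<e> omega" "agrR x y k" "n \<e> k" by blast
    then show ?thesis using agr_iff[OF x(1,2) k(1)] nat_trs[OF k(1)] trsD by auto
  qed simp
next
  assume a: "ALL i. i \<e> succ n --> app x i = app y i"
  show "distl x y n"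
  proof (cases "x = y")
    case False
    then obtain i where i: "i \<e> omega" "app x i ~= app y i" using fun_ext x by (metis fs)
    have "D (%e. app x (e 0) ~= app y (e 0))" by (intro dfi)
    from Ord_least[OF this Ord_nat[OF i(1)] i(2)] obtain k where
      k: "Ord k" "app x k ~= app y k" "!!c. c \<e> k ==> app x c = app y c" by blast
    have "k = i | k \<e> i" using Ord_lin[OF k(1) Ord_nat[OF i(1)]] k(3) i(2) by blast
    then have kw: "k \<e> omega" using i(1) nat_mem by blast
    have "~ k \<e> succ n" using a k(2) by blast
    then have "n \<e> k" using Ord_lin[OF k(1) Ord_nat[OF x(3)]] by auto
    then show ?thesis unfolding distl_def using kw k same_iff[OF x(1,2) kw] agr_iff[OF x(1,2) kw] by blast
  qed (simp add: distl_def)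
qed

lemma dist_node: assumes "x \<e> fs S" "y \<e> fs S" "n \<e> omega" "isfun s (succ n) S" "sub s x"
  shows "distl x y n \<longleftrightarrow> sub s y"
  using assms(5) unfolding dist_iff[OF assms(1-3)] sub_fun[OF assms(4) assms(1)[unfolded fs]] sub_fun[OF assms(4) assms(2)[unfolded fs]] by auto

lemma openR_iff: "openR (fs S) U \<longleftrightarrow> sub U (fs S) & (ALL x. x \<e> U --> (EX s. s \<e> ND & sub s x & (ALL y. y \<e> fs S & sub s y --> y \<e> U)))"
proof -
  have "(EX n. n \<e> omega & (ALL y. y \<e> fs S & distl x y n --> y \<e> U)) \<longleftrightarrow>
     (EX s. s \<e> ND & sub s x & (ALL y. y \<e> fs S & sub s y --> y \<e> U))" if x: "x \<e> fs S" for x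
  proof
    assume "EX n. n \<e> omega & (ALL y. y \<e> fs S & distl x y n --> y \<e> U)"
    then obtain n where n: "n \<e> omega" "!!y. y \<e> fs S ==> distl x y n ==> y \<e> U" by blast
    obtain s where s: "isfun s (succ n) S" "sub s x" "s \<e> ND" using node_at[OF x omega_succ[OF n(1)]] by blast
    then show "EX s. s \<e> ND & sub s x & (ALL y. y \<e> fs S & sub s y --> y \<e> U)"
      using n(2) dist_node[OF x _ n(1) s(1,2)] by blast
  next
    assume "EX s. s \<e> ND & sub s x & (ALL y. y \<e> fs S & sub s y --> y \<e> U)"
    then obtain s where s: "s \<e> ND" "sub s x" "!!y. y \<e> fs S ==> sub s y ==> y \<e> U" by blast
    obtain l where l: "l \<e> omega" "isfun s l S" using ND_fun[OF s(1)] by blast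
    have "y \<e> U" if y: "y \<e> fs S" "distl x y l" for y
    proof (rule s(3)[OF y(1)])
      show "sub s y" using s(2) y(2) unfolding dist_iff[OF x y(1) l(1)] sub_fun[OF l(2) x[unfolded fs]]
          sub_fun[OF l(2) y(1)[unfolded fs]] by auto
    qed
    then show "EX n. n \<e> omega & (ALL y. y \<e> fs S & distl x y n --> y \<e> U)" using l(1) by blast
  qed
  then show ?thesis unfolding openR_def sub_def by blast
qed

abbreviation "cone s \<equiv> sepS (fs S) (%x. sub s x)"
lemma cone: "x \<e> cone s \<longleftrightarrow> x \<e> fs S & sub s x" by (rule sepS) (intro dfi)
lemma cone_open: "s \<e> ND ==> openR (fs S) (cone s)"
  unfolding openR_iff sub_def[of "cone s"] cone by blast
lemma cone_ne: "s \<e> ND ==> cone s ~= emp"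
  unfolding ne_emp cone using ext_node sub_omega ND_fun fs by metis

abbreviation "part A s \<equiv> sepS A (%x. sub s x)"
lemma part: "x \<e> part A s \<longleftrightarrow> x \<e> A & sub s x" by (rule sepS) (intro dfi)

lemma dense1D: assumes "dense1 (fs S) A" shows "sub A (fs S)" "s \<e> ND ==> ~ ctbl (part A s)" "size1 A"
proof -
  show s: "sub A (fs S)" using assms unfolding dense1_def by blast
  have "size1 (part A s)" if sN: "s \<e> ND" for s
  proof -
    obtain C where C: "!!x. x \<e> C \<longleftrightarrow> x \<e> A & x \<e> cone s" "size1 C"
      using assms cone_open[OF sN] cone_ne[OF sN] unfolding dense1_def by blast
    have "C = part A s" by (rule extens) (use C(1) s[THEN subD] in \<open>auto simp: part cone\<close>)
    then show ?thesis using C by simp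
  qed
  note sz = this
  show "s \<e> ND ==> ~ ctbl (part A s)" using sz size1D(2) by blast
  have "part A emp = A" by (rule extens) (simp add: part, simp add: sub_def)
  then show "size1 A" using sz[OF ND_emp] by simp
qed

text \<open>Every non-empty open set contains a cone, so uncountable traces on cones suffice;
  \<open>size1I\<close> turns the two bounds into size exactly aleph_1.\<close>

lemma dense1I: assumes A: "sub A (fs S)" "cov w1 A" "!!s. s \<e> ND ==> ~ ctbl (part A s)"
  shows "dense1 (fs S) A"
  unfolding dense1_def
proof (intro conjI allI impI A(1))
  fix U assume U: "openR (fs S) U & U ~= emp"
  then obtain x s where s: "s \<e> ND" "sub s x" "!!y. y \<e> fs S ==> sub s y ==> y \<e> U" unfolding openR_iff ne_emp by blast
  have m: "x \<e> sepS A (%x. x \<e> U) \<longleftrightarrow> x \<e> A & x \<e> U" for x by (rule sepS) (intro dfi)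
  have "sub (part A s) (sepS A (%x. x \<e> U))" unfolding sub_def[of "part A s"] part m using s(3) A(1) subD by blast
  then have "~ ctbl (sepS A (%x. x \<e> U))" using A(3)[OF s(1)] cov_sub by blast
  moreover have "cov w1 (sepS A (%x. x \<e> U))" by (rule cov_sub[OF A(2)]) (simp add: sub_def m)
  ultimately have "size1 (sepS A (%x. x \<e> U))" by (intro size1I)
  then show "EX C. (ALL x. x \<e> C \<longleftrightarrow> x \<e> A & x \<e> U) & size1 C" using m by blast
qed

lemma separate: assumes "fin F" "sub F (fs S)"
  shows "EX n. n \<e> omega & (ALL m. m \<e> omega --> sub n m --> (ALL x. x \<e> F --> (ALL y. y \<e> F --> x ~= y --> (EX i. i \<e> m & app x i ~= app y i))))"
proof (rule fin_eventually[OF _ assms(1)])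
  show "D (%e. ALL y. y \<e> F --> e 0 ~= y --> (EX i. i \<e> e (Suc 0) & app (e 0) i ~= app y i))" by (intro dfi)
  fix x assume x: "x \<e> F"
  show "EX n. n \<e> omega & (ALL m. m \<e> omega --> sub n m --> (ALL y. y \<e> F --> x ~= y --> (EX i. i \<e> m & app x i ~= app y i)))"
  proof (rule fin_eventually[OF _ assms(1)])
    show "D (%e. x ~= e 0 --> (EX i. i \<e> e (Suc 0) & app x i ~= app (e 0) i))" by (intro dfi)
    fix y assume y: "y \<e> F"
    show "EX n. n \<e> omega & (ALL m. m \<e> omega --> sub n m --> x ~= y --> (EX i. i \<e> m & app x i ~= app y i))"
    proof (cases "x = y")
      case False
      then obtain i where i: "i \<e> omega" "app x i ~= app y i" using fun_ext x y assms(2) by (metis fs subD)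
      then have "i \<e> m" if "sub (succ i) m" for m using that by (auto simp: sub_def)
      then show ?thesis using i omega_succ by blast
    qed (use omega_0 in blast)
  qed
qed

lemma S_two: "d \<e> S ==> EX d'. d' \<e> S & d' ~= d" using S_0 S_1 succ_ne by metis

lemma node_adj: assumes "isfun s l S" "d \<e> S" "l \<e> omega" shows "isfun (adj s (pair l d)) (succ l) S"
proof -
  have f: "fn s l" and v: "!!i. i \<e> l ==> app s i \<e> S" using assms(1) unfolding isfun_def by auto
  note a = fn_adj(1)[OF f mem_irrefl, of d] fn_adj(2)[OF f mem_irrefl, of _ d] fn_adj(3)[OF f mem_irrefl, of d]
  have "app (adj s (pair l d)) i \<e> S" if "i \<e> l | i = l" for i using that a(2)[of i] a(3) v assms(2) by auto
  then show ?thesis using a(1) unfolding isfun_def succ_def adj by blast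
qed

text \<open>Each point is left by one further digit that differs from its own; \<open>S\<close> has
  at least two elements to choose from.\<close>

lemma avoid: assumes "fin F" "s \<e> ND" "sub F (fs S)"
  shows "EX s'. s' \<e> ND & sub s s' & (ALL x. x \<e> F --> ~ sub s' x)"
proof -
  have "sub u F --> (EX s'. s' \<e> ND & sub s s' & (ALL x. x \<e> u --> ~ sub s' x))" if "fin u" for u
    using that
  proof (induct rule: fin_induct)
    case D show ?case by (intro dfi)
  next
    case emp show ?case using assms(2) sub_refl by auto
  next
    case (adj u x)
    have am: "z \<e> zfc.adj E u x \<longleftrightarrow> z \<e> u | z = x" for z by simp
    show ?case
    proof
      assume "sub (zfc.adj E u x) F"
      then have u: "sub u F" "x \<e> F" by (auto simp: sub_def)
      then obtain s' where s': "s' \<e> ND" "sub s s'" "!!y. y \<e> u ==> ~ sub s' y" using adj(2) by blast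
      obtain l where l: "l \<e> omega" "isfun s' l S" using ND_fun[OF s'(1)] by blast
      have xf: "isfun x omega S" using u(2) assms(3) by (simp add: sub_def)
      obtain d where d: "d \<e> S" "d ~= app x l" using S_two xf l(1) unfolding isfun_def by blast
      let ?t = "zfc.adj E s' (pair l d)"
      have t: "isfun ?t (succ l) S" by (rule node_adj[OF l(2) d(1) l(1)])
      have st: "sub s' ?t" by (auto simp: sub_def)
      have "pair l d \<e> ?t" by simp
      then have "~ sub ?t x" using d(2) fun_pair[OF xf] unfolding sub_def by blast
      moreover have "?t \<e> ND" using t omega_succ[OF l(1)] ND by blast
      moreover have "~ sub ?t y" if "y \<e> u" for y using s'(3)[OF that] sub_trans[OF st] by blast
      ultimately show "EX s'. s' \<e> ND & sub s s' & (ALL y. y \<e> zfc.adj E u x --> ~ sub s' y)"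
        unfolding am using sub_trans[OF s'(2) st] by blast
    qed
  qed
  then show ?thesis using assms(1) sub_refl by blast
qed

subsection \<open>Homeomorphisms from coherent matchings of nodes\<close>

text \<open>A length-preserving isomorphism between two sets of nodes that meet every branch at
  arbitrarily high levels. Levels in between may be missing, so the induced homeomorphism need not
  be an isometry.\<close>

definition good where "good H \<longleftrightarrow>
  (ALL s t s' t'. pair s t \<e> H & pair s' t' \<e> H --> (sub s s' \<longleftrightarrow> sub t t')) &
  (ALL w. w \<e> H --> (EX l s t. l \<e> omega & isfun s l S & isfun t l S & w = pair s t)) &
  (ALL x k. x \<e> fs S --> k \<e> omega --> (EX l s t. l \<e> omega & sub k l & isfun s l S & isfun t l S & pair s t \<e> H & sub s x)) &
  (ALL y k. y \<e> fs S --> k \<e> omega --> (EX l s t. l \<e> omega & sub k l & isfun s l S & isfun t l S & pair s t \<e> H & sub t y))"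
definition mt where "mt H x y \<longleftrightarrow> (ALL s t. pair s t \<e> H --> (sub s x \<longleftrightarrow> sub t y))"
definition conv where "conv H = img (%w. pair (snd w) (fst w)) H"

lemma mt_D [dfi]: "T s ==> T t ==> T u ==> D (%e. mt (s e) (t e) (u e))" unfolding mt_def by (intro dfi dft_shift)

lemma goodD: assumes "good H"
  shows "pair s t \<e> H ==> pair s' t' \<e> H ==> sub s s' \<longleftrightarrow> sub t t'"
    "w \<e> H ==> EX l s t. l \<e> omega & isfun s l S & isfun t l S & w = pair s t"
    "x \<e> fs S ==> k \<e> omega ==> EX l s t. l \<e> omega & sub k l & isfun s l S & isfun t l S & pair s t \<e> H & sub s x"
    "y \<e> fs S ==> k \<e> omega ==> EX l s t. l \<e> omega & sub k l & isfun s l S & isfun t l S & pair s t \<e> H & sub t y"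
proof -
  note c = assms[unfolded good_def]
  show "pair s t \<e> H ==> pair s' t' \<e> H ==> sub s s' \<longleftrightarrow> sub t t'" using c[THEN conjunct1] by blast
  show "w \<e> H ==> EX l s t. l \<e> omega & isfun s l S & isfun t l S & w = pair s t" using c[THEN conjunct2, THEN conjunct1] by blast
  show "x \<e> fs S ==> k \<e> omega ==> EX l s t. l \<e> omega & sub k l & isfun s l S & isfun t l S & pair s t \<e> H & sub s x"
    using c[THEN conjunct2, THEN conjunct2, THEN conjunct1] by blast
  show "y \<e> fs S ==> k \<e> omega ==> EX l s t. l \<e> omega & sub k l & isfun s l S & isfun t l S & pair s t \<e> H & sub t y"
    using c[THEN conjunct2, THEN conjunct2, THEN conjunct2] by blast
qed

lemma conv: assumes "good H" shows "pair t s \<e> conv H \<longleftrightarrow> pair s t \<e> H"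
proof -
  have "pair t s \<e> conv H \<longleftrightarrow> (EX w. w \<e> H & pair t s = pair (snd w) (fst w))" unfolding conv_def by (rule img) (intro dfi)
  then show ?thesis using goodD(2)[OF assms] by (metis pair_inj fst snd)
qed

lemma mt_conv: "good H ==> mt (conv H) y x \<longleftrightarrow> mt H x y" unfolding mt_def conv by blast

lemma good_conv: assumes "good H" shows "good (conv H)"
  unfolding good_def conv[OF assms]
proof (intro conjI allI impI)
  note G = goodD[OF assms]
  show "pair t s \<e> H & pair t' s' \<e> H ==> sub s s' \<longleftrightarrow> sub t t'" for s t s' t' using G(1) by blast
  fix w assume "w \<e> conv H"
  moreover have "w \<e> conv H \<longleftrightarrow> (EX w'. w' \<e> H & w = pair (snd w') (fst w'))" unfolding conv_def by (rule img) (intro dfi)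
  ultimately show "EX l s t. l \<e> omega & isfun s l S & isfun t l S & w = pair s t" using G(2) by (metis fst snd)
next
  note G = goodD[OF assms]
  show "x \<e> fs S ==> k \<e> omega ==> EX l s t. l \<e> omega & sub k l & isfun s l S & isfun t l S & pair t s \<e> H & sub s x" for x k
    using G(4)[of x k] by blast
  show "y \<e> fs S ==> k \<e> omega ==> EX l s t. l \<e> omega & sub k l & isfun s l S & isfun t l S & pair t s \<e> H & sub t y" for y k
    using G(3)[of y k] by blast
qed

text \<open>The image of \<open>x\<close> is the union of the nodes matched with initial segments of
  \<open>x\<close>; these form a chain because the initial segments do.\<close>

lemma mt_ex: assumes H: "good H" and x: "x \<e> fs S" shows "EX y. y \<e> fs S & mt H x y"
proof -
  note G = goodD[OF H]
  have xf: "isfun x omega S" using x by simp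
  define V' where "V' i v \<longleftrightarrow> (EX s t. pair s t \<e> H & sub s x & pair i v \<e> t)" for i v
  have V'_D: "T s ==> T t ==> D (%e. V' (s e) (t e))" for s t unfolding V'_def by (intro dfi dft_shift)
  have node: "EX l. l \<e> omega & isfun s l S & isfun t l S" if "pair s t \<e> H" for s t using G(2)[OF that] by auto
  have cmp: "sub t t' | sub t' t" if m: "pair s t \<e> H" "sub s x" "pair s' t' \<e> H" "sub s' x" for s t s' t'
  proof -
    obtain l where l: "l \<e> omega" "isfun s l S" using node[OF m(1)] by blast
    obtain l' where l': "l' \<e> omega" "isfun s' l' S" using node[OF m(3)] by blast
    have "sub s s' | sub s' s"
      using nat_max[OF l(1) l'(1)] sub_common[OF l(2) l'(2) xf _ m(2,4)] sub_common[OF l'(2) l(2) xf _ m(4,2)] by blast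
    then show ?thesis using G(1) m by blast
  qed
  have uni: "v = v'" if vv: "V' i v" "V' i v'" for i v v'
  proof -
    obtain s t where st: "pair s t \<e> H" "sub s x" "pair i v \<e> t" using vv(1) unfolding V'_def by blast
    obtain s' t' where st': "pair s' t' \<e> H" "sub s' x" "pair i v' \<e> t'" using vv(2) unfolding V'_def by blast
    have "EX u l. isfun u l S & pair i v \<e> u & pair i v' \<e> u"
      using cmp[OF st(1,2) st'(1,2)] st(3) st'(3) node[OF st(1)] node[OF st'(1)] unfolding sub_def by blast
    then show ?thesis using fun_pair by metis
  qed
  have ex: "EX v. v \<e> S & V' i v" if i: "i \<e> omega" for i
  proof -
    obtain l s t where l: "sub (succ i) l" "isfun t l S" "pair s t \<e> H" "sub s x"
      using G(3)[OF x omega_succ[OF i]] by blast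
    then have il: "i \<e> l" by (auto simp: sub_def)
    then have "pair i (app t i) \<e> t" using fun_pair[OF l(2)] by blast
    then show ?thesis using l il unfolding V'_def isfun_def by blast
  qed
  define y where "y = sepS (prod omega S) (%w. EX i v. w = pair i v & V' i v)"
  have "w \<e> y \<longleftrightarrow> w \<e> prod omega S & (EX i v. w = pair i v & V' i v)" for w
    unfolding y_def by (rule sepS) (intro dfi V'_D)
  then have ym: "pair i v \<e> y \<longleftrightarrow> i \<e> omega & v \<e> S & V' i v"
    and ym2: "w \<e> y ==> EX i v. i \<e> omega & v \<e> S & w = pair i v" for i v w by (auto simp: prod)
  have yf: "isfun y omega S" unfolding isfun_iff
  proof (intro conjI allI impI)
    fix i assume "i \<e> omega"
    then obtain v where "v \<e> S" "V' i v" using ex by blast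
    then show "EX v. ALL u. pair i u \<e> y \<longleftrightarrow> u = v" using ym uni \<open>i \<e> omega\<close> by blast
  qed (rule ym2)
  have st_y: "sub t y" if sH: "pair s t \<e> H" "sub s x" for s t
    unfolding sub_def
  proof (intro allI impI)
    fix w assume w: "w \<e> t"
    obtain l where l: "l \<e> omega" "isfun t l S" using node[OF sH(1)] by blast
    obtain i where i: "i \<e> l" "w = pair i (app t i)" using w unfolding fun_mem[OF l(2)] by blast
    have "V' i (app t i)" unfolding V'_def using sH w i by blast
    then show "w \<e> y" unfolding i(2) ym using i(1) l nat_mem unfolding isfun_def by blast
  qed
  have "sub s x" if m: "pair s t \<e> H" "sub t y" for s t
  proof -
    obtain l where l: "l \<e> omega" "isfun s l S" "isfun t l S" using node[OF m(1)] by blast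
    obtain l' s' t' where l': "sub l l'" "isfun t' l' S" "pair s' t' \<e> H" "sub s' x" using G(3)[OF x l(1)] by blast
    have "sub t t'" by (rule sub_common[OF l(3) l'(2) yf l'(1) m(2) st_y[OF l'(3,4)]])
    then have "sub s s'" using G(1)[OF m(1) l'(3)] by blast
    then show ?thesis using l'(4) sub_trans by blast
  qed
  then have "mt H x y" unfolding mt_def using st_y by blast
  then show ?thesis using yf by auto
qed

lemma mt_uniq: assumes H: "good H" and x: "x \<e> fs S" "y \<e> fs S" "y' \<e> fs S" "mt H x y" "mt H x y'" shows "y = y'"
proof (rule fun_ext)
  show y: "isfun y omega S" "isfun y' omega S" using x by simp_all
  fix i assume i: "i \<e> omega"
  obtain l s t where l: "sub (succ i) l" "isfun t l S" "pair s t \<e> H" "sub s x"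
    using goodD(3)[OF H x(1) omega_succ[OF i]] by blast
  have t: "sub t y" "sub t y'" using l(3,4) x(4,5) unfolding mt_def by blast+
  have "i \<e> l" using l(1) by (auto simp: sub_def)
  then show "app y i = app y' i" using t unfolding sub_fun[OF l(2) y(1)] sub_fun[OF l(2) y(2)] by auto
qed

text \<open>Matched nodes have corresponding cones, which gives continuity in both
  directions.\<close>

lemma homeo_ex:
  assumes H: "good H" and A: "sub A (fs S)" and B: "sub B (fs S)"
    and AB: "!!a. a \<e> A ==> EX b. b \<e> B & mt H a b" and BA: "!!b. b \<e> B ==> EX a. a \<e> A & mt H a b"
  shows "EX h. autoh (fs S) h & imgR h A B"
proof -
  note G = goodD[OF H]
  let ?X = "fs S"
  define h where "h = sepS (prod ?X ?X) (%w. EX x y. w = pair x y & mt H x y)"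
  have "w \<e> h \<longleftrightarrow> w \<e> prod ?X ?X & (EX x y. w = pair x y & mt H x y)" for w unfolding h_def by (rule sepS) (intro dfi)
  note h = this
  have hm: "pair x y \<e> h \<longleftrightarrow> x \<e> ?X & y \<e> ?X & mt H x y" and
    hm2: "w \<e> h ==> EX x y. x \<e> ?X & y \<e> ?X & w = pair x y" for x y w
    unfolding h prod by auto
  have xu: "x = x'" if "x \<e> ?X" "x' \<e> ?X" "y \<e> ?X" "mt H x y" "mt H x' y" for x x' y
    using mt_uniq[OF good_conv[OF H] that(3,1,2)] mt_conv[OF H] that by blast
  have xe: "EX x. x \<e> ?X & mt H x y" if "y \<e> ?X" for y
    using mt_ex[OF good_conv[OF H] that] mt_conv[OF H] by blast
  have bij: "bijR h ?X ?X" unfolding bijR_def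
  proof (intro conjI)
    show "isfun h ?X ?X" unfolding isfun_iff
    proof (intro conjI allI impI)
      fix x assume x: "x \<e> ?X"
      obtain y where "y \<e> ?X" "mt H x y" using mt_ex[OF H x] by blast
      then show "EX y. ALL v. pair x v \<e> h \<longleftrightarrow> v = y" unfolding hm using mt_uniq[OF H x] x by blast
    qed (rule hm2)
    show "injR h ?X" unfolding injR_def hm using xu by blast
    show "imgR h ?X ?X" unfolding imgR_def hm using xe by blast
  qed
  have pre: "openR ?X W" if U: "openR ?X U" "preR h ?X U W" for U W
    unfolding openR_iff
  proof (intro conjI allI impI)
    show "sub W ?X" using U(2) unfolding preR_def sub_def by blast
    fix x assume "x \<e> W"
    then obtain y where y: "y \<e> U" "x \<e> ?X" "y \<e> ?X" "mt H x y" using U(2) unfolding preR_def hm by blast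
    then obtain t where t: "t \<e> ND" "sub t y" "!!z. z \<e> ?X ==> sub t z ==> z \<e> U" using U(1) unfolding openR_iff by blast
    obtain k where k: "k \<e> omega" "isfun t k S" using ND_fun[OF t(1)] by blast
    obtain l s1 t1 where l: "l \<e> omega" "sub k l" "isfun s1 l S" "isfun t1 l S" "pair s1 t1 \<e> H" "sub t1 y" using G(4)[OF y(3) k(1)] by blast
    have tt: "sub t t1" by (rule sub_common[OF k(2) l(4) y(3)[unfolded fs] l(2) t(2) l(6)])
    have "x' \<e> W" if x': "x' \<e> ?X" "sub s1 x'" for x'
    proof -
      obtain y' where y': "y' \<e> ?X" "mt H x' y'" using mt_ex[OF H x'(1)] by blast
      then have "sub t1 y'" using l(5) x'(2) unfolding mt_def by blast
      then have "y' \<e> U" using t(3)[OF y'(1)] sub_trans[OF tt] by blast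
      then show ?thesis using U(2) x'(1) y' unfolding preR_def hm by blast
    qed
    moreover have "sub s1 x" using l(5,6) y(4) unfolding mt_def by blast
    moreover have "s1 \<e> ND" using l ND by blast
    ultimately show "EX s. s \<e> ND & sub s x & (ALL y. y \<e> ?X & sub s y --> y \<e> W)" by blast
  qed
  have im: "openR ?X W" if U: "openR ?X U" "imgR h U W" for U W
    unfolding openR_iff
  proof (intro conjI allI impI)
    show "sub W ?X" using U(2) unfolding imgR_def sub_def hm by blast
    fix y assume "y \<e> W"
    then obtain x where x: "x \<e> U" "x \<e> ?X" "y \<e> ?X" "mt H x y" using U(2) unfolding imgR_def hm by blast
    then obtain s where s: "s \<e> ND" "sub s x" "!!z. z \<e> ?X ==> sub s z ==> z \<e> U" using U(1) unfolding openR_iff by blast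
    obtain k where k: "k \<e> omega" "isfun s k S" using ND_fun[OF s(1)] by blast
    obtain l s1 t1 where l: "l \<e> omega" "sub k l" "isfun s1 l S" "isfun t1 l S" "pair s1 t1 \<e> H" "sub s1 x" using G(3)[OF x(2) k(1)] by blast
    have ss: "sub s s1" by (rule sub_common[OF k(2) l(3) x(2)[unfolded fs] l(2) s(2) l(6)])
    have "y' \<e> W" if y': "y' \<e> ?X" "sub t1 y'" for y'
    proof -
      obtain x' where x': "x' \<e> ?X" "mt H x' y'" using xe[OF y'(1)] by blast
      then have "sub s1 x'" using l(5) y'(2) unfolding mt_def by blast
      then have "x' \<e> U" using s(3)[OF x'(1)] sub_trans[OF ss] by blast
      then show ?thesis using U(2) y'(1) x' unfolding imgR_def hm by blast
    qed
    moreover have "sub t1 y" using l(5,6) x(4) unfolding mt_def by blast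
    moreover have "t1 \<e> ND" using l ND by blast
    ultimately show "EX s. s \<e> ND & sub s y & (ALL z. z \<e> ?X & sub s z --> z \<e> W)" by blast
  qed
  have "autoh ?X h" unfolding autoh_def using bij pre im by blast
  moreover have "imgR h A B" unfolding imgR_def hm
  proof (intro allI iffI)
    fix y assume "y \<e> B"
    then show "EX x. x \<e> A & x \<e> ?X & y \<e> ?X & mt H x y" using BA A B subD by blast
  next
    fix y assume "EX x. x \<e> A & x \<e> ?X & y \<e> ?X & mt H x y"
    then obtain x where x: "x \<e> A" "x \<e> ?X" "y \<e> ?X" "mt H x y" by blast
    obtain b where b: "b \<e> B" "mt H x b" using AB[OF x(1)] by blast
    then have "b = y" using mt_uniq[OF H x(2) _ x(3) _ x(4)] B subD by blast
    then show "y \<e> B" using b by simp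
  qed
  ultimately show ?thesis by blast
qed

end

section \<open>Splitting a dense set into countable dense blocks\<close>

context nodes
begin

text \<open>\<open>a\<close> enumerates a set of points one-to-one in \<open>\<aleph>\<^sub>1\<close> many dense blocks, \<open>pair h n\<close> being the index of
  the \<open>n\<close>-th point of the \<open>h\<close>-th block.\<close>

definition Theta where "Theta a \<longleftrightarrow>
  (ALL p. p \<e> a --> (EX h n y x. h \<e> w1 & n \<e> omega & isfun y omega S & x = pair h n & p = pair x y)) &
  (ALL x y u v. pair x y \<e> a & pair u v \<e> a --> (x = u \<longleftrightarrow> y = v)) &
  (ALL h s. h \<e> w1 & s \<e> ND --> (EX n x y. x = pair h n & pair x y \<e> a & sub s y))"

text \<open>Block \<open>h\<close> takes, for every node \<open>s\<close>, the element of
  \<open>A\<close> through \<open>s\<close> of least index outside the earlier blocks. There are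
  countably many nodes, so blocks are countable. The choice for \<open>s = emp\<close> makes the
  blocks exhaust \<open>A\<close>, by the argument of \<open>size1I\<close>.\<close>

lemma blocks: assumes dense: "dense1 (fs S) A"
  shows "EX a. Theta a & (ALL y. y \<e> A \<longleftrightarrow> (EX x. pair x y \<e> a))"
proof -
  note d = dense1D[OF dense]
  obtain f where f: "isfun f A w1" "inje f A" using size1D[OF d(3)] by blast
  define lst where "lst U s x \<longleftrightarrow> x \<e> A & (~ x \<e> U & sub s x) & (ALL z. z \<e> A --> ~ z \<e> U & sub s z --> ~ app f z \<e> app f x)" for U s x
  have lst_D [dfi]: "T s ==> T t ==> T u ==> D (%e. lst (s e) (t e) (u e))" for s t u unfolding lst_def by (intro dfi dft_shift)
  have un1: "x = y" if "lst U s x" "lst U s y" for U s x y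
  proof -
    have xy: "x \<e> A" "y \<e> A" "~ app f x \<e> app f y" "~ app f y \<e> app f x" using that unfolding lst_def by blast+
    then have "app f x = app f y" using Ord_lin Ord_mem[OF w1(1)] f(1) unfolding isfun_def by blast
    then show ?thesis using f(2) xy unfolding inje_def by blast
  qed
  define Y where "Y U = sepS A (%x. EX s. s \<e> ND & lst U s x)" for U
  have Y_T [dfi]: "T s ==> T (%e. Y (s e))" for s unfolding Y_def by (intro dfi dft_shift)
  have "x \<e> Y U \<longleftrightarrow> x \<e> A & (EX s. s \<e> ND & lst U s x)" for x U unfolding Y_def by (rule sepS) (intro dfi)
  then have Y: "x \<e> Y U \<longleftrightarrow> (EX s. s \<e> ND & lst U s x)" for x U unfolding lst_def by blast
  have Yc: "ctbl (Y U)" for U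
  proof (rule cov_trans[OF ND_ctbl], rule covI[where F = "%s. un (sepS A (%x. lst U s x))"])
    show "T (%e. un (sepS A (lst U (e 0))))" by (intro dfi)
    fix y assume "y \<e> Y U"
    then obtain s where s: "s \<e> ND" "lst U s y" unfolding Y by blast
    have "z \<e> sepS A (lst U s) \<longleftrightarrow> z \<e> A & lst U s z" for z by (rule sepS) (intro dfi)
    moreover have "z \<e> A & lst U s z \<longleftrightarrow> z = y" for z using s(2) un1[of U s z y] unfolding lst_def by blast
    ultimately have "z \<e> sepS A (lst U s) \<longleftrightarrow> z = y" for z by blast
    then have "un (sepS A (lst U s)) = y" by (intro extens) simp
    then show "EX s. s \<e> ND & un (sepS A (lst U s)) = y" using s by blast
  qed
  define G where "G h g = Y (un (img (app g) h))" for h g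
  have G_T: "T (%e. G (e 0) (e (Suc 0)))" unfolding G_def by (intro dfi)
  define K where "K = rec G"
  have K_T [dfi]: "T s ==> T (%e. K (s e))" for s unfolding K_def by (rule rec_T[OF G_T])
  have K0: "T (%e. K (e 0))" by (intro dfi)
  define W where "W h = un (img K h)" for h
  have Wm: "x \<e> W h \<longleftrightarrow> (EX k. k \<e> h & x \<e> K k)" for x h unfolding W_def using K0 by auto
  have W_T [dfi]: "T s ==> T (%e. W (s e))" for s unfolding W_def by (intro dfi dft_shift)
  have im: "img (app (lam h K)) h = img K h" for h
  proof (rule extens)
    fix z
    have "T (%e. app (lam h K) (e 0))" by (intro dfi)
    then show "z \<e> img (app (lam h K)) h \<longleftrightarrow> z \<e> img K h" using K0 lam(2)[OF K0, of _ h] by (simp cong: conj_cong)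
  qed
  have KW: "K h = Y (W h)" for h
    using rec_eq[OF G_T, of h] unfolding K_def[symmetric] W_def by (simp only: G_def im)
  have Kc: "ctbl (K h)" for h unfolding KW by (rule Yc)
  have Wc: "ctbl (W h)" if "h \<e> w1" for h unfolding W_def
    using cov_trans[OF w1(3)[OF that] cov_img[OF K0]] Kc K0 by (intro ctbl_un) auto
  have KA: "x \<e> A & ~ x \<e> W h" if "x \<e> K h" for x h using that unfolding KW Y lst_def by blast
  have ne: "EX x. x \<e> K h & lst (W h) s x" if hs: "h \<e> w1" "s \<e> ND" for h s
  proof -
    have "~ sub (part A s) (W h)" using d(2)[OF hs(2)] Wc[OF hs(1)] cov_sub by blast
    then obtain x where x: "x \<e> A" "~ x \<e> W h & sub s x" unfolding sub_def[of "part A s"] part by blast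
    have "D (%e. ~ e 0 \<e> W h & sub s (e 0))" by (intro dfi)
    from least_index[OF f(1) this x] obtain y where "lst (W h) s y" unfolding lst_def by blast
    then show ?thesis using hs(2) unfolding KW Y by blast
  qed
  have disj: "h = k" if "h \<e> w1" "k \<e> w1" "x \<e> K h" "x \<e> K k" for h k x
  proof -
    have "~ h \<e> k" "~ k \<e> h" using KA[OF that(4)] KA[OF that(3)] that(3,4) unfolding Wm by blast+
    then show ?thesis using Ord_lin Ord_mem[OF w1(1)] that by blast
  qed
  have all: "EX h. h \<e> w1 & x \<e> K h" if x: "x \<e> A" for x
  proof (rule ccontr)
    assume n: "~ ?thesis"
    have "D (%e. e (Suc 0) \<e> K (e 0) & lst (W (e 0)) emp (e (Suc 0)))" by (intro dfi)
    from skolem[OF this, of w1] ne[OF _ ND_emp] obtain g where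
      g: "!!h. h \<e> w1 ==> app g h \<e> K h & lst (W h) emp (app g h)" by blast
    have fx: "app f x \<e> w1" using f(1) x unfolding isfun_def by blast
    have t: "T (%e. app f (app g (e 0)))" by (intro dfi)
    show False
    proof (rule w1_inj[OF Ord_mem[OF w1(1) fx] fx t])
      fix h assume h: "h \<e> w1"
      have "~ x \<e> W h" using n Ord_trsD[OF w1(1) h] unfolding Wm by blast
      moreover have "sub emp x" by (simp add: sub_def)
      ultimately show "app f (app g h) \<e> succ (app f x)"
        using g[OF h] x index_le[OF f(1) x] unfolding lst_def by blast
    next
      fix h k assume "h \<e> w1" "k \<e> w1" "app f (app g h) = app f (app g k)"
      then show "h = k" using g disj f(2) KA unfolding inje_def by metis
    qed
  qed
  \<comment> \<open>The points of a block are numbered by an injection into \<open>omega\<close>,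
    chosen for all blocks at once.\<close>
  have "D (%e. isfun (e (Suc 0)) (K (e 0)) omega & inje (e (Suc 0)) (K (e 0)))" by (intro dfi)
  from skolem[OF this, of w1] cov_inj[OF Kc] obtain C where
    C: "!!h. h \<e> w1 ==> isfun (app C h) (K h) omega & inje (app C h) (K h)" by blast
  define a where "a = sepS (prod (prod w1 omega) A) (%w. EX h y. h \<e> w1 & y \<e> K h & w = pair (pair h (app (app C h) y)) y)"
  have "w \<e> a \<longleftrightarrow> w \<e> prod (prod w1 omega) A & (EX h y. h \<e> w1 & y \<e> K h & w = pair (pair h (app (app C h) y)) y)" for w
    unfolding a_def by (rule sepS) (intro dfi)
  moreover have "pair (pair h (app (app C h) y)) y \<e> prod (prod w1 omega) A" if "h \<e> w1" "y \<e> K h" for h y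
    using that C[OF that(1)] KA[OF that(2)] unfolding isfun_def by simp
  ultimately have a: "w \<e> a \<longleftrightarrow> (EX h y. h \<e> w1 & y \<e> K h & w = pair (pair h (app (app C h) y)) y)" for w by blast
  have Afs: "isfun y omega S" if "y \<e> A" for y using d(1) that unfolding sub_def by simp
  have 1: "EX h n y x. h \<e> w1 & n \<e> omega & isfun y omega S & x = pair h n & p = pair x y" if "p \<e> a" for p
    using that C KA Afs unfolding a isfun_def[of "app C _"] by blast
  have 2: "x = u \<longleftrightarrow> y = v" if xy: "pair x y \<e> a" "pair u v \<e> a" for x y u v
  proof -
    obtain h where h: "h \<e> w1" "y \<e> K h" "x = pair h (app (app C h) y)" using xy(1) unfolding a pair_inj by blast
    obtain k where k: "k \<e> w1" "v \<e> K k" "u = pair k (app (app C k) v)" using xy(2) unfolding a pair_inj by blast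
    show ?thesis
    proof
      assume "x = u"
      then show "y = v" using h k C[OF h(1)] unfolding inje_def by auto
    next
      assume "y = v"
      then show "x = u" using h k disj[OF h(1) k(1)] by blast
    qed
  qed
  have 3: "EX n x y. x = pair h n & pair x y \<e> a & sub s y" if "h \<e> w1" "s \<e> ND" for h s
    using ne[OF that] that(1) unfolding a lst_def by blast
  have "y \<e> A \<longleftrightarrow> (EX x. pair x y \<e> a)" for y
  proof
    assume "y \<e> A"
    from all[OF this] obtain h where "h \<e> w1" "y \<e> K h" by blast
    then have "pair (pair h (app (app C h) y)) y \<e> a" unfolding a by blast
    then show "EX x. pair x y \<e> a" by blast
  next
    assume "EX x. pair x y \<e> a"
    then obtain x where "pair x y \<e> a" by blast
    then obtain h where "y \<e> K h" unfolding a pair_inj by blast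
    then show "y \<e> A" using KA by blast
  qed
  moreover have "Theta a" unfolding Theta_def
  proof (intro conjI allI impI)
    show "p \<e> a ==> EX h n y x. h \<e> w1 & n \<e> omega & isfun y omega S & x = pair h n & p = pair x y" for p by (rule 1)
    show "pair x y \<e> a & pair u v \<e> a ==> x = u \<longleftrightarrow> y = v" for x y u v by (elim conjE) (rule 2)
    show "h \<e> w1 & s \<e> ND ==> EX n x y. x = pair h n & pair x y \<e> a & sub s y" for h s by (elim conjE) (rule 3)
  qed
  ultimately show ?thesis by blast
qed

end

text \<open>\<open>Theta\<close> as a formula, so that a condition can force it; \<open>w1\<close>,
  \<open>omega\<close>, \<open>S\<close> and the set of nodes enter as parameters.\<close>

definition theta_s :: "nat => nat => nat => nat => nat => sfm" where
  "theta_s a k w S nd =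
   ((\<^bold>\<forall>p. p \<^bold>\<in> a \<^bold>\<longrightarrow> (\<^bold>\<exists>h n y x. h \<^bold>\<in> k \<^bold>\<and> n \<^bold>\<in> w \<^bold>\<and> function_s y w S \<^bold>\<and> pair_s h n x \<^bold>\<and> pair_s x y p)) \<^bold>\<and>
    (\<^bold>\<forall>x y u v. app_s a x y \<^bold>\<and> app_s a u v \<^bold>\<longrightarrow> (x \<^bold>= u \<^bold>\<longleftrightarrow> y \<^bold>= v)) \<^bold>\<and>
    (\<^bold>\<forall>h s. h \<^bold>\<in> k \<^bold>\<and> s \<^bold>\<in> nd \<^bold>\<longrightarrow> (\<^bold>\<exists>n x y. pair_s h n x \<^bold>\<and> app_s a x y \<^bold>\<and> s \<^bold>\<subseteq> y)))"

lemma (in nodes) sat_theta: "sat E e (theta_s 0 1 2 3 4 5) \<longleftrightarrow> Theta (e 0)"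
  if "e 1 = w1" "e 2 = omega" "e 3 = S" "e 4 = ND"
  using that
  by (simp add: theta_s_def Theta_def sfm_sat sat_pair sat_app sat_function sat_subset del: fun_upd_apply)

definition env3 :: "'a => 'a => 'a => nat => 'a" where
  "env3 a b c = (%i. if i = 0 then a else if i = 1 then b else c)"
lemma env3 [simp]: "env3 a b c 0 = a" "env3 a b c (Suc 0) = b" "env3 a b c 2 = c" by (auto simp: env3_def)
lemma env3_comp: "(%i. f (env3 a b c i)) = env3 (f a) (f b) (f c)" by (auto simp: env3_def)

context forcing
begin

lemma frc3_D: "T s ==> T t ==> T u ==> T v ==> D (%e. frc (s e) (env3 (t e) (u e) (v e)) a)"
proof -
  assume t: "T s" "T t" "T u" "T v"
  have "D (%e. frc (s e) (%i. (if i = 0 then t else if i = 1 then u else v) e) a)"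
    by (rule frc_D) (use t in auto)
  moreover have "(%i. (if i = 0 then t else if i = 1 then u else v) e) = env3 (t e) (u e) (v e)" for e
    by (auto simp: env3_def)
  ultimately show ?thesis by (simp only:)
qed

lemma forces_generic: "generic E P G ==> p \<in> G ==> frc p e a ==> sat (generic.EG E P G) (%i. generic.val E P G (e i)) a"
  using generic.truth by blast

end

locale bgen = baum E S + generic E "baum.PP E S" G for E :: "nat => nat => bool" (infix "\<e>" 50) and S and G

section \<open>Countable predense sets and nice names\<close>

context baum
begin

lemma bgenI: "generic E PP G ==> bgen E S G"
  unfolding bgen_def using baum_axioms by blast

text \<open>If no countable set would do, a recursion of length \<open>w1\<close> could pick
  pairwise incompatible conditions with \<open>Q\<close>, against the chain condition.\<close>

lemma predense: assumes Q: "D (%e. Q (e 0))"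
  shows "EX d. ctbl d & (ALL q. q \<e> d --> q \<e> PP & Q q) &
    (ALL q. q \<e> PP --> Q q --> (EX q0 r. q0 \<e> d & r \<e> PP & sub q r & sub q0 r))"
proof (rule ccontr)
  assume neg: "~ ?thesis"
  note dfc1[OF Q, dfi]
  define A where "A = sepS PP Q"
  have A: "q \<e> A \<longleftrightarrow> q \<e> PP & Q q" for q unfolding A_def by (rule sepS) (intro dfi)
  define cp where "cp q q' \<longleftrightarrow> (EX r. r \<e> PP & sub q r & sub q' r)" for q q'
  have cp_D [dfi]: "T s ==> T t ==> D (%e. cp (s e) (t e))" for s t unfolding cp_def by (intro dfi dft_shift)
  define R where "R h f = sepS A (%q. ~ (EX i. i \<e> h & cp q (app f i)))" for h f
  have R: "q \<e> R h f \<longleftrightarrow> q \<e> A & ~ (EX i. i \<e> h & cp q (app f i))" for q h f unfolding R_def by (rule sepS) (intro dfi)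
  have dd: "D (%e. EX z. z \<e> e 0)" by (intro dfi)
  have "!!y. y \<e> sepS (pw A) (%y. EX z. z \<e> y) ==> EX z. z \<e> y" by (simp add: sepS[OF dd])
  from choice_function[OF this] obtain c where
    c0: "!!y. y \<e> sepS (pw A) (%y. EX z. z \<e> y) ==> app c y \<e> y" by blast
  have c: "app c y \<e> y" if "sub y A" "EX z. z \<e> y" for y using c0[of y] that by (simp add: sepS[OF dd] sub_def)
  have G_T: "T (%e. app c (R (e 0) (e (Suc 0))))" unfolding R_def by (intro dfi)
  define s where "s = rec (%h f. app c (R h f))"
  have s_T [dfi]: "T t ==> T (%e. s (t e))" for t unfolding s_def by (rule rec_T[OF G_T])
  have s0: "T (%e. s (e 0))" by (intro dfi)
  have sR: "s h = app c (R h (lam h s))" for h unfolding s_def by (rule rec_eq[OF G_T])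
  have good: "h \<e> w1 --> s h \<e> A & ~ (EX i. i \<e> h & cp (s h) (s i))" for h
  proof (induct h rule: eps_induct)
    case D show ?case by (intro dfi)
  next
    case (step h)
    show ?case
    proof
      assume h: "h \<e> w1"
      have iA: "s i \<e> A" if "i \<e> h" for i using step[OF that] Ord_trsD[OF w1(1) h that] by blast
      have "ctbl (img s h)" using cov_trans[OF w1(3)[OF h] cov_img[OF s0]] .
      moreover have "ALL q. q \<e> img s h --> q \<e> PP & Q q" using iA s0 unfolding A by auto
      ultimately obtain q where q: "q \<e> A" "!!q0. q0 \<e> img s h ==> ~ cp q q0" using neg unfolding A cp_def by blast
      have "q \<e> R h (lam h s)" unfolding R using q s0 lam(2)[OF s0, of _ h] by auto
      moreover have "sub (R h (lam h s)) A" unfolding sub_def R by blast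
      ultimately have "s h \<e> R h (lam h s)" unfolding sR[of h] using c by blast
      then show "s h \<e> A & ~ (EX i. i \<e> h & cp (s h) (s i))" unfolding R using lam(2)[OF s0, of _ h] by auto
    qed
  qed
  have "!!i. i \<e> w1 ==> s i \<e> PP & emp \<e> upair emp emp" using good unfolding A by simp
  from ccc_P[OF w1(2) s0 dft_const fin_ctbl[OF fin_upair] this] obtain i k where
    ik: "i \<e> w1" "k \<e> w1" "i ~= k" "cup (s i) (s k) \<e> PP" by blast
  have cp: "cp (s i) (s k)" "cp (s k) (s i)" unfolding cp_def using ik(4) by (auto intro!: exI[of _ "cup (s i) (s k)"] simp: sub_def)
  have "i \<e> k | k \<e> i" using Ord_lin Ord_mem[OF w1(1)] ik by blast
  then show False using good cp ik by blast
qed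

definition incl_s :: sfm where "incl_s = (\<^bold>\<exists>y. app_s 0 1 y \<^bold>\<and> 2 \<^bold>\<subseteq> y)"
abbreviation "fst3 q a x s \<equiv> frc q (env3 a (chk x) (chk s)) (incl_s 3)"

text \<open>For a point \<open>x\<close> and a level \<open>k\<close>, countably many conditions
  suffice to decide the initial segment of length \<open>k\<close>. So \<open>N\<close> has no more
  elements than \<open>X1\<close> and belongs to \<open>II\<close>.\<close>

lemma nice_name: assumes J: "sub J X1"
  shows "EX N. N \<e> II & (ALL q x s. pair q (pair x s) \<e> N --> q \<e> PP & x \<e> J & s \<e> ND & fst3 q a x s) &
   (ALL G x k. generic E PP G --> x \<e> J --> k \<e> omega --> (EX q s. q \<in> G & isfun s k S & fst3 q a x s) -->
      (EX q s. q \<in> G & isfun s k S & pair q (pair x s) \<e> N))"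
proof -
  define Q where "Q w q \<longleftrightarrow> (EX s. isfun s (snd w) S & fst3 q a (fst w) s)" for w q
  have Q_D [dfi]: "T s ==> T t ==> D (%e. Q (s e) (t e))" for s t unfolding Q_def by (intro dfi dft_shift frc3_D)
  define B where "B w d \<longleftrightarrow> ctbl d & (ALL q. q \<e> d --> q \<e> PP & Q w q) &
    (ALL q. q \<e> PP --> Q w q --> (EX q0 r. q0 \<e> d & r \<e> PP & sub q r & sub q0 r))" for w d
  have "D (%e. B (e 0) (e (Suc 0)))" unfolding B_def by (intro dfi)
  moreover have "EX d. B w d" for w unfolding B_def by (rule predense) (intro dfi)
  ultimately obtain dd where dd: "!!w. w \<e> prod J omega ==> B w (app dd w)" using skolem[of B "prod J omega"] by blast
  define N where "N = sepS (prod PP (prod J ND)) (%w. EX q x s k. w = pair q (pair x s) & k \<e> omega & isfun s k S & q \<e> app dd (pair x k) & fst3 q a x s)"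
  have N: "w \<e> N \<longleftrightarrow> w \<e> prod PP (prod J ND) & (EX q x s k. w = pair q (pair x s) & k \<e> omega & isfun s k S & q \<e> app dd (pair x k) & fst3 q a x s)" for w
    unfolding N_def by (rule sepS) (intro dfi frc3_D)
  have t: "T (%e. app dd (e 0))" by (intro dfi)
  let ?U = "un (img (app dd) (prod J omega))"
  have cX: "cov X1 x" if "ctbl x" for x using cov_dom[OF that omega_sub_X1] .
  have c1: "cov X1 (prod J omega)"
    using cov_trans[OF X1_cov_prod cov_prod[OF cov_of_sub[OF J] cov_of_sub[OF omega_sub_X1]]] .
  have "cov (prod X1 X1) ?U"
  proof (rule cov_union)
    show "cov X1 (img (app dd) (prod J omega))" using cov_trans[OF c1 cov_img[OF t]] .
    fix y assume "y \<e> img (app dd) (prod J omega)"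
    then show "cov X1 y" using t dd cX unfolding B_def by auto
  qed
  then have cU: "cov X1 ?U" using cov_trans[OF X1_cov_prod] by blast
  have cJN: "cov X1 (prod J ND)"
    using cov_trans[OF X1_cov_prod cov_prod[OF cov_of_sub[OF J] cX[OF ND_ctbl]]] .
  have "sub N (prod ?U (prod J ND))"
  proof (rule subI)
    fix w assume "w \<e> N"
    then obtain q x s k where w: "w = pair q (pair x s)" "k \<e> omega" "q \<e> app dd (pair x k)" "x \<e> J" "s \<e> ND" unfolding N by auto
    have "app dd (pair x k) \<e> img (app dd) (prod J omega)" unfolding img[OF t] using w by (intro exI[of _ "pair x k"]) simp
    then have "q \<e> ?U" unfolding un using w by blast
    then show "w \<e> prod ?U (prod J ND)" using w by simp
  qed
  then have "cov X1 N" using cov_sub cov_trans[OF X1_cov_prod cov_prod[OF cU cJN]] by blast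
  moreover have "sub N II"
  proof (rule subI)
    fix w assume "w \<e> N"
    then obtain q x s where w: "w = pair q (pair x s)" "q \<e> PP" "x \<e> J" "s \<e> ND" unfolding N by auto
    have "s \<e> II" using ZZ_ND[OF w(4)] ZZ(2) X1_in_II unfolding sub_def by blast
    then show "w \<e> II" using w PP_II J X1_in_II II_pair unfolding sub_def by simp
  qed
  ultimately have "N \<e> II" by (intro II_closed)
  moreover have "EX q s. q \<in> G & isfun s k S & pair q (pair x s) \<e> N"
    if g: "generic E PP G" and x: "x \<e> J" "k \<e> omega" and q: "q \<in> G" "isfun s k S" "fst3 q a x s" for G x k q s
  proof -
    interpret G: generic E PP G by (rule g)
    have xk: "pair x k \<e> prod J omega" using x by simp
    have "EX r. r \<in> G & sub q r & (EX q0. q0 \<e> app dd (pair x k) & sub q0 r)"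
    proof (rule G.gen_below[OF _ q(1)])
      show "D (%e. EX q0. q0 \<e> app dd (pair x k) & sub q0 (e 0))" by (intro dfi)
      fix r assume r: "r \<e> PP" "sub q r"
      have "Q (pair x k) r" unfolding Q_def fst snd using frc_mono[OF q(3) r] q(2) by blast
      then obtain q0 r' where "q0 \<e> app dd (pair x k)" "r' \<e> PP" "sub r r'" "sub q0 r'"
        using dd[OF xk] r(1) unfolding B_def by blast
      then show "EX r'. r' \<e> PP & sub r r' & (EX q0. q0 \<e> app dd (pair x k) & sub q0 r')" by blast
    qed
    then obtain r q0 where r: "r \<in> G" "q0 \<e> app dd (pair x k)" "sub q0 r" by blast
    then have q0: "q0 \<e> PP" "Q (pair x k) q0" using dd[OF xk] unfolding B_def by blast+
    then obtain s0 where s0: "isfun s0 k S" "fst3 q0 a x s0" unfolding Q_def fst snd by blast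
    then have "pair q0 (pair x s0) \<e> N" unfolding N using x q0 r(2) ND by auto
    moreover have "q0 \<in> G" using G.G_up[OF r(1) q0(1) r(3)] .
    ultimately show ?thesis using s0 by blast
  qed
  moreover have "ALL q x s. pair q (pair x s) \<e> N --> q \<e> PP & x \<e> J & s \<e> ND & fst3 q a x s" unfolding N by auto
  ultimately show ?thesis by blast
qed

end

section \<open>Absoluteness of nodes and preservation of aleph_1\<close>

context bgen
begin

lemma nodesN: "nodes EG (j S)"
proof unfold_locales
  show "N.sub (j S) N.omega" unfolding N.sub_def EG_j j_omega[symmetric] using S_omega unfolding sub_def by auto
  show "EG N.emp (j S)" unfolding j_emp[symmetric] using S_0 by simp
  show "EG (N.succ N.emp) (j S)" unfolding j_emp[symmetric] j_succ[symmetric] using S_1 by simp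
qed

sublocale NN: nodes EG "j S" by (rule nodesN)

lemma j_isfun: assumes "isfun s l b" shows "N.isfun (j s) (j l) (j b)"
  using assms j_fn[of s l] unfolding N.isfun_def isfun_def EG_j by auto

text \<open>By induction in the extension on the length: the last value is old and is adjoined to an
  old sequence.\<close>

lemma j_isfun_conv: assumes l: "l \<e> omega" and t: "N.isfun t (j l) (j S)" shows "EX s. t = j s & isfun s l S"
proof -
  have "EG n N.omega ==> ALL t. N.isfun t n (j S) --> EG t (j ND)" for n
  proof (induct rule: N.omega_induct)
    case D show ?case by (intro dfi)
  next
    case emp
    show ?case
    proof (intro allI impI)
      fix t assume t: "N.isfun t N.emp (j S)"
      have "t = N.emp" using t unfolding N.isfun_iff N.emp_iff by auto
      then show "EG t (j ND)" using ND_emp j_emp by (metis EG_jj)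
    qed
  next
    case (succ n)
    show ?case
    proof (intro allI impI)
      fix t assume t: "N.isfun t (N.succ n) (j S)"
      have ns: "N.sub n (N.succ n)" by (simp add: N.sub_def)
      obtain t' where t': "N.isfun t' n (j S)" "N.sub t' t" using NN.restr_ex[OF t ns] by blast
      then obtain s' where s': "s' \<e> ND" "t' = j s'" using succ(2) unfolding EG_j by blast
      obtain m where m: "m \<e> omega" "n = j m" using succ(1) unfolding j_omega[symmetric] EG_j by blast
      have "EG (N.app t n) (j S)" using t unfolding N.isfun_def by simp
      then obtain d where d: "d \<e> S" "N.app t n = j d" unfolding EG_j by blast
      obtain l' where l': "l' \<e> omega" "isfun s' l' S" using ND_fun[OF s'(1)] by blast
      have "j l' = n" using N.fn_cong_dom j_isfun[OF l'(2)] t'(1) s'(2) unfolding N.isfun_def by blast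
      then have lm: "l' = m" using m by simp
      let ?s = "adj s' (pair m d)"
      have sf: "isfun ?s (zfc.succ E m) S" using node_adj[OF _ d(1) m(1)] l' lm by blast
      have "t = j ?s"
      proof (rule NN.fun_ext[OF t])
        show jf: "N.isfun (j ?s) (N.succ n) (j S)" using j_isfun[OF sf] m j_succ by simp
        fix i assume i: "EG i (N.succ n)"
        have pr: "EG p t \<longleftrightarrow> EG p (j ?s)" if "p = N.pair i (N.app t i)" for p
        proof -
          have "EG p t" using N.fn_app[of t "N.succ n" i] t i that unfolding N.isfun_def by blast
          moreover have "EG p (j ?s)"
          proof (cases "i = n")
            case True
            then have "p = j (pair m d)" using that m d j_pair by simp
            then show ?thesis by simp
          next
            case False
            then have "EG i n" using i by simp
            then have "EG (N.pair i (N.app t' i)) t'" using N.fn_app[of t' n i] t'(1) unfolding N.isfun_def by blast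
            moreover have "N.app t' i = N.app t i" using t'(2) \<open>EG i n\<close> unfolding NN.sub_fun[OF t'(1) t] by blast
            ultimately have "EG p (j s')" using that s'(2) by simp
            then show ?thesis unfolding EG_j by auto
          qed
          ultimately show ?thesis by blast
        qed
        have "EG (N.pair i (N.app t i)) (j ?s)" using pr[OF refl] N.fn_app[of t "N.succ n" i] t i unfolding N.isfun_def by blast
        then show "N.app t i = N.app (j ?s) i" using N.fn_app[of "j ?s" "N.succ n" i] jf i unfolding N.isfun_def by blast
      qed
      moreover have "?s \<e> ND" using sf omega_succ[OF m(1)] ND by blast
      ultimately show "EG t (j ND)" by simp
    qed
  qed
  moreover have "EG (j l) N.omega" using l unfolding j_omega[symmetric] by simp
  ultimately have "EG t (j ND)" using t by blast
  then obtain s where s: "s \<e> ND" "t = j s" unfolding EG_j by blast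
  obtain l' where l': "l' \<e> omega" "isfun s l' S" using ND_fun[OF s(1)] by blast
  have "j l' = j l" using N.fn_cong_dom j_isfun[OF l'(2)] t s(2) unfolding N.isfun_def by blast
  then show ?thesis using s l' by auto
qed

lemma j_ND: "j ND = NN.ND"
proof (rule N.extens)
  fix z
  show "EG z (j ND) \<longleftrightarrow> EG z NN.ND"
    unfolding NN.ND EG_j ND j_omega[symmetric] using j_isfun j_isfun_conv by blast
qed

lemma j_sub [simp]: "N.sub (j x) (j y) \<longleftrightarrow> sub x y" unfolding N.sub_def EG_j sub_def by auto

text \<open>If \<open>w1\<close> became countable, a condition below \<open>p\<close> could be
  chosen for each index to decide the value of an injection into \<open>omega\<close>. The chain
  condition yields two compatible ones with the same value at different arguments, and a generic
  filter through both refutes injectivity.\<close>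

lemma j_w1: "j w1 = N.w1"
proof -
  have "~ N.ctbl (j w1)"
  proof
    assume "N.ctbl (j w1)"
    then obtain f where f: "N.isfun f (j w1) N.omega" "N.injR f (j w1)" unfolding N.ctbl_iff by blast
    obtain fn where fn: "f = val fn" using val_surj by blast
    let ?A = "And (function_s 0 1 2 3) (injective_on_s 0 1 3)"
    have "sat EG (%i. val (env3 fn (chk w1) (chk omega) i)) ?A"
      unfolding env3_comp fn[symmetric] j_def[symmetric] using f by (simp add: N.sat_function N.sat_inj j_omega)
    then obtain p where p: "p \<in> G" "frc p (env3 fn (chk w1) (chk omega)) ?A" unfolding truth by blast
    define Q where "Q i w \<longleftrightarrow> fst w \<e> PP & sub p (fst w) & snd w \<e> omega & frc (fst w) (env3 fn (chk i) (chk (snd w))) (app_s 0 1 2 3)" for i w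
    have Q_D: "D (%e. Q (e 0) (e (Suc 0)))" unfolding Q_def by (intro dfi frc3_D)
    have "EX w. Q i w" if i: "i \<e> w1" for i
    proof -
      have "EG (N.app f (j i)) N.omega" "EG (N.pair (j i) (N.app f (j i))) f"
        using f(1) i N.fn_app[of f "j w1" "j i"] unfolding N.isfun_def by auto
      then obtain n where n: "n \<e> omega" "N.app f (j i) = j n" unfolding j_omega[symmetric] EG_j by blast
      then have n: "n \<e> omega" "EG (N.pair (j i) (j n)) f" using \<open>EG (N.pair (j i) (N.app f (j i))) f\<close> by simp_all
      then have "sat EG (%k. val (env3 fn (chk i) (chk n) k)) (app_s 0 1 2 3)"
        unfolding env3_comp fn[symmetric] j_def[symmetric] by (simp add: N.sat_app)
      then obtain q where q: "q \<in> G" "frc q (env3 fn (chk i) (chk n)) (app_s 0 1 2 3)" unfolding truth by blast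
      obtain r where r: "r \<in> G" "sub p r" "sub q r" using G_dir[OF p(1) q(1)] by blast
      then have "Q i (pair r n)" unfolding Q_def fst snd using frc_mono[OF q(2)] G_P n by blast
      then show ?thesis by blast
    qed
    then obtain g where g: "!!i. i \<e> w1 ==> Q i (app g i)" using skolem[OF Q_D, of w1] by blast
    have t: "T (%e. fst (app g (e 0)))" "T (%e. snd (app g (e 0)))" by (intro dfi)+
    have "!!i. i \<e> w1 ==> fst (app g i) \<e> PP & snd (app g i) \<e> omega" using g unfolding Q_def by blast
    from ccc_P[OF w1(2) t cov_refl this] obtain i k where ik: "i \<e> w1" "k \<e> w1" "i ~= k"
      "snd (app g i) = snd (app g k)" "cup (fst (app g i)) (fst (app g k)) \<e> PP" by blast
    let ?r = "cup (fst (app g i)) (fst (app g k))"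
    \<comment> \<open>A new generic filter takes the place of reasoning about what the union
      forces.\<close>
    obtain G' where G': "?r \<in> G'" "generic E PP G'" using generic_exists[OF ik(5)] by blast
    interpret G': generic E PP G' by (rule G'(2))
    have sb: "sub (fst (app g i)) ?r" "sub (fst (app g k)) ?r" by (auto simp: sub_def)
    have in': "fst (app g i) \<in> G'" "fst (app g k) \<in> G'" using G'.G_up[OF G'(1)] sb g ik unfolding Q_def by blast+
    have "p \<in> G'" using G'.G_up[OF in'(1)] g[OF ik(1)] G_P[OF p(1)] unfolding Q_def by blast
    from forces_generic[OF G'(2) this p(2)]
    have inj: "G'.N.injR (G'.val fn) (G'.j w1)" unfolding env3_comp G'.j_def[symmetric] by (simp add: G'.N.sat_inj)
    have ap: "EG' (G'.N.pair (G'.j x) (G'.j (snd (app g x)))) (G'.val fn)" if "x \<e> w1" "fst (app g x) \<in> G'" "EG' = G'.EG" for x EG'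
      using forces_generic[OF G'(2) that(2), of "env3 fn (chk x) (chk (snd (app g x)))" "app_s 0 1 2 3"] g[OF that(1)] that(3)
      unfolding env3_comp G'.j_def[symmetric] Q_def by (simp add: G'.N.sat_app)
    have "G'.j i = G'.j k"
      using inj ap[OF ik(1) in'(1) refl] ap[OF ik(2) in'(2) refl] ik(1,2,4) unfolding G'.N.injR_def
      by (metis G'.EG_jj)
    then show False using ik(3) by simp
  qed
  moreover have "N.Ord (j w1)" by (rule j_Ord[OF w1(1)])
  moreover have "EG a (j w1) ==> N.ctbl a" for a unfolding EG_j using j_cov[OF w1(3)] j_omega by auto
  ultimately show ?thesis using N.w1_unique[of "j w1"] by blast
qed

end

section \<open>Baumgartner's axiom in the extension\<close>

context generic
begin

text \<open>The filter cannot be used in an induction inside the model, so that finitely many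
  choices from it are made by a density argument.\<close>

lemma G_fin:
  assumes Q: "D (%e. Q (e 0) (e (Suc 0)))" and F: "fin F"
    and mono: "!!w q r. Q w q ==> sub q r ==> Q w r"
    and ex: "!!w. w \<e> F ==> EX q. q \<in> G & Q w q"
  shows "EX r. r \<in> G & (ALL w. w \<e> F --> Q w r)"
proof -
  note dfc2[OF Q, dfi]
  \<comment> \<open>Either all of \<open>u\<close> is settled or some \<open>w\<close> is refused by
    every extension; a condition of \<open>G\<close> cannot refuse, as some member of
    \<open>G\<close> satisfies \<open>Q w\<close>.\<close>
  define R where "R u r \<longleftrightarrow> (ALL w. w \<e> u --> Q w r) | (EX w. w \<e> F & (ALL r'. r' \<e> P --> sub r r' --> ~ Q w r'))" for u r
  have R_D [dfi]: "T s ==> T t ==> D (%e. R (s e) (t e))" for s t unfolding R_def by (intro dfi dft_shift)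
  have "sub u F --> (ALL r. r \<e> P --> (EX r'. r' \<e> P & sub r r' & R u r'))" if "fin u" for u
    using that
  proof (induct rule: fin_induct)
    case D show ?case by (intro dfi)
  next
    case emp show ?case unfolding R_def using sub_refl by auto
  next
    case (adj u x)
    have am: "z \<e> zfc.adj E u x \<longleftrightarrow> z \<e> u | z = x" for z by simp
    show ?case
    proof (intro impI allI)
      fix r assume "sub (zfc.adj E u x) F" and r: "r \<e> P"
      then have u: "sub u F" "x \<e> F" by (auto simp: sub_def)
      then obtain r1 where r1: "r1 \<e> P" "sub r r1" "R u r1" using adj(2) r by blast
      show "EX r'. r' \<e> P & sub r r' & R (zfc.adj E u x) r'"
      proof (cases "EX r2. r2 \<e> P & sub r1 r2 & Q x r2")
        case True
        then obtain r2 where r2: "r2 \<e> P" "sub r1 r2" "Q x r2" by blast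
        have "R (zfc.adj E u x) r2"
          using r1(3) mono[OF _ r2(2)] r2(3) sub_trans[OF r2(2)] unfolding R_def am by blast
        then show ?thesis using r2 sub_trans[OF r1(2)] by blast
      next
        case False
        then have "R (zfc.adj E u x) r1" unfolding R_def using u(2) by blast
        then show ?thesis using r1 by blast
      qed
    qed
  qed
  then have d: "!!r. r \<e> P ==> EX r'. r' \<e> P & sub r r' & R F r'" using F sub_refl by blast
  have "EX q. q \<in> G & sub emp q & R F q" by (rule gen_below[OF _ G_one]) (intro dfi, use d in blast)
  then obtain q where q: "q \<in> G" "R F q" by blast
  have "EX r'. r' \<e> P & sub q r' & Q w r'" if wF: "w \<e> F" for w
  proof -
    obtain q' where q': "q' \<in> G" "Q w q'" using ex[OF wF] by blast
    obtain r where r: "r \<in> G" "sub q r" "sub q' r" using G_dir[OF q(1) q'(1)] by blast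
    then show ?thesis using mono[OF q'(2) r(3)] G_P by blast
  qed
  then show ?thesis using q unfolding R_def by blast
qed

text \<open>The check name of \<open>w\<close> enters with exactly those conditions that contain
  \<open>w\<close>.\<close>

lemma G_set: "EX U. ALL z. EG z U \<longleftrightarrow> (EX r w. r \<in> G & w \<e> r & z = j w)"
proof -
  have t: "T (%e. chk (e 0))" by (intro dfi)
  define y where "y = sepS (prod (img chk (un P)) P) (%z. EX w r. z = pair (chk w) r & w \<e> r)"
  have m: "z \<e> y \<longleftrightarrow> z \<e> prod (img chk (un P)) P & (EX w r. z = pair (chk w) r & w \<e> r)" for z
    unfolding y_def by (rule sepS) (intro dfi)
  have nm: "nm y u q \<longleftrightarrow> q \<e> P & (EX w. u = chk w & w \<e> q)" for u q
    unfolding nm_def m[of "pair u q"] prod_pair pair_inj img[OF t] un by blast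
  have "EG z (val y) \<longleftrightarrow> (EX r w. r \<in> G & w \<e> r & z = j w)" for z
    unfolding EG_val memG_def nm val_eq[symmetric] val_nam j_def using G_P by blast
  then show ?thesis by blast
qed

lemma j_fin: "fin x ==> N.fin (j x)"
  unfolding fin_def N.fin_def j_omega[symmetric] using j_cov EG_jj by meson

end

context nodes
begin

lemma ThetaD: assumes "Theta a"
  shows "p \<e> a ==> EX h n y x. h \<e> w1 & n \<e> omega & isfun y omega S & x = pair h n & p = pair x y"
    "pair x y \<e> a ==> pair u v \<e> a ==> x = u \<longleftrightarrow> y = v"
    "h \<e> w1 ==> s \<e> ND ==> EX n x y. x = pair h n & pair x y \<e> a & sub s y"
    "pair x y \<e> a ==> isfun y omega S"
    "pair x y \<e> a ==> app a x = y"
proof -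
  note t = assms[unfolded Theta_def]
  show 1: "p \<e> a ==> EX h n y x. h \<e> w1 & n \<e> omega & isfun y omega S & x = pair h n & p = pair x y" for p
    using t[THEN conjunct1] by blast
  show 2: "pair x y \<e> a ==> pair u v \<e> a ==> x = u \<longleftrightarrow> y = v" for x y u v
    using t[THEN conjunct2, THEN conjunct1] by blast
  show "h \<e> w1 ==> s \<e> ND ==> EX n x y. x = pair h n & pair x y \<e> a & sub s y"
    using t[THEN conjunct2, THEN conjunct2] by blast
  show "pair x y \<e> a ==> isfun y omega S" using 1[of "pair x y"] by auto
  show "app a x = y" if "pair x y \<e> a"
    by (rule extens) (use that 2[OF that] in \<open>auto simp: app\<close>)
qed

end

context baum
begin

subsection \<open>Extending conditions at a coordinate\<close>

text \<open>A permutation of a level at least as high as all those at \<open>c0 a\<close>, coherent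
  with them and obeying every match already promised. If \<open>r\<close> has none at
  \<open>c0 a\<close>, the permutation of level 0 serves.\<close>

definition top where "top r a p l \<longleftrightarrow> p \<e> ZZ & Perm p l &
  (ALL p'. pair (c0 a) p' \<e> r --> coh p' p & (EX l'. Perm p' l' & sub l' l)) &
  (ALL h n m. pair (c1 a h) (pair n m) \<e> r --> match r a h n m p)"

lemma fin_fib: assumes "cond r" shows "fin (fib r c)"
proof -
  have t: "T (%e. snd (e 0))" by (intro dfi)
  have "sub (fib r c) (img snd r)" unfolding sub_def fib img[OF t] using snd by metis
  then show ?thesis using fin_sub fin_img[OF t condD(1)[OF assms]] by blast
qed

lemma top_ex: assumes r: "cond r" shows "EX p l. top r a p l & ((EX p. pair (c0 a) p \<e> r) --> pair (c0 a) p \<e> r)"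
proof (cases "EX p. pair (c0 a) p \<e> r")
  case True
  then obtain p0 where p0: "p0 \<e> fib r (c0 a)" unfolding fib by blast
  have "!!p. p \<e> fib r (c0 a) ==> EX l. Perm p l" unfolding fib using cond0[OF r] by blast
  from max_perm[OF fin_fib[OF r] this p0] obtain p l
    where p: "p \<e> fib r (c0 a)" "Perm p l" "!!p' l'. p' \<e> fib r (c0 a) ==> Perm p' l' ==> sub l' l" by blast
  have "top r a p l" unfolding top_def
  proof (intro conjI allI impI)
    show "p \<e> ZZ" using cond0[OF r] p(1) unfolding fib by blast
    show "coh p' p" if "pair (c0 a) p' \<e> r" for p' using condD(3)[OF r that] p(1) unfolding fib by blast
    show "EX l'. Perm p' l' & sub l' l" if "pair (c0 a) p' \<e> r" for p' using cond0[OF r that] p(3) that unfolding fib by blast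
    show "match r a h n m p" if "pair (c1 a h) (pair n m) \<e> r" for h n m using condD(6)[OF r that] p(1) unfolding fib by blast
  qed (rule p(2))
  then show ?thesis using p(1) unfolding fib by blast
next
  case False
  let ?p = "adj emp (pair emp emp)"
  have e: "isfun s emp S \<longleftrightarrow> s = emp" for s unfolding isfun_iff emp_iff by auto
  have "Perm ?p emp" unfolding Perm_def e by simp
  moreover have "?p \<e> ZZ" using ZZ(3,4) ZZ_pair by blast
  moreover have "~ pair (c1 a h) x \<e> r" for h x using False condD(5)[OF r] by blast
  ultimately have "top r a ?p emp" unfolding top_def using False by blast
  then show ?thesis using False by blast
qed

text \<open>Amalgamation at the rank of \<open>a\<close>: \<open>r'\<close> contributes all that it
  decides about the two names, while the coordinates at \<open>a\<close> stay as in
  \<open>r\<close>.\<close>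

lemma amalgam_name: assumes r: "cond r" "cond r'" "sub r r'"
  shows "EX u. cond u & sub r u & (ALL x. pair (c0 a) x \<e> u \<longleftrightarrow> pair (c0 a) x \<e> r) &
    (ALL h x. pair (c1 a h) x \<e> u \<longleftrightarrow> pair (c1 a h) x \<e> r) &
    (ALL N x s. N = fst a | N = snd a --> dec r' N x s --> dec u N x s)"
proof -
  obtain b where b: "sub a (V b)" "~ a \<e> V b" using rank_ex by blast
  let ?u = "cup r (sepS r' (low b))"
  have "w \<e> sepS r' (low b) \<longleftrightarrow> w \<e> r' & low b w" for w by (rule sepS) (unfold low_def, intro dfi)
  then have m: "w \<e> ?u \<longleftrightarrow> w \<e> r | w \<e> r' & low b w" for w by simp
  have V: "sub N (V b)" if Na: "N = fst a | N = snd a" for N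
  proof (rule subI)
    fix y assume y: "y \<e> N"
    then obtain u v where uv: "a = pair u v" using Na fst_snd_pair by blast
    have "upair u v \<e> V b" using b(1) unfolding uv pair_def sub_def by simp
    then have "u \<e> V b" "v \<e> V b" using V_trs trsD by (metis upair)+
    then show "y \<e> V b" using y Na uv V_trs trsD by auto
  qed
  have d: "dec ?u N x s" if "N = fst a | N = snd a" "dec r' N x s" for N x s
    using that(2) name_low[OF V[OF that(1)] _ _ r(2)] unfolding dec_def sub_def m by meson
  have "cond ?u" by (rule amalgam[OF r])
  then show ?thesis using d b(2) m unfolding sub_def by (intro exI[of _ ?u]) auto
qed

text \<open>By \<open>i1\<close> and \<open>i2\<close> the level \<open>L\<close> is so high that
  different matched points pass through different nodes. What \<open>r'\<close> decides of them is
  then a finite matching of nodes of level \<open>L\<close>, which \<open>refine\<close> extends to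
  a permutation.\<close>

lemma add_perm:
  assumes r: "cond r" "cond r'" "sub r r'" and a: "a \<e> II" and t: "top r a p l" and L: "L \<e> omega" "sub l L"
    and ex: "!!h n m. pair (c1 a h) (pair n m) \<e> r ==>
      EX s t. isfun s L S & isfun t L S & dec r' (fst a) (pair h n) s & dec r' (snd a) (pair h m) t"
    and co: "!!N x s s' k k'. N = fst a | N = snd a ==> dec r' N x s ==> dec r' N x s' ==> isfun s k S ==> isfun s' k' S ==> sub k k' ==> sub s s'"
    and i1: "!!h n m h' n' m' s. pair (c1 a h) (pair n m) \<e> r ==> pair (c1 a h') (pair n' m') \<e> r ==> isfun s L S ==>
      dec r' (fst a) (pair h n) s ==> dec r' (fst a) (pair h' n') s ==> h = h' & n = n'"
    and i2: "!!h n m h' n' m' s. pair (c1 a h) (pair n m) \<e> r ==> pair (c1 a h') (pair n' m') \<e> r ==> isfun s L S ==>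
      dec r' (snd a) (pair h m) s ==> dec r' (snd a) (pair h' m') s ==> h = h' & m = m'"
  shows "EX q r''. cond r'' & sub r r'' & pair (c0 a) q \<e> r'' & Perm q L"
proof -
  obtain u where u: "cond u" "sub r u" and u0: "!!x. pair (c0 a) x \<e> u \<longleftrightarrow> pair (c0 a) x \<e> r"
    and u1: "!!h x. pair (c1 a h) x \<e> u \<longleftrightarrow> pair (c1 a h) x \<e> r"
    and ud: "!!N x s. N = fst a | N = snd a ==> dec r' N x s ==> dec u N x s" using amalgam_name[OF r, of a] by blast
  have p: "p \<e> ZZ" "Perm p l" and p': "!!p'. pair (c0 a) p' \<e> r ==> coh p' p & (EX l'. Perm p' l' & sub l' l)"
    and pm: "!!h n m. pair (c1 a h) (pair n m) \<e> r ==> match r a h n m p" using t unfolding top_def by blast+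
  have un: "s = s'" if "N = fst a | N = snd a" "dec r' N x s" "dec r' N x s'" "isfun s L S" "isfun s' L S" for N x s s'
    using co[OF that sub_refl] sub_same that(4,5) by blast
  define W where "W = sepS r (%w. EX h n m. w = pair (c1 a h) (pair n m))"
  have W: "w \<e> W \<longleftrightarrow> w \<e> r & (EX h n m. w = pair (c1 a h) (pair n m))" for w unfolding W_def by (rule sepS) (intro dfi)
  define Q where "Q w v \<longleftrightarrow> (EX h n m s t. w = pair (c1 a h) (pair n m) & v = pair s t & isfun s L S & isfun t L S &
     dec r' (fst a) (pair h n) s & dec r' (snd a) (pair h m) t)" for w v
  have "D (%e. Q (e 0) (e (Suc 0)))" unfolding Q_def by (intro dfi)
  moreover have "EX v. Q w v" if wW: "w \<e> W" for w
  proof -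
    obtain h n m where w: "w = pair (c1 a h) (pair n m)" "w \<e> r" using wW unfolding W by blast
    then show ?thesis using ex[of h n m] unfolding Q_def by blast
  qed
  ultimately obtain g where g: "!!w. w \<e> W ==> Q w (app g w)" using skolem[of Q W] by blast
  have t: "T (%e. app g (e 0))" by (intro dfi)
  let ?v = "img (app g) W"
  have v: "EX h n m s t. pair (c1 a h) (pair n m) \<e> r & w = pair s t & isfun s L S & isfun t L S &
     dec r' (fst a) (pair h n) s & dec r' (snd a) (pair h m) t" if "w \<e> ?v" for w
  proof -
    obtain w' where w': "w' \<e> W" "w = app g w'" using \<open>w \<e> ?v\<close> unfolding img[OF t] by blast
    then show ?thesis using g[OF w'(1)] unfolding Q_def W by metis
  qed
  have v': "pair s t \<e> ?v" if f: "pair (c1 a h) (pair n m) \<e> r" and st: "isfun s L S" "isfun t L S"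
     "dec r' (fst a) (pair h n) s" "dec r' (snd a) (pair h m) t" for h n m s t
  proof -
    have w: "pair (c1 a h) (pair n m) \<e> W" unfolding W using f by blast
    obtain s' t' where st': "app g (pair (c1 a h) (pair n m)) = pair s' t'" "isfun s' L S" "isfun t' L S"
      "dec r' (fst a) (pair h n) s'" "dec r' (snd a) (pair h m) t'" using g[OF w] unfolding Q_def pair_inj c_simps by blast
    have "s' = s" "t' = t" using un st st' by blast+
    then show ?thesis unfolding img[OF t] using w st'(1) by metis
  qed
  have fv: "fin ?v" by (rule fin_img[OF t fin_sub[OF condD(1)[OF r(1)]]]) (simp add: sub_def W)
  have "EX q. q \<e> ZZ & Perm q L & coh p q & sub ?v q"
  proof (rule refine[OF ZZ(5) ZZ(6) p(2,1) L fv])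
    show "!!w. w \<e> ?v ==> EX s t. isfun s L S & isfun t L S & w = pair s t" using v by blast
    fix s t assume "pair s t \<e> ?v"
    from v[OF this] obtain h n m where f: "pair (c1 a h) (pair n m) \<e> r" and st: "isfun s L S" "isfun t L S"
     "dec r' (fst a) (pair h n) s" "dec r' (snd a) (pair h m) t" unfolding pair_inj by blast
    { fix s' t' assume "pair s' t' \<e> ?v"
      from v[OF this] obtain h' n' m' where f': "pair (c1 a h') (pair n' m') \<e> r" and st': "isfun s' L S" "isfun t' L S"
       "dec r' (fst a) (pair h' n') s'" "dec r' (snd a) (pair h' m') t'" unfolding pair_inj by blast
      show "s = s' \<longleftrightarrow> t = t'"
      proof
        assume "s = s'"
        then have "h = h'" "n = n'" using i1[OF f f' st(1,3)] st'(3) by blast+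
        then have "m = m'" using condD(4)[OF r(1)] f f' by blast
        then show "t = t'" using un[of "snd a"] st st' \<open>h = h'\<close> by blast
      next
        assume "t = t'"
        then have "h = h'" "m = m'" using i2[OF f f' st(2,4)] st'(4) by blast+
        then have "n = n'" using condD(4)[OF r(1)] f f' by blast
        then show "s = s'" using un[of "fst a"] st st' \<open>h = h'\<close> by blast
      qed }
    \<comment> \<open>The match promised at \<open>p\<close> sends an initial segment
      \<open>s0\<close> of \<open>s\<close> to an initial segment \<open>t0\<close> of
      \<open>t\<close>; this is the coherence that \<open>refine\<close> asks for.\<close>
    { fix c d assume cd: "pair c d \<e> p"
      obtain s0 t0 where s0: "pair s0 t0 \<e> p" "dec r (fst a) (pair h n) s0" "dec r (snd a) (pair h m) t0"
        using pm[OF f] unfolding match_def by blast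
      note P = PermD[OF p(2)]
      have "sub s0 s" using co[OF _ dec_mono[OF s0(2) r(3)] st(3) P(2)[OF s0(1)] st(1) L(2)] by blast
      then have "sub c s \<longleftrightarrow> c = s0" using sub_common_same[OF P(2)[OF cd] P(2)[OF s0(1)] st(1)] by blast
      moreover have "sub t0 t" using co[OF _ dec_mono[OF s0(3) r(3)] st(4) P(3)[OF s0(1)] st(2) L(2)] by blast
      then have "sub d t \<longleftrightarrow> d = t0" using sub_common_same[OF P(3)[OF cd] P(3)[OF s0(1)] st(2)] by blast
      ultimately show "sub c s \<longleftrightarrow> sub d t" using P(6)[OF cd s0(1)] by blast }
  qed
  then obtain q where q: "q \<e> ZZ" "Perm q L" "coh p q" "sub ?v q" by blast
  have "cond (adj u (pair (c0 a) q))"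
  proof (rule add0[OF u(1) a q(1,2)])
    fix p1 assume "pair (c0 a) p1 \<e> u"
    then obtain l1 where p1: "coh p1 p" "Perm p1 l1" "sub l1 l" using p' u0 by blast
    have c: "coh p1 q" by (rule coh_trans[OF p1(2) p(2) q(2) p1(3) p1(1) q(3) L(2)])
    have "coh q p1" by (rule coh_sym[OF p1(2) q(2) _ c]) (rule sub_trans[OF p1(3) L(2)])
    then show "coh q p1 & coh p1 q" using c by blast
  next
    fix h n m assume f: "pair (c1 a h) (pair n m) \<e> u"
    then obtain s t where "isfun s L S" "isfun t L S" "dec r' (fst a) (pair h n) s" "dec r' (snd a) (pair h m) t"
      using ex u1 by blast
    moreover from this have "pair s t \<e> q" using v' f q(4) unfolding u1 sub_def by blast
    ultimately show "match u a h n m q" unfolding match_def using ud by blast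
  qed
  moreover have "sub r (adj u (pair (c0 a) q))" using u(2) by (simp add: sub_def)
  ultimately show ?thesis using q(2) by (intro exI[of _ q] exI[of _ "adj u (pair (c0 a) q)"]) simp
qed

text \<open>\<open>p\<close> has the highest level, so the matches demanded by the other
  permutations at \<open>c0 a\<close> follow by restriction.\<close>

lemma add_match:
  assumes r: "cond r" "cond r'" "sub r r'" and a: "a \<e> II" and t: "top r a p l" "pair (c0 a) p \<e> r"
    and x: "h \<e> w1" "n \<e> omega" "m \<e> omega"
    and st: "pair s t \<e> p" "dec r' (fst a) (pair h n) s" "dec r' (snd a) (pair h m) t"
    and new: "!!n' m'. pair (c1 a h) (pair n' m') \<e> r ==> n' ~= n & m' ~= m"
  shows "EX r''. cond r'' & sub r r'' & pair (c1 a h) (pair n m) \<e> r''"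
proof -
  obtain u where u: "cond u" "sub r u" and u0: "!!x. pair (c0 a) x \<e> u \<longleftrightarrow> pair (c0 a) x \<e> r"
    and u1: "!!h x. pair (c1 a h) x \<e> u \<longleftrightarrow> pair (c1 a h) x \<e> r"
    and ud: "!!N x s. N = fst a | N = snd a ==> dec r' N x s ==> dec u N x s" using amalgam_name[OF r, of a] by blast
  have p: "Perm p l" and p': "!!p'. pair (c0 a) p' \<e> r ==> coh p' p & (EX l'. Perm p' l' & sub l' l)"
    using t unfolding top_def by blast+
  note P = PermD[OF p]
  have "cond (adj u (pair (c1 a h) (pair n m)))"
  proof (rule add1[OF u(1) a x])
    show "pair (c0 a) p \<e> u" using t(2) u0 by blast
    show "n' ~= n & m' ~= m" if "pair (c1 a h) (pair n' m') \<e> u" for n' m' using new that u1 by blast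
    fix p1 assume "pair (c0 a) p1 \<e> u"
    then obtain l1 where p1: "coh p1 p" "Perm p1 l1" "sub l1 l" using p' u0 by blast
    obtain s1 where s1: "isfun s1 l1 S" "sub s1 s" using restr_ex[OF P(2)[OF st(1)] p1(3)] by blast
    obtain t1 where t1: "pair s1 t1 \<e> p1" using PermD(4)[OF p1(2) s1(1)] by blast
    have "sub t1 t" using p1(1) t1 st(1) s1(2) unfolding coh_def by blast
    then show "match u a h n m p1" unfolding match_def using t1 dec_sub ud st(2,3) s1(2) by blast
  qed
  moreover have "sub r (adj u (pair (c1 a h) (pair n m)))" using u(2) by (simp add: sub_def)
  ultimately show ?thesis by (intro exI[of _ "adj u (pair (c1 a h) (pair n m))"]) simp
qed

text \<open>The quantifiers over \<open>G\<close> range over filters of the metatheory, so this is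
  not a predicate of the model. It records what survives a change of the generic filter through
  \<open>p0\<close>.\<close>

definition nice where "nice p0 a N \<longleftrightarrow> N \<e> II &
  (ALL q x s. pair q (pair x s) \<e> N --> q \<e> PP & x \<e> prod w1 omega & s \<e> ND & fst3 q a x s) &
  (ALL G x k. generic E PP G --> x \<e> prod w1 omega --> k \<e> omega --> (EX q s. q \<in> G & isfun s k S & fst3 q a x s) -->
      (EX q s. q \<in> G & isfun s k S & pair q (pair x s) \<e> N)) &
  (ALL G. generic E PP G --> p0 \<in> G --> nodes.Theta (generic.EG E PP G) (generic.j E PP G S) (generic.val E PP G a))"

definition env5 where "env5 a = (%i::nat. if i = 0 then a else if i = 1 then chk w1 else if i = 2 then chk omega else if i = 3 then chk S else chk ND)"

end

context bgen
begin

lemma theta_env5: "sat EG (%i. val (env5 a i)) (theta_s 0 1 2 3 4 5) \<longleftrightarrow> NN.Theta (val a)"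
  by (subst NN.sat_theta) (simp_all add: env5_def j_def[symmetric] j_w1 j_omega j_ND)

end

context baum
begin

lemma nice_ex: assumes "bgen E S G" "nodes.Theta (generic.EG E PP G) (generic.j E PP G S) (generic.val E PP G a)"
  shows "EX p0 N. p0 \<in> G & nice p0 a N"
proof -
  interpret G: bgen E S G by fact
  obtain p0 where p0: "p0 \<in> G" "frc p0 (env5 a) (theta_s 0 1 2 3 4 5)"
    using assms(2) unfolding G.theta_env5[symmetric] G.truth by blast
  have th: "nodes.Theta (generic.EG E PP G') (generic.j E PP G' S) (generic.val E PP G' a)"
    if g: "generic E PP G'" "p0 \<in> G'" for G'
  proof -
    interpret G': bgen E S G' by (rule bgenI[OF g(1)])
    show ?thesis using forces_generic[OF g p0(2)] unfolding G'.theta_env5 .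
  qed
  have "sub (prod w1 omega) X1" unfolding sub_def prod using X1_pair w1_in_X1 omega_X1 by blast
  from nice_name[OF this, of a] obtain N where "N \<e> II"
    "ALL q x s. pair q (pair x s) \<e> N --> q \<e> PP & x \<e> prod w1 omega & s \<e> ND & fst3 q a x s"
    "ALL G x k. generic E PP G --> x \<e> prod w1 omega --> k \<e> omega --> (EX q s. q \<in> G & isfun s k S & fst3 q a x s) -->
      (EX q s. q \<in> G & isfun s k S & pair q (pair x s) \<e> N)" by blast
  then have "nice p0 a N" unfolding nice_def using th by (intro conjI allI impI) simp_all
  then show ?thesis using p0(1) by blast
qed

end

section \<open>Nice names evaluated in the extension\<close>

context bgen
begin

context fixes p0 a N' assumes nc: "nice p0 a N'" and p0: "p0 \<in> G"
begin

abbreviation (input) "at x y \<equiv> EG (N.pair x y) (val a)"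

lemma Th: "NN.Theta (val a)" using nc[unfolded nice_def] p0 generic_axioms by blast
lemma nice_II: "N' \<e> II" using nc[unfolded nice_def, THEN conjunct1] .
lemma nice_mem: "pair q (pair x s) \<e> N' ==> q \<e> PP & x \<e> prod w1 omega & s \<e> ND & fst3 q a x s"
  using nc[unfolded nice_def, THEN conjunct2, THEN conjunct1] by blast

lemma sat_incl: "sat EG (%i. val (env3 a (chk x) (chk s) i)) (incl_s 3) \<longleftrightarrow> (EX y. at (j x) y & N.sub (j s) y)"
  unfolding env3_comp j_def[symmetric] by (simp add: incl_s_def sfm_sat N.sat_app N.sat_subset del: fun_upd_apply)

lemma n3: assumes "r \<in> G" "dec r N' x s" shows "EX y. at (j x) y & N.sub (j s) y"
proof -
  obtain q s' where q: "pair q (pair x s') \<e> N'" "sub q r" "sub s s'" using assms(2) unfolding dec_def by blast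
  have "q \<in> G" using G_up[OF assms(1) _ q(2)] nice_mem[OF q(1)] by blast
  then have "sat EG (%i. val (env3 a (chk x) (chk s') i)) (incl_s 3)" using truth nice_mem[OF q(1)] by blast
  then obtain y where "at (j x) y" "N.sub (j s') y" unfolding sat_incl by blast
  then show ?thesis using N.sub_trans q(3) j_sub by blast
qed

lemma n3': assumes "r \<in> G" "dec r N' x s" "at (j x) y" shows "N.sub (j s) y"
  using n3[OF assms(1,2)] NN.ThetaD(2)[OF Th assms(3)] by blast

lemma at_dom: "at (j x) y ==> x \<e> prod w1 omega"
proof -
  assume "at (j x) y"
  from NN.ThetaD(1)[OF Th this] obtain h n where hn: "EG h N.w1" "EG n N.omega" "j x = N.pair h n" unfolding N.pair_inj by blast
  then obtain h' n' where "h' \<e> w1" "h = j h'" "n' \<e> omega" "n = j n'" unfolding j_w1[symmetric] j_omega[symmetric] EG_j by blast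
  then have "x = pair h' n'" using hn(3) j_pair j_inj by metis
  then show ?thesis using \<open>h' \<e> w1\<close> \<open>n' \<e> omega\<close> by simp
qed

lemma n4: assumes y: "at (j x) y" and k: "k \<e> omega" shows "EX r s. r \<in> G & isfun s k S & dec r N' x s & N.sub (j s) y"
proof -
  have yf: "N.isfun y N.omega (j S)" using NN.ThetaD(4)[OF Th y] .
  have "N.sub (j k) N.omega" using sub_omega[OF k] unfolding j_omega[symmetric] by simp
  then obtain t where t: "N.isfun t (j k) (j S)" "N.sub t y" using NN.restr_ex[OF yf] by blast
  then obtain s where s: "t = j s" "isfun s k S" using j_isfun_conv[OF k] by blast
  then have "sat EG (%i. val (env3 a (chk x) (chk s) i)) (incl_s 3)" unfolding sat_incl using y t(2) by blast
  then obtain q where q: "q \<in> G" "fst3 q a x s" using truth by blast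
  then obtain q' s' where s': "q' \<in> G" "isfun s' k S" "pair q' (pair x s') \<e> N'"
    using nc[unfolded nice_def, THEN conjunct2, THEN conjunct2, THEN conjunct1] generic_axioms at_dom[OF y] k s(2) by blast
  then have "dec q' N' x s'" unfolding dec_def using sub_refl by blast
  then show ?thesis using s'(1,2) n3'[OF s'(1) _ y] by blast
qed

lemma n5: assumes y: "at (j x) y" and s: "s \<e> ND" "N.sub (j s) y" shows "EX r. r \<in> G & dec r N' x s"
proof -
  obtain k where k: "k \<e> omega" "isfun s k S" using ND_fun[OF s(1)] by blast
  obtain r s' where r: "r \<in> G" "isfun s' k S" "dec r N' x s'" "N.sub (j s') y" using n4[OF y k(1)] by blast
  have "j s = j s'" using NN.sub_common_same[OF j_isfun[OF k(2)] j_isfun[OF r(2)] NN.ThetaD(4)[OF Th y] s(2) r(4)] .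
  then show ?thesis using r by auto
qed

lemma dec_coh: assumes r: "r \<in> G" "dec r N' x s" "dec r N' x s'" and k: "isfun s k S" "isfun s' k' S" "sub k k'" shows "sub s s'"
proof -
  obtain y where y: "at (j x) y" "N.sub (j s) y" using n3[OF r(1,2)] by blast
  have "N.sub (j s) (j s')"
    by (rule NN.sub_common[OF j_isfun[OF k(1)] j_isfun[OF k(2)] NN.ThetaD(4)[OF Th y(1)] _ y(2) n3'[OF r(1,3) y(1)]]) (simp add: k(3))
  then show ?thesis by simp
qed

text \<open>Finitely many points of the extension are separated below some level. Beyond it, a node
  decided for two indices forces the points to coincide, and hence the indices.\<close>

lemma levels: assumes X: "fin X" "!!x. x \<e> X ==> EX y. at (j x) y"
  shows "EX k. k \<e> omega & (ALL L x x' s r. L \<e> omega --> sub k L --> x \<e> X --> x' \<e> X --> r \<in> G --> isfun s L S -->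
     dec r N' x s --> dec r N' x' s --> x = x')"
proof -
  have t: "dft EG (%e. N.app (val a) (e 0))" by (intro dfi)
  let ?F = "N.img (N.app (val a)) (j X)"
  have F: "EG y ?F" if "x \<e> X" "at (j x) y" for x y
    unfolding N.img[OF t] EG_j using that NN.ThetaD(5)[OF Th that(2)] by blast
  have "N.fin ?F" by (rule N.fin_img[OF t j_fin[OF X(1)]])
  moreover have "N.sub ?F (N.fs (j S))" unfolding N.sub_def N.img[OF t] EG_j N.fs
    using X(2) NN.ThetaD(4,5)[OF Th] by metis
  ultimately obtain n where n: "EG n N.omega" "!!m x y. EG m N.omega ==> N.sub n m ==> EG x ?F ==> EG y ?F ==> x ~= y ==>
     EX i. EG i m & N.app x i ~= N.app y i" using NN.separate[of ?F] by blast
  obtain k where k: "k \<e> omega" "n = j k" using n(1) unfolding j_omega[symmetric] EG_j by blast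
  have "x = x'" if L: "L \<e> omega" "sub k L" and x: "x \<e> X" "x' \<e> X" and r: "r \<in> G" "isfun s L S" "dec r N' x s" "dec r N' x' s" for L x x' s r
  proof -
    obtain y where y: "at (j x) y" "N.sub (j s) y" using n3[OF r(1,3)] by blast
    obtain y' where y': "at (j x') y'" "N.sub (j s) y'" using n3[OF r(1,4)] by blast
    have "y = y'"
    proof (rule ccontr)
      assume "y ~= y'"
      then obtain i where i: "EG i (j L)" "N.app y i ~= N.app y' i"
        using n(2)[of "j L", OF _ _ F[OF x(1) y(1)] F[OF x(2) y'(1)]] L k(2) j_omega[symmetric] by auto
      have "N.app (j s) i = N.app y i" "N.app (j s) i = N.app y' i"
        using y(2) y'(2) i(1) unfolding NN.sub_fun[OF j_isfun[OF r(2)] NN.ThetaD(4)[OF Th y(1)]]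
          NN.sub_fun[OF j_isfun[OF r(2)] NN.ThetaD(4)[OF Th y'(1)]] by blast+
      then show False using i(2) by simp
    qed
    then show ?thesis using NN.ThetaD(2)[OF Th y(1) y'(1)] by simp
  qed
  then show ?thesis using k(1) by blast
qed

text \<open>Extending \<open>t\<close> first avoids the finitely many points with numbers in
  \<open>M\<close>; the block is dense, so it has a point through the longer node.\<close>

lemma partner: assumes M: "fin M" and h: "h \<e> w1" and t: "t \<e> ND"
  shows "EX n y. n \<e> omega & ~ n \<e> M & at (j (pair h n)) y & N.sub (j t) y"
proof -
  have T: "dft EG (%e. N.app (val a) (N.pair (j h) (e 0)))" by (intro dfi)
  let ?I = "N.img (%x. N.app (val a) (N.pair (j h) x)) (j M)"
  \<comment> \<open>A number in \<open>M\<close> may belong to no point, so values that are not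
    sequences are discarded.\<close>
  let ?F = "N.sepS ?I (%y. N.isfun y N.omega (j S))"
  have F: "EG y ?F \<longleftrightarrow> EG y ?I & N.isfun y N.omega (j S)" for y by (rule N.sepS) (intro dfi)
  have "N.fin ?F" by (rule N.fin_sub[OF N.fin_img[OF T j_fin[OF M]]]) (simp add: N.sub_def F)
  moreover have "EG (j t) NN.ND" using t j_ND by (metis EG_jj)
  moreover have "N.sub ?F (N.fs (j S))" by (simp add: N.sub_def F)
  ultimately obtain t' where t': "EG t' NN.ND" "N.sub (j t) t'" "!!x. EG x ?F ==> ~ N.sub t' x" using NN.avoid[of ?F "j t"] by blast
  have "EG (j h) N.w1" using h unfolding j_w1[symmetric] by simp
  then obtain n y where y: "at (N.pair (j h) n) y" "N.sub t' y" using NN.ThetaD(3)[OF Th _ t'(1)] by blast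
  have "EG n N.omega" using NN.ThetaD(1)[OF Th y(1)] by auto
  then obtain m where m: "m \<e> omega" "n = j m" unfolding j_omega[symmetric] EG_j by blast
  have "~ m \<e> M"
  proof
    assume "m \<e> M"
    then have "EG y ?I" unfolding N.img[OF T] using NN.ThetaD(5)[OF Th y(1)] m(2) by (intro exI[of _ n]) simp
    then have "EG y ?F" unfolding F using NN.ThetaD(4)[OF Th y(1)] by blast
    then show False using t'(3) y(2) by blast
  qed
  then show ?thesis using m y N.sub_trans[OF t'(2) y(2)] unfolding m(2) j_pair[symmetric] by blast
qed

end

end

context baum
begin

lemma nice_mono: assumes "nice p a N" "p \<e> PP" "sub p q" shows "nice q a N"
proof -
  have "p \<in> G" if "generic E PP G" "q \<in> G" for G
    using generic.G_up[OF that assms(2,3)] .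
  then show ?thesis using assms(1) unfolding nice_def by blast
qed

lemma nat_ub: "m \<e> omega ==> n \<e> omega ==> EX k. k \<e> omega & sub m k & sub n k"
  using nat_max sub_refl by blast

end

section \<open>Extending conditions of a generic filter at a pair of nice names\<close>

context bgen
begin

lemma cond_G: "r \<in> G ==> cond r" using G_P PP by blast

context
  fixes p0 an bn NA NB
  assumes nA: "nice p0 an NA" and nB: "nice p0 bn NB" and p0: "p0 \<in> G"
begin

abbreviation (input) "al \<equiv> pair NA NB"
lemma al_II: "al \<e> II" using nice_II[OF nA p0] nice_II[OF nB p0] II_pair by blast

lemmas A3 = n3[OF nA p0] and A3' = n3'[OF nA p0] and A5 = n5[OF nA p0] and A4 = n4[OF nA p0]
  and B3 = n3[OF nB p0] and B3' = n3'[OF nB p0] and B5 = n5[OF nB p0] and B4 = n4[OF nB p0]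

text \<open>\<open>L\<close> is chosen above \<open>k\<close>, the level of the top permutation and
  the levels that separate the matched points. \<open>G_fin\<close> supplies one condition of
  \<open>G\<close> that decides all these points at level \<open>L\<close>.\<close>

lemma D1: assumes r: "r \<in> G" and k: "k \<e> omega"
  shows "EX q r' L. cond r' & sub r r' & pair (c0 al) q \<e> r' & Perm q L & sub k L"
proof -
  note cr = cond_G[OF r]
  obtain p l where t: "top r al p l" using top_ex[OF cr] by blast
  then have pl: "Perm p l" unfolding top_def by blast
  define W where "W = sepS r (%w. EX h n m. w = pair (c1 al h) (pair n m))"
  have W: "w \<e> W \<longleftrightarrow> w \<e> r & (EX h n m. w = pair (c1 al h) (pair n m))" for w unfolding W_def by (rule sepS) (intro dfi)
  have fW: "fin W" by (rule fin_sub[OF condD(1)[OF cr]]) (simp add: sub_def W)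
  have ya: "EX y. EG (N.pair (j (pair h n)) y) (val an)" "EX y. EG (N.pair (j (pair h m)) y) (val bn)"
    if f: "pair (c1 al h) (pair n m) \<e> r" for h n m
  proof -
    obtain s t where st: "dec r NA (pair h n) s" "dec r NB (pair h m) t" using t f unfolding top_def match_def fst snd by blast
    show "EX y. EG (N.pair (j (pair h n)) y) (val an)" using A3[OF r st(1)] by blast
    show "EX y. EG (N.pair (j (pair h m)) y) (val bn)" using B3[OF r st(2)] by blast
  qed
  define dA where "dA w = pair (snd (snd (fst w))) (fst (snd w))" for w
  define dB where "dB w = pair (snd (snd (fst w))) (snd (snd w))" for w
  have dT: "T (%e. dA (e 0))" "T (%e. dB (e 0))" unfolding dA_def dB_def by (intro dfi)+
  have dd: "dA (pair (c1 al h) (pair n m)) = pair h n" "dB (pair (c1 al h) (pair n m)) = pair h m" for h n m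
    by (simp_all add: dA_def dB_def c1_def)
  have mA: "pair h n \<e> img dA W" "pair h m \<e> img dB W" if "pair (c1 al h) (pair n m) \<e> r" for h n m
    unfolding img[OF dT(1)] img[OF dT(2)] W using that dd by metis+
  have "EX y. EG (N.pair (j x) y) (val an)" if "x \<e> img dA W" for x
    using that ya(1) dd(1) unfolding img[OF dT(1)] W by metis
  from levels[OF nA p0 fin_img[OF dT(1) fW] this] obtain k1 where k1: "k1 \<e> omega"
    "!!L x x' s r. L \<e> omega ==> sub k1 L ==> x \<e> img dA W ==> x' \<e> img dA W ==> r \<in> G ==> isfun s L S ==>
     dec r NA x s ==> dec r NA x' s ==> x = x'" by blast
  have "EX y. EG (N.pair (j x) y) (val bn)" if "x \<e> img dB W" for x
    using that ya(2) dd(2) unfolding img[OF dT(2)] W by metis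
  from levels[OF nB p0 fin_img[OF dT(2) fW] this] obtain k2 where k2: "k2 \<e> omega"
    "!!L x x' s r. L \<e> omega ==> sub k2 L ==> x \<e> img dB W ==> x' \<e> img dB W ==> r \<in> G ==> isfun s L S ==>
     dec r NB x s ==> dec r NB x' s ==> x = x'" by blast
  obtain L1 where L1: "L1 \<e> omega" "sub k L1" "sub l L1" using nat_ub[OF k PermD(1)[OF pl]] by blast
  obtain L2 where L2: "L2 \<e> omega" "sub k1 L2" "sub k2 L2" using nat_ub[OF k1(1) k2(1)] by blast
  obtain L where L: "L \<e> omega" "sub L1 L" "sub L2 L" using nat_ub[OF L1(1) L2(1)] by blast
  have Ls: "sub k L" "sub l L" "sub k1 L" "sub k2 L" using sub_trans L1 L2 L by blast+
  define Q where "Q w q \<longleftrightarrow> (EX h n m s t. w = pair (c1 al h) (pair n m) & isfun s L S & isfun t L S &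
     dec q NA (pair h n) s & dec q NB (pair h m) t)" for w q
  have "EX r. r \<in> G & (ALL w. w \<e> W --> Q w r)"
  proof (rule G_fin[OF _ fW])
    show "D (%e. Q (e 0) (e (Suc 0)))" unfolding Q_def by (intro dfi)
    show "Q w r" if q: "Q w q" "sub q r" for w q r using q(1) dec_mono[OF _ q(2)] unfolding Q_def by blast
    fix w assume "w \<e> W"
    then obtain h n m where w: "w = pair (c1 al h) (pair n m)" "pair (c1 al h) (pair n m) \<e> r" unfolding W by blast
    obtain y y' where y: "EG (N.pair (j (pair h n)) y) (val an)" "EG (N.pair (j (pair h m)) y') (val bn)" using ya[OF w(2)] by blast
    obtain r1 s where s: "r1 \<in> G" "isfun s L S" "dec r1 NA (pair h n) s" using A4[OF y(1) L(1)] by blast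
    obtain r2 t where t: "r2 \<in> G" "isfun t L S" "dec r2 NB (pair h m) t" using B4[OF y(2) L(1)] by blast
    obtain r3 where r3: "r3 \<in> G" "sub r1 r3" "sub r2 r3" using G_dir[OF s(1) t(1)] by blast
    have "Q w r3" unfolding Q_def using w(1) s t dec_mono r3 by blast
    then show "EX q. q \<in> G & Q w q" using r3(1) by blast
  qed
  then obtain r1 where r1: "r1 \<in> G" "!!w. w \<e> W ==> Q w r1" by blast
  obtain r2 where r2: "r2 \<in> G" "sub r r2" "sub r1 r2" using G_dir[OF r r1(1)] by blast
  have "EX q r''. cond r'' & sub r r'' & pair (c0 al) q \<e> r'' & Perm q L"
  proof (rule add_perm[OF cr cond_G[OF r2(1)] r2(2) al_II t L(1) Ls(2)], unfold fst snd)
    fix h n m assume "pair (c1 al h) (pair n m) \<e> r"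
    then have "pair (c1 al h) (pair n m) \<e> W" unfolding W by blast
    from r1(2)[OF this] show "EX s t. isfun s L S & isfun t L S & dec r2 NA (pair h n) s & dec r2 NB (pair h m) t"
      unfolding Q_def pair_inj c_simps using dec_mono[OF _ r2(3)] by blast
  next
    fix N' x s s' k k' assume *: "N' = NA | N' = NB" and a: "dec r2 N' x s" "dec r2 N' x s'" "isfun s k S" "isfun s' k' S" "sub k k'"
    show "sub s s'" using * dec_coh[OF nA p0 r2(1)] dec_coh[OF nB p0 r2(1)] a by blast
  next
    fix h n m h' n' m' s
    assume f: "pair (c1 al h) (pair n m) \<e> r" "pair (c1 al h') (pair n' m') \<e> r" and s: "isfun s L S"
    show "dec r2 NA (pair h n) s ==> dec r2 NA (pair h' n') s ==> h = h' & n = n'"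
      using k1(2)[OF L(1) Ls(3) mA(1)[OF f(1)] mA(1)[OF f(2)] r2(1) s] by simp
    show "dec r2 NB (pair h m) s ==> dec r2 NB (pair h' m') s ==> h = h' & m = m'"
      using k2(2)[OF L(1) Ls(4) mA(2)[OF f(1)] mA(2)[OF f(2)] r2(1) s] by simp
  qed
  then show ?thesis using Ls(1) by blast
qed

lemma fin_c1: "r \<in> G ==> fin (img fst (fib r (c1 a h)))" "r \<in> G ==> fin (img snd (fib r (c1 a h)))"
proof -
  have t: "T (%e. fst (e 0))" "T (%e. snd (e 0))" by (intro dfi)+
  show "r \<in> G ==> fin (img fst (fib r (c1 a h)))" "r \<in> G ==> fin (img snd (fib r (c1 a h)))"
    using fin_img[OF t(1) fin_fib[OF cond_G]] fin_img[OF t(2) fin_fib[OF cond_G]] by blast+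
qed

lemma c1_mem: assumes "pair (c1 a h) (pair n m) \<e> r" shows "n \<e> img fst (fib r (c1 a h))" "m \<e> img snd (fib r (c1 a h))"
proof -
  have t: "T (%e. fst (e 0))" "T (%e. snd (e 0))" by (intro dfi)+
  show "n \<e> img fst (fib r (c1 a h))" "m \<e> img snd (fib r (c1 a h))"
    unfolding img[OF t(1)] img[OF t(2)] fib using assms fst snd by metis+
qed

lemma at_dom2: "EG (N.pair (j (pair h n)) y) (val an) ==> h \<e> w1 & n \<e> omega"
  "EG (N.pair (j (pair h n)) y) (val bn) ==> h \<e> w1 & n \<e> omega"
  using at_dom[OF nA p0] at_dom[OF nB p0] prod_pair by blast+

text \<open>The top permutation sends the initial segment \<open>s\<close> of the given point to
  \<open>t\<close>, and the corresponding block of the other set has a point through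
  \<open>t\<close> whose number is not yet matched.\<close>

lemma D2: assumes r: "r \<in> G" "dec r NA (pair h n) emp" "pair (c0 al) p1 \<e> r"
  shows "EX r'. cond r' & sub r r' & (EX m. pair (c1 al h) (pair n m) \<e> r')"
proof (cases "EX m. pair (c1 al h) (pair n m) \<e> r")
  case True
  then show ?thesis using cond_G[OF r(1)] sub_refl by blast
next
  case False
  obtain y where y: "EG (N.pair (j (pair h n)) y) (val an)" using A3[OF r(1,2)] by blast
  obtain p l where p: "top r al p l" "pair (c0 al) p \<e> r" using top_ex[OF cond_G[OF r(1)], of al] r(3) by blast
  then have P: "Perm p l" unfolding top_def by blast
  obtain r1 s where s: "r1 \<in> G" "isfun s l S" "dec r1 NA (pair h n) s" using A4[OF y PermD(1)[OF P]] by blast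
  obtain t where t: "pair s t \<e> p" using PermD(4)[OF P s(2)] by blast
  have tN: "t \<e> ND" using PermD(3)[OF P t] PermD(1)[OF P] ND by blast
  obtain m y' where m: "m \<e> omega" "~ m \<e> img snd (fib r (c1 al h))" "EG (N.pair (j (pair h m)) y') (val bn)" "N.sub (j t) y'"
    using partner[OF nB p0 fin_c1(2)[OF r(1)] _ tN] at_dom2(1)[OF y] by blast
  obtain r2 where r2: "r2 \<in> G" "dec r2 NB (pair h m) t" using B5[OF m(3) tN m(4)] by blast
  obtain r3 where r3: "r3 \<in> G" "sub r1 r3" "sub r2 r3" using G_dir[OF s(1) r2(1)] by blast
  obtain r4 where r4: "r4 \<in> G" "sub r r4" "sub r3 r4" using G_dir[OF r(1) r3(1)] by blast
  have d: "dec r4 NA (pair h n) s" "dec r4 NB (pair h m) t" using dec_mono s(3) r2(2) r3 r4 by blast+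
  have "EX r''. cond r'' & sub r r'' & pair (c1 al h) (pair n m) \<e> r''"
  proof (rule add_match[OF cond_G[OF r(1)] cond_G[OF r4(1)] r4(2) al_II p _ _ m(1) t])
    show "n' ~= n & m' ~= m" if "pair (c1 al h) (pair n' m') \<e> r" for n' m' using that False m(2) c1_mem by blast
  qed (use d at_dom2(1)[OF y] in simp_all)
  then show ?thesis by blast
qed

text \<open>The argument of \<open>D2\<close> with the inverse of the permutation.\<close>

lemma D3: assumes r: "r \<in> G" "dec r NB (pair h m) emp" "pair (c0 al) p1 \<e> r"
  shows "EX r'. cond r' & sub r r' & (EX n. pair (c1 al h) (pair n m) \<e> r')"
proof (cases "EX n. pair (c1 al h) (pair n m) \<e> r")
  case True
  then show ?thesis using cond_G[OF r(1)] sub_refl by blast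
next
  case False
  obtain y where y: "EG (N.pair (j (pair h m)) y) (val bn)" using B3[OF r(1,2)] by blast
  obtain p l where p: "top r al p l" "pair (c0 al) p \<e> r" using top_ex[OF cond_G[OF r(1)], of al] r(3) by blast
  then have P: "Perm p l" unfolding top_def by blast
  obtain r1 t where t: "r1 \<in> G" "isfun t l S" "dec r1 NB (pair h m) t" using B4[OF y PermD(1)[OF P]] by blast
  obtain s where s: "pair s t \<e> p" using PermD(5)[OF P t(2)] by blast
  have sN: "s \<e> ND" using PermD(2)[OF P s] PermD(1)[OF P] ND by blast
  obtain n y' where n: "n \<e> omega" "~ n \<e> img fst (fib r (c1 al h))" "EG (N.pair (j (pair h n)) y') (val an)" "N.sub (j s) y'"
    using partner[OF nA p0 fin_c1(1)[OF r(1)] _ sN] at_dom2(2)[OF y] by blast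
  obtain r2 where r2: "r2 \<in> G" "dec r2 NA (pair h n) s" using A5[OF n(3) sN n(4)] by blast
  obtain r3 where r3: "r3 \<in> G" "sub r1 r3" "sub r2 r3" using G_dir[OF t(1) r2(1)] by blast
  obtain r4 where r4: "r4 \<in> G" "sub r r4" "sub r3 r4" using G_dir[OF r(1) r3(1)] by blast
  have d: "dec r4 NA (pair h n) s" "dec r4 NB (pair h m) t" using dec_mono t(3) r2(2) r3 r4 by blast+
  have "EX r''. cond r'' & sub r r'' & pair (c1 al h) (pair n m) \<e> r''"
  proof (rule add_match[OF cond_G[OF r(1)] cond_G[OF r4(1)] r4(2) al_II p _ n(1) _ s])
    show "n' ~= n & m' ~= m" if "pair (c1 al h) (pair n' m') \<e> r" for n' m' using that False n(2) c1_mem by blast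
  qed (use d at_dom2(2)[OF y] in simp_all)
  then show ?thesis by blast
qed

end

end

section \<open>The homeomorphism given by the generic filter\<close>

context bgen
begin

context
  fixes p0 an bn NA NB
  assumes nA: "nice p0 an NA" and nB: "nice p0 bn NB" and p0: "p0 \<in> G"
begin

text \<open>\<open>D1\<close> to \<open>D3\<close> work in a filter containing the given condition.
  Every condition lies in some generic filter, and their conclusions mention conditions only, so
  they amount to density below \<open>p0\<close>.\<close>

lemma dense_G: assumes Q: "D (%e. Q (e 0))" and r: "r \<in> G"
    and st: "!!G' q. bgen E S G' ==> p0 \<in> G' ==> q \<in> G' ==> sub r q ==> EX r'. cond r' & sub q r' & Q r'"
  shows "EX r. r \<in> G & Q r"
proof -
  obtain r0 where r0: "r0 \<in> G" "sub p0 r0" "sub r r0" using G_dir[OF p0 r] by blast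
  have "EX q. q \<in> G & sub r0 q & Q q"
  proof (rule gen_below[OF Q r0(1)])
    fix q assume q: "q \<e> PP" "sub r0 q"
    obtain G' where G': "q \<in> G'" "generic E PP G'" using generic_exists[OF q(1)] by blast
    have "p0 \<in> G'" using generic.G_up[OF G'(2,1) G_P[OF p0] sub_trans[OF r0(2) q(2)]] .
    from st[OF bgenI[OF G'(2)] this G'(1) sub_trans[OF r0(3) q(2)]] show "EX r. r \<e> PP & sub q r & Q r" using PP by blast
  qed
  then show ?thesis by blast
qed

lemma G_level: assumes k: "k \<e> omega" shows "EX r q L. r \<in> G & pair (c0 (pair NA NB)) q \<e> r & Perm q L & sub k L"
proof -
  have "EX r. r \<in> G & (EX q L. pair (c0 (pair NA NB)) q \<e> r & Perm q L & sub k L)"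
  proof (rule dense_G[OF _ p0])
    show "D (%e. EX q L. pair (c0 (pair NA NB)) q \<e> e 0 & Perm q L & sub k L)" by (intro dfi)
    show "EX r'. cond r' & sub q r' & (EX q L. pair (c0 (pair NA NB)) q \<e> r' & Perm q L & sub k L)"
      if "bgen E S G'" "p0 \<in> G'" "q \<in> G'" for G' q using bgen.D1[OF that(1) nA nB that(2,3) k] by blast
  qed
  then show ?thesis by blast
qed

lemma G_match1: assumes y: "EG (N.pair x y) (val an)"
  shows "EX r h n m. r \<in> G & x = j (pair h n) & pair (c1 (pair NA NB) h) (pair n m) \<e> r"
proof -
  obtain x' where x': "x = j x'" using NN.ThetaD(1)[OF Th[OF nA p0] y] unfolding N.pair_inj j_w1[symmetric] j_omega[symmetric] EG_j by (metis j_pair)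
  obtain h n where hn: "x' = pair h n" using at_dom[OF nA p0] y unfolding x' prod by blast
  obtain r1 where r1: "r1 \<in> G" "dec r1 NA (pair h n) emp"
    using n5[OF nA p0 y[unfolded x' hn] ND_emp] j_emp by (auto simp: N.sub_def)
  obtain r2 p1 where r2: "r2 \<in> G" "pair (c0 (pair NA NB)) p1 \<e> r2" using G_level[OF omega_0] by blast
  obtain r3 where r3: "r3 \<in> G" "sub r1 r3" "sub r2 r3" using G_dir[OF r1(1) r2(1)] by blast
  have "EX r. r \<in> G & (EX m. pair (c1 (pair NA NB) h) (pair n m) \<e> r)"
  proof (rule dense_G[OF _ r3(1)])
    show "D (%e. EX m. pair (c1 (pair NA NB) h) (pair n m) \<e> e 0)" by (intro dfi)
    show "EX r'. cond r' & sub q r' & (EX m. pair (c1 (pair NA NB) h) (pair n m) \<e> r')"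
      if g: "bgen E S G'" "p0 \<in> G'" "q \<in> G'" "sub r3 q" for G' q
    proof (rule bgen.D2[OF g(1) nA nB g(2,3)])
      show "dec q NA (pair h n) emp" using dec_mono r1(2) r3(2) g(4) by blast
      show "pair (c0 (pair NA NB)) p1 \<e> q" using r2(2) r3(3) g(4) unfolding sub_def by blast
    qed
  qed
  then show ?thesis using x' hn by blast
qed

lemma G_match2: assumes y: "EG (N.pair x y) (val bn)"
  shows "EX r h n m. r \<in> G & x = j (pair h m) & pair (c1 (pair NA NB) h) (pair n m) \<e> r"
proof -
  obtain x' where x': "x = j x'" using NN.ThetaD(1)[OF Th[OF nB p0] y] unfolding N.pair_inj j_w1[symmetric] j_omega[symmetric] EG_j by (metis j_pair)
  obtain h m where hm: "x' = pair h m" using at_dom[OF nB p0] y unfolding x' prod by blast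
  obtain r1 where r1: "r1 \<in> G" "dec r1 NB (pair h m) emp"
    using n5[OF nB p0 y[unfolded x' hm] ND_emp] j_emp by (auto simp: N.sub_def)
  obtain r2 p1 where r2: "r2 \<in> G" "pair (c0 (pair NA NB)) p1 \<e> r2" using G_level[OF omega_0] by blast
  obtain r3 where r3: "r3 \<in> G" "sub r1 r3" "sub r2 r3" using G_dir[OF r1(1) r2(1)] by blast
  have "EX r. r \<in> G & (EX n. pair (c1 (pair NA NB) h) (pair n m) \<e> r)"
  proof (rule dense_G[OF _ r3(1)])
    show "D (%e. EX n. pair (c1 (pair NA NB) h) (pair n m) \<e> e 0)" by (intro dfi)
    show "EX r'. cond r' & sub q r' & (EX n. pair (c1 (pair NA NB) h) (pair n m) \<e> r')"
      if g: "bgen E S G'" "p0 \<in> G'" "q \<in> G'" "sub r3 q" for G' q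
    proof (rule bgen.D3[OF g(1) nA nB g(2,3)])
      show "dec q NB (pair h m) emp" using dec_mono r1(2) r3(2) g(4) by blast
      show "pair (c0 (pair NA NB)) p1 \<e> q" using r2(2) r3(3) g(4) unfolding sub_def by blast
    qed
  qed
  then show ?thesis using x' hm by blast
qed

text \<open>\<open>H\<close> is the union of the permutations at \<open>c0 (pair NA NB)\<close> in
  \<open>G\<close>. A pair of points matched in \<open>G\<close> respects all of them, since any two
  conditions of \<open>G\<close> have a common extension in \<open>G\<close>.\<close>

lemma matching: "EX H. NN.good H &
   (ALL x y. EG (N.pair x y) (val an) --> (EX x' y'. EG (N.pair x' y') (val bn) & NN.mt H y y')) &
   (ALL x' y'. EG (N.pair x' y') (val bn) --> (EX x y. EG (N.pair x y) (val an) & NN.mt H y y'))"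
proof -
  let ?al = "pair NA NB"
  obtain U where U: "!!z. EG z U \<longleftrightarrow> (EX r w. r \<in> G & w \<e> r & z = j w)" using G_set by blast
  define H where "H = N.sepS (N.prod NN.ND NN.ND) (%z. EX p. EG z p & EG (N.pair (j (c0 ?al)) p) U)"
  have "EG z H \<longleftrightarrow> EG z (N.prod NN.ND NN.ND) & (EX p. EG z p & EG (N.pair (j (c0 ?al)) p) U)" for z
    unfolding H_def by (rule N.sepS) (intro dfi)
  moreover have "EG (N.pair (j (c0 ?al)) p) U \<longleftrightarrow> (EX r q. r \<in> G & pair (c0 ?al) q \<e> r & p = j q)" for p
  proof
    assume "EG (N.pair (j (c0 ?al)) p) U"
    then obtain r w where r: "r \<in> G" "w \<e> r" "N.pair (j (c0 ?al)) p = j w" unfolding U by blast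
    obtain c v where "w = pair c v" using fact_prod condD(2)[OF cond_G[OF r(1)] r(2)] by blast
    then show "EX r q. r \<in> G & pair (c0 ?al) q \<e> r & p = j q" using r unfolding \<open>w = pair c v\<close> j_pair N.pair_inj j_inj by blast
  next
    assume "EX r q. r \<in> G & pair (c0 ?al) q \<e> r & p = j q"
    then show "EG (N.pair (j (c0 ?al)) p) U" unfolding U using j_pair by metis
  qed
  ultimately have H0: "EG z H \<longleftrightarrow> EG z (N.prod NN.ND NN.ND) & (EX r q. r \<in> G & pair (c0 ?al) q \<e> r & EG z (j q))" for z by metis
  have perm: "EX l. Perm q l" if "r \<in> G" "pair (c0 ?al) q \<e> r" for r q using cond0[OF cond_G[OF that(1)] that(2)] by blast
  have H: "EG z H \<longleftrightarrow> (EX r q s t l. r \<in> G & pair (c0 ?al) q \<e> r & Perm q l & pair s t \<e> q & z = N.pair (j s) (j t))" for z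
  proof
    assume "EG z H"
    then obtain r q where rq: "r \<in> G" "pair (c0 ?al) q \<e> r" "EG z (j q)" unfolding H0 by blast
    obtain w where w: "w \<e> q" "z = j w" using rq(3) unfolding EG_j by blast
    obtain l where l: "Perm q l" using perm[OF rq(1,2)] by blast
    obtain s t where "w = pair s t" using l w(1) unfolding Perm_def by blast
    then show "EX r q s t l. r \<in> G & pair (c0 ?al) q \<e> r & Perm q l & pair s t \<e> q & z = N.pair (j s) (j t)"
      using rq(1,2) l w j_pair by metis
  next
    assume "EX r q s t l. r \<in> G & pair (c0 ?al) q \<e> r & Perm q l & pair s t \<e> q & z = N.pair (j s) (j t)"
    then obtain r q s t l where *: "r \<in> G" "pair (c0 ?al) q \<e> r" "Perm q l" "pair s t \<e> q" "z = j (pair s t)" using j_pair by metis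
    have "s \<e> ND" "t \<e> ND" using PermD(1-3)[OF *(3)] *(4) ND by blast+
    then have "EG z (N.prod NN.ND NN.ND)" unfolding *(5) j_pair N.prod_pair j_ND[symmetric] by simp
    then show "EG z H" unfolding H0 using * by auto
  qed
  have H2: "EG (N.pair a b) H \<longleftrightarrow> (EX r q s t l. r \<in> G & pair (c0 ?al) q \<e> r & Perm q l & pair s t \<e> q & a = j s & b = j t)" for a b
    unfolding H N.pair_inj by blast
  \<comment> \<open>\<open>c\<close> selects the side on which \<open>x\<close> lies, so that both
    halves of \<open>good\<close> are covered.\<close>
  have lev: "EX l' s t r q l. EG l' N.omega & N.sub k l' & r \<in> G & pair (c0 ?al) q \<e> r & Perm q l & pair s t \<e> q & l' = j l &
       N.isfun (j s) l' (j S) & N.isfun (j t) l' (j S) & (if c then N.sub (j s) x else N.sub (j t) x)"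
    if x: "EG x (N.fs (j S))" and k: "EG k N.omega" for x k c
  proof -
    obtain k' where k': "k' \<e> omega" "k = j k'" using k unfolding j_omega[symmetric] EG_j by blast
    obtain r q L where q: "r \<in> G" "pair (c0 ?al) q \<e> r" "Perm q L" "sub k' L" using G_level[OF k'(1)] by blast
    note P = PermD[OF q(3)]
    have "N.sub (j L) N.omega" using sub_omega[OF P(1)] unfolding j_omega[symmetric] by simp
    then obtain t where t: "N.isfun t (j L) (j S)" "N.sub t x" using NN.restr_ex x unfolding N.fs by blast
    then obtain u where u: "t = j u" "isfun u L S" using j_isfun_conv[OF P(1)] by blast
    obtain s t where st: "pair s t \<e> q" "if c then s = u else t = u" using P(4,5)[OF u(2)] by (metis (full_types))
    have "N.isfun (j s) (j L) (j S)" "N.isfun (j t) (j L) (j S)" using j_isfun P(2,3)[OF st(1)] by blast+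
    moreover have "if c then N.sub (j s) x else N.sub (j t) x" using st(2) u(1) \<open>N.sub _ x\<close> by (simp split: if_splits)
    moreover have "N.sub k (j L)" "EG (j L) N.omega" using q(4) k'(2) P(1) unfolding j_omega[symmetric] by simp_all
    ultimately show ?thesis using q st(1) by blast
  qed
  have "NN.good H" unfolding NN.good_def
  proof (intro conjI allI impI)
    fix a b a' b' assume "EG (N.pair a b) H & EG (N.pair a' b') H"
    then obtain r q s t r' q' s' t' where *: "r \<in> G" "pair (c0 ?al) q \<e> r" "pair s t \<e> q" "a = j s" "b = j t"
      "r' \<in> G" "pair (c0 ?al) q' \<e> r'" "pair s' t' \<e> q'" "a' = j s'" "b' = j t'" unfolding H2 by blast
    obtain r1 where r1: "r1 \<in> G" "sub r r1" "sub r' r1" using G_dir[OF *(1,6)] by blast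
    have "coh q q'" using condD(3)[OF cond_G[OF r1(1)]] * r1 unfolding sub_def by blast
    then have "sub s s' \<longleftrightarrow> sub t t'" using *(3,8) unfolding coh_def by blast
    then show "N.sub a a' \<longleftrightarrow> N.sub b b'" using * by simp
  next
    fix z assume "EG z H"
    then obtain q s t l where *: "Perm q l" "pair s t \<e> q" "z = N.pair (j s) (j t)" unfolding H by blast
    have "N.isfun (j s) (j l) (j S)" "N.isfun (j t) (j l) (j S)" "EG (j l) N.omega"
      using j_isfun PermD(1-3)[OF *(1)] *(2) unfolding j_omega[symmetric] by auto
    then show "EX l s t. EG l N.omega & N.isfun s l (j S) & N.isfun t l (j S) & z = N.pair s t" using *(3) by blast
  next
    fix x k assume x: "EG x (N.fs (j S))" "EG k N.omega"
    show "EX l s t. EG l N.omega & N.sub k l & N.isfun s l (j S) & N.isfun t l (j S) & EG (N.pair s t) H & N.sub s x"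
      using lev[OF x, of True] unfolding H2 if_True by blast
    show "EX l s t. EG l N.omega & N.sub k l & N.isfun s l (j S) & N.isfun t l (j S) & EG (N.pair s t) H & N.sub t x"
      using lev[OF x, of False] unfolding H2 if_False by blast
  qed
  moreover have mt: "EX y y'. EG (N.pair (j (pair h n)) y) (val an) & EG (N.pair (j (pair h m)) y') (val bn) & NN.mt H y y'"
    if r: "r \<in> G" "pair (c1 ?al h) (pair n m) \<e> r" for r h n m
  proof -
    have ex: "EX s0 t0 r1. r1 \<in> G & pair s0 t0 \<e> q & dec r1 NA (pair h n) s0 & dec r1 NB (pair h m) t0"
      if rq: "r' \<in> G" "pair (c0 ?al) q \<e> r'" for r' q
    proof -
      obtain r1 where r1: "r1 \<in> G" "sub r r1" "sub r' r1" using G_dir[OF r(1) rq(1)] by blast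
      have "match r1 ?al h n m q" using condD(6)[OF cond_G[OF r1(1)]] r(2) rq(2) r1 unfolding sub_def by blast
      then show ?thesis unfolding match_def fst snd using r1(1) by blast
    qed
    obtain q0 where q0: "pair (c0 ?al) q0 \<e> r" using condD(5)[OF cond_G[OF r(1)] r(2)] by blast
    obtain s0 t0 r1 where r1: "r1 \<in> G" "dec r1 NA (pair h n) s0" "dec r1 NB (pair h m) t0" using ex[OF r(1) q0] by blast
    obtain y where y: "EG (N.pair (j (pair h n)) y) (val an)" using n3[OF nA p0 r1(1,2)] by blast
    obtain y' where y': "EG (N.pair (j (pair h m)) y') (val bn)" using n3[OF nB p0 r1(1,3)] by blast
    have yf: "N.isfun y N.omega (j S)" "N.isfun y' N.omega (j S)"
      using NN.ThetaD(4)[OF Th[OF nA p0] y] NN.ThetaD(4)[OF Th[OF nB p0] y'] by blast+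
    have "NN.mt H y y'" unfolding NN.mt_def
    proof (intro allI impI)
      fix a b assume "EG (N.pair a b) H"
      then obtain r' q s t l where *: "r' \<in> G" "pair (c0 ?al) q \<e> r'" "Perm q l" "pair s t \<e> q" "a = j s" "b = j t" unfolding H2 by blast
      obtain s1 t1 r2 where r2: "r2 \<in> G" "pair s1 t1 \<e> q" "dec r2 NA (pair h n) s1" "dec r2 NB (pair h m) t1" using ex[OF *(1,2)] by blast
      have s: "N.sub (j s1) y" "N.sub (j t1) y'" using n3'[OF nA p0 r2(1,3) y] n3'[OF nB p0 r2(1,4) y'] by blast+
      note P = PermD[OF *(3)]
      have "N.sub a y \<longleftrightarrow> s = s1" using NN.sub_common_same[OF j_isfun[OF P(2)[OF *(4)]] j_isfun[OF P(2)[OF r2(2)]] yf(1) _ s(1)] s(1) *(5) by auto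
      moreover have "N.sub b y' \<longleftrightarrow> t = t1" using NN.sub_common_same[OF j_isfun[OF P(3)[OF *(4)]] j_isfun[OF P(3)[OF r2(2)]] yf(2) _ s(2)] s(2) *(6) by auto
      ultimately show "N.sub a y \<longleftrightarrow> N.sub b y'" using P(6)[OF *(4) r2(2)] by blast
    qed
    then show ?thesis using y y' by blast
  qed
  moreover have "EX x' y'. EG (N.pair x' y') (val bn) & NN.mt H y y'" if y: "EG (N.pair x y) (val an)" for x y
  proof -
    obtain r h n m where m: "r \<in> G" "x = j (pair h n)" "pair (c1 ?al h) (pair n m) \<e> r" using G_match1[OF y] by blast
    obtain y1 y' where "EG (N.pair x y1) (val an)" "EG (N.pair (j (pair h m)) y') (val bn)" "NN.mt H y1 y'" using mt[OF m(1,3)] m(2) by blast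
    moreover from this have "y1 = y" using NN.ThetaD(2)[OF Th[OF nA p0] _ y] by blast
    ultimately show ?thesis by blast
  qed
  moreover have "EX x y. EG (N.pair x y) (val an) & NN.mt H y y'" if y: "EG (N.pair x' y') (val bn)" for x' y'
  proof -
    obtain r h n m where m: "r \<in> G" "x' = j (pair h m)" "pair (c1 ?al h) (pair n m) \<e> r" using G_match2[OF y] by blast
    obtain y1 y2 where "EG (N.pair (j (pair h n)) y1) (val an)" "EG (N.pair x' y2) (val bn)" "NN.mt H y1 y2" using mt[OF m(1,3)] m(2) by blast
    moreover from this have "y2 = y'" using NN.ThetaD(2)[OF Th[OF nB p0] _ y] by blast
    ultimately show ?thesis by blast
  qed
  ultimately show ?thesis by blast
qed

end

theorem BA_ext: "N.BA (N.fs (j S))"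
  unfolding N.BA_def
proof (intro allI impI, elim conjE)
  fix A B assume d: "N.dense1 (N.fs (j S)) A" "N.dense1 (N.fs (j S)) B"
  obtain a where a: "NN.Theta a" "!!y. EG y A \<longleftrightarrow> (EX x. EG (N.pair x y) a)" using NN.blocks[OF d(1)] by blast
  obtain b where b: "NN.Theta b" "!!y. EG y B \<longleftrightarrow> (EX x. EG (N.pair x y) b)" using NN.blocks[OF d(2)] by blast
  obtain an bn where n: "a = val an" "b = val bn" using val_surj by metis
  obtain p1 NA where p1: "p1 \<in> G" "nice p1 an NA" using nice_ex[OF bgen_axioms a(1)[unfolded n]] by blast
  obtain p2 NB where p2: "p2 \<in> G" "nice p2 bn NB" using nice_ex[OF bgen_axioms b(1)[unfolded n]] by blast
  obtain p0 where p0: "p0 \<in> G" "sub p1 p0" "sub p2 p0" using G_dir[OF p1(1) p2(1)] by blast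
  note nA = nice_mono[OF p1(2) G_P[OF p1(1)] p0(2)] and nB = nice_mono[OF p2(2) G_P[OF p2(1)] p0(3)]
  obtain H where H: "NN.good H"
    "!!x y. EG (N.pair x y) a ==> EX x' y'. EG (N.pair x' y') b & NN.mt H y y'"
    "!!x' y'. EG (N.pair x' y') b ==> EX x y. EG (N.pair x y) a & NN.mt H y y'"
    using matching[OF nA nB p0(1)] unfolding n by blast
  show "EX h. N.autoh (N.fs (j S)) h & N.imgR h A B"
  proof (rule NN.homeo_ex[OF H(1) NN.dense1D(1)[OF d(1)] NN.dense1D(1)[OF d(2)]])
    show "EG y A ==> EX z. EG z B & NN.mt H y z" for y unfolding a(2) b(2) using H(2) by blast
    show "EG z B ==> EX y. EG y A & NN.mt H y z" for z unfolding a(2) b(2) using H(3) by blast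
  qed
qed

end

section \<open>Failure of the Lipschitz axioms\<close>

definition env4 :: "'a => 'a => 'a => 'a => nat => 'a" where
  "env4 a b c d = (%i. if i = 0 then a else if i = 1 then b else if i = 2 then c else d)"
lemma env4 [simp]: "env4 a b c d 0 = a" "env4 a b c d (Suc 0) = b" "env4 a b c d 2 = c" "env4 a b c d 3 = d" by (auto simp: env4_def)
lemma env4_comp: "(%i. f (env4 a b c d i)) = env4 (f a) (f b) (f c) (f d)" by (auto simp: env4_def)

lemma (in forcing) frc4_D: "T s ==> T t ==> T u ==> T v ==> T w ==> D (%e. frc (s e) (env4 (t e) (u e) (v e) (w e)) a)"
proof -
  assume t: "T s" "T t" "T u" "T v" "T w"
  have "D (%e. frc (s e) (%i. (if i = 0 then t else if i = 1 then u else if i = 2 then v else w) e) a)"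
    by (rule frc_D) (use t in auto)
  moreover have "(%i. (if i = 0 then t else if i = 1 then u else if i = 2 then v else w) e) = env4 (t e) (u e) (v e) (w e)" for e
    by (auto simp: env4_def)
  ultimately show ?thesis by (simp only:)
qed

text \<open>All that must survive a change of the generic filter: \<open>X\<close> is the full
  space, the members of the sequence are Lipschitz on it, and the sequence is single-valued.\<close>

definition lipF_s :: sfm where
  "lipF_s = ((\<^bold>\<forall>x. x \<^bold>\<in> 1 \<^bold>\<longleftrightarrow> function_s x 2 3) \<^bold>\<and>
    (\<^bold>\<forall>n f. n \<^bold>\<in> 2 \<^bold>\<and> app_s 0 n f \<^bold>\<longrightarrow> lipschitz_s 2 1 f) \<^bold>\<and>
    (\<^bold>\<forall>n f g. app_s 0 n f \<^bold>\<and> app_s 0 n g \<^bold>\<longrightarrow> f \<^bold>= g))"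
definition hit_s :: sfm where "hit_s = (\<^bold>\<exists>f. app_s 0 1 f \<^bold>\<and> app_s f 2 3)"

lemma (in zfc) sat_lipF: "sat E (env4 F X omega S) (lipF_s 4) \<longleftrightarrow> (ALL x. x \<e> X \<longleftrightarrow> isfun x omega S) &
    (ALL n f. n \<e> omega & pair n f \<e> F --> lipR X f) & (ALL n f g. pair n f \<e> F & pair n g \<e> F --> f = g)"
  by (simp add: lipF_s_def sfm_sat sat_function sat_app sat_lip del: fun_upd_apply)

lemma (in zfc) sat_hit: "sat E (env4 F n x y) (hit_s 4) \<longleftrightarrow> (EX f. pair n f \<e> F & pair x y \<e> f)"
  by (simp add: hit_s_def sfm_sat sat_app del: fun_upd_apply)

context baum
begin

abbreviation "one \<equiv> succ emp"
lemma two_mem: "emp \<e> two" "one \<e> two" by (simp_all add: two_def)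

lemma fresh_pos: assumes "cond r" shows "EX k. k \<e> omega & (ALL d. ~ pair c (pair k d) \<e> r & ~ pair c' (pair k d) \<e> r)"
proof -
  have t: "T (%e. fst (e 0))" by (intro dfi)
  let ?M = "cup (img fst (fib r c)) (img fst (fib r c'))"
  have "fin ?M" by (intro fin_cup fin_img[OF t] fin_fib[OF assms])
  then have "~ sub omega ?M" using fin_sub not_fin_omega by blast
  then obtain k where k: "k \<e> omega" "~ k \<e> ?M" unfolding sub_def by blast
  then show ?thesis unfolding cup img[OF t] fib using fst by metis
qed

lemma ctbl_cup: assumes "ctbl x" "ctbl y" shows "ctbl (cup x y)"
  unfolding cup_def by (rule ctbl_un[OF fin_ctbl[OF fin_upair]]) (use assms in auto)

lemma fresh_coord: assumes r: "cond r" and i0: "i0 \<e> w1" shows "EX i. i \<e> w1 & ~ i \<e> i0 & (ALL x. ~ pair (c2 t i) x \<e> r)"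
proof -
  have T: "T (%e. snd (snd (fst (e 0))))" by (intro dfi)
  let ?M = "cup (img (%w. snd (snd (fst w))) r) i0"
  have "ctbl ?M" by (intro ctbl_cup fin_ctbl fin_img[OF T] condD(1)[OF r] w1(3)[OF i0])
  then have "~ sub w1 ?M" using cov_sub w1(2) by blast
  then obtain i where i: "i \<e> w1" "~ i \<e> ?M" unfolding sub_def by blast
  have "~ pair (c2 t i) x \<e> r" for x
  proof
    assume a: "pair (c2 t i) x \<e> r"
    have "i = snd (snd (fst (pair (c2 t i) x)))" by (simp add: c2_def)
    then have "i \<e> ?M" unfolding cup img[OF T] using a by blast
    then show False using i by blast
  qed
  then show ?thesis using i unfolding cup by blast
qed

lemma add_node: assumes r: "cond r" and x: "t \<e> two" "i \<e> w1" "!!x. ~ pair (c2 t i) x \<e> r" and s: "s \<e> ND"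
  shows "cond (cup r (img (pair (c2 t i)) s))"
proof (rule cond_cup[OF r])
  have T: "T (%e. pair (c2 t i) (e 0))" by (intro dfi)
  note m = img[OF T, of _ s]
  obtain l where l: "l \<e> omega" "isfun s l S" using ND_fun[OF s] by blast
  have f: "fin (img (pair (c2 t i)) s)" by (rule fin_img[OF T fun_fin[OF fin_nat[OF l(1)] l(2)]])
  have sp: "EX k d. w = pair k d & k \<e> omega & d \<e> S" if "w \<e> s" for w
    using that nat_mem[OF l(1)] l(2) unfolding fun_mem[OF l(2)] isfun_def by blast
  show "cond (img (pair (c2 t i)) s)" unfolding cond_def
  proof (intro conjI allI impI)
    show "k0 w | k1 w | k2 w" if "w \<e> img (pair (c2 t i)) s" for w
      using that sp x(1,2) unfolding m k2_def by blast
  qed (use f fun_pair[OF l(2)] in \<open>auto simp: m\<close>)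
  show "fagree r (img (pair (c2 t i)) s)" unfolding fagree_def m pair_inj using x(3) by blast
qed

text \<open>Only the coordinate \<open>c2 t i\<close> is touched, so a position left open at another
  coordinate stays open.\<close>

lemma fill: assumes r: "cond r" and x: "t \<e> two" "i \<e> w1" and l: "l \<e> omega"
  shows "EX r' u. cond r' & sub r r' & isfun u l S & (ALL w. w \<e> u --> pair (c2 t i) w \<e> r') &
    (ALL c x. c ~= c2 t i --> (pair c x \<e> r' \<longleftrightarrow> pair c x \<e> r))"
  using l
proof (induct rule: omega_induct)
  case D show ?case by (intro dfi)
next
  case emp
  have "isfun (zfc.emp E) (zfc.emp E) S" unfolding isfun_iff by simp
  then show ?case using r by (intro exI[of _ r] exI[of _ "zfc.emp E"]) simp
next
  case (succ l)
  have cs: "z \<e> zfc.succ E l \<longleftrightarrow> z \<e> l | z = l" for z by simp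
  obtain r' u where u: "cond r'" "sub r r'" "isfun u l S" "!!w. w \<e> u ==> pair (c2 t i) w \<e> r'"
    "!!c x. c ~= c2 t i ==> pair c x \<e> r' \<longleftrightarrow> pair c x \<e> r" using succ(2) by blast
  have "EX r'' d. cond r'' & sub r' r'' & d \<e> S & pair (c2 t i) (pair l d) \<e> r'' &
     (ALL c x. c ~= c2 t i --> (pair c x \<e> r'' \<longleftrightarrow> pair c x \<e> r'))"
  proof (cases "EX d. pair (c2 t i) (pair l d) \<e> r'")
    case True
    then show ?thesis using cond2[OF u(1)] u(1) sub_refl pair_inj by metis
  next
    case False
    then have "cond (adj r' (pair (c2 t i) (pair l (zfc.emp E))))" using add2[OF u(1) x succ(1) S_0] by blast
    then show ?thesis using S_0 by (intro exI[of _ "adj r' (pair (c2 t i) (pair l (zfc.emp E)))"] exI[of _ "zfc.emp E"]) (simp add: sub_def)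
  qed
  then obtain r'' d where d: "cond r''" "sub r' r''" "d \<e> S" "pair (c2 t i) (pair l d) \<e> r''"
    "!!c x. c ~= c2 t i ==> pair c x \<e> r'' \<longleftrightarrow> pair c x \<e> r'" by blast
  have "isfun (adj u (pair l d)) (zfc.succ E l) S" by (rule node_adj[OF u(3) d(3) succ(1)])
  moreover have "ALL w. w \<e> adj u (pair l d) --> pair (c2 t i) w \<e> r''" using u(4) d(2,4) unfolding adj sub_def by blast
  moreover have "ALL c x. c ~= c2 t i --> (pair c x \<e> r'' \<longleftrightarrow> pair c x \<e> r)" using u(5) d(5) by blast
  ultimately show ?case using d(1) sub_trans[OF u(2) d(2)] by (intro exI[of _ r''] exI[of _ "adj u (pair l d)"]) blast
qed

text \<open>The canonical name for the \<open>i\<close>-th generic point of set number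
  \<open>t\<close>: each value enters with the conditions that contain it.\<close>

definition cn where "cn t i = sepS (prod (img chk (prod omega S)) PP) (%z. EX k d r. z = pair (chk (pair k d)) r & pair (c2 t i) (pair k d) \<e> r)"
lemma cn_T [dfi]: "T s ==> T t ==> T (%e. cn (s e) (t e))" unfolding cn_def by (intro dfi dft_shift)

end

section \<open>The generic points in the extension\<close>

context bgen
begin

lemma cn_mem: "EG z (val (cn t i)) \<longleftrightarrow> (EX r k d. r \<in> G & pair (c2 t i) (pair k d) \<e> r & z = N.pair (j k) (j d))"
proof -
  have t: "T (%e. chk (e 0))" by (intro dfi)
  have m: "z \<e> cn t i \<longleftrightarrow> z \<e> prod (img chk (prod omega S)) PP & (EX k d r. z = pair (chk (pair k d)) r & pair (c2 t i) (pair k d) \<e> r)" for z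
    unfolding cn_def by (rule sepS) (intro dfi)
  have nm: "nm (cn t i) u q \<longleftrightarrow> q \<e> PP & (EX k d. u = chk (pair k d) & pair (c2 t i) (pair k d) \<e> q)" for u q
  proof
    assume "q \<e> PP & (EX k d. u = chk (pair k d) & pair (c2 t i) (pair k d) \<e> q)"
    then obtain k d where k: "q \<e> PP" "u = chk (pair k d)" "pair (c2 t i) (pair k d) \<e> q" by blast
    then have kd: "pair k d \<e> prod omega S" using cond2[of q t i "pair k d"] PP by auto
    show "nm (cn t i) u q" unfolding nm_def m[of "pair u q"] prod_pair[of u q] img[OF t] pair_inj using k kd by blast
  next
    assume "nm (cn t i) u q"
    then show "q \<e> PP & (EX k d. u = chk (pair k d) & pair (c2 t i) (pair k d) \<e> q)"
      unfolding nm_def m[of "pair u q"] pair_inj by blast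
  qed
  show ?thesis unfolding EG_val memG_def nm val_eq[symmetric] val_nam j_pair[symmetric] unfolding j_def using G_P by blast
qed

lemma cn_pair: "EG (N.pair (j k) (j d)) (val (cn t i)) \<longleftrightarrow> (EX r. r \<in> G & pair (c2 t i) (pair k d) \<e> r)"
  unfolding cn_mem by auto

lemma cn_total: assumes x: "t \<e> two" "i \<e> w1" "k \<e> omega" shows "EX r d. r \<in> G & pair (c2 t i) (pair k d) \<e> r"
proof -
  have "EX r. r \<in> G & sub emp r & (EX d. pair (c2 t i) (pair k d) \<e> r)"
  proof (rule gen_below[OF _ G_one])
    show "D (%e. EX d. pair (c2 t i) (pair k d) \<e> e 0)" by (intro dfi)
    fix q assume q: "q \<e> PP"
    show "EX r. r \<e> PP & sub q r & (EX d. pair (c2 t i) (pair k d) \<e> r)"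
    proof (cases "EX d. pair (c2 t i) (pair k d) \<e> q")
      case False
      then have "cond (adj q (pair (c2 t i) (pair k emp)))" using add2[OF q[unfolded PP] x S_0] by blast
      moreover have "sub q (adj q (pair (c2 t i) (pair k emp)))" by (simp add: sub_def)
      ultimately show ?thesis unfolding PP by (intro exI[of _ "adj q (pair (c2 t i) (pair k emp))"]) auto
    qed (use q sub_refl in blast)
  qed
  then show ?thesis by blast
qed

lemma cn_fun: assumes x: "t \<e> two" "i \<e> w1" shows "N.isfun (val (cn t i)) N.omega (j S)"
  unfolding N.isfun_iff
proof (intro conjI allI impI)
  fix p assume "EG p (val (cn t i))"
  then obtain r k d where r: "r \<in> G" "pair (c2 t i) (pair k d) \<e> r" "p = N.pair (j k) (j d)" unfolding cn_mem by blast
  then have "k \<e> omega" "d \<e> S" using cond2[OF cond_G[OF r(1)] r(2)] by auto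
  then show "EX x y. EG x N.omega & EG y (j S) & p = N.pair x y" using r(3) unfolding j_omega[symmetric] using EG_jj by blast
next
  fix n assume "EG n N.omega"
  then obtain k where k: "k \<e> omega" "n = j k" unfolding j_omega[symmetric] EG_j by blast
  obtain r d where r: "r \<in> G" "pair (c2 t i) (pair k d) \<e> r" using cn_total[OF x k(1)] by blast
  have "v = j d" if "EG (N.pair n v) (val (cn t i))" for v
  proof -
    obtain r' d' where r': "r' \<in> G" "pair (c2 t i) (pair k d') \<e> r'" "v = j d'"
      using \<open>EG (N.pair n v) (val (cn t i))\<close> unfolding cn_mem k(2) N.pair_inj j_inj by blast
    obtain r1 where r1: "r1 \<in> G" "sub r r1" "sub r' r1" using G_dir[OF r(1) r'(1)] by blast
    have "d' = d" using condD(7)[OF cond_G[OF r1(1)]] r(2) r'(2) r1(2,3) unfolding sub_def by blast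
    then show ?thesis using r' by simp
  qed
  then show "EX y. ALL v. EG (N.pair n v) (val (cn t i)) \<longleftrightarrow> v = y"
    using r cn_pair k(2) by (intro exI[of _ "j d"]) blast
qed

lemma cn_inj: assumes x: "t \<e> two" "i \<e> w1" "i' \<e> w1" "i ~= i'" shows "val (cn t i) ~= val (cn t i')"
proof -
  have "EX r. r \<in> G & sub emp r & (EX k. pair (c2 t i) (pair k emp) \<e> r & pair (c2 t i') (pair k one) \<e> r)"
  proof (rule gen_below[OF _ G_one])
    show "D (%e. EX k. pair (c2 t i) (pair k emp) \<e> e 0 & pair (c2 t i') (pair k one) \<e> e 0)" by (intro dfi)
    fix q assume q: "q \<e> PP"
    obtain k where k: "k \<e> omega" "!!d. ~ pair (c2 t i) (pair k d) \<e> q" "!!d. ~ pair (c2 t i') (pair k d) \<e> q"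
      using fresh_pos[OF q[unfolded PP]] by blast
    let ?q = "adj q (pair (c2 t i) (pair k emp))"
    have q1: "cond ?q" by (rule add2[OF q[unfolded PP] x(1,2) k(1) S_0 k(2)])
    let ?q' = "adj ?q (pair (c2 t i') (pair k one))"
    have "cond ?q'" by (rule add2[OF q1 x(1,3) k(1) S_1]) (use k(3) x(4) in simp)
    moreover have "sub q ?q'" by (simp add: sub_def)
    moreover have "pair (c2 t i) (pair k emp) \<e> ?q'" "pair (c2 t i') (pair k one) \<e> ?q'" by simp_all
    ultimately show "EX r. r \<e> PP & sub q r & (EX k. pair (c2 t i) (pair k emp) \<e> r & pair (c2 t i') (pair k one) \<e> r)"
      unfolding PP by blast
  qed
  then obtain r k where r: "r \<in> G" "pair (c2 t i) (pair k emp) \<e> r" "pair (c2 t i') (pair k one) \<e> r" by blast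
  show ?thesis
  proof
    assume eq: "val (cn t i) = val (cn t i')"
    have "EG (N.pair (j k) (j emp)) (val (cn t i))" "EG (N.pair (j k) (j one)) (val (cn t i'))"
      unfolding cn_pair using r by blast+
    then have e: "EG (N.pair (j k) (j emp)) (val (cn t i))" "EG (N.pair (j k) (j one)) (val (cn t i))"
      unfolding eq by simp_all
    note fp = NN.fun_pair[OF cn_fun[OF x(1,2)], of "j k"]
    have "j emp = j one" using e unfolding fp by simp
    then show False unfolding j_inj using succ_ne by metis
  qed
qed

text \<open>A condition mentions finitely many coordinates, so some point with an index outside
  \<open>i0\<close> is still free to begin with \<open>s\<close>.\<close>

lemma cn_unbounded: assumes x: "t \<e> two" "i0 \<e> w1" "s \<e> ND" shows "EX i. i \<e> w1 & ~ i \<e> i0 & N.sub (j s) (val (cn t i))"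
proof -
  have "EX r. r \<in> G & sub emp r & (EX i. i \<e> w1 & ~ i \<e> i0 & (ALL w. w \<e> s --> pair (c2 t i) w \<e> r))"
  proof (rule gen_below[OF _ G_one])
    show "D (%e. EX i. i \<e> w1 & ~ i \<e> i0 & (ALL w. w \<e> s --> pair (c2 t i) w \<e> e 0))" by (intro dfi)
    fix q assume q: "q \<e> PP"
    obtain i where i: "i \<e> w1" "~ i \<e> i0" "!!x. ~ pair (c2 t i) x \<e> q" using fresh_coord[OF q[unfolded PP] x(2)] by blast
    have T: "T (%e. pair (c2 t i) (e 0))" by (intro dfi)
    have "cond (cup q (img (pair (c2 t i)) s))" by (rule add_node[OF q[unfolded PP] x(1) i(1,3) x(3)])
    moreover have "ALL w. w \<e> s --> pair (c2 t i) w \<e> cup q (img (pair (c2 t i)) s)" unfolding cup img[OF T] by blast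
    moreover have "sub q (cup q (img (pair (c2 t i)) s))" by (simp add: sub_def)
    ultimately show "EX r. r \<e> PP & sub q r & (EX i. i \<e> w1 & ~ i \<e> i0 & (ALL w. w \<e> s --> pair (c2 t i) w \<e> r))"
      unfolding PP using i(1,2) by blast
  qed
  then obtain r i where r: "r \<in> G" "i \<e> w1" "~ i \<e> i0" "!!w. w \<e> s ==> pair (c2 t i) w \<e> r" by blast
  obtain l where l: "isfun s l S" using ND_fun[OF x(3)] by blast
  have "EG z (val (cn t i))" if z: "EG z (j s)" for z
  proof -
    obtain w where w: "w \<e> s" "z = j w" using z unfolding EG_j by blast
    obtain k where "w = pair k (app s k)" using w(1) unfolding fun_mem[OF l] by blast
    then have "z = j (pair k (app s k))" "pair k (app s k) \<e> s" using w by blast+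
    then show ?thesis using r(1,4) unfolding cn_mem j_pair by blast
  qed
  then show ?thesis using r(2,3) N.subI by blast
qed

text \<open>Every \<open>cn t i\<close> is a separate name. Read off uniformly from the set of facts
  in \<open>G\<close>, the points become the values of a function definable in the
  extension.\<close>

lemma cn_set: "EX C. dft EG (%e. C (e 0)) & (ALL i. i \<e> w1 --> C (j i) = val (cn t i))"
proof -
  obtain U where U: "!!z. EG z U \<longleftrightarrow> (EX r w. r \<in> G & w \<e> r & z = j w)" using G_set by blast
  define C where "C i = N.sepS (N.prod N.omega (j S)) (%z. EG (N.pair (N.pair (j two) (N.pair (j t) i)) z) U)" for i
  have "dft EG (%e. C (e 0))" unfolding C_def by (intro dfi)
  moreover have "C (j i) = val (cn t i)" for i
  proof (rule N.extens)
    fix z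
    have "EG z (C (j i)) \<longleftrightarrow> EG z (N.prod N.omega (j S)) & EG (N.pair (j (c2 t i)) z) U"
      unfolding C_def c2_def j_pair by (rule N.sepS) (intro dfi)
    also have "\<dots> \<longleftrightarrow> (EX r k d. r \<in> G & pair (c2 t i) (pair k d) \<e> r & z = N.pair (j k) (j d))"
    proof
      assume "EG z (N.prod N.omega (j S)) & EG (N.pair (j (c2 t i)) z) U"
      then obtain k d r w where *: "z = j (pair k d)" "r \<in> G" "w \<e> r" "N.pair (j (c2 t i)) z = j w"
        unfolding N.prod j_omega[symmetric] EG_j U j_pair by blast
      then have "w = pair (c2 t i) (pair k d)" using j_pair j_inj by metis
      then show "EX r k d. r \<in> G & pair (c2 t i) (pair k d) \<e> r & z = N.pair (j k) (j d)" using * j_pair by blast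
    next
      assume "EX r k d. r \<in> G & pair (c2 t i) (pair k d) \<e> r & z = N.pair (j k) (j d)"
      then obtain r k d where *: "r \<in> G" "pair (c2 t i) (pair k d) \<e> r" "z = j (pair k d)" unfolding j_pair by blast
      have "k \<e> omega" "d \<e> S" using cond2[OF cond_G[OF *(1)] *(2)] by auto
      then have "EG z (N.prod N.omega (j S))" unfolding *(3) j_omega[symmetric] j_prod[symmetric] by simp
      moreover have "EG (N.pair (j (c2 t i)) z) U" unfolding U *(3) j_pair[symmetric] using *(1,2) by blast
      ultimately show "EG z (N.prod N.omega (j S)) & EG (N.pair (j (c2 t i)) z) U" by blast
    qed
    finally show "EG z (C (j i)) \<longleftrightarrow> EG z (val (cn t i))" unfolding cn_mem .
  qed
  ultimately show ?thesis by blast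
qed

lemma cn_dense: assumes t: "t \<e> two" and C: "dft EG (%e. C (e 0))" "!!i. i \<e> w1 ==> C (j i) = val (cn t i)"
  shows "N.dense1 (N.fs (j S)) (N.img C N.w1)"
proof (rule NN.dense1I)
  have w: "EG i N.w1 \<longleftrightarrow> (EX i'. i' \<e> w1 & i = j i')" for i unfolding j_w1[symmetric] EG_j ..
  show "N.sub (N.img C N.w1) (N.fs (j S))" unfolding N.sub_def N.img[OF C(1)] w N.fs using C(2) cn_fun[OF t] by auto
  show "N.cov N.w1 (N.img C N.w1)" by (rule N.cov_img[OF C(1)])
  fix s assume "EG s NN.ND"
  then obtain s' where s': "s' \<e> ND" "s = j s'" unfolding j_ND[symmetric] EG_j by blast
  show "~ N.ctbl (NN.part (N.img C N.w1) s)"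
  proof
    assume c: "N.ctbl (NN.part (N.img C N.w1) s)"
    note dftc1[OF C(1)[unfolded dft_def], dfi]
    define K where "K = N.sepS N.w1 (%i. N.sub s (C i))"
    have K: "EG i K \<longleftrightarrow> EG i N.w1 & N.sub s (C i)" for i unfolding K_def by (rule N.sepS) (intro dfi)
    have la: "N.app (N.lam K C) i = C i" if "EG i K" for i using N.lam(2)[OF C(1) that] .
    have "EG (N.app (N.lam K C) i) (NN.part (N.img C N.w1) s)" if "EG i K" for i
      unfolding la[OF that] NN.part N.img[OF C(1)] using that unfolding K by blast
    then have "N.isfun (N.lam K C) K (NN.part (N.img C N.w1) s)" unfolding N.isfun_def using N.lam(1)[OF C(1)] by blast
    moreover have "N.inje (N.lam K C) K" unfolding N.inje_def
    proof (intro allI impI, elim conjE)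
      fix x y assume xy: "EG x K" "EG y K" "N.app (N.lam K C) x = N.app (N.lam K C) y"
      then have "C x = C y" using la by metis
      moreover obtain x' y' where "x' \<e> w1" "x = j x'" "y' \<e> w1" "y = j y'" using xy(1,2) unfolding K w by blast
      ultimately show "x = y" using cn_inj[OF t] C(2) by metis
    qed
    ultimately have "N.cov (NN.part (N.img C N.w1) s) K" by (rule N.inj_cov)
    then have "N.ctbl K" using N.cov_trans[OF c] by blast
    moreover have "N.sub K N.w1" unfolding N.sub_def K by blast
    \<comment> \<open>Being countable, \<open>K\<close> would be bounded in \<open>w1\<close>, while
      \<open>cn_unbounded\<close> finds a member of \<open>K\<close> beyond the bound.\<close>
    ultimately have "EG (N.un K) N.w1" using N.w1_un by blast
    then have "EG (N.succ (N.un K)) N.w1" by (rule N.w1_succ)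
    then obtain i0 where i0: "i0 \<e> w1" "N.succ (N.un K) = j i0" unfolding w by blast
    obtain i where i: "i \<e> w1" "~ i \<e> i0" "N.sub (j s') (val (cn t i))" using cn_unbounded[OF t i0(1) s'(1)] by blast
    have iK: "EG (j i) K" unfolding K w s'(2) using i C(2)[OF i(1)] by auto
    have "~ EG (j i) (N.succ (N.un K))" unfolding i0(2) using i(2) by simp
    moreover have "N.Ord (j i)" "N.Ord (N.succ (N.un K))" using N.Ord_mem[OF N.w1(1)] i(1) i0 unfolding w by auto
    ultimately have "EG (N.succ (N.un K)) (j i) | N.succ (N.un K) = j i" using N.Ord_lin by blast
    then have "EG (N.un K) (j i)"
    proof
      assume a: "EG (N.succ (N.un K)) (j i)"
      have "EG (N.un K) (N.succ (N.un K))" by simp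
      then show ?thesis using N.Ord_trsD[OF \<open>N.Ord (j i)\<close> a] by blast
    next
      assume "N.succ (N.un K) = j i"
      then show ?thesis by (metis N.succ)
    qed
    then have "EG (N.un K) (N.un K)" unfolding N.un using iK by blast
    then show False by simp
  qed
qed

text \<open>Two compatible conditions which force two values of the same Lipschitz function at arguments with
  the same initial segment of length \<open>m + 1\<close> can be extended so as to make the values differ at \<open>m\<close>.\<close>

lemma no_lipschitz_cover:
  assumes C: "dft EG (%e. C (e 0))" "!!i. i \<e> w1 ==> C (j i) = val (cn emp i)"
    and D: "dft EG (%e. D' (e 0))" "!!i. i \<e> w1 ==> D' (j i) = val (cn one i)"
    and fu: "!!n f g. EG (N.pair n f) F ==> EG (N.pair n g) F ==> f = g"
    and lip: "!!n f. EG n N.omega ==> EG (N.pair n f) F ==> N.lipR (N.fs (j S)) f"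
    and cover: "!!y. EG y (N.img D' N.w1) ==> EX n f x. EG n N.omega & EG (N.pair n f) F & EG x (N.img C N.w1) & EG (N.pair x y) f"
  shows False
proof -
  have w: "EG i N.w1 \<longleftrightarrow> (EX i'. i' \<e> w1 & i = j i')" for i unfolding j_w1[symmetric] EG_j ..
  obtain Fn where Fn: "F = val Fn" using val_surj by blast
  obtain Xn where Xn: "N.fs (j S) = val Xn" using val_surj by blast
  have "sat EG (%i. val (env4 Fn Xn (chk omega) (chk S) i)) (lipF_s 4)"
    unfolding env4_comp j_def[symmetric] Fn[symmetric] Xn[symmetric] j_omega N.sat_lipF using fu lip by auto
  then obtain p0 where p0: "p0 \<in> G" "frc p0 (env4 Fn Xn (chk omega) (chk S)) (lipF_s 4)" unfolding truth by blast
  \<comment> \<open>The coordinate of the \<open>i\<close>-th point must occur in \<open>r\<close>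
    although its position \<open>m\<close> is open: if it occurs in the other condition as well, the
    equal fibres keep \<open>m\<close> open there too.\<close>
  define Q where "Q i w \<longleftrightarrow> (EX r k n m u. w = pair (pair r k) (pair n (pair m u)) & r \<e> PP & sub p0 r & k \<e> w1 & n \<e> omega & m \<e> omega &
     isfun u (succ m) S & (ALL z. z \<e> u --> pair (c2 emp k) z \<e> r) & (ALL d. ~ pair (c2 one i) (pair m d) \<e> r) &
     (EX z. pair (c2 one i) z \<e> r) & frc r (env4 Fn (chk n) (cn emp k) (cn one i)) (hit_s 4))" for i w
  have "D (%e. Q (e 0) (e (Suc 0)))" unfolding Q_def by (intro dfi frc4_D)
  moreover have "EX w. Q i w" if i: "i \<e> w1" for i
  proof -
    have "EG (val (cn one i)) (N.img D' N.w1)" unfolding N.img[OF D(1)] w using D(2)[OF i] i by metis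
    then obtain n f x where x: "EG n N.omega" "EG (N.pair n f) F" "EG x (N.img C N.w1)" "EG (N.pair x (val (cn one i))) f" using cover by blast
    obtain n' where n: "n' \<e> omega" "n = j n'" using x(1) unfolding j_omega[symmetric] EG_j by blast
    obtain k where k: "k \<e> w1" "x = val (cn emp k)" using x(3) C(2) unfolding N.img[OF C(1)] w by blast
    have "sat EG (%l. val (env4 Fn (chk n') (cn emp k) (cn one i) l)) (hit_s 4)"
      unfolding env4_comp j_def[symmetric] Fn[symmetric] N.sat_hit using x n k by blast
    then obtain q where q: "q \<in> G" "frc q (env4 Fn (chk n') (cn emp k) (cn one i)) (hit_s 4)" unfolding truth by blast
    obtain r where r: "r \<in> G" "sub p0 r" "sub q r" using G_dir[OF p0(1) q(1)] by blast
    obtain r0 d where r0: "r0 \<in> G" "pair (c2 one i) (pair emp d) \<e> r0" using cn_total[OF two_mem(2) i omega_0] by blast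
    obtain r1 where r1: "r1 \<in> G" "sub r r1" "sub r0 r1" using G_dir[OF r(1) r0(1)] by blast
    obtain m where m: "m \<e> omega" "!!d. ~ pair (c2 one i) (pair m d) \<e> r1" using fresh_pos[OF cond_G[OF r1(1)]] by blast
    obtain r2 u where r2: "cond r2" "sub r1 r2" "isfun u (succ m) S" "!!z. z \<e> u ==> pair (c2 emp k) z \<e> r2"
      "!!c x. c ~= c2 emp k ==> pair c x \<e> r2 \<longleftrightarrow> pair c x \<e> r1"
      using fill[OF cond_G[OF r1(1)] two_mem(1) k(1) omega_succ[OF m(1)]] by blast
    have ne: "c2 one i ~= c2 emp k" by simp
    have s: "sub p0 r2" "sub q r2" "sub r0 r2" using sub_trans r r1 r2(2) by blast+
    have r2P: "r2 \<e> PP" using r2(1) PP by blast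
    have "ALL d. ~ pair (c2 one i) (pair m d) \<e> r2" using r2(5)[OF ne] m(2) by blast
    moreover have "EX z. pair (c2 one i) z \<e> r2" using r0(2) s(3) unfolding sub_def by blast
    ultimately have "Q i (pair (pair r2 k) (pair n' (pair m u)))" unfolding Q_def
      using r2P s(1) k(1) n(1) m(1) r2(3,4) frc_mono[OF q(2) r2P s(2)] by blast
    then show ?thesis by blast
  qed
  ultimately obtain g where g: "!!i. i \<e> w1 ==> Q i (app g i)" using skolem[of Q w1] by blast
  have t: "T (%e. fst (fst (app g (e 0))))" "T (%e. snd (app g (e 0)))" by (intro dfi)+
  \<comment> \<open>The colour consists of \<open>n\<close>, \<open>m\<close> and the node
    \<open>u\<close> of length \<open>m + 1\<close>; only countably many are possible, while
    \<open>i\<close> and \<open>k\<close> vary.\<close>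
  have Y: "ctbl (prod omega (prod omega ND))" by (intro ctbl_prod cov_refl ND_ctbl)
  have "fst (fst (app g i)) \<e> PP & snd (app g i) \<e> prod omega (prod omega ND)" if "i \<e> w1" for i
  proof -
    obtain r k n m u where "app g i = pair (pair r k) (pair n (pair m u))" "r \<e> PP" "n \<e> omega" "m \<e> omega" "isfun u (succ m) S"
      using g[OF \<open>i \<e> w1\<close>] unfolding Q_def by blast
    then show ?thesis using ND omega_succ by auto
  qed
  from ccc_P[OF w1(2) t Y this] obtain i i' where ii: "i \<e> w1" "i' \<e> w1" "i ~= i'" "snd (app g i) = snd (app g i')"
    "fagree (fst (fst (app g i))) (fst (fst (app g i')))" "cup (fst (fst (app g i))) (fst (fst (app g i'))) \<e> PP" by blast
  obtain r k n m u where r: "app g i = pair (pair r k) (pair n (pair m u))" "r \<e> PP" "sub p0 r" "k \<e> w1" "n \<e> omega" "m \<e> omega"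
     "isfun u (succ m) S" "!!z. z \<e> u ==> pair (c2 emp k) z \<e> r" "!!d. ~ pair (c2 one i) (pair m d) \<e> r"
     "EX z. pair (c2 one i) z \<e> r" "frc r (env4 Fn (chk n) (cn emp k) (cn one i)) (hit_s 4)"
    using g[OF ii(1)] unfolding Q_def by blast
  obtain r' k' where r': "app g i' = pair (pair r' k') (pair n (pair m u))" "r' \<e> PP" "k' \<e> w1"
     "!!z. z \<e> u ==> pair (c2 emp k') z \<e> r'" "!!d. ~ pair (c2 one i') (pair m d) \<e> r'"
     "EX z. pair (c2 one i') z \<e> r'" "frc r' (env4 Fn (chk n) (cn emp k') (cn one i')) (hit_s 4)"
  proof -
    obtain r' k' n' m' u' where *: "app g i' = pair (pair r' k') (pair n' (pair m' u'))" "r' \<e> PP" "k' \<e> w1"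
     "!!z. z \<e> u' ==> pair (c2 emp k') z \<e> r'" "!!d. ~ pair (c2 one i') (pair m' d) \<e> r'"
     "EX z. pair (c2 one i') z \<e> r'" "frc r' (env4 Fn (chk n') (cn emp k') (cn one i')) (hit_s 4)"
      using g[OF ii(2)] unfolding Q_def by blast
    moreover have "n' = n" "m' = m" "u' = u" using ii(4) unfolding r(1) *(1) snd pair_inj by blast+
    ultimately show ?thesis by (intro that) simp_all
  qed
  have fa: "fagree r r'" and cP: "cup r r' \<e> PP" using ii(5,6) r(1) r'(1) by simp_all
  have n1: "~ pair (c2 one i) (pair m d) \<e> cup r r'" and n2: "~ pair (c2 one i') (pair m d) \<e> cup r r'" for d
    using fa r(9,10) r'(5,6) unfolding fagree_def cup by blast+
  \<comment> \<open>The arguments are made equal by \<open>u\<close> up to and including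
    \<open>m\<close>, yet the values at \<open>m\<close> become \<open>0\<close> and
    \<open>1\<close>.\<close>
  let ?r1 = "adj (cup r r') (pair (c2 one i) (pair m emp))"
  let ?r2 = "adj ?r1 (pair (c2 one i') (pair m one))"
  have "cond ?r1" by (rule add2[OF cP[unfolded PP] two_mem(2) ii(1) r(6) S_0 n1])
  then have "cond ?r2" by (rule add2[OF _ two_mem(2) ii(2) r(6) S_1]) (use n2 ii(3) in simp)
  then obtain G' where G': "?r2 \<in> G'" "generic E PP G'" using generic_exists PP by blast
  interpret G': bgen E S G' by (rule bgenI[OF G'(2)])
  have s: "sub r ?r2" "sub r' ?r2" by (auto simp: sub_def)
  have m: "r \<in> G'" "r' \<in> G'" using G'.G_up[OF G'(1)] s r(2) r'(2) by blast+
  then have "p0 \<in> G'" using G'.G_up G_P[OF p0(1)] r(3) by blast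
  from forces_generic[OF G'(2) this p0(2)] have
    X: "!!x. G'.EG x (G'.val Xn) \<longleftrightarrow> G'.N.isfun x G'.N.omega (G'.j S)" and
    L: "!!n f. G'.EG n G'.N.omega ==> G'.EG (G'.N.pair n f) (G'.val Fn) ==> G'.N.lipR (G'.val Xn) f" and
    U: "!!n f g. G'.EG (G'.N.pair n f) (G'.val Fn) ==> G'.EG (G'.N.pair n g) (G'.val Fn) ==> f = g"
    unfolding env4_comp G'.j_def[symmetric] G'.j_omega G'.N.sat_lipF by blast+
  let ?x = "G'.val (cn emp k)" and ?x' = "G'.val (cn emp k')" and ?y = "G'.val (cn one i)" and ?y' = "G'.val (cn one i')"
  obtain f where f: "G'.EG (G'.N.pair (G'.j n) f) (G'.val Fn)" "G'.EG (G'.N.pair ?x ?y) f"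
    using forces_generic[OF G'(2) m(1) r(11)] unfolding env4_comp G'.j_def[symmetric] G'.N.sat_hit by blast
  obtain f' where f': "G'.EG (G'.N.pair (G'.j n) f') (G'.val Fn)" "G'.EG (G'.N.pair ?x' ?y') f'"
    using forces_generic[OF G'(2) m(2) r'(7)] unfolding env4_comp G'.j_def[symmetric] G'.N.sat_hit by blast
  have "f' = f" using U f(1) f'(1) by blast
  have "G'.EG (G'.j n) G'.N.omega" using r(5) unfolding G'.j_omega[symmetric] by simp
  then have lp: "G'.N.lipR (G'.val Xn) f" using L f(1) by blast
  note cf = G'.cn_fun
  have xX: "G'.EG ?x (G'.val Xn)" "G'.EG ?x' (G'.val Xn)" unfolding X using cf two_mem r(4) r'(3) by blast+
  have sm: "G'.EG (G'.N.succ (G'.j m)) G'.N.omega" using omega_succ[OF r(6)] unfolding G'.j_succ[symmetric] G'.j_omega[symmetric] by simp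
  have "G'.N.agrR ?x ?x' (G'.N.succ (G'.j m))" unfolding G'.N.agrR_def G'.N.sameR_def G'.j_succ[symmetric]
  proof (intro allI impI)
    fix l assume "G'.EG l (G'.j (succ m))"
    then obtain l' where l': "l' \<e> succ m" "l = G'.j l'" unfolding G'.EG_j by blast
    have "pair l' (app u l') \<e> u" using fun_pair[OF r(7)] l'(1) by blast
    then have "G'.EG (G'.N.pair l (G'.j (app u l'))) ?x" "G'.EG (G'.N.pair l (G'.j (app u l'))) ?x'"
      unfolding l'(2) G'.cn_pair using m r(8) r'(4) by blast+
    then show "EX v. G'.EG (G'.N.pair l v) ?x & G'.EG (G'.N.pair l v) ?x'" by blast
  qed
  then have "G'.N.agrR ?y ?y' (G'.N.succ (G'.j m))" using lp xX f(2) f'(2) sm unfolding G'.N.lipR_def \<open>f' = f\<close> by blast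
  then obtain v where v: "G'.EG (G'.N.pair (G'.j m) v) ?y" "G'.EG (G'.N.pair (G'.j m) v) ?y'"
    unfolding G'.N.agrR_def G'.N.sameR_def by auto
  have e: "G'.EG (G'.N.pair (G'.j m) (G'.j emp)) ?y" "G'.EG (G'.N.pair (G'.j m) (G'.j one)) ?y'"
    unfolding G'.cn_pair using G'(1) by (auto intro!: exI[of _ ?r2])
  note fp = G'.NN.fun_pair[OF cf[OF two_mem(2) ii(1)], of "G'.j m"] G'.NN.fun_pair[OF cf[OF two_mem(2) ii(2)], of "G'.j m"]
  have "v = G'.j emp" using v(1) e(1) unfolding fp by simp
  moreover have "v = G'.j one" using v(2) e(2) unfolding fp by simp
  ultimately show False using succ_ne G'.j_inj by metis
qed

text \<open>\<open>F\<close> is any single-valued set of pairs, so both a sequence of functions and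
  one function alone can be inserted.\<close>

lemma dense_pair: "EX A B. N.dense1 (N.fs (j S)) A & N.dense1 (N.fs (j S)) B &
   (ALL F. (ALL n f g. EG (N.pair n f) F --> EG (N.pair n g) F --> f = g) -->
     (ALL n f. EG n N.omega & EG (N.pair n f) F --> N.lipR (N.fs (j S)) f) -->
     (EX y. EG y B & ~ (EX n f x. EG n N.omega & EG (N.pair n f) F & EG x A & EG (N.pair x y) f)))"
proof -
  obtain C where C: "dft EG (%e. C (e 0))" "!!i. i \<e> w1 ==> C (j i) = val (cn emp i)" using cn_set by blast
  obtain D' where D': "dft EG (%e. D' (e 0))" "!!i. i \<e> w1 ==> D' (j i) = val (cn one i)" using cn_set by blast
  have d: "N.dense1 (N.fs (j S)) (N.img C N.w1)" "N.dense1 (N.fs (j S)) (N.img D' N.w1)"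
    by (rule cn_dense[OF two_mem(1) C], assumption, rule cn_dense[OF two_mem(2) D'], assumption)
  have "EX y. EG y (N.img D' N.w1) & ~ (EX n f x. EG n N.omega & EG (N.pair n f) F & EG x (N.img C N.w1) & EG (N.pair x y) f)"
    if "ALL n f g. EG (N.pair n f) F --> EG (N.pair n g) F --> f = g"
      "ALL n f. EG n N.omega & EG (N.pair n f) F --> N.lipR (N.fs (j S)) f" for F
    using no_lipschitz_cover[OF C D', of F] that by blast
  then show ?thesis using d by blast
qed

end

section \<open>The completeness theorem\<close>

instance fm :: countable by countable_datatype

fun vars :: "fm => nat set" where
  "vars (Mem x y) = {x, y}"
| "vars (Equ x y) = {x, y}"
| "vars Bot = {}"
| "vars (Imp p q) = vars p \<union> vars q"
| "vars (Forall x p) = insert x (vars p)"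

lemma finite_vars: "finite (vars p)" by (induction p) auto
lemma fv_vars: "x \<in> fv p ==> x \<in> vars p" by (induction p) auto
lemma free_for_vars: "y \<notin> vars p ==> free_for x y p" by (induction p) auto
lemma free_for_self: "free_for x x p" by (induction p) auto
lemma subst_self: "subst x x p = p" by (induction p) auto
lemma subst_notin: "x \<notin> fv p ==> subst x y p = p" by (induction p) auto
lemma subst_back: "y \<notin> vars p ==> subst y x (subst x y p) = p"
proof (induction p)
  case (Forall z p)
  then have "y \<notin> fv p" using fv_vars by auto
  then show ?case using Forall by (auto simp: subst_notin)
qed auto
lemma free_for_back: "y \<notin> vars p ==> free_for y x (subst x y p)"
proof (induction p)
  case (Forall z p)
  then show ?case using fv_vars[of y p] by auto
qed auto
lemma fv_subst: "x ~= y ==> x \<notin> fv (subst x y p)" by (induction p) auto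
lemma size_subst [simp]: "size (subst x y p) = size p" by (induction p) auto

text \<open>In the calculus every axiom may be generalized, so open formulas cannot be assumed
  there. Here generalization stays inside \<open>T \<turnstile> p\<close>, and the deduction theorem
  holds for the open assumptions \<open>A\<close>.\<close>

inductive der :: "fm set => fm set => fm => bool" for T A where
  prv: "T \<turnstile> p ==> der T A p"
| asm: "p \<in> A ==> der T A p"
| mp: "der T A (Imp p q) ==> der T A p ==> der T A q"

lemma der_mono: "der T A p ==> A \<subseteq> B ==> der T B p"
  by (induction rule: der.induct) (auto intro: der.intros)

lemma der_fin: "der T A p ==> EX F. finite F & F \<subseteq> A & der T F p"
proof (induction rule: der.induct)
  case (prv p)
  then show ?case by (intro exI[of _ "{}"]) (auto intro: der.prv)
next
  case (asm p)
  then show ?case by (intro exI[of _ "{p}"]) (auto intro: der.asm)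
next
  case (mp p q)
  then obtain F G where "finite F" "F \<subseteq> A" "der T F (Imp p q)" "finite G" "G \<subseteq> A" "der T G p" by blast
  then show ?case by (intro exI[of _ "F \<union> G"]) (meson Un_upper1 Un_upper2 der.mp der_mono finite_UnI le_sup_iff)
qed

lemma der_K: "der T A p ==> der T A (Imp q p)" using der.mp[OF der.prv[OF Imp_K]] .

lemma der_ded: "der T (insert p A) q ==> der T A (Imp p q)"
proof (induction rule: der.induct)
  case (prv q)
  then show ?case by (intro der_K der.prv)
next
  case (asm q)
  have "der T A (Imp p p)"
    using der.mp[OF der.mp[OF der.prv[OF Imp_S] der.prv[OF Imp_K]] der.prv[OF Imp_K, of _ _ p]] .
  then show ?case using asm by (auto intro: der_K der.asm)
next
  case (mp q r)
  then show ?case using der.mp[OF der.mp[OF der.prv[OF Imp_S]]] by blast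
qed

lemma der_neg: "der T (insert (Imp p Bot) A) Bot ==> der T A p"
  using der.mp[OF der.prv[OF Double_neg[unfolded Neg_def]] der_ded] .
lemma der_Bot: "der T A Bot ==> der T A p"
  by (rule der_neg) (auto intro: der_mono)

lemma der_inst: "der T A (Forall x p) ==> free_for x y p ==> der T A (subst x y p)"
  using der.mp[OF der.prv[OF Forall_inst]] by blast

lemma der_empty: "der T {} p ==> T \<turnstile> p" by (induction rule: der.induct) (auto intro: MP)

lemma Forall_mp: "T \<turnstile> Imp (Forall y (Imp p q)) (Imp (Forall y p) (Forall y q))"
proof -
  let ?a = "Forall y (Imp p q)" and ?b = "Forall y p"
  have "der T {?b, ?a} (subst y y (Imp p q))" "der T {?b, ?a} (subst y y p)"
    by (rule der_inst[OF der.asm free_for_self], simp)+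
  then have "der T {?b, ?a} q" unfolding subst_self by (rule der.mp)
  then have "T \<turnstile> Imp ?a (Imp ?b q)" by (intro der_empty der_ded)
  then have 1: "T \<turnstile> Imp ?a (Forall y (Imp ?b q))" using MP[OF Forall_dist Gen] by simp
  have "der T {?b, ?a} (Forall y (Imp ?b q))" using der.mp[OF der.prv[OF 1] der.asm] by simp
  moreover have "T \<turnstile> Imp (Forall y (Imp ?b q)) (Imp ?b (Forall y q))" by (rule Forall_dist) simp
  ultimately have "der T {?b, ?a} (Imp ?b (Forall y q))" using der.mp der.prv by blast
  then have "der T {?b, ?a} (Forall y q)" by (rule der.mp) (simp add: der.asm)
  then show ?thesis by (intro der_empty der_ded)
qed

lemma der_gen: "der T A q ==> (!!r. r \<in> A ==> y \<notin> fv r) ==> der T A (Forall y q)"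
proof (induction rule: der.induct)
  case (prv p)
  then show ?case by (intro der.prv Gen)
next
  case (asm p)
  have "T \<turnstile> Imp p p" by (intro der_empty der_ded der.asm) simp
  then have "T \<turnstile> Imp p (Forall y p)" using MP[OF Forall_dist Gen] asm by blast
  then show ?case using der.mp[OF der.prv der.asm] asm(1) by blast
next
  case (mp p q)
  then show ?case using der.mp[OF der.mp[OF der.prv[OF Forall_mp]]] by blast
qed

text \<open>If the witness formula were refutable, \<open>A\<close> would derive the instance at
  \<open>y\<close>. As \<open>y\<close> is fresh, the instance generalizes, and the witness formula
  follows after all.\<close>

lemma henkin_step:
  assumes c: "~ der T A Bot" and y: "!!r. r \<in> A ==> y \<notin> fv r" "y \<notin> vars p" "y ~= x"
  shows "~ der T (insert (Imp (subst x y p) (Forall x p)) A) Bot"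
proof
  let ?s = "subst x y p" and ?a = "Forall x p"
  assume "der T (insert (Imp ?s ?a) A) Bot"
  then have h: "der T A (Imp (Imp ?s ?a) Bot)" by (rule der_ded)
  have "der T A ?s"
  proof (rule der_neg)
    have "der T (insert ?s (insert (Imp ?s Bot) A)) Bot" by (rule der.mp[of _ _ ?s]) (auto intro: der.asm)
    then have "der T (insert (Imp ?s Bot) A) (Imp ?s ?a)" by (rule der_ded[OF der_Bot])
    then show "der T (insert (Imp ?s Bot) A) Bot" using der.mp[OF der_mono[OF h]] by blast
  qed
  then have s: "der T A (Forall y ?s)" using der_gen y(1) by blast
  have "T \<turnstile> Imp (Forall y ?s) (subst y x ?s)" by (rule Forall_inst[OF free_for_back[OF y(2)]])
  then have "T \<turnstile> Imp (Forall y ?s) p" unfolding subst_back[OF y(2)] .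
  then have "T \<turnstile> Imp (Forall y ?s) ?a" by (intro MP[OF Forall_dist Gen]) (use fv_subst y(3) in auto)
  then have "der T A ?a" using s der.mp der.prv by blast
  then show False using c der.mp[OF h der_K] by blast
qed

text \<open>The counter \<open>k\<close> makes each pair of \<open>x\<close> and \<open>p\<close>
  occur at infinitely many \<open>n\<close>.\<close>

definition henk :: "nat => nat => fm" where
  "henk n y = (let (k :: nat, x, p) = from_nat n in Imp (subst x y p) (Forall x p))"

text \<open>The bound \<open>n \<le> w n\<close> gives every element of the model infinitely many names, so that for each
  formula there is one whose substitution does not lead to a capture.\<close>

lemma henkin_witnesses: assumes "~ T \<turnstile> Bot"
  shows "EX w. (ALL n. n \<le> w n) & ~ der T (range (%n. henk n (w n))) Bot"
proof -
  define used where "used n ys = (\<Union>i<n. vars (henk i (ys i))) \<union> (\<Union>i\<in>{n}. let (k :: nat, x, p) = from_nat i in insert x (vars p))" for n ys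
  have fu: "finite (used n ys)" for n ys unfolding used_def by (auto simp: finite_vars split: prod.split)
  \<comment> \<open>The \<open>n\<close>-th witness exceeds every variable used so far; the summand
    \<open>n\<close> gives the lower bound.\<close>
  define W where "W = rec_nat (%_. 0) (%n ys. ys(n := n + Suc (Max (insert 0 (used n ys)))))"
  have WS: "W (Suc n) = (W n)(n := n + Suc (Max (insert 0 (used n (W n)))))" for n by (simp add: W_def)
  define w where "w n = W (Suc n) n" for n
  have Ww: "i < n ==> W n i = w i" for i n
    by (induction n) (auto simp: WS w_def less_Suc_eq)
  have uw: "used n (W n) = used n w" for n unfolding used_def using Ww by auto
  have wn: "w n = n + Suc (Max (insert 0 (used n w)))" for n unfolding w_def WS uw[symmetric] by simp
  have fr: "w n \<notin> used n w" for n
  proof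
    assume "w n \<in> used n w"
    then have "w n \<le> Max (insert 0 (used n w))" using fu by (intro Max_ge) auto
    then show False using wn[of n] by simp
  qed
  have c: "~ der T ((%i. henk i (w i)) ` {..<n}) Bot" for n
  proof (induction n)
    case 0
    then show ?case using assms der_empty by auto
  next
    case (Suc n)
    obtain k x :: nat and p :: fm where kxp: "from_nat n = (k, x, p)" using prod_cases3 by blast
    have h: "henk n (w n) = Imp (subst x (w n) p) (Forall x p)" unfolding henk_def kxp by simp
    have u: "w n \<notin> vars p" "w n ~= x" "!!i. i < n ==> w n \<notin> vars (henk i (w i))"
      using fr[of n] unfolding used_def by (auto simp: kxp)
    have "~ der T (insert (henk n (w n)) ((%i. henk i (w i)) ` {..<n})) Bot"
      unfolding h by (rule henkin_step[OF Suc _ u(1,2)]) (use u(3) fv_vars in auto)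
    then show ?case by (simp add: lessThan_Suc)
  qed
  have "~ der T (range (%n. henk n (w n))) Bot"
  proof
    assume "der T (range (%n. henk n (w n))) Bot"
    from der_fin[OF this] obtain F where F: "finite F" "F \<subseteq> range (%n. henk n (w n))" "der T F Bot" by blast
    then obtain I where I: "finite I" "F = (%n. henk n (w n)) ` I" by (meson finite_subset_image)
    obtain n where "I \<subseteq> {..<n}" using I(1) finite_nat_iff_bounded by blast
    then show False using c[of n] der_mono[OF F(3)] I(2) by (meson image_mono)
  qed
  moreover have "n \<le> w n" for n using wn[of n] by simp
  ultimately show ?thesis by blast
qed

lemma lindenbaum: assumes "~ der T A Bot"
  shows "EX M. A \<subseteq> M & ~ der T M Bot & (ALL p. p \<notin> M --> der T (insert p M) Bot)"
proof -
  define L where "L = rec_nat A (%n B. if der T (insert (from_nat n) B) Bot then B else insert (from_nat n) B)"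
  have L0: "L 0 = A" and LS: "L (Suc n) = (if der T (insert (from_nat n) (L n)) Bot then L n else insert (from_nat n) (L n))" for n
    by (simp_all add: L_def)
  have c: "~ der T (L n) Bot" for n by (induction n) (auto simp: L0 LS assms)
  have m: "m \<le> n ==> L m \<subseteq> L n" for m n by (induction n rule: dec_induct) (auto simp: LS)
  let ?M = "\<Union>n. L n"
  have "~ der T ?M Bot"
  proof
    assume "der T ?M Bot"
    from der_fin[OF this] obtain F where F: "finite F" "F \<subseteq> ?M" "der T F Bot" by blast
    have "EX n. F \<subseteq> L n" using F(1,2)
    proof (induction F)
      case (insert p F)
      then obtain n k where "F \<subseteq> L n" "p \<in> L k" by blast
      then show ?case using m[of n "max n k"] m[of k "max n k"] by (intro exI[of _ "max n k"]) auto
    qed simp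
    then show False using c der_mono[OF F(3)] by blast
  qed
  moreover have "der T (insert p ?M) Bot" if "p \<notin> ?M" for p
  proof -
    have "p \<notin> L (Suc (to_nat p))" using that by blast
    then have "der T (insert p (L (to_nat p))) Bot" unfolding LS by (auto split: if_splits)
    then show ?thesis by (rule der_mono) auto
  qed
  ultimately show ?thesis using L0 by blast
qed

section \<open>Satisfaction up to a congruence, and a model made of variables\<close>

fun satq :: "('a => 'a => bool) => ('a => 'a => bool) => (nat => 'a) => fm => bool" where
  "satq Q E e (Mem x y) = E (e x) (e y)"
| "satq Q E e (Equ x y) = Q (e x) (e y)"
| "satq Q E e Bot = False"
| "satq Q E e (Imp p q) = (satq Q E e p --> satq Q E e q)"
| "satq Q E e (Forall x p) = (ALL a. satq Q E (e(x := a)) p)"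

lemma satq_Neg [simp]: "satq Q E e (Neg p) = (~ satq Q E e p)"
  and satq_And [simp]: "satq Q E e (And p q) = (satq Q E e p & satq Q E e q)"
  and satq_Or [simp]: "satq Q E e (Or p q) = (satq Q E e p | satq Q E e q)"
  and satq_Iff [simp]: "satq Q E e (Iff p q) = (satq Q E e p = satq Q E e q)"
  and satq_Exists [simp]: "satq Q E e (Exists x p) = (EX a. satq Q E (e(x := a)) p)"
  by (auto simp: Neg_def And_def Or_def Iff_def Exists_def)

lemma satq_quot:
  assumes E: "!!a b. E a b \<longleftrightarrow> E' (v a) (v b)" and Q: "!!a b. Q a b \<longleftrightarrow> v a = v b" and v: "surj v"
  shows "satq Q E e p \<longleftrightarrow> sat E' (%x. v (e x)) p"
proof (induction p arbitrary: e)
  case (Forall x p)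
  have u: "(%y. v ((e(x := a)) y)) = (%y. v (e y))(x := v a)" for a by auto
  then have "satq Q E (e(x := a)) p \<longleftrightarrow> sat E' ((%y. v (e y))(x := v a)) p" for a using Forall[of "e(x := a)"] by (simp only: u)
  then show ?case using v by (metis sat.simps(5) satq.simps(5) surjD)
qed (simp_all add: E Q)

lemma satq_subst: assumes "y \<notin> vars p" shows "satq Q E e (subst x y p) = satq Q E (e(x := e y)) p"
  using assms
proof (induction p arbitrary: e)
  case (Forall z p)
  show ?case
  proof (cases "z = x")
    case True
    then show ?thesis by (simp del: fun_upd_apply)
  next
    case False
    then have "(e(x := e y))(z := a) = (e(z := a))(x := (e(z := a)) y)" for a using Forall.prems by auto
    then show ?thesis using False Forall by (simp del: fun_upd_apply)
  qed
qed auto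

lemma satq_cong:
  assumes "!!a a' b b'. Q a a' ==> Q b b' ==> E a b \<longleftrightarrow> E a' b'" "!!a a' b b'. Q a a' ==> Q b b' ==> Q a b \<longleftrightarrow> Q a' b'"
    "!!a. Q a a" "!!x. Q (e x) (e' x)"
  shows "satq Q E e p \<longleftrightarrow> satq Q E e' p"
  using assms(4)
proof (induction p arbitrary: e e')
  case (Forall x p)
  have "satq Q E (e(x := a)) p \<longleftrightarrow> satq Q E (e'(x := a)) p" for a using Forall.prems assms(3) by (intro Forall.IH) simp
  then show ?case by simp
next
  case (Mem x y)
  then show ?case using assms(1) by simp
next
  case (Equ x y)
  then show ?case using assms(2) by simp
next
  case (Imp p q)
  then show ?case by (metis satq.simps(4))
qed simp

text \<open>The variables themselves are the elements, so no constants are added. \<open>M\<close>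
  may equate distinct variables, hence the congruence \<open>Q\<close> in place of equality.\<close>

lemma henkin_model: assumes "~ T \<turnstile> Bot"
  shows "EX (E :: nat => nat => bool) Q. equivp Q & (ALL a a' b b'. Q a a' --> Q b b' --> E a b --> E a' b') &
    (ALL p. T \<turnstile> p --> satq Q E (%x. x) p)"
proof -
  obtain w where w: "!!n. n \<le> w n" "~ der T (range (%n. henk n (w n))) Bot" using henkin_witnesses[OF assms] by blast
  obtain M where M: "range (%n. henk n (w n)) \<subseteq> M" "~ der T M Bot" "!!p. p \<notin> M ==> der T (insert p M) Bot"
    using lindenbaum[OF w(2)] by blast
  have cl: "p \<in> M" if "der T M p" for p using M(2) M(3)[of p] der_ded der.mp that by blast
  have th: "p \<in> M" if "T \<turnstile> p" for p by (rule cl[OF der.prv[OF that]])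
  have Bot: "Bot \<notin> M" using M(2) der.asm by blast
  have mp: "q \<in> M" if "Imp p q \<in> M" "p \<in> M" for p q using cl der.mp der.asm that by blast
  have Imp: "Imp p q \<in> M \<longleftrightarrow> (p \<in> M --> q \<in> M)" for p q
  proof
    assume a: "p \<in> M --> q \<in> M"
    have "der T (insert p M) q" using a M(3)[of p] der_Bot der.asm by blast
    then show "Imp p q \<in> M" using cl der_ded by blast
  qed (use mp in blast)
  have inst: "subst x y p \<in> M" if "Forall x p \<in> M" "free_for x y p" for x y p
    using mp[OF th[OF Forall_inst]] that by blast
  have wit: "\<exists>y \<ge> N. Imp (subst x y p) (Forall x p) \<in> M" for x p N
  proof -
    have "inj (%k :: nat. to_nat (k, x, p))" by (auto intro: injI)
    then have "infinite (range (%k :: nat. to_nat (k, x, p)))" by (rule range_inj_infinite)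
    then obtain n k where n: "n \<ge> N" "n = to_nat (k :: nat, x, p)" unfolding infinite_nat_iff_unbounded_le by blast
    have "henk n (w n) = Imp (subst x (w n) p) (Forall x p)" unfolding henk_def n(2) by simp
    moreover have "henk n (w n) \<in> M" using M(1) by blast
    ultimately show ?thesis using w(1)[of n] n(1) by (intro exI[of _ "w n"]) simp
  qed
  define Q where "Q a b \<longleftrightarrow> Equ a b \<in> M" for a b
  define E where "E a b \<longleftrightarrow> Mem a b \<in> M" for a b
  have refl: "Q a a" for a unfolding Q_def using th Equ_refl by blast
  have sb: "subst z b p \<in> M" if "Q a b" "subst z a p \<in> M" "free_for z a p" "free_for z b p" for z a b p
    using mp[OF mp[OF th[OF Equ_subst[OF that(3,4)]]]] that(1,2) unfolding Q_def by blast
  have sym: "Q b a" if "Q a b" for a b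
  proof -
    obtain z :: nat where "z ~= a" by (metis n_not_Suc_n)
    then show ?thesis using sb[of a b z "Equ z a"] that refl[of a] unfolding Q_def by simp
  qed
  have trans: "Q a c" if "Q a b" "Q b c" for a b c
  proof -
    obtain z :: nat where "z ~= a" by (metis n_not_Suc_n)
    then show ?thesis using sb[of b c z "Equ a z"] that unfolding Q_def by simp
  qed
  have E1: "E a' b" if "Q a a'" "E a b" for a a' b
  proof -
    obtain z :: nat where "z ~= b" by (metis n_not_Suc_n)
    then show ?thesis using sb[of a a' z "Mem z b"] that unfolding E_def by simp
  qed
  have E2: "E a b'" if "Q b b'" "E a b" for a b b'
  proof -
    obtain z :: nat where "z ~= a" by (metis n_not_Suc_n)
    then show ?thesis using sb[of b b' z "Mem a z"] that unfolding E_def by simp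
  qed
  have EE: "E a b \<longleftrightarrow> E a' b'" if "Q a a'" "Q b b'" for a a' b b'
    using E1[OF that(1), of b] E2[OF that(2), of a'] E1[OF sym[OF that(1)], of b'] E2[OF sym[OF that(2)], of a] by blast
  have QQ: "Q a b \<longleftrightarrow> Q a' b'" if "Q a a'" "Q b b'" for a a' b b'
    using trans[OF trans[OF sym[OF that(1)]] that(2)] trans[OF trans[OF that(1)] sym[OF that(2)]] by blast
  \<comment> \<open>Each class contains arbitrarily large variables, among them ones that can be
    substituted into a given formula without capture.\<close>
  have inf: "\<exists>y \<ge> N. Q z y" for z N
  proof -
    obtain x :: nat where x: "x ~= z" by (metis n_not_Suc_n)
    obtain y where y: "y \<ge> N" "Imp (subst x y (Neg (Equ z x))) (Forall x (Neg (Equ z x))) \<in> M" using wit by blast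
    have "Equ z y \<in> M"
    proof (rule ccontr)
      assume "Equ z y \<notin> M"
      then have "subst x y (Neg (Equ z x)) \<in> M" using x by (simp add: Neg_def Imp)
      then have "subst x z (Neg (Equ z x)) \<in> M" by (rule inst[OF mp[OF y(2)]]) (simp add: Neg_def)
      then show False using x refl[of z] Bot unfolding Q_def by (simp add: Neg_def Imp)
    qed
    then show ?thesis using y(1) unfolding Q_def by blast
  qed
  have fresh: "EX N. \<forall>y \<ge> N. y \<notin> vars p" for p
    using finite_vars[of p] unfolding finite_nat_iff_bounded by (meson lessThan_iff not_le subset_iff)
  have truth: "satq Q E (%x. x) p \<longleftrightarrow> p \<in> M" for p
  \<comment> \<open>The quantifier case passes to a substitution instance, which has the same size
    as the body but is no subformula.\<close>
  proof (induction "size p" arbitrary: p rule: less_induct)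
    case less
    show ?case
    proof (cases p)
      case (Forall x q)
      have IH: "satq Q E ((%x. x)(x := y)) q \<longleftrightarrow> subst x y q \<in> M" if "y \<notin> vars q" for y
        using less[of "subst x y q"] satq_subst[OF that, of Q E "%x. x" x] Forall by simp
      obtain N where N: "!!y. y \<ge> N ==> y \<notin> vars q" using fresh by blast
      have "satq Q E ((%x. x)(x := a)) q" if "Forall x q \<in> M" for a
      proof -
        obtain y where y: "y \<ge> N" "Q a y" using inf by blast
        have "satq Q E ((%x. x)(x := y)) q" using IH[OF N[OF y(1)]] inst[OF that free_for_vars[OF N[OF y(1)]]] by blast
        moreover have up: "Q (((%x. x)(x := a)) z) (((%x. x)(x := y)) z)" for z
          using y(2) refl[of z] by (cases "z = x") simp_all
        have "satq Q E ((%x. x)(x := a)) q \<longleftrightarrow> satq Q E ((%x. x)(x := y)) q"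
          by (rule satq_cong) (fact EE QQ refl up)+
        ultimately show ?thesis by blast
      qed
      moreover have "Forall x q \<in> M" if "!!a. satq Q E ((%x. x)(x := a)) q"
      proof -
        obtain y where y: "y \<ge> N" "Imp (subst x y q) (Forall x q) \<in> M" using wit by blast
        then show ?thesis using mp IH[OF N[OF y(1)]] that by blast
      qed
      ultimately show ?thesis unfolding Forall by auto
    next
      case (Imp q r)
      then show ?thesis using less[of q] less[of r] by (simp add: \<open>!!p q. (Imp p q \<in> M) = (p \<in> M --> q \<in> M)\<close>)
    qed (simp_all add: Q_def E_def Bot)
  qed
  have "equivp Q" by (intro equivpI reflpI sympI transpI) (use refl sym trans in blast)+
  moreover have "ALL a a' b b'. Q a a' --> Q b b' --> E a b --> E a' b'" using E1 E2 by blast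
  moreover have "ALL p. T \<turnstile> p --> satq Q E (%x. x) p" using truth th by blast
  ultimately show ?thesis by blast
qed

text \<open>Pairing and union could collect finitely many classes into one set. That set would be a
  member of itself, against foundation.\<close>

lemma infinitely_many_sets:
  assumes Q: "equivp Q" "!!a a' b b'. Q a a' ==> Q b b' ==> E a b ==> E a' b'"
    and s: "!!p. p \<in> ZFC ==> satq Q E (e :: nat => 'a) p" and F: "finite F"
  shows "EX a. \<forall>b \<in> F. ~ Q a b"
proof (rule ccontr)
  assume "~ ?thesis"
  then have all: "\<exists>b \<in> F. Q a b" for a by blast
  have "satq Q E e Defs.pairing" "satq Q E e Defs.union" "satq Q E e foundation" using s by (auto simp: ZFC_def)
  then have pr: "!!x y. EX z. ALL u. E u z \<longleftrightarrow> Q u x | Q u y" and un: "!!F. EX U. ALL x. E x U \<longleftrightarrow> (EX y. E y F & E x y)"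
    and fo: "!!x z. E z x ==> EX y. E y x & ~ (EX z. E z x & E z y)"
    by (simp_all add: Defs.pairing_def Defs.union_def foundation_def upair_s_def empty_s_def sfm_sat del: fun_upd_apply) blast+
  have rf: "Q a a" for a using Q(1) by (simp add: equivp_reflp)
  have "EX z. \<forall>x \<in> F. E x z" using F
  proof (induction F)
    case (insert x F)
    then obtain z where z: "!!y. y \<in> F ==> E y z" by blast
    obtain t where t: "!!u. E u t \<longleftrightarrow> Q u x | Q u x" using pr by blast
    obtain v where v: "!!u. E u v \<longleftrightarrow> Q u z | Q u t" using pr by blast
    obtain U where "!!u. E u U \<longleftrightarrow> (EX y. E y v & E u y)" using un by blast
    then show ?case using z t v rf by (intro exI[of _ U]) blast
  qed simp
  then obtain z where z: "!!x. x \<in> F ==> E x z" by blast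
  obtain b where "b \<in> F" "Q z b" using all by blast
  then have zz: "E z z" using Q(2)[of b z z z] z rf Q(1) by (meson equivp_symp)
  obtain t where t: "!!u. E u t \<longleftrightarrow> Q u z | Q u z" using pr by blast
  obtain y where y: "E y t" "!!u. ~ (E u t & E u y)" using fo[of z t] t rf by blast
  have "E z y" using Q(2)[OF rf _ zz, of y] y(1) t Q(1) by (meson equivp_symp)
  then show False using y(2) t rf by blast
qed

lemma proves_closure: "T \<turnstile> p ==> T \<turnstile> universal_closure p"
proof -
  assume "T \<turnstile> p"
  then have "T \<turnstile> foldr Forall xs p" for xs by (induction xs) (auto intro: Gen)
  then show ?thesis unfolding universal_closure_def .
qed

lemma fv_closure: "fv (universal_closure p) = {}"
proof -
  have "fv (foldr Forall xs p) = fv p - set xs" for xs by (induction xs) auto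
  then show ?thesis unfolding universal_closure_def by (simp add: finite_fv)
qed

text \<open>Dividing by the congruence and numbering the infinitely many classes gives a model on
  the natural numbers with true equality.\<close>

theorem countable_model: assumes "consistent ZFC" shows "EX E :: nat => nat => bool. zfc E"
proof -
  from henkin_model[OF assms[unfolded consistent_def]] obtain E :: "nat => nat => bool" and Q where
    m: "equivp Q & (ALL a a' b b'. Q a a' --> Q b b' --> E a b --> E a' b') & (ALL p. ZFC \<turnstile> p --> satq Q E (%x. x) p)"
    by (elim exE)
  then have Q: "equivp Q" "!!a a' b b'. Q a a' ==> Q b b' ==> E a b ==> E a' b'"
    "!!p. ZFC \<turnstile> p ==> satq Q E (%x. x) p" by blast+
  define rp where "rp a = (LEAST b. Q a b)" for a
  have rQ: "Q a (rp a)" for a unfolding rp_def by (rule LeastI[of _ a]) (simp add: Q(1) equivp_reflp)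
  have rp: "rp a = rp b \<longleftrightarrow> Q a b" for a b
    using rQ Q(1) unfolding rp_def by (metis equivp_def)
  have rr: "rp (rp a) = rp a" for a unfolding rp using rQ Q(1) by (meson equivp_symp)
  have inf: "infinite (range rp)"
  proof
    assume "finite (range rp)"
    have "EX a. \<forall>b \<in> range rp. ~ Q a b"
      by (rule infinitely_many_sets[OF Q(1,2) Q(3)[OF Axiom] \<open>finite (range rp)\<close>])
    then show False using rQ by blast
  qed
  define v where "v a = inv_into UNIV (enumerate (range rp)) (rp a)" for a
  have ev: "enumerate (range rp) (v a) = rp a" for a
    unfolding v_def by (rule f_inv_into_f) (simp add: range_enumerate[OF inf])
  have vQ: "Q a b \<longleftrightarrow> v a = v b" for a b
  proof
    assume "Q a b"
    then have "rp a = rp b" by (rule rp[THEN iffD2])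
    then show "v a = v b" unfolding v_def by (rule arg_cong)
  next
    assume "v a = v b"
    have "rp a = enumerate (range rp) (v a)" by (rule ev[symmetric])
    also have "\<dots> = rp b" unfolding \<open>v a = v b\<close> by (rule ev)
    finally have "rp a = rp b" .
    then show "Q a b" by (rule rp[THEN iffD1])
  qed
  have "surj v"
  proof (rule surjI)
    fix n
    have "rp (enumerate (range rp) n) = enumerate (range rp) n" using enumerate_in_set[OF inf, of n] rr by auto
    then show "v (enumerate (range rp) n) = n" unfolding v_def using inv_f_f[OF strict_mono_imp_inj_on[OF strict_mono_enumerate[OF inf]]] by simp
  qed
  define E' where "E' m n = E (enumerate (range rp) m) (enumerate (range rp) n)" for m n
  have EE: "E a b \<longleftrightarrow> E' (v a) (v b)" for a b
    unfolding E'_def ev using Q(2)[OF rQ rQ, of a b] Q(2)[of "rp a" a "rp b" b] rQ Q(1) by (meson equivp_symp)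
  have "sat E' e p" if "p \<in> ZFC" for p e
  proof -
    have "satq Q E (%x. x) (universal_closure p)" using Q(3) proves_closure Axiom that by blast
    then have "sat E' v (universal_closure p)" unfolding satq_quot[of E E' v Q, OF EE vQ \<open>surj v\<close>] .
    \<comment> \<open>The closure is a sentence, so its truth under \<open>v\<close> gives its truth
      under any assignment.\<close>
    then have "sat E' e (universal_closure p)" for e using sat_cong[of "universal_closure p" v e E'] fv_closure by simp
    then show ?thesis using sat_universal_closure by blast
  qed
  then show ?thesis using sat_imp_zfc by blast
qed

section \<open>The theorem\<close>

theorem corollary1p6:
  assumes "consistent ZFC"
  shows "\<not> ZFC \<turnstile> Imp BA_Cantor BA_Lip_Cantor \<and> \<not> ZFC \<turnstile> Imp BA_Baire BA_Lip_Baire"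
proof -
  obtain E :: "nat => nat => bool" where "zfc E" using countable_model[OF assms] by blast
  then interpret zfc E .
  have C: "baum E two"
    by unfold_locales (auto simp: two_def sub_def intro: omega_succ)
  have B: "baum E omega"
    by unfold_locales (auto intro: omega_succ)
  have no: "~ ZFC \<turnstile> Imp p q" if "zfc M" "sat M e p" "~ sat M e q" for M :: "nat => nat => bool" and e p q
    using soundness[of ZFC "Imp p q" M e] zfc_imp_sat[OF that(1)] that(2,3) by auto
  have "~ ZFC \<turnstile> Imp BA_Cantor BA_Lip_Cantor"
  proof -
    interpret baum E two by (rule C)
    obtain G where "generic E PP G" using generic_exists one by blast
    then interpret bgen E two G by (rule bgenI)
    have "~ sat EG (%_. 0) BA_Lip_Cantor" unfolding N.sat_Lip_Cantor
    proof
      assume a: "ALL A B. N.dense1 (N.fs N.two) A & N.dense1 (N.fs N.two) B -->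
        (EX F L. N.isfun F N.omega L & (ALL n f. EG n N.omega & EG (N.pair n f) F --> N.lipR (N.fs N.two) f) &
          (ALL y. EG y B \<longleftrightarrow> (EX n f x. EG n N.omega & EG (N.pair n f) F & EG x A & EG (N.pair x y) f)))"
      obtain A B where AB: "N.dense1 (N.fs N.two) A" "N.dense1 (N.fs N.two) B" "!!F. (ALL n f g. EG (N.pair n f) F --> EG (N.pair n g) F --> f = g) ==>
        (ALL n f. EG n N.omega & EG (N.pair n f) F --> N.lipR (N.fs N.two) f) ==>
        (EX y. EG y B & ~ (EX n f x. EG n N.omega & EG (N.pair n f) F & EG x A & EG (N.pair x y) f))"
        using dense_pair unfolding j_two by blast
      from a[rule_format, OF conjI[OF AB(1,2)]] obtain F L where F: "N.isfun F N.omega L" "ALL n f. EG n N.omega & EG (N.pair n f) F --> N.lipR (N.fs N.two) f"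
        "ALL y. EG y B \<longleftrightarrow> (EX n f x. EG n N.omega & EG (N.pair n f) F & EG x A & EG (N.pair x y) f)" by blast
      have "ALL n f g. EG (N.pair n f) F --> EG (N.pair n g) F --> f = g"
        using F(1) N.fn_app N.fn_dom unfolding N.isfun_def by metis
      from AB(3)[OF this F(2)] show False using F(3) by blast
    qed
    moreover have "sat EG (%_. 0) BA_Cantor" unfolding N.sat_BA_Cantor using BA_ext unfolding j_two .
    ultimately show ?thesis using no N.zfc_axioms by blast
  qed
  moreover have "~ ZFC \<turnstile> Imp BA_Baire BA_Lip_Baire"
  proof -
    interpret baum E omega by (rule B)
    obtain G where "generic E PP G" using generic_exists one by blast
    then interpret bgen E omega G by (rule bgenI)
    have "~ sat EG (%_. 0) BA_Lip_Baire" unfolding N.sat_Lip_Baire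
    proof
      assume a: "ALL A B. N.dense1 (N.fs N.omega) A & N.dense1 (N.fs N.omega) B -->
        (EX f. N.lipR (N.fs N.omega) f & N.injR f A & N.imgR f A B)"
      obtain A B where AB: "N.dense1 (N.fs N.omega) A" "N.dense1 (N.fs N.omega) B" "!!F. (ALL n f g. EG (N.pair n f) F --> EG (N.pair n g) F --> f = g) ==>
        (ALL n f. EG n N.omega & EG (N.pair n f) F --> N.lipR (N.fs N.omega) f) ==>
        (EX y. EG y B & ~ (EX n f x. EG n N.omega & EG (N.pair n f) F & EG x A & EG (N.pair x y) f))"
        using dense_pair unfolding j_omega by blast
      obtain f where f: "N.lipR (N.fs N.omega) f" "N.imgR f A B" using a AB(1,2) by blast
      \<comment> \<open>A single Lipschitz function counts as a sequence with the one index
        \<open>emp\<close>.\<close>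
      let ?F = "N.upair (N.pair N.emp f) (N.pair N.emp f)"
      have F: "EG (N.pair n g) ?F \<longleftrightarrow> n = N.emp & g = f" for n g by simp
      obtain y where y: "EG y B" "~ (EX n g x. EG n N.omega & EG (N.pair n g) ?F & EG x A & EG (N.pair x y) g)"
        using AB(3)[of ?F] f(1) unfolding F by blast
      then show False using f(2) N.omega_0 unfolding F N.imgR_def by blast
    qed
    moreover have "sat EG (%_. 0) BA_Baire" unfolding N.sat_BA_Baire using BA_ext unfolding j_omega .
    ultimately show ?thesis using no N.zfc_axioms by blast
  qed
  ultimately show ?thesis by blast
qed

end
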